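(* Let $\mathbb{F}$ be $\mathbb{R}$ or a local field, and $\mathbb{K}$ a valued field which is a topological extension field of $\mathbb{F}$. Let $r,s,k\in\mathbb{N}_0\cup\{\infty\}$, let $M$ be a paracompact, finite-dimensional $C^r_{\mathbb{F}}$-manifold, $N$ a paracompact, finite-dimensional $C^s_{\mathbb{F}}$-manifold, and let $E$ and $F$ be topological $\mathbb{K}$-vector spaces. Let $f\colon P\to C^s_c(N,F)$ be a map defined on an open subset $P\subseteq C^r_c(M,E)$. If the restriction $f|_{P\cap C^r_K(M,E)}$ is of class $C^k_{\mathbb{K}}$ for every compact subset $K\subseteq M$, and $f$ is locally almost local, then $f$ is of class $C^k_{\mathbb{K}}$.
   Context: All topological spaces, fields and topological vector spaces are Hausdorff; topological fields are non-discrete. A local field is a totally disconnected, locally compact topological field. A valued field is a field with an absolute value defining a non-discrete topology. Almost local: $f\colon P\to C^s_c(N,F)$ is almost local if there exist locally finite covers $(U_i)_{i\in I}$ of $M$ and $(V_i)_{i\in I}$ of $N$ (same index set) by relatively compact, open sets such that for all $i\in I$ and all $\gamma,\eta\in P$ with $\gamma|_{U_i}=\eta|_{U_i}$ one has $f(\gamma)|_{V_i}=f(\eta)|_{V_i}$. $f$ is locally almost local if every $\gamma\in P$ has an open neighbourhood $Q\subseteq P$ such that $f|_Q$ is almost local. Differential calculus over a topological field $\mathbb{K}$: For a topological $\mathbb{K}$-vector space $E$ and $U\subseteq E$ open, put $U^{[0]}:=U$, $U^{[1]}:=\{(x,y,t)\in U\times E\times\mathbb{K}: x+ty\in U\}$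 and $U^{[j+1]}:=(U^{[j]})^{[1]}$. A map $f\colon U\to F$ into a topological $\mathbb{K}$-vector space is $C^0_{\mathbb{K}}$ if it is continuous ($f^{[0]}:=f$); it is $C^1_{\mathbb{K}}$ if it is continuous and there is a (necessarily unique) continuous map $f^{[1]}\colon U^{[1]}\to F$ with $f^{[1]}(x,y,t)=\frac1t(f(x+ty)-f(x))$ for all $(x,y,t)\in U^{[1]}$ with $t\neq0$; for $k\ge2$ it is $C^k_{\mathbb{K}}$ if it is $C^{k-1}_{\mathbb{K}}$ and $f^{[k-1]}$ is $C^1_{\mathbb{K}}$, and then $f^{[k]}:=(f^{[k-1]})^{[1]}$; it is $C^\infty_{\mathbb{K}}$ if it is $C^k_{\mathbb{K}}$ for all $k$. Manifolds and $C^r$-maps on them are defined as usual via charts. Function spaces: For $V$ open in a topological $\mathbb{F}$-vector space and $E$ a topological $\mathbb{K}$-vector space, $C^r(V,E)$ is the space of $C^r_{\mathbb{F}}$-maps $V\to E$ with the initial topology with respect to the maps $\gamma\mapsto\gamma^{[j]}\in C(V^{[j]},E)$ (compact-open topology), $j\in\mathbb{N}_0$, $j\le r$. For a $C^r_{\mathbb{F}}$-manifold $M$, $C^r(M,E)$ carries the initial topology with respect to the maps $\gamma\mapsto\gamma|_U\circ\kappa^{-1}\in C^r(V,E)$, for $\kappa\colon U\to V$ ranging through the charts of $M$; for compact $K\subseteq M$, $C^r_K(M,E):=\{\gamma\in C^r(M,E):\operatorname{supp}\gamma\subseteq K\}$ carries the induced topology. $C^r_c(M,E)$ is the space of compactly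 supported $C^r_{\mathbb{F}}$-maps $M\to E$ with the box topology, i.e. the topology induced by $C^r_c(M,E)\to\bigoplus_iC^r(U_i,E)$, $\gamma\mapsto(\gamma|_{U_i})_i$, for any locally finite cover $(U_i)_{i\in I}$ of $M$ by relatively compact open sets (independent of the choice of cover); here a direct sum $\bigoplus_iE_i$ has the zero-neighbourhood basis consisting of the sets $(\bigoplus_iE_i)\cap\prod_iW_i$ with $W_i\subseteq E_i$ open zero-neighbourhoods. *)

theory Defs
  imports "HOL-Analysis.Analysis" "HOL-Library.Function_Algebras"
begin

section \<open>Topological fields\<close>

definition topological_field :: "'a::field topology \<Rightarrow> bool" where
  "topological_field T \<longleftrightarrow>
     topspace T = UNIV \<and> Hausdorff_space T \<and> T \<noteq> discrete_topology UNIV \<and>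
     continuous_map (prod_topology T T) T (\<lambda>(x, y). x + y) \<and>
     continuous_map T T uminus \<and>
     continuous_map (prod_topology T T) T (\<lambda>(x, y). x * y) \<and>
     continuous_map (subtopology T (- {0})) T inverse"

definition totally_disconnected_space :: "'a topology \<Rightarrow> bool" where
  "totally_disconnected_space X \<longleftrightarrow>
     (\<forall>x\<in>topspace X. connected_component_of_set X x = {x})"

definition local_field :: "'a::field topology \<Rightarrow> bool" where
  "local_field T \<longleftrightarrow>
     topological_field T \<and> totally_disconnected_space T \<and> locally_compact_space T"

definition field_hom :: "('a::field \<Rightarrow> 'b::field) \<Rightarrow> bool" where
  "field_hom h \<longleftrightarrow>
     h 1 = 1 \<and> (\<forall>x y. h (x + y) = h x + h y) \<and> (\<forall>x y. h (x * y) = h x * h y)"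

text \<open>The topological field is the real line, up to isomorphism of topological fields.\<close>

definition is_real_field :: "'a::field topology \<Rightarrow> bool" where
  "is_real_field T \<longleftrightarrow>
     topspace T = UNIV \<and> (\<exists>h::'a \<Rightarrow> real. field_hom h \<and> homeomorphic_map T euclideanreal h)"

definition absolute_value :: "('k::field \<Rightarrow> real) \<Rightarrow> bool" where
  "absolute_value av \<longleftrightarrow>
     (\<forall>x. 0 \<le> av x) \<and> (\<forall>x. av x = 0 \<longleftrightarrow> x = 0) \<and>
     (\<forall>x y. av (x * y) = av x * av y) \<and> (\<forall>x y. av (x + y) \<le> av x + av y)"

definition valued_topology :: "('k::field \<Rightarrow> real) \<Rightarrow> 'k topology" where
  "valued_topology av = Metric_space.mtopology UNIV (\<lambda>x y. av (x - y))"

definition valued_field :: "('k::field \<Rightarrow> real) \<Rightarrow> bool" where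
  "valued_field av \<longleftrightarrow> absolute_value av \<and> valued_topology av \<noteq> discrete_topology UNIV"

text \<open>The inclusion of the smaller field is an explicit embedding; the smaller field carries the
  topology induced by the larger one.\<close>

definition topological_extension_field ::
    "'a::field topology \<Rightarrow> 'k::field topology \<Rightarrow> ('a \<Rightarrow> 'k) \<Rightarrow> bool" where
  "topological_extension_field TF TK emb \<longleftrightarrow> field_hom emb \<and> embedding_map TF TK emb"


section \<open>Topological vector spaces\<close>

text \<open>The carrier of a topological vector space is the topspace of its topology, a linear subspace
  of the ambient type. Addition is that of the ambient type.\<close>

record ('k, 'v) tvs =
  scale :: "'k \<Rightarrow> 'v \<Rightarrow> 'v"
  vtop :: "'v topology"

definition topological_vector_space ::
    "'k::field topology \<Rightarrow> ('k, 'v::ab_group_add) tvs \<Rightarrow> bool" where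
  "topological_vector_space TK X \<longleftrightarrow>
     vector_space (scale X) \<and> module.subspace (scale X) (topspace (vtop X)) \<and>
     Hausdorff_space (vtop X) \<and>
     continuous_map (prod_topology (vtop X) (vtop X)) (vtop X) (\<lambda>(x, y). x + y) \<and>
     continuous_map (prod_topology TK (vtop X)) (vtop X) (\<lambda>(t, x). scale X t x)"

definition finite_dimensional_tvs :: "('k::field, 'v::ab_group_add) tvs \<Rightarrow> bool" where
  "finite_dimensional_tvs X \<longleftrightarrow>
     (\<exists>B. finite B \<and> B \<subseteq> topspace (vtop X) \<and> module.span (scale X) B = topspace (vtop X))"

definition restrict_scalars :: "('a \<Rightarrow> 'k) \<Rightarrow> ('k, 'v) tvs \<Rightarrow> ('a, 'v) tvs" where
  "restrict_scalars emb X = \<lparr>scale = (\<lambda>a. scale X (emb a)), vtop = vtop X\<rparr>"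


section \<open>Differential calculus over a topological field\<close>

text \<open>The domains \<open>U\<^sup>[\<^sup>j\<^sup>]\<close> lie in different spaces \<open>E\<^sub>0 = E\<close> and
  \<open>E\<^bsub>j+1\<^esub> = E\<^sub>j \<times> E\<^sub>j \<times> K\<close>. The following type contains all of them: an element of \<open>E\<^sub>0\<close> is
  \<open>Base x\<close>, and \<open>Node x y t\<close> encodes the triple \<open>(x, y, t)\<close>. The operations below are meaningful only
  when applied to elements of one and the same \<open>E\<^sub>j\<close>.\<close>

datatype ('v, 'k) iter =
    Base (base: 'v)
  | Node (pnt: "('v, 'k) iter") (dir: "('v, 'k) iter") (par: 'k)

primrec iadd :: "('v::plus, 'k::plus) iter \<Rightarrow> ('v, 'k) iter \<Rightarrow> ('v, 'k) iter" where
  "iadd (Base x) w = Base (x + base w)"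
| "iadd (Node x y t) w = Node (iadd x (pnt w)) (iadd y (dir w)) (t + par w)"

primrec iscale ::
    "('k \<Rightarrow> 'v \<Rightarrow> 'v) \<Rightarrow> 'k::times \<Rightarrow> ('v, 'k) iter \<Rightarrow> ('v, 'k) iter" where
  "iscale s a (Base x) = Base (s a x)"
| "iscale s a (Node x y t) = Node (iscale s a x) (iscale s a y) (a * t)"

text \<open>The topology of \<open>E\<^sub>j\<close>; its topspace is \<open>E\<^sub>j\<close>.\<close>

primrec itop :: "'k topology \<Rightarrow> 'v topology \<Rightarrow> nat \<Rightarrow> ('v, 'k) iter topology" where
  "itop TK T 0 = pullback_topology (range Base) base T"
| "itop TK T (Suc j) =
     pullback_topology {w. \<exists>x y t. w = Node x y t} (\<lambda>w. (pnt w, dir w, par w))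
       (prod_topology (itop TK T j) (prod_topology (itop TK T j) TK))"

primrec idom ::
    "'k::field topology \<Rightarrow> ('k, 'v::ab_group_add) tvs \<Rightarrow> 'v set \<Rightarrow> nat \<Rightarrow> ('v, 'k) iter set" where
  "idom TK X U 0 = Base ` U"
| "idom TK X U (Suc j) =
     {Node x y t | x y t. x \<in> idom TK X U j \<and> y \<in> topspace (itop TK (vtop X) j) \<and>
        t \<in> topspace TK \<and> iadd x (iscale (scale X) t y) \<in> idom TK X U j}"

definition idom_top ::
    "'k::field topology \<Rightarrow> ('k, 'v::ab_group_add) tvs \<Rightarrow> 'v set \<Rightarrow> nat \<Rightarrow> ('v, 'k) iter topology" where
  "idom_top TK X U j = subtopology (itop TK (vtop X) j) (idom TK X U j)"

text \<open>\<open>h = g\<^sup>[\<^sup>1\<^sup>]\<close> for a map \<open>g\<close> on \<open>U\<^sup>[\<^sup>j\<^sup>]\<close>; extensionality makes \<open>h\<close> a function on \<open>U\<^sup>[\<^sup>j\<^sup>+\<^sup>1\<^sup>]\<close> only.\<close>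

definition is_dquot ::
    "'k::field topology \<Rightarrow> ('k, 'v::ab_group_add) tvs \<Rightarrow> ('k, 'w::ab_group_add) tvs \<Rightarrow> 'v set \<Rightarrow> nat
      \<Rightarrow> (('v, 'k) iter \<Rightarrow> 'w) \<Rightarrow> (('v, 'k) iter \<Rightarrow> 'w) \<Rightarrow> bool" where
  "is_dquot TK X Y U j g h \<longleftrightarrow>
     h \<in> extensional (idom TK X U (Suc j)) \<and>
     continuous_map (idom_top TK X U (Suc j)) (vtop Y) h \<and>
     (\<forall>x y t. Node x y t \<in> idom TK X U (Suc j) \<longrightarrow> t \<noteq> 0 \<longrightarrow>
        h (Node x y t) = scale Y (1 / t) (g (iadd x (iscale (scale X) t y)) - g x))"

text \<open>The map \<open>f\<^sup>[\<^sup>j\<^sup>]\<close> on \<open>U\<^sup>[\<^sup>j\<^sup>]\<close>, meaningful if \<open>f\<close> is \<open>C\<^sup>j\<close> on \<open>U\<close>.\<close>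

primrec iter_dquot ::
    "'k::field topology \<Rightarrow> ('k, 'v::ab_group_add) tvs \<Rightarrow> ('k, 'w::ab_group_add) tvs \<Rightarrow> 'v set
      \<Rightarrow> ('v \<Rightarrow> 'w) \<Rightarrow> nat \<Rightarrow> ('v, 'k) iter \<Rightarrow> 'w" where
  "iter_dquot TK X Y U f 0 = restrict (f \<circ> base) (idom TK X U 0)"
| "iter_dquot TK X Y U f (Suc j) = (THE h. is_dquot TK X Y U j (iter_dquot TK X Y U f j) h)"

primrec Ck_nat ::
    "'k::field topology \<Rightarrow> ('k, 'v::ab_group_add) tvs \<Rightarrow> ('k, 'w::ab_group_add) tvs \<Rightarrow> 'v set
      \<Rightarrow> ('v \<Rightarrow> 'w) \<Rightarrow> nat \<Rightarrow> bool" where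
  "Ck_nat TK X Y U f 0 \<longleftrightarrow> continuous_map (subtopology (vtop X) U) (vtop Y) f"
| "Ck_nat TK X Y U f (Suc j) \<longleftrightarrow>
     Ck_nat TK X Y U f j \<and>
     continuous_map (idom_top TK X U j) (vtop Y) (iter_dquot TK X Y U f j) \<and>
     (\<exists>h. is_dquot TK X Y U j (iter_dquot TK X Y U f j) h)"

definition Ck ::
    "'k::field topology \<Rightarrow> ('k, 'v::ab_group_add) tvs \<Rightarrow> ('k, 'w::ab_group_add) tvs \<Rightarrow> enat
      \<Rightarrow> 'v set \<Rightarrow> ('v \<Rightarrow> 'w) \<Rightarrow> bool" where
  "Ck TK X Y k U f \<longleftrightarrow> (\<forall>j. enat j \<le> k \<longrightarrow> Ck_nat TK X Y U f j)"


section \<open>Manifolds\<close>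

text \<open>A chart \<open>\<kappa>: U \<rightarrow> V\<close> is a pair \<open>(U, \<kappa>)\<close> with \<open>\<kappa>\<close> extensional on \<open>U\<close>.\<close>

record ('a, 'z, 'm) manifold =
  mtop :: "'m topology"
  model :: "('a, 'z) tvs"
  atlas :: "('m set \<times> ('m \<Rightarrow> 'z)) set"

definition is_chart :: "'m topology \<Rightarrow> ('a, 'z) tvs \<Rightarrow> 'm set \<times> ('m \<Rightarrow> 'z) \<Rightarrow> bool" where
  "is_chart T Z = (\<lambda>(U, \<kappa>).
     openin T U \<and> \<kappa> \<in> extensional U \<and> openin (vtop Z) (\<kappa> ` U) \<and>
     homeomorphic_map (subtopology T U) (subtopology (vtop Z) (\<kappa> ` U)) \<kappa>)"

definition compatible_charts ::
    "'a::field topology \<Rightarrow> ('a, 'z::ab_group_add) tvs \<Rightarrow> enat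
      \<Rightarrow> 'm set \<times> ('m \<Rightarrow> 'z) \<Rightarrow> 'm set \<times> ('m \<Rightarrow> 'z) \<Rightarrow> bool" where
  "compatible_charts TF Z r = (\<lambda>(U, \<kappa>) (U', \<kappa>').
     Ck TF Z Z r (\<kappa> ` (U \<inter> U')) (\<kappa>' \<circ> inv_into U \<kappa>) \<and>
     Ck TF Z Z r (\<kappa>' ` (U \<inter> U')) (\<kappa> \<circ> inv_into U' \<kappa>'))"

text \<open>The \<open>C\<^sup>r\<close>-structure is given by a maximal atlas.\<close>

definition Cr_manifold ::
    "'a::field topology \<Rightarrow> enat \<Rightarrow> ('a, 'z::ab_group_add, 'm) manifold \<Rightarrow> bool" where
  "Cr_manifold TF r M \<longleftrightarrow>
     topological_vector_space TF (model M) \<and>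
     Hausdorff_space (mtop M) \<and>
     (\<forall>c\<in>atlas M. is_chart (mtop M) (model M) c) \<and>
     (\<Union>c\<in>atlas M. fst c) = topspace (mtop M) \<and>
     (\<forall>c\<in>atlas M. \<forall>d\<in>atlas M. compatible_charts TF (model M) r c d) \<and>
     (\<forall>c. is_chart (mtop M) (model M) c \<longrightarrow>
        (\<forall>d\<in>atlas M. compatible_charts TF (model M) r c d) \<longrightarrow> c \<in> atlas M)"

definition open_submanifold ::
    "('a, 'z, 'm) manifold \<Rightarrow> 'm set \<Rightarrow> ('a, 'z, 'm) manifold" where
  "open_submanifold M W =
     \<lparr>mtop = subtopology (mtop M) W, model = model M, atlas = {c \<in> atlas M. fst c \<subseteq> W}\<rparr>"

definition paracompact_space :: "'m topology \<Rightarrow> bool" where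
  "paracompact_space T \<longleftrightarrow>
     Hausdorff_space T \<and>
     (\<forall>\<U>. (\<forall>U\<in>\<U>. openin T U) \<longrightarrow> \<Union>\<U> = topspace T \<longrightarrow>
        (\<exists>\<V>. (\<forall>V\<in>\<V>. openin T V \<and> (\<exists>U\<in>\<U>. V \<subseteq> U)) \<and> \<Union>\<V> = topspace T \<and>
             locally_finite_in T \<V>))"

text \<open>Indexed families; the index set may contain repetitions and empty members.\<close>

definition rc_cover :: "'m topology \<Rightarrow> 'i set \<Rightarrow> ('i \<Rightarrow> 'm set) \<Rightarrow> bool" where
  "rc_cover T I U \<longleftrightarrow>
     (\<forall>i\<in>I. openin T (U i) \<and> compactin T (T closure_of U i)) \<and>
     (\<Union>i\<in>I. U i) = topspace T \<and>
     (\<forall>x\<in>topspace T. \<exists>W. openin T W \<and> x \<in> W \<and> finite {i\<in>I. U i \<inter> W \<noteq> {}})"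


section \<open>Function spaces\<close>

definition initial_topology ::
    "'x set \<Rightarrow> 'j set \<Rightarrow> ('j \<Rightarrow> 'x \<Rightarrow> 'y) \<Rightarrow> ('j \<Rightarrow> 'y topology) \<Rightarrow> 'x topology" where
  "initial_topology S J f T =
     topology_generated_by (insert S {f j -` V \<inter> S | j V. j \<in> J \<and> openin (T j) V})"

definition compact_open_topology :: "'x topology \<Rightarrow> 'y topology \<Rightarrow> ('x \<Rightarrow> 'y) topology" where
  "compact_open_topology X Y =
     topology_generated_by
       {{f. f \<in> extensional (topspace X) \<and> continuous_map X Y f \<and> f ` K \<subseteq> V} | K V.
          compactin X K \<and> openin Y V}"

text \<open>Vector-valued functions on a set \<open>S\<close> are represented by functions on the whole type that
  vanish off \<open>S\<close>; so they form a linear subspace of a function type.\<close>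

definition ext0 :: "'x set \<Rightarrow> ('x \<Rightarrow> 'y::zero) \<Rightarrow> 'x \<Rightarrow> 'y" where
  "ext0 S g = (\<lambda>x. if x \<in> S then g x else 0)"

definition fun_scale :: "('k \<Rightarrow> 'e \<Rightarrow> 'e) \<Rightarrow> 'k \<Rightarrow> ('x \<Rightarrow> 'e) \<Rightarrow> 'x \<Rightarrow> 'e" where
  "fun_scale s a \<gamma> = (\<lambda>x. s a (\<gamma> x))"

text \<open>\<open>C\<^sup>r(V, E)\<close> for an open subset \<open>V\<close> of a topological vector space \<open>Z\<close>.\<close>

definition Cr_open ::
    "'a::field topology \<Rightarrow> enat \<Rightarrow> ('a, 'z::ab_group_add) tvs \<Rightarrow> ('a, 'e::ab_group_add) tvs
      \<Rightarrow> 'z set \<Rightarrow> ('z \<Rightarrow> 'e) set" where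
  "Cr_open TF r Z E V = {\<gamma>. (\<forall>x. x \<notin> V \<longrightarrow> \<gamma> x = 0) \<and> Ck TF Z E r V \<gamma>}"

definition Cr_open_top ::
    "'a::field topology \<Rightarrow> enat \<Rightarrow> ('a, 'z::ab_group_add) tvs \<Rightarrow> ('a, 'e::ab_group_add) tvs
      \<Rightarrow> 'z set \<Rightarrow> ('z \<Rightarrow> 'e) topology" where
  "Cr_open_top TF r Z E V =
     initial_topology (Cr_open TF r Z E V) {j. enat j \<le> r}
       (\<lambda>j \<gamma>. iter_dquot TF Z E V \<gamma> j)
       (\<lambda>j. compact_open_topology (idom_top TF Z V j) (vtop E))"

text \<open>\<open>C\<^sup>r(M, E)\<close> for a \<open>C\<^sup>r\<close>-manifold \<open>M\<close>.\<close>

definition Cr_fun ::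
    "'a::field topology \<Rightarrow> enat \<Rightarrow> ('a, 'z::ab_group_add, 'm) manifold
      \<Rightarrow> ('a, 'e::ab_group_add) tvs \<Rightarrow> ('m \<Rightarrow> 'e) set" where
  "Cr_fun TF r M E =
     {\<gamma>. (\<forall>x. x \<notin> topspace (mtop M) \<longrightarrow> \<gamma> x = 0) \<and>
         (\<forall>(U, \<kappa>)\<in>atlas M. Ck TF (model M) E r (\<kappa> ` U) (\<gamma> \<circ> inv_into U \<kappa>))}"

definition Cr_top ::
    "'a::field topology \<Rightarrow> enat \<Rightarrow> ('a, 'z::ab_group_add, 'm) manifold
      \<Rightarrow> ('a, 'e::ab_group_add) tvs \<Rightarrow> ('m \<Rightarrow> 'e) topology" where
  "Cr_top TF r M E =
     initial_topology (Cr_fun TF r M E) (atlas M)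
       (\<lambda>(U, \<kappa>) \<gamma>. ext0 (\<kappa> ` U) (\<gamma> \<circ> inv_into U \<kappa>))
       (\<lambda>(U, \<kappa>). Cr_open_top TF r (model M) E (\<kappa> ` U))"

definition support :: "'m topology \<Rightarrow> ('m \<Rightarrow> 'e::zero) \<Rightarrow> 'm set" where
  "support T \<gamma> = T closure_of {x \<in> topspace T. \<gamma> x \<noteq> 0}"

definition CrK_fun ::
    "'a::field topology \<Rightarrow> enat \<Rightarrow> ('a, 'z::ab_group_add, 'm) manifold
      \<Rightarrow> ('a, 'e::ab_group_add) tvs \<Rightarrow> 'm set \<Rightarrow> ('m \<Rightarrow> 'e) set" where
  "CrK_fun TF r M E K = {\<gamma> \<in> Cr_fun TF r M E. support (mtop M) \<gamma> \<subseteq> K}"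

definition Crc_fun ::
    "'a::field topology \<Rightarrow> enat \<Rightarrow> ('a, 'z::ab_group_add, 'm) manifold
      \<Rightarrow> ('a, 'e::ab_group_add) tvs \<Rightarrow> ('m \<Rightarrow> 'e) set" where
  "Crc_fun TF r M E = {\<gamma> \<in> Cr_fun TF r M E. compactin (mtop M) (support (mtop M) \<gamma>)}"

text \<open>In \<open>CrK\<close> and \<open>Crc\<close> below, \<open>E\<close> is a vector space over \<open>'k\<close>, regarded as one over \<open>'a\<close> by means
  of \<open>emb\<close> for the calculus on \<open>M\<close>; the function spaces are vector spaces over \<open>'k\<close>.\<close>

definition CrK ::
    "'a::field topology \<Rightarrow> ('a \<Rightarrow> 'k) \<Rightarrow> enat \<Rightarrow> ('a, 'z::ab_group_add, 'm) manifold
      \<Rightarrow> ('k::field, 'e::ab_group_add) tvs \<Rightarrow> 'm set \<Rightarrow> ('k, 'm \<Rightarrow> 'e) tvs" where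
  "CrK TF emb r M E K =
     \<lparr>scale = fun_scale (scale E),
      vtop = subtopology (Cr_top TF r M (restrict_scalars emb E))
        (CrK_fun TF r M (restrict_scalars emb E) K)\<rparr>"

definition direct_sum :: "'i set \<Rightarrow> ('i \<Rightarrow> 'x::zero topology) \<Rightarrow> ('i \<Rightarrow> 'x) set" where
  "direct_sum I T =
     {x. (\<forall>i. i \<notin> I \<longrightarrow> x i = 0) \<and> (\<forall>i\<in>I. x i \<in> topspace (T i)) \<and> finite {i\<in>I. x i \<noteq> 0}}"

definition direct_sum_topology ::
    "'i set \<Rightarrow> ('i \<Rightarrow> 'x::ab_group_add topology) \<Rightarrow> ('i \<Rightarrow> 'x) topology" where
  "direct_sum_topology I T = topology (\<lambda>O'. O' \<subseteq> direct_sum I T \<and>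
     (\<forall>x\<in>O'. \<exists>W. (\<forall>i\<in>I. openin (T i) (W i) \<and> 0 \<in> W i) \<and>
        (\<forall>y\<in>direct_sum I T. (\<forall>i\<in>I. y i \<in> W i) \<longrightarrow> x + y \<in> O')))"

lemma openin_direct_sum_topology:
  "openin (direct_sum_topology I T) O' \<longleftrightarrow> O' \<subseteq> direct_sum I T \<and>
     (\<forall>x\<in>O'. \<exists>W. (\<forall>i\<in>I. openin (T i) (W i) \<and> 0 \<in> W i) \<and>
        (\<forall>y\<in>direct_sum I T. (\<forall>i\<in>I. y i \<in> W i) \<longrightarrow> x + y \<in> O'))"
proof -
  define P where "P O' x W \<longleftrightarrow> (\<forall>i\<in>I. openin (T i) (W i) \<and> 0 \<in> W i) \<and>
        (\<forall>y\<in>direct_sum I T. (\<forall>i\<in>I. y i \<in> W i) \<longrightarrow> x + y \<in> O')" for O' x W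
  have Int: "P (A \<inter> B) x (\<lambda>i. V i \<inter> W i)" if "P A x V" "P B x W" for A B x V W
    using that unfolding P_def by (simp add: openin_Int)
  have mono: "P B x W" if "P A x W" "A \<subseteq> B" for A B x W
    using that unfolding P_def by (meson subsetD)
  have "istopology (\<lambda>O'. O' \<subseteq> direct_sum I T \<and> (\<forall>x\<in>O'. \<exists>W. P O' x W))"
    unfolding istopology_def
  proof (intro conjI allI impI)
    fix A B
    assume A: "A \<subseteq> direct_sum I T \<and> (\<forall>x\<in>A. \<exists>W. P A x W)"
      and B: "B \<subseteq> direct_sum I T \<and> (\<forall>x\<in>B. \<exists>W. P B x W)"
    show "A \<inter> B \<subseteq> direct_sum I T" using A by (meson inf.coboundedI1)
    show "\<forall>x\<in>A \<inter> B. \<exists>W. P (A \<inter> B) x W"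
      using A B Int by (meson IntD1 IntD2)
  next
    fix \<K> assume \<K>: "\<forall>K\<in>\<K>. K \<subseteq> direct_sum I T \<and> (\<forall>x\<in>K. \<exists>W. P K x W)"
    then show "\<Union>\<K> \<subseteq> direct_sum I T" by (meson Sup_least)
    show "\<forall>x\<in>\<Union>\<K>. \<exists>W. P (\<Union>\<K>) x W"
      using \<K> mono by (meson UnionE Sup_upper)
  qed
  then show ?thesis
    unfolding direct_sum_topology_def P_def by (rule topology_inverse'[THEN fun_cong])
qed

text \<open>\<open>C\<^sup>r\<^sub>c(M, E)\<close> with the box topology, computed from the locally finite cover \<open>(U i)\<^bsub>i\<in>I\<^esub>\<close> of
  \<open>M\<close> by relatively compact open sets.\<close>

definition Crc ::
    "'a::field topology \<Rightarrow> ('a \<Rightarrow> 'k) \<Rightarrow> enat \<Rightarrow> ('a, 'z::ab_group_add, 'm) manifold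
      \<Rightarrow> ('k::field, 'e::ab_group_add) tvs \<Rightarrow> 'i set \<Rightarrow> ('i \<Rightarrow> 'm set) \<Rightarrow> ('k, 'm \<Rightarrow> 'e) tvs" where
  "Crc TF emb r M E I U =
     \<lparr>scale = fun_scale (scale E),
      vtop = pullback_topology (Crc_fun TF r M (restrict_scalars emb E))
        (\<lambda>\<gamma> i. if i \<in> I then ext0 (U i) \<gamma> else 0)
        (direct_sum_topology I
          (\<lambda>i. Cr_top TF r (open_submanifold M (U i)) (restrict_scalars emb E)))\<rparr>"


section \<open>Almost local maps\<close>

text \<open>The index set of the two covers may be taken inside the type \<open>'m set \<times> 'n set\<close>: retaining one
  index for each pair \<open>(U i, V i)\<close> gives covers with the same properties.\<close>

definition almost_local ::
    "'m topology \<Rightarrow> 'n topology \<Rightarrow> ('m \<Rightarrow> 'e) set \<Rightarrow> (('m \<Rightarrow> 'e) \<Rightarrow> 'n \<Rightarrow> 'f) \<Rightarrow> bool" where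
  "almost_local TM TN P f \<longleftrightarrow>
     (\<exists>(I :: ('m set \<times> 'n set) set) U V. rc_cover TM I U \<and> rc_cover TN I V \<and>
        (\<forall>i\<in>I. \<forall>\<gamma>\<in>P. \<forall>\<eta>\<in>P. (\<forall>x\<in>U i. \<gamma> x = \<eta> x) \<longrightarrow> (\<forall>y\<in>V i. f \<gamma> y = f \<eta> y)))"

definition locally_almost_local ::
    "('m \<Rightarrow> 'e) topology \<Rightarrow> 'm topology \<Rightarrow> 'n topology \<Rightarrow> ('m \<Rightarrow> 'e) set
      \<Rightarrow> (('m \<Rightarrow> 'e) \<Rightarrow> 'n \<Rightarrow> 'f) \<Rightarrow> bool" where
  "locally_almost_local T TM TN P f \<longleftrightarrow>
     (\<forall>\<gamma>\<in>P. \<exists>Q. openin T Q \<and> \<gamma> \<in> Q \<and> Q \<subseteq> P \<and> almost_local TM TN Q f)"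

end

theory Submission
  imports Defs
begin

text \<open>Only finitely many test functions occur in a point of \<open>P\<^sup>[\<^sup>m\<^sup>]\<close>, and they are supported in a common
  compact set \<open>K\<close>. So the difference quotients of the maps \<open>f\<close> restricted to \<open>C\<^sup>r\<^sub>K(M, E)\<close> fit together to maps
  on the sets \<open>P\<^sup>[\<^sup>m\<^sup>]\<close>, and only their continuity with respect to the box topologies is in question.
  Difference quotients of an almost local map are almost local: on a small set \<open>V\<close> their values do
  not change when all test functions are multiplied by a cutoff function equal to 1 on a certain
  compact set. Each component of the difference quotient in the direct sum thus factors through
  some \<open>C\<^sup>r\<^sub>K(M, E)\<close> and is continuous. The components have to be controlled simultaneously.
  For all but finitely many of them the cutoff function kills every test function occurring in the
  given point \<open>w\<^sub>0\<close>; after the cutoff, points near \<open>w\<^sub>0\<close> have small test functions (up to an additive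
  constant in the base point) and bounded parameters. The rescaling \<open>(x, y, t) \<mapsto> (x, b y, t / b)\<close>
  makes the parameters small as well, so continuity at a point with vanishing directions suffices.\<close>

section \<open>Differentiability at a level of the iterated domains\<close>

text \<open>The parameters are the obstacle. Those of \<open>w0\<close> may be large, while
  continuity of a quotient at a point with zero directions concerns small ones; and the larger field
  is merely valued, so bounded parameters need not form a compact set and no tube argument over them
  is available. Rescaling takes its place. Its factor is harmless because quotients of positive
  order vanish where all directions vanish, so a smaller neighbourhood of 0 absorbs it. The
  quotients in the definition of \<open>Ck\<close> are selected by \<open>THE\<close> on one open
  set. Function spaces call for families of quotients that are jointly continuous in a parameter,
  and cutoffs for a product rule, a chain rule and locality; hence the separate notion
  \<open>cdiff\<close>, compared with \<open>Ck\<close> once. Identities between quotients are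
  checked for \<open>t \<noteq> 0\<close> and extend to \<open>t = 0\<close> since the scalar field
  is not discrete. Local compactness of the smaller field serves evaluation maps, coordinates and
  compact supports; smooth bumps come from Hadamard's integral formula in the real case and from
  locally constant functions in the local case.\<close>

locale top_field =
  fixes TK :: "'k::field topology"
  assumes top_field: "topological_field TK"
begin

abbreviation "tvs \<equiv> topological_vector_space TK"

abbreviation "lv X \<equiv> itop TK (vtop X)"

abbreviation "istep X x y t \<equiv> iadd x (iscale (scale X) t y)"

abbreviation "fld \<equiv> \<lparr>scale = (*), vtop = TK\<rparr>"

lemma topspace_TK [simp]: "topspace TK = UNIV"
  and Hausdorff_TK: "Hausdorff_space TK"
  using top_field by (auto simp: topological_field_def)

lemma cont_const: "c \<in> topspace Y \<Longrightarrow> continuous_map T Y (\<lambda>_. c)"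
  by simp

lemma cont_add:
  assumes "continuous_map T TK a" "continuous_map T TK b"
  shows "continuous_map T TK (\<lambda>x. a x + b x)"
  using continuous_map_compose[OF continuous_map_pairedI[OF assms],
      of TK "\<lambda>(x, y). x + y"] top_field
  by (simp add: topological_field_def o_def)

lemma cont_mult:
  assumes "continuous_map T TK a" "continuous_map T TK b"
  shows "continuous_map T TK (\<lambda>x. a x * b x)"
  using continuous_map_compose[OF continuous_map_pairedI[OF assms],
      of TK "\<lambda>(x, y). x * y"] top_field
  by (simp add: topological_field_def o_def)

lemma cont_inverse:
  assumes "continuous_map T TK a" "\<And>x. x \<in> topspace T \<Longrightarrow> a x \<noteq> 0"
  shows "continuous_map T TK (\<lambda>x. inverse (a x))"
proof -
  have "continuous_map T (subtopology TK (- {0})) a"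
    using assms by (simp add: continuous_map_in_subtopology Pi_iff image_subset_iff)
  from continuous_map_compose[OF this, of TK inverse] show ?thesis
    using top_field by (simp add: topological_field_def o_def)
qed

text \<open>Translations are homeomorphisms, so one open point would make every point open. In this
  form non-discreteness is used to pass from nonzero parameters to the parameter 0.\<close>

lemma not_open_singleton: "\<not> openin TK {c}"
proof
  assume c: "openin TK {c}"
  have "openin TK {x}" for x
  proof -
    have "continuous_map TK TK (\<lambda>y. y + (c - x))"
      by (intro cont_add) auto
    then have "openin TK {y \<in> topspace TK. y + (c - x) \<in> {c}}"
      using c openin_continuous_map_preimage by blast
    moreover have "{y \<in> topspace TK. y + (c - x) \<in> {c}} = {x}"
      by (auto simp: algebra_simps)
    ultimately show ?thesis by simp
  qed
  then have "TK = discrete_topology UNIV"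
    by (subst eq_commute) (simp add: discrete_topology_unique)
  then show False
    using top_field by (simp add: topological_field_def)
qed

section \<open>Elementary facts on topological vector spaces\<close>

lemma tvsD:
  assumes "tvs X"
  shows tvs_vs: "vector_space (scale X)"
    and tvs_zero: "0 \<in> topspace (vtop X)"
    and tvs_add: "\<And>x y. x \<in> topspace (vtop X) \<Longrightarrow> y \<in> topspace (vtop X) \<Longrightarrow> x + y \<in> topspace (vtop X)"
    and tvs_scale: "\<And>c x. x \<in> topspace (vtop X) \<Longrightarrow> scale X c x \<in> topspace (vtop X)"
    and tvs_Hausdorff: "Hausdorff_space (vtop X)"
proof -
  show "vector_space (scale X)"
    using assms by (simp add: topological_vector_space_def)
  then interpret vector_space "scale X" .
  show "0 \<in> topspace (vtop X)"
    "\<And>x y. x \<in> topspace (vtop X) \<Longrightarrow> y \<in> topspace (vtop X) \<Longrightarrow> x + y \<in> topspace (vtop X)"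
    "\<And>c x. x \<in> topspace (vtop X) \<Longrightarrow> scale X c x \<in> topspace (vtop X)"
    "Hausdorff_space (vtop X)"
    using assms subspace_0 subspace_add subspace_scale by (auto simp: topological_vector_space_def)
qed

lemma tvs_cont_add:
  assumes "tvs X" "continuous_map T (vtop X) a" "continuous_map T (vtop X) b"
  shows "continuous_map T (vtop X) (\<lambda>x. a x + b x)"
  using continuous_map_compose[OF continuous_map_pairedI[OF assms(2,3)],
      of "vtop X" "\<lambda>(x, y). x + y"] assms(1)
  by (simp add: topological_vector_space_def o_def)

lemma tvs_cont_scale:
  assumes "tvs X" "continuous_map T TK a" "continuous_map T (vtop X) b"
  shows "continuous_map T (vtop X) (\<lambda>x. scale X (a x) (b x))"
  using continuous_map_compose[OF continuous_map_pairedI[OF assms(2,3)],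
      of "vtop X" "\<lambda>(t, x). scale X t x"] assms(1)
  by (simp add: topological_vector_space_def o_def)

lemma scale_simps:
  assumes "tvs X"
  shows "scale X 0 x = 0" "scale X c 0 = 0" "scale X 1 x = x"
    "scale X a (scale X b x) = scale X (a * b) x"
    "scale X a (x + y) = scale X a x + scale X a y"
    "scale X (a + b) x = scale X a x + scale X b x"
    "scale X a (x - y) = scale X a x - scale X a y"
    "scale X (- a) x = - scale X a x"
    "scale X a (- x) = - scale X a x"
proof -
  interpret vector_space "scale X" using assms by (rule tvs_vs)
  show "scale X 0 x = 0" "scale X c 0 = 0" "scale X 1 x = x"
    "scale X a (scale X b x) = scale X (a * b) x"
    "scale X a (x + y) = scale X a x + scale X a y"
    "scale X (a + b) x = scale X a x + scale X b x"
    "scale X a (x - y) = scale X a x - scale X a y"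
    "scale X (- a) x = - scale X a x"
    "scale X a (- x) = - scale X a x"
    by (simp_all add: scale_right_distrib scale_left_distrib scale_right_diff_distrib)
qed

lemma scale_cancel:
  assumes "tvs X" "t \<noteq> 0" "scale X t x = scale X t y"
  shows "x = y"
proof -
  have "scale X (1 / t) (scale X t x) = scale X (1 / t) (scale X t y)"
    using assms by simp
  then show ?thesis using assms(1,2) by (simp add: scale_simps)
qed

lemma tvs_cont_diff:
  assumes "tvs X" "continuous_map T (vtop X) a" "continuous_map T (vtop X) b"
  shows "continuous_map T (vtop X) (\<lambda>x. a x - b x)"
proof -
  have "continuous_map T (vtop X) (\<lambda>x. a x + scale X (- 1) (b x))"
    by (intro tvs_cont_add tvs_cont_scale assms) simp
  then show ?thesis using assms by (simp add: scale_simps)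
qed

lemma tvs_fld: "tvs fld"
proof -
  have vs: "vector_space ((*) :: 'k \<Rightarrow> 'k \<Rightarrow> 'k)"
    by unfold_locales (auto simp: algebra_simps)
  have "module.subspace ((*) :: 'k \<Rightarrow> 'k \<Rightarrow> 'k) UNIV"
    by (rule vector_space_over_itself.subspace_UNIV)
  then show ?thesis
    using top_field vs by (simp add: topological_vector_space_def topological_field_def)
qed

section \<open>The ambient spaces of the iterated domains\<close>

lemma lv_0: "topspace (lv X 0) = Base ` topspace (vtop X)"
  by (auto simp: topspace_pullback_topology itop.simps)

lemma lv_Suc: "topspace (lv X (Suc j)) =
    {Node x y t | x y t. x \<in> topspace (lv X j) \<and> y \<in> topspace (lv X j)}"
  by (auto simp: topspace_pullback_topology itop.simps)

lemma Base_in_lv [simp]: "Base x \<in> topspace (lv X 0) \<longleftrightarrow> x \<in> topspace (vtop X)"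
  by (auto simp: topspace_pullback_topology itop.simps)

lemma Node_in_lv [simp]: "Node x y t \<in> topspace (lv X (Suc j)) \<longleftrightarrow>
    x \<in> topspace (lv X j) \<and> y \<in> topspace (lv X j)"
  by (auto simp: topspace_pullback_topology itop.simps)

declare itop.simps [simp del]

lemma cont_Base:
  assumes "continuous_map T (vtop X) a"
  shows "continuous_map T (lv X 0) (\<lambda>x. Base (a x))"
  using continuous_map_pullback'[of T "vtop X" base "\<lambda>x. Base (a x)" "range Base"] assms
  by (auto simp: o_def itop.simps)

lemma cont_base:
  assumes "continuous_map T (lv X 0) a"
  shows "continuous_map T (vtop X) (\<lambda>x. base (a x))"
proof -
  have "continuous_map (lv X 0) (vtop X) (id \<circ> base)"
    unfolding itop.simps by (rule continuous_map_pullback) simp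
  from continuous_map_compose[OF assms this] show ?thesis by (simp add: o_def)
qed

lemma cont_Node:
  assumes "continuous_map T (lv X j) a" "continuous_map T (lv X j) b" "continuous_map T TK c"
  shows "continuous_map T (lv X (Suc j)) (\<lambda>x. Node (a x) (b x) (c x))"
  unfolding itop.simps
  by (rule continuous_map_pullback')
    (auto simp: o_def assms intro!: continuous_map_pairedI)

lemma cont_triple: "continuous_map (lv X (Suc j)) (prod_topology (lv X j) (prod_topology (lv X j) TK))
    (\<lambda>w. (pnt w, dir w, par w))"
proof -
  have "continuous_map (lv X (Suc j)) (prod_topology (lv X j) (prod_topology (lv X j) TK))
     (id \<circ> (\<lambda>w. (pnt w, dir w, par w)))"
    unfolding itop.simps by (rule continuous_map_pullback) simp
  then show ?thesis by (simp add: o_def)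
qed

lemma cont_pnt:
  assumes "continuous_map T (lv X (Suc j)) a"
  shows "continuous_map T (lv X j) (\<lambda>x. pnt (a x))"
  using continuous_map_fst_of[OF continuous_map_compose[OF assms cont_triple]] by (simp add: o_def)

lemma cont_dir:
  assumes "continuous_map T (lv X (Suc j)) a"
  shows "continuous_map T (lv X j) (\<lambda>x. dir (a x))"
  using continuous_map_fst_of[OF continuous_map_snd_of[OF continuous_map_compose[OF assms cont_triple]]]
  by (simp add: o_def)

lemma cont_par:
  assumes "continuous_map T (lv X (Suc j)) a"
  shows "continuous_map T TK (\<lambda>x. par (a x))"
  using continuous_map_snd_of[OF continuous_map_snd_of[OF continuous_map_compose[OF assms cont_triple]]]
  by (simp add: o_def)

lemma cont_fst:
  assumes "continuous_map T (prod_topology A B) a"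
  shows "continuous_map T A (\<lambda>x. fst (a x))"
  using continuous_map_fst_of[OF assms] by (simp add: o_def)

lemma cont_snd:
  assumes "continuous_map T (prod_topology A B) a"
  shows "continuous_map T B (\<lambda>x. snd (a x))"
  using continuous_map_snd_of[OF assms] by (simp add: o_def)

lemma cont_ident: "continuous_map T T (\<lambda>x. x)"
  by (simp add: continuous_map_id[unfolded id_def])

lemma cont_ident_sub: "continuous_map (subtopology T D) T (\<lambda>x. x)"
  by (intro continuous_map_from_subtopology cont_ident)

lemma cont_on_comp:
  assumes "continuous_map (subtopology S D) Y g" "continuous_map T S u"
    "\<And>x. x \<in> topspace T \<Longrightarrow> u x \<in> D"
  shows "continuous_map T Y (\<lambda>x. g (u x))"
proof -
  have "continuous_map T (subtopology S D) u"
    using assms by (intro continuous_map_into_subtopology) auto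
  from continuous_map_compose[OF this assms(1)] show ?thesis by (simp add: o_def)
qed

lemma iadd_in_lv:
  assumes "tvs X" "x \<in> topspace (lv X j)" "y \<in> topspace (lv X j)"
  shows "iadd x y \<in> topspace (lv X j)"
  using assms(2,3)
proof (induction j arbitrary: x y)
  case 0 then show ?case using tvs_add[OF assms(1)] by (auto simp: lv_0)
next
  case (Suc j) then show ?case by (auto simp: lv_Suc)
qed

lemma iscale_in_lv:
  assumes "tvs X" "y \<in> topspace (lv X j)"
  shows "iscale (scale X) t y \<in> topspace (lv X j)"
  using assms(2)
proof (induction j arbitrary: y)
  case 0 then show ?case using tvs_scale[OF assms(1)] by (auto simp: lv_0)
next
  case (Suc j) then show ?case by (auto simp: lv_Suc)
qed

lemma istep_in_lv:
  assumes "tvs X" "x \<in> topspace (lv X j)" "y \<in> topspace (lv X j)"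
  shows "istep X x y t \<in> topspace (lv X j)"
  by (intro iadd_in_lv iscale_in_lv assms)

lemma istep_0:
  assumes "tvs X" "x \<in> topspace (lv X j)" "y \<in> topspace (lv X j)"
  shows "istep X x y 0 = x"
  using assms(2,3)
proof (induction j arbitrary: x y)
  case 0 then show ?case using assms(1) by (auto simp: lv_0 scale_simps)
next
  case (Suc j)
  then obtain a b t a' b' t' where [simp]: "x = Node a b t" "y = Node a' b' t'"
    and ab: "a \<in> topspace (lv X j)" "b \<in> topspace (lv X j)" "a' \<in> topspace (lv X j)" "b' \<in> topspace (lv X j)"
    by (auto simp: lv_Suc)
  show ?case using Suc.IH[OF ab(1,3)] Suc.IH[OF ab(2,4)] by simp
qed

lemma cont_cong:
  assumes "continuous_map T Y f" "\<And>x. x \<in> topspace T \<Longrightarrow> f x = g x"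
  shows "continuous_map T Y g"
  using assms continuous_map_eq by blast

lemma cont_iadd:
  assumes "tvs X" "continuous_map T (lv X j) a" "continuous_map T (lv X j) b"
  shows "continuous_map T (lv X j) (\<lambda>x. iadd (a x) (b x))"
  using assms(2,3)
proof (induction j arbitrary: a b)
  case 0
  have "continuous_map T (lv X 0) (\<lambda>x. Base (base (a x) + base (b x)))"
    by (intro cont_Base tvs_cont_add[OF assms(1)] cont_base 0)
  moreover have "Base (base (a x) + base (b x)) = iadd (a x) (b x)" if "x \<in> topspace T" for x
  proof -
    have "a x \<in> topspace (lv X 0)" using that 0 by (meson continuous_map_image_subset_topspace image_subset_iff)
    then show ?thesis by (auto simp: lv_0)
  qed
  ultimately show ?case by (rule cont_cong)
next
  case (Suc j)
  have "continuous_map T (lv X (Suc j)) (\<lambda>x. Node (iadd (pnt (a x)) (pnt (b x)))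
      (iadd (dir (a x)) (dir (b x))) (par (a x) + par (b x)))"
    by (intro cont_Node Suc.IH cont_add cont_pnt[OF Suc.prems(1)] cont_dir[OF Suc.prems(1)] cont_par[OF Suc.prems(1)]
        cont_pnt[OF Suc.prems(2)] cont_dir[OF Suc.prems(2)] cont_par[OF Suc.prems(2)])
  moreover have "Node (iadd (pnt (a x)) (pnt (b x))) (iadd (dir (a x)) (dir (b x))) (par (a x) + par (b x))
      = iadd (a x) (b x)" if "x \<in> topspace T" for x
  proof -
    have "a x \<in> topspace (lv X (Suc j))" using that Suc.prems by (meson continuous_map_image_subset_topspace image_subset_iff)
    then show ?thesis by (auto simp: lv_Suc)
  qed
  ultimately show ?case by (rule cont_cong)
qed

lemma cont_iscale:
  assumes "tvs X" "continuous_map T TK c" "continuous_map T (lv X j) b"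
  shows "continuous_map T (lv X j) (\<lambda>x. iscale (scale X) (c x) (b x))"
  using assms(3)
proof (induction j arbitrary: b)
  case 0
  have "continuous_map T (lv X 0) (\<lambda>x. Base (scale X (c x) (base (b x))))"
    by (intro cont_Base tvs_cont_scale[OF assms(1)] cont_base 0 assms(2))
  moreover have "Base (scale X (c x) (base (b x))) = iscale (scale X) (c x) (b x)" if "x \<in> topspace T" for x
  proof -
    have "b x \<in> topspace (lv X 0)" using that 0 by (meson continuous_map_image_subset_topspace image_subset_iff)
    then show ?thesis by (auto simp: lv_0)
  qed
  ultimately show ?case by (rule cont_cong)
next
  case (Suc j)
  have "continuous_map T (lv X (Suc j)) (\<lambda>x. Node (iscale (scale X) (c x) (pnt (b x)))
      (iscale (scale X) (c x) (dir (b x))) (c x * par (b x)))"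
    by (intro cont_Node Suc.IH cont_mult cont_pnt[OF Suc.prems] cont_dir[OF Suc.prems] cont_par[OF Suc.prems] assms(2))
  moreover have "Node (iscale (scale X) (c x) (pnt (b x)))
      (iscale (scale X) (c x) (dir (b x))) (c x * par (b x)) = iscale (scale X) (c x) (b x)"
    if "x \<in> topspace T" for x
  proof -
    have "b x \<in> topspace (lv X (Suc j))" using that Suc.prems by (meson continuous_map_image_subset_topspace image_subset_iff)
    then show ?thesis by (auto simp: lv_Suc)
  qed
  ultimately show ?case by (rule cont_cong)
qed

section \<open>Difference calculus with a continuous parameter\<close>

definition dq_dom :: "('k, 'v::ab_group_add) tvs \<Rightarrow> nat \<Rightarrow> ('p \<times> ('v, 'k) iter) set \<Rightarrow> ('p \<times> ('v, 'k) iter) set"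
  where "dq_dom X i D =
    {(p, Node x y t) | p x y t. (p, x) \<in> D \<and> y \<in> topspace (lv X i) \<and> (p, istep X x y t) \<in> D}"

text \<open>The quotient relation is multiplied out. At \<open>t = 0\<close> it holds by itself, so
  the algebra needs no case distinction; the value of \<open>h\<close> there is pinned down by
  continuity.\<close>

definition dq_rel :: "('k, 'v::ab_group_add) tvs \<Rightarrow> ('k, 'w::ab_group_add) tvs \<Rightarrow> nat \<Rightarrow>
    ('p \<times> ('v, 'k) iter) set \<Rightarrow> ('p \<times> ('v, 'k) iter \<Rightarrow> 'w) \<Rightarrow> ('p \<times> ('v, 'k) iter \<Rightarrow> 'w) \<Rightarrow> bool"
  where "dq_rel X Y i D g h \<longleftrightarrow> (\<forall>p x y t. (p, Node x y t) \<in> dq_dom X i D \<longrightarrow>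
    g (p, istep X x y t) = g (p, x) + scale Y t (h (p, Node x y t)))"

definition cont_on :: "'p topology \<Rightarrow> ('k, 'v::ab_group_add) tvs \<Rightarrow> 'w topology \<Rightarrow> nat \<Rightarrow>
    ('p \<times> ('v, 'k) iter) set \<Rightarrow> ('p \<times> ('v, 'k) iter \<Rightarrow> 'w) \<Rightarrow> bool"
  where "cont_on TP X T i D g \<longleftrightarrow> D \<subseteq> topspace TP \<times> topspace (lv X i) \<and>
    continuous_map (subtopology (prod_topology TP (lv X i)) D) T g"

text \<open>Differentiability of order \<open>k\<close> in the second variable, continuously in a
  parameter from \<open>TP\<close>, beginning on a subset of level \<open>i\<close>. The quotient is
  asserted to exist instead of being selected, so \<open>D\<close> can be any set and the calculus
  rules may exhibit quotients without a uniqueness argument. The parameter serves the exponential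
  law and differentiation under the integral sign.\<close>

primrec cdiff :: "nat \<Rightarrow> 'p topology \<Rightarrow> ('k, 'v::ab_group_add) tvs \<Rightarrow> ('k, 'w::ab_group_add) tvs \<Rightarrow> nat \<Rightarrow>
    ('p \<times> ('v, 'k) iter) set \<Rightarrow> ('p \<times> ('v, 'k) iter \<Rightarrow> 'w) \<Rightarrow> bool" where
  "cdiff 0 TP X Y i D g \<longleftrightarrow> cont_on TP X (vtop Y) i D g"
| "cdiff (Suc k) TP X Y i D g \<longleftrightarrow> cont_on TP X (vtop Y) i D g \<and>
    (\<exists>h. dq_rel X Y i D g h \<and> cdiff k TP X Y (Suc i) (dq_dom X i D) h)"

lemma cdiff_cont: "cdiff k TP X Y i D g \<Longrightarrow> cont_on TP X (vtop Y) i D g"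
  by (cases k) auto

lemma cdiff_dom: "cdiff k TP X Y i D g \<Longrightarrow> D \<subseteq> topspace TP \<times> topspace (lv X i)"
  using cdiff_cont cont_on_def by blast

lemma cdiff_SucD: "cdiff (Suc k) TP X Y i D g \<Longrightarrow> cdiff k TP X Y i D g"
proof (induction k arbitrary: i D g)
  case 0 then show ?case by simp
next
  case (Suc k)
  from Suc.prems obtain h where "cont_on TP X (vtop Y) i D g" "dq_rel X Y i D g h"
    "cdiff (Suc k) TP X Y (Suc i) (dq_dom X i D) h" by (subst (asm) cdiff.simps) blast
  then show ?case using Suc.IH by (subst cdiff.simps) blast
qed

lemma mem_dq_dom [simp]: "(p, Node x y t) \<in> dq_dom X i D \<longleftrightarrow>
    (p, x) \<in> D \<and> y \<in> topspace (lv X i) \<and> (p, istep X x y t) \<in> D"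
  by (auto simp: dq_dom_def)

lemma dq_domE:
  assumes "z \<in> dq_dom X i D"
  obtains p x y t where "z = (p, Node x y t)" "(p, x) \<in> D" "y \<in> topspace (lv X i)" "(p, istep X x y t) \<in> D"
  using assms by (auto simp: dq_dom_def)

lemma dq_dom_subset: "D \<subseteq> A \<times> topspace (lv X i) \<Longrightarrow> dq_dom X i D \<subseteq> A \<times> topspace (lv X (Suc i))"
  by (auto simp: dq_dom_def)

lemma dq_dom_mono: "D' \<subseteq> D \<Longrightarrow> dq_dom X i D' \<subseteq> dq_dom X i D"
  by (auto simp: dq_dom_def)

lemma dq_dom_Int: "dq_dom X i D \<inter> dq_dom X i D' = dq_dom X i (D \<inter> D')"
  by (auto simp: dq_dom_def)

lemma cont_on_subset: "cont_on TP X T i D g \<Longrightarrow> D' \<subseteq> D \<Longrightarrow> cont_on TP X T i D' g"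
  unfolding cont_on_def using continuous_map_from_subtopology_mono by blast

lemma dq_rel_subset: "dq_rel X Y i D g h \<Longrightarrow> D' \<subseteq> D \<Longrightarrow> dq_rel X Y i D' g h"
  unfolding dq_rel_def using dq_dom_mono[of D' D X i] by blast

lemma cdiff_subset: "cdiff k TP X Y i D g \<Longrightarrow> D' \<subseteq> D \<Longrightarrow> cdiff k TP X Y i D' g"
proof (induction k arbitrary: i D D' g)
  case 0 then show ?case using cont_on_subset by auto
next
  case (Suc k)
  from Suc.prems(1) obtain h where "cont_on TP X (vtop Y) i D g" "dq_rel X Y i D g h"
    "cdiff k TP X Y (Suc i) (dq_dom X i D) h" by auto
  then show ?case
    using Suc.IH[OF _ dq_dom_mono[OF Suc.prems(2)]] cont_on_subset dq_rel_subset Suc.prems(2)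
    by (metis cdiff.simps(2))
qed

lemma cont_on_cong: "cont_on TP X T i D g \<Longrightarrow> (\<And>z. z \<in> D \<Longrightarrow> g z = g' z) \<Longrightarrow> cont_on TP X T i D g'"
  unfolding cont_on_def by (auto intro: cont_cong)

lemma dq_rel_cong: "dq_rel X Y i D g h \<Longrightarrow> (\<And>z. z \<in> D \<Longrightarrow> g z = g' z) \<Longrightarrow> dq_rel X Y i D g' h"
  unfolding dq_rel_def by auto

lemma cdiff_cong: "cdiff k TP X Y i D g \<Longrightarrow> (\<And>z. z \<in> D \<Longrightarrow> g z = g' z) \<Longrightarrow> cdiff k TP X Y i D g'"
proof (induction k)
  case 0 then show ?case using cont_on_cong[of TP X "vtop Y" i D g g'] by simp
next
  case (Suc k)
  then show ?case
    using cont_on_cong[of TP X "vtop Y" i D g g'] dq_rel_cong[of X Y i D g _ g'] by (metis cdiff.simps(2))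
qed

lemma cont_onD:
  assumes "cont_on TP X T i D g" "continuous_map S TP a" "continuous_map S (lv X i) b"
    "\<And>s. s \<in> topspace S \<Longrightarrow> (a s, b s) \<in> D"
  shows "continuous_map S T (\<lambda>s. g (a s, b s))"
  using assms unfolding cont_on_def
  by (intro cont_on_comp[of "prod_topology TP (lv X i)" D T g S "\<lambda>s. (a s, b s)"])
    (auto intro: continuous_map_pairedI)

lemma cont_onI:
  assumes "D \<subseteq> topspace TP \<times> topspace (lv X i)"
    "\<And>S. S = subtopology (prod_topology TP (lv X i)) D \<Longrightarrow> topspace S = D \<Longrightarrow>
      continuous_map S TP fst \<Longrightarrow> continuous_map S (lv X i) snd \<Longrightarrow> continuous_map S T g"
  shows "cont_on TP X T i D g"
proof -
  have "continuous_map (subtopology (prod_topology TP (lv X i)) D) T g"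
    using assms(1) by (intro assms(2)[OF refl])
      (auto intro: continuous_map_from_subtopology continuous_map_fst continuous_map_snd)
  then show ?thesis
    unfolding cont_on_def using assms(1) by blast
qed

text \<open>Linearity is expressed through \<open>x + t y\<close> within one level, because the
  operations on \<open>iter\<close> are meaningful only there.\<close>

definition ilin :: "('k, 'v::ab_group_add) tvs \<Rightarrow> nat \<Rightarrow> ('k, 'u::ab_group_add) tvs \<Rightarrow> nat \<Rightarrow>
    (('v, 'k) iter \<Rightarrow> ('u, 'k) iter) \<Rightarrow> bool"
  where "ilin X i X2 j l \<longleftrightarrow> continuous_map (lv X i) (lv X2 j) l \<and>
    (\<forall>x\<in>topspace (lv X i). \<forall>y\<in>topspace (lv X i). \<forall>t. l (istep X x y t) = istep X2 (l x) (l y) t)"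

lemma cont_comp:
  assumes "continuous_map S Y l" "continuous_map T S a"
  shows "continuous_map T Y (\<lambda>x. l (a x))"
  using continuous_map_compose[OF assms(2,1)] by (simp add: o_def)

lemma ilin_Node:
  assumes "ilin X i X2 j l"
  shows "ilin X (Suc i) X2 (Suc j) (\<lambda>w. Node (l (pnt w)) (l (dir w)) (par w))"
proof -
  have "continuous_map (lv X i) (lv X2 j) l" using assms by (simp add: ilin_def)
  then have "continuous_map (lv X (Suc i)) (lv X2 (Suc j)) (\<lambda>w. Node (l (pnt w)) (l (dir w)) (par w))"
    by (intro cont_Node cont_comp[OF _ cont_pnt[OF cont_ident]] cont_comp[OF _ cont_dir[OF cont_ident]]
        cont_par[OF cont_ident])
  then show ?thesis
    using assms by (auto simp: ilin_def lv_Suc)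
qed

lemma ilin_pnt: "ilin X (Suc i) X i pnt"
  by (auto simp: ilin_def lv_Suc intro: cont_pnt[OF cont_ident])

lemma ilin_dir: "ilin X (Suc i) X i dir"
  by (auto simp: ilin_def lv_Suc intro: cont_dir[OF cont_ident])

lemma ilin_in: "ilin X i X2 j l \<Longrightarrow> x \<in> topspace (lv X i) \<Longrightarrow> l x \<in> topspace (lv X2 j)"
  unfolding ilin_def by (meson continuous_map_image_subset_topspace image_subset_iff)

text \<open>As \<open>l\<close> commutes with the step \<open>x + t y\<close>, the old quotient at
  \<open>(l x, l y, t)\<close> is a quotient of the composite. That substitution is again linear one
  level higher, which closes the induction.\<close>

lemma cdiff_precomp:
  assumes "cdiff k TP' X2 Y j D' g" "ilin X i X2 j l" "continuous_map TP TP' \<alpha>"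
    "D \<subseteq> topspace TP \<times> topspace (lv X i)" "\<And>p x. (p, x) \<in> D \<Longrightarrow> (\<alpha> p, l x) \<in> D'"
  shows "cdiff k TP X Y i D (\<lambda>z. g (\<alpha> (fst z), l (snd z)))"
  using assms(1,2,4,5)
proof (induction k arbitrary: i j D D' g l)
  case 0
  have "continuous_map (lv X i) (lv X2 j) l" using 0 by (simp add: ilin_def)
  then have "cont_on TP X (vtop Y) i D (\<lambda>z. g (\<alpha> (fst z), l (snd z)))"
    by (intro cont_onI 0) (rule cont_onD[of TP' X2 "vtop Y" j D'];
      use 0 assms(3) in \<open>auto intro: cont_comp\<close>)
  then show ?case by simp
next
  case (Suc k)
  from Suc.prems(1) obtain h where h: "dq_rel X2 Y j D' g h" "cdiff k TP' X2 Y (Suc j) (dq_dom X2 j D') h"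
    and gc: "cont_on TP' X2 (vtop Y) j D' g" by auto
  have "continuous_map (lv X i) (lv X2 j) l" using Suc by (simp add: ilin_def)
  then have c: "cont_on TP X (vtop Y) i D (\<lambda>z. g (\<alpha> (fst z), l (snd z)))"
    by (intro cont_onI Suc.prems) (rule cont_onD[of TP' X2 "vtop Y" j D'];
      use Suc.prems gc assms(3) in \<open>auto intro: cont_comp\<close>)
  define l' where "l' = (\<lambda>w. Node (l (pnt w)) (l (dir w)) (par w))"
  have l: "l (istep X x y t) = istep X2 (l x) (l y) t" if "(p, x) \<in> D" "y \<in> topspace (lv X i)" for p x y t
    using that Suc.prems(2,3) by (auto simp: ilin_def)
  have D: "(\<alpha> p, l' w) \<in> dq_dom X2 j D'" if "(p, w) \<in> dq_dom X i D" for p w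
    using that by (auto simp: l'_def l[symmetric] elim!: dq_domE intro: Suc.prems(4) ilin_in[OF Suc.prems(2)])
  have "cdiff k TP X Y (Suc i) (dq_dom X i D) (\<lambda>z. h (\<alpha> (fst z), l' (snd z)))"
    using D by (intro Suc.IH[OF h(2)]) (auto simp: l'_def intro: ilin_Node Suc.prems dest!: dq_dom_subset[OF Suc.prems(3), THEN subsetD])
  moreover have "dq_rel X Y i D (\<lambda>z. g (\<alpha> (fst z), l (snd z))) (\<lambda>z. h (\<alpha> (fst z), l' (snd z)))"
    unfolding dq_rel_def
  proof (intro allI impI)
    fix p x y t assume a: "(p, Node x y t) \<in> dq_dom X i D"
    have "(\<alpha> p, Node (l x) (l y) t) \<in> dq_dom X2 j D'" using D[OF a] by (simp add: l'_def)
    from h(1)[unfolded dq_rel_def, rule_format, OF this]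
    show "g (\<alpha> (fst (p, istep X x y t)), l (snd (p, istep X x y t))) =
       g (\<alpha> (fst (p, x)), l (snd (p, x))) +
       scale Y t (h (\<alpha> (fst (p, Node x y t)), l' (snd (p, Node x y t))))"
      using a by (auto simp: l'_def l)
  qed
  ultimately show ?case using c by auto
qed

end

context top_field
begin

section \<open>Sums, products, linear maps and parameters\<close>

lemma cont_on_in:
  assumes "cont_on TP X T i D g" "z \<in> D"
  shows "g z \<in> topspace T"
proof -
  have "z \<in> topspace (subtopology (prod_topology TP (lv X i)) D)"
    using assms unfolding cont_on_def by auto
  then show ?thesis
    using assms unfolding cont_on_def by (meson continuous_map_image_subset_topspace image_subset_iff)
qed

lemma cdiff_in: "cdiff k TP X Y i D g \<Longrightarrow> z \<in> D \<Longrightarrow> g z \<in> topspace (vtop Y)"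
  using cdiff_cont cont_on_in by blast

lemma cont_on_map: "cont_on TP X T i D g \<Longrightarrow> continuous_map (subtopology (prod_topology TP (lv X i)) D) T g"
  by (simp add: cont_on_def)

text \<open>The product and reciprocal rules contain factors evaluated at the base point of
  \<open>(x, y, t)\<close>; the projection to it is linear.\<close>

lemma cdiff_pnt:
  assumes "cdiff k TP X Y i D g"
  shows "cdiff k TP X Y (Suc i) (dq_dom X i D) (\<lambda>z. g (fst z, pnt (snd z)))"
  by (rule cdiff_precomp[OF assms ilin_pnt, of TP id, simplified])
    (use dq_dom_subset[OF cdiff_dom[OF assms]] in \<open>auto elim!: dq_domE\<close>)

lemma cdiff_SucI:
  assumes "cont_on TP X (vtop Y) i D g" "cdiff k TP X Y (Suc i) (dq_dom X i D) h"
    "\<And>p x y t. (p, x) \<in> D \<Longrightarrow> y \<in> topspace (lv X i) \<Longrightarrow> (p, istep X x y t) \<in> D \<Longrightarrow>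
      g (p, istep X x y t) = g (p, x) + scale Y t (h (p, Node x y t))"
  shows "cdiff (Suc k) TP X Y i D g"
  using assms by (auto simp: dq_rel_def)

lemma cdiff_SucE:
  assumes "cdiff (Suc k) TP X Y i D g"
  obtains h where "cont_on TP X (vtop Y) i D g" "cdiff k TP X Y (Suc i) (dq_dom X i D) h"
    "\<And>p x y t. (p, x) \<in> D \<Longrightarrow> y \<in> topspace (lv X i) \<Longrightarrow> (p, istep X x y t) \<in> D \<Longrightarrow>
      g (p, istep X x y t) = g (p, x) + scale Y t (h (p, Node x y t))"
  using assms by (auto simp: dq_rel_def)

lemma cdiff_SucE_fld:
  assumes "cdiff (Suc k) TP X fld i D g"
  obtains h where "cont_on TP X TK i D g" "cdiff k TP X fld (Suc i) (dq_dom X i D) h"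
    "\<And>p x y t. (p, x) \<in> D \<Longrightarrow> y \<in> topspace (lv X i) \<Longrightarrow> (p, istep X x y t) \<in> D \<Longrightarrow>
      g (p, istep X x y t) = g (p, x) + t * h (p, Node x y t)"
proof -
  obtain h where "cont_on TP X (vtop fld) i D g" "cdiff k TP X fld (Suc i) (dq_dom X i D) h"
    "\<And>p x y t. (p, x) \<in> D \<Longrightarrow> y \<in> topspace (lv X i) \<Longrightarrow> (p, istep X x y t) \<in> D \<Longrightarrow>
      g (p, istep X x y t) = g (p, x) + scale fld t (h (p, Node x y t))"
    using assms by (rule cdiff_SucE) blast
  then show ?thesis by (intro that[of h]) simp_all
qed

lemma cdiff_add:
  assumes "tvs Y" "cdiff k TP X Y i D g" "cdiff k TP X Y i D g'"
  shows "cdiff k TP X Y i D (\<lambda>z. g z + g' z)"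
  using assms(2,3)
proof (induction k arbitrary: i D g g')
  case 0 then show ?case by (auto simp: cont_on_def intro: tvs_cont_add[OF assms(1)])
next
  case (Suc k)
  obtain h where h: "cont_on TP X (vtop Y) i D g" "cdiff k TP X Y (Suc i) (dq_dom X i D) h"
    "\<And>p x y t. (p, x) \<in> D \<Longrightarrow> y \<in> topspace (lv X i) \<Longrightarrow> (p, istep X x y t) \<in> D \<Longrightarrow>
      g (p, istep X x y t) = g (p, x) + scale Y t (h (p, Node x y t))"
    using Suc.prems(1) by (rule cdiff_SucE) blast
  obtain h' where h': "cont_on TP X (vtop Y) i D g'" "cdiff k TP X Y (Suc i) (dq_dom X i D) h'"
    "\<And>p x y t. (p, x) \<in> D \<Longrightarrow> y \<in> topspace (lv X i) \<Longrightarrow> (p, istep X x y t) \<in> D \<Longrightarrow>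
      g' (p, istep X x y t) = g' (p, x) + scale Y t (h' (p, Node x y t))"
    using Suc.prems(2) by (rule cdiff_SucE) blast
  show ?case
  proof (rule cdiff_SucI)
    show "cont_on TP X (vtop Y) i D (\<lambda>z. g z + g' z)"
      using h(1) h'(1) by (auto simp: cont_on_def intro: tvs_cont_add[OF assms(1)])
    show "cdiff k TP X Y (Suc i) (dq_dom X i D) (\<lambda>z. h z + h' z)"
      by (intro Suc.IH h h')
  qed (simp add: h(3) h'(3) scale_simps[OF assms(1)])
qed

text \<open>The linear map may vary with the parameter. In this way scalars of the larger field act
  on functions that are differentiable over the smaller one.\<close>

lemma cdiff_postcomp:
  assumes "continuous_map (prod_topology TP (vtop Y)) (vtop Y2) (\<lambda>z. L (fst z) (snd z))"
    "\<And>p y y' t. p \<in> topspace TP \<Longrightarrow> y \<in> topspace (vtop Y) \<Longrightarrow> y' \<in> topspace (vtop Y) \<Longrightarrow>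
      L p (y + scale Y t y') = L p y + scale Y2 t (L p y')"
    "cdiff k TP X Y i D g"
  shows "cdiff k TP X Y2 i D (\<lambda>z. L (fst z) (g z))"
proof -
  have c: "cont_on TP X (vtop Y2) i D (\<lambda>z. L (fst z) (g z))" if "cont_on TP X (vtop Y) i D g" for i D g
  proof -
    have "continuous_map (subtopology (prod_topology TP (lv X i)) D) (prod_topology TP (vtop Y)) (\<lambda>z. (fst z, g z))"
      using that unfolding cont_on_def
      by (intro continuous_map_pairedI continuous_map_from_subtopology[OF continuous_map_fst]) simp
    from cont_comp[OF assms(1) this] show ?thesis
      using that by (simp add: cont_on_def)
  qed
  show ?thesis
    using assms(3)
  proof (induction k arbitrary: i D g)
    case 0 then show ?case using c by simp
  next
    case (Suc k)
    obtain h where h: "cont_on TP X (vtop Y) i D g" "cdiff k TP X Y (Suc i) (dq_dom X i D) h"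
      "\<And>p x y t. (p, x) \<in> D \<Longrightarrow> y \<in> topspace (lv X i) \<Longrightarrow> (p, istep X x y t) \<in> D \<Longrightarrow>
        g (p, istep X x y t) = g (p, x) + scale Y t (h (p, Node x y t))"
      using Suc.prems(1) by (rule cdiff_SucE) blast
    show ?case
    proof (rule cdiff_SucI[OF c[OF h(1)] Suc.IH[OF h(2)]])
      fix p x y t assume a: "(p, x) \<in> D" "y \<in> topspace (lv X i)" "(p, istep X x y t) \<in> D"
      have "p \<in> topspace TP" using a h(1) by (auto simp: cont_on_def)
      moreover have "h (p, Node x y t) \<in> topspace (vtop Y)" by (rule cdiff_in[OF h(2)]) (use a in simp)
      ultimately show "L (fst (p, istep X x y t)) (g (p, istep X x y t)) =
       L (fst (p, x)) (g (p, x)) + scale Y2 t (L (fst (p, Node x y t)) (h (p, Node x y t)))"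
        using cont_on_in[OF h(1) a(1)] by (simp add: h(3)[OF a] assms(2))
    qed
  qed
qed

lemma cdiff_param:
  assumes "tvs Y" "continuous_map TP (vtop Y) c" "D \<subseteq> topspace TP \<times> topspace (lv X i)"
  shows "cdiff k TP X Y i D (\<lambda>z. c (fst z))"
  using assms(2,3)
proof (induction k arbitrary: i D c)
  case 0 then show ?case
    by (auto intro!: cont_onI cont_comp[of TP])
next
  case (Suc k)
  have 0: "continuous_map TP (vtop Y) (\<lambda>_. 0)" using tvs_zero[OF assms(1)] by simp
  show ?case
  proof (rule cdiff_SucI)
    show "cont_on TP X (vtop Y) i D (\<lambda>z. c (fst z))"
      using Suc by (auto intro!: cont_onI cont_comp[of TP])
    show "cdiff k TP X Y (Suc i) (dq_dom X i D) (\<lambda>z. 0)"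
      by (rule Suc.IH[OF 0 dq_dom_subset[OF Suc.prems(2)]])
  qed (simp add: scale_simps[OF assms(1)])
qed

text \<open>A quotient at \<open>(x, y, t)\<close> is \<open>l y\<close>, which is linear in the
  triple, so the same argument applies at every order.\<close>

lemma cdiff_lin:
  assumes "continuous_map (lv X i) (vtop Y) l"
    "\<And>x y t. x \<in> topspace (lv X i) \<Longrightarrow> y \<in> topspace (lv X i) \<Longrightarrow> l (istep X x y t) = l x + scale Y t (l y)"
    "D \<subseteq> topspace TP \<times> topspace (lv X i)"
  shows "cdiff k TP X Y i D (\<lambda>z. l (snd z))"
  using assms
proof (induction k arbitrary: i D l)
  case 0 then show ?case
    by (auto intro!: cont_onI intro: cont_comp)
next
  case (Suc k)
  show ?case
  proof (rule cdiff_SucI)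
    show "cont_on TP X (vtop Y) i D (\<lambda>z. l (snd z))"
      using Suc by (auto intro!: cont_onI intro: cont_comp)
    show "cdiff k TP X Y (Suc i) (dq_dom X i D) (\<lambda>z. l (dir (snd z)))"
    proof (rule Suc.IH[of "Suc i" "\<lambda>w. l (dir w)"])
      show "continuous_map (lv X (Suc i)) (vtop Y) (\<lambda>w. l (dir w))"
        by (rule cont_comp[OF Suc.prems(1) cont_dir[OF cont_ident]])
      show "dq_dom X i D \<subseteq> topspace TP \<times> topspace (lv X (Suc i))"
        by (rule dq_dom_subset[OF Suc.prems(3)])
      show "l (dir (istep X x y t)) = l (dir x) + scale Y t (l (dir y))"
        if "x \<in> topspace (lv X (Suc i))" "y \<in> topspace (lv X (Suc i))" for x y t
        using that by (auto simp: lv_Suc Suc.prems(2))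
    qed
  qed (use Suc.prems(2,3) in auto)
qed

lemma cdiff_par:
  assumes "D \<subseteq> topspace TP \<times> topspace (lv X (Suc i))"
  shows "cdiff k TP X fld (Suc i) D (\<lambda>z. par (snd z))"
  using assms by (intro cdiff_lin[where l = par]) (auto simp: lv_Suc intro: cont_par[OF cont_ident])

lemma cdiff_base:
  assumes "D \<subseteq> topspace TP \<times> topspace (lv X 0)"
  shows "cdiff k TP X X 0 D (\<lambda>z. base (snd z))"
  using assms by (intro cdiff_lin[where l = base]) (auto simp: lv_0 intro: cont_base[OF cont_ident])

lemma cdiff_scale:
  assumes "tvs Y" "cdiff k TP X fld i D a" "cdiff k TP X Y i D g"
  shows "cdiff k TP X Y i D (\<lambda>z. scale Y (a z) (g z))"
  using assms(2,3)
proof (induction k arbitrary: i D a g)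
  case 0 then show ?case by (auto simp: cont_on_def intro: tvs_cont_scale[OF assms(1)])
next
  case (Suc k)
  obtain h where h: "cont_on TP X (vtop Y) i D g" "cdiff k TP X Y (Suc i) (dq_dom X i D) h"
    "\<And>p x y t. (p, x) \<in> D \<Longrightarrow> y \<in> topspace (lv X i) \<Longrightarrow> (p, istep X x y t) \<in> D \<Longrightarrow>
      g (p, istep X x y t) = g (p, x) + scale Y t (h (p, Node x y t))"
    using Suc.prems(2) by (rule cdiff_SucE) blast
  obtain b where b: "cont_on TP X TK i D a" "cdiff k TP X fld (Suc i) (dq_dom X i D) b"
    "\<And>p x y t. (p, x) \<in> D \<Longrightarrow> y \<in> topspace (lv X i) \<Longrightarrow> (p, istep X x y t) \<in> D \<Longrightarrow>
      a (p, istep X x y t) = a (p, x) + t * (b (p, Node x y t))"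
    using Suc.prems(1) by (rule cdiff_SucE_fld) blast
  have dom: "dq_dom X i D \<subseteq> topspace TP \<times> topspace (lv X (Suc i))"
    by (rule cdiff_dom[OF h(2)])
  show ?case
  proof (rule cdiff_SucI)
    show "cont_on TP X (vtop Y) i D (\<lambda>z. scale Y (a z) (g z))"
      using h(1) b(1) by (auto simp: cont_on_def intro: tvs_cont_scale[OF assms(1)])
    \<comment> \<open>From \<open>(a + t b)(g + t h) - a g = t (a h + b g + t b h)\<close>. The last
      summand makes the parameter itself a factor that has to be differentiated.\<close>
    show "cdiff k TP X Y (Suc i) (dq_dom X i D)
       (\<lambda>z. (scale Y (a (fst z, pnt (snd z))) (h z) + scale Y (b z) (g (fst z, pnt (snd z))))
          + scale Y (par (snd z)) (scale Y (b z) (h z)))"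
      by (intro cdiff_add assms(1) Suc.IH h b cdiff_par dom cdiff_pnt[OF cdiff_SucD[OF Suc.prems(1)]]
          cdiff_pnt[OF cdiff_SucD[OF Suc.prems(2)]])
  next
    fix p x y t assume z: "(p, x) \<in> D" "y \<in> topspace (lv X i)" "(p, istep X x y t) \<in> D"
    show "scale Y (a (p, istep X x y t)) (g (p, istep X x y t)) = scale Y (a (p, x)) (g (p, x)) +
       scale Y t ((scale Y (a (fst (p, Node x y t), pnt (snd (p, Node x y t)))) (h (p, Node x y t)) +
          scale Y (b (p, Node x y t)) (g (fst (p, Node x y t), pnt (snd (p, Node x y t))))) +
         scale Y (par (snd (p, Node x y t))) (scale Y (b (p, Node x y t)) (h (p, Node x y t))))"
      by (simp add: h(3)[OF z] b(3)[OF z] scale_simps[OF assms(1)] distrib_left mult.commute mult.left_commute add.assoc add.left_commute)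
  qed
qed

lemma cdiff_mult:
  assumes "cdiff k TP X fld i D a" "cdiff k TP X fld i D b"
  shows "cdiff k TP X fld i D (\<lambda>z. a z * b z)"
  using cdiff_scale[OF tvs_fld assms] by simp

lemma cdiff_const_scale:
  assumes "tvs Y" "cdiff k TP X Y i D g"
  shows "cdiff k TP X Y i D (\<lambda>z. scale Y c (g z))"
  by (intro cdiff_scale assms cdiff_param[of fld TP "\<lambda>_. c"] tvs_fld cdiff_dom[OF assms(2)]) simp

lemma cdiff_diff:
  assumes "tvs Y" "cdiff k TP X Y i D g" "cdiff k TP X Y i D g'"
  shows "cdiff k TP X Y i D (\<lambda>z. g z - g' z)"
  using cdiff_add[OF assms(1,2) cdiff_const_scale[OF assms(1,3), of "-1"]]
  by (simp add: scale_simps[OF assms(1)])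

text \<open>A map into level \<open>n\<close> is treated as the tuple of its leaves and parameters,
  each of which is to be differentiable. The chain rule lengthens this tuple by one level with every
  differentiation.\<close>

primrec tdiff :: "nat \<Rightarrow> nat \<Rightarrow> 'p topology \<Rightarrow> ('k, 'v::ab_group_add) tvs \<Rightarrow> ('k, 'u::ab_group_add) tvs \<Rightarrow> nat \<Rightarrow>
    ('p \<times> ('v, 'k) iter) set \<Rightarrow> ('p \<times> ('v, 'k) iter \<Rightarrow> ('u, 'k) iter) \<Rightarrow> bool" where
  "tdiff 0 k TP X X2 i D \<theta> \<longleftrightarrow> (\<forall>z\<in>D. \<exists>a. \<theta> z = Base a) \<and> cdiff k TP X X2 i D (\<lambda>z. base (\<theta> z))"
| "tdiff (Suc n) k TP X X2 i D \<theta> \<longleftrightarrow> (\<forall>z\<in>D. \<exists>a b t. \<theta> z = Node a b t) \<and>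
    tdiff n k TP X X2 i D (\<lambda>z. pnt (\<theta> z)) \<and> tdiff n k TP X X2 i D (\<lambda>z. dir (\<theta> z)) \<and>
    cdiff k TP X fld i D (\<lambda>z. par (\<theta> z))"

lemma tdiff_SucD: "tdiff n (Suc k) TP X X2 i D \<theta> \<Longrightarrow> tdiff n k TP X X2 i D \<theta>"
  by (induction n arbitrary: \<theta>) (auto simp del: cdiff.simps intro: cdiff_SucD)

lemma tdiff_dom: "tdiff n k TP X X2 i D \<theta> \<Longrightarrow> D \<subseteq> topspace TP \<times> topspace (lv X i)"
  by (cases n) (auto simp del: cdiff.simps dest: cdiff_dom)

lemma tdiff_cont: "tdiff n k TP X X2 i D \<theta> \<Longrightarrow> cont_on TP X (lv X2 n) i D \<theta>"
proof (induction n arbitrary: \<theta>)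
  case 0
  then have "cont_on TP X (vtop X2) i D (\<lambda>z. base (\<theta> z))" by (auto intro: cdiff_cont)
  then have "cont_on TP X (lv X2 0) i D (\<lambda>z. Base (base (\<theta> z)))"
    unfolding cont_on_def by (auto intro: cont_Base)
  then show ?case using 0 by (elim cont_on_cong) auto
next
  case (Suc n)
  then have "cont_on TP X TK i D (\<lambda>z. par (\<theta> z))" by (auto dest: cdiff_cont)
  then have "cont_on TP X (lv X2 (Suc n)) i D (\<lambda>z. Node (pnt (\<theta> z)) (dir (\<theta> z)) (par (\<theta> z)))"
    using Suc.IH[of "\<lambda>z. pnt (\<theta> z)"] Suc.IH[of "\<lambda>z. dir (\<theta> z)"] Suc.prems
    unfolding cont_on_def by (auto intro!: cont_Node)
  then show ?case using Suc.prems by (elim cont_on_cong) auto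
qed

lemma tdiff_in: "tdiff n k TP X X2 i D \<theta> \<Longrightarrow> z \<in> D \<Longrightarrow> \<theta> z \<in> topspace (lv X2 n)"
  using tdiff_cont cont_on_in by blast

lemma tdiff_precomp:
  assumes "tdiff n k TP' X2 X3 j D' \<theta>" "ilin X i X2 j l" "continuous_map TP TP' \<alpha>"
    "D \<subseteq> topspace TP \<times> topspace (lv X i)" "\<And>p x. (p, x) \<in> D \<Longrightarrow> (\<alpha> p, l x) \<in> D'"
  shows "tdiff n k TP X X3 i D (\<lambda>z. \<theta> (\<alpha> (fst z), l (snd z)))"
  using assms(1)
proof (induction n arbitrary: \<theta>)
  case 0
  then show ?case
    using cdiff_precomp[OF _ assms(2-5), of k X3 "\<lambda>z. base (\<theta> z)"] assms(5) by auto
next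
  case (Suc n)
  then show ?case
    using cdiff_precomp[OF _ assms(2-5), of k fld "\<lambda>z. par (\<theta> z)"] assms(5)
     Suc.IH[of "\<lambda>z. pnt (\<theta> z)"] Suc.IH[of "\<lambda>z. dir (\<theta> z)"] by auto
qed

lemma tdiff_pnt:
  assumes "tdiff n k TP X X2 i D \<theta>"
  shows "tdiff n k TP X X2 (Suc i) (dq_dom X i D) (\<lambda>z. \<theta> (fst z, pnt (snd z)))"
  by (rule tdiff_precomp[OF assms ilin_pnt, of TP id, simplified])
    (use dq_dom_subset[OF tdiff_dom[OF assms]] in \<open>auto elim!: dq_domE\<close>)

text \<open>\<open>iadd\<close> and \<open>iscale\<close> act entrywise, so the quotients of the
  entries assemble to one quotient with values in trees.\<close>

lemma tdiff_dq:
  assumes "tdiff n (Suc k) TP X X2 i D \<theta>"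
  obtains \<theta>' where "tdiff n k TP X X2 (Suc i) (dq_dom X i D) \<theta>'"
    "\<And>p x y t. (p, x) \<in> D \<Longrightarrow> y \<in> topspace (lv X i) \<Longrightarrow> (p, istep X x y t) \<in> D \<Longrightarrow>
      \<theta> (p, istep X x y t) = istep X2 (\<theta> (p, x)) (\<theta>' (p, Node x y t)) t"
proof -
  have "\<exists>\<theta>'. tdiff n k TP X X2 (Suc i) (dq_dom X i D) \<theta>' \<and>
    (\<forall>p x y t. (p, x) \<in> D \<longrightarrow> y \<in> topspace (lv X i) \<longrightarrow> (p, istep X x y t) \<in> D \<longrightarrow>
      \<theta> (p, istep X x y t) = istep X2 (\<theta> (p, x)) (\<theta>' (p, Node x y t)) t)"
    using assms
  proof (induction n arbitrary: \<theta>)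
    case 0
    then have *: "cdiff (Suc k) TP X X2 i D (\<lambda>z. base (\<theta> z))" and B: "\<forall>z\<in>D. \<exists>a. \<theta> z = Base a" by auto
    obtain h where h: "cdiff k TP X X2 (Suc i) (dq_dom X i D) h"
      "\<And>p x y t. (p, x) \<in> D \<Longrightarrow> y \<in> topspace (lv X i) \<Longrightarrow> (p, istep X x y t) \<in> D \<Longrightarrow>
        base (\<theta> (p, istep X x y t)) = base (\<theta> (p, x)) + scale X2 t (h (p, Node x y t))"
      using * by (rule cdiff_SucE) blast
    show ?case
    proof (intro exI[of _ "\<lambda>z. Base (h z)"] conjI allI impI)
      show "tdiff 0 k TP X X2 (Suc i) (dq_dom X i D) (\<lambda>z. Base (h z))" using h(1) by simp
      fix p x y t assume z: "(p, x) \<in> D" "y \<in> topspace (lv X i)" "(p, istep X x y t) \<in> D"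
      then obtain a b where "\<theta> (p, x) = Base a" "\<theta> (p, istep X x y t) = Base b" using B by blast
      then show "\<theta> (p, istep X x y t) = istep X2 (\<theta> (p, x)) (Base (h (p, Node x y t))) t"
        using h(2)[OF z] by simp
    qed
  next
    case (Suc n)
    from Suc.IH[of "\<lambda>z. pnt (\<theta> z)"] Suc.prems obtain \<theta>1 where
      1: "tdiff n k TP X X2 (Suc i) (dq_dom X i D) \<theta>1"
      "\<And>p x y t. (p, x) \<in> D \<Longrightarrow> y \<in> topspace (lv X i) \<Longrightarrow> (p, istep X x y t) \<in> D \<Longrightarrow>
      pnt (\<theta> (p, istep X x y t)) = istep X2 (pnt (\<theta> (p, x))) (\<theta>1 (p, Node x y t)) t" by auto
    from Suc.IH[of "\<lambda>z. dir (\<theta> z)"] Suc.prems obtain \<theta>2 where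
      2: "tdiff n k TP X X2 (Suc i) (dq_dom X i D) \<theta>2"
      "\<And>p x y t. (p, x) \<in> D \<Longrightarrow> y \<in> topspace (lv X i) \<Longrightarrow> (p, istep X x y t) \<in> D \<Longrightarrow>
      dir (\<theta> (p, istep X x y t)) = istep X2 (dir (\<theta> (p, x))) (\<theta>2 (p, Node x y t)) t" by auto
    have *: "cdiff (Suc k) TP X fld i D (\<lambda>z. par (\<theta> z))" and N: "\<forall>z\<in>D. \<exists>a b t. \<theta> z = Node a b t"
      using Suc.prems by auto
    obtain h where h: "cdiff k TP X fld (Suc i) (dq_dom X i D) h"
      "\<And>p x y t. (p, x) \<in> D \<Longrightarrow> y \<in> topspace (lv X i) \<Longrightarrow> (p, istep X x y t) \<in> D \<Longrightarrow>
        par (\<theta> (p, istep X x y t)) = par (\<theta> (p, x)) + t * (h (p, Node x y t))"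
      using * by (rule cdiff_SucE_fld) blast
    show ?case
    proof (intro exI[of _ "\<lambda>z. Node (\<theta>1 z) (\<theta>2 z) (h z)"] conjI allI impI)
      show "tdiff (Suc n) k TP X X2 (Suc i) (dq_dom X i D) (\<lambda>z. Node (\<theta>1 z) (\<theta>2 z) (h z))"
        using h(1) 1(1) 2(1) by simp
      fix p x y t assume z: "(p, x) \<in> D" "y \<in> topspace (lv X i)" "(p, istep X x y t) \<in> D"
      then obtain a b c a' b' c' where "\<theta> (p, x) = Node a b c" "\<theta> (p, istep X x y t) = Node a' b' c'"
        using N by blast
      then show "\<theta> (p, istep X x y t) = istep X2 (\<theta> (p, x))
          (Node (\<theta>1 (p, Node x y t)) (\<theta>2 (p, Node x y t)) (h (p, Node x y t))) t"
        using h(2)[OF z] 1(2)[OF z] 2(2)[OF z] by simp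
    qed
  qed
  then show ?thesis using that by blast
qed

lemma cdiff_chain:
  assumes "cdiff k TP X2 Y n D2 g" "tdiff n k TP X X2 i D \<theta>" "\<And>p w. (p, w) \<in> D \<Longrightarrow> (p, \<theta> (p, w)) \<in> D2"
  shows "cdiff k TP X Y i D (\<lambda>z. g (fst z, \<theta> z))"
  using assms
proof (induction k arbitrary: n i D D2 g \<theta>)
  case 0
  have "cont_on TP X (vtop Y) i D (\<lambda>z. g (fst z, \<theta> z))"
    using tdiff_cont[OF 0(2)] 0(1,3) tdiff_dom[OF 0(2)]
    by (intro cont_onI cont_onD[of TP X2 "vtop Y" n D2]) (auto simp: cont_on_def)
  then show ?case by simp
next
  case (Suc k)
  obtain h where h: "cont_on TP X2 (vtop Y) n D2 g" "cdiff k TP X2 Y (Suc n) (dq_dom X2 n D2) h"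
    "\<And>p x y t. (p, x) \<in> D2 \<Longrightarrow> y \<in> topspace (lv X2 n) \<Longrightarrow> (p, istep X2 x y t) \<in> D2 \<Longrightarrow>
      g (p, istep X2 x y t) = g (p, x) + scale Y t (h (p, Node x y t))"
    using Suc.prems(1) by (rule cdiff_SucE) blast
  obtain \<theta>' where \<theta>': "tdiff n k TP X X2 (Suc i) (dq_dom X i D) \<theta>'"
    "\<And>p x y t. (p, x) \<in> D \<Longrightarrow> y \<in> topspace (lv X i) \<Longrightarrow> (p, istep X x y t) \<in> D \<Longrightarrow>
      \<theta> (p, istep X x y t) = istep X2 (\<theta> (p, x)) (\<theta>' (p, Node x y t)) t"
    using Suc.prems(2) by (rule tdiff_dq) blast
  have \<theta>'_in: "\<theta>' (p, Node x y t) \<in> topspace (lv X2 n)"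
    if "(p, x) \<in> D" "y \<in> topspace (lv X i)" "(p, istep X x y t) \<in> D" for p x y t
    by (rule tdiff_in[OF \<theta>'(1)]) (use that in simp)
  define \<Theta> where "\<Theta> z = Node (\<theta> (fst z, pnt (snd z))) (\<theta>' z) (par (snd z))" for z
  have \<Theta>: "tdiff (Suc n) k TP X X2 (Suc i) (dq_dom X i D) \<Theta>"
    using tdiff_pnt[OF tdiff_SucD[OF Suc.prems(2)]] \<theta>'(1) cdiff_par[OF dq_dom_subset[OF tdiff_dom[OF Suc.prems(2)]]]
    by (simp add: \<Theta>_def)
  have D: "(p, \<Theta> (p, w)) \<in> dq_dom X2 n D2" if "(p, w) \<in> dq_dom X i D" for p w
    using that by (auto simp: \<Theta>_def Suc.prems(3) \<theta>'_in \<theta>'(2)[symmetric] elim!: dq_domE)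
  show ?case
  proof (rule cdiff_SucI)
    show "cont_on TP X (vtop Y) i D (\<lambda>z. g (fst z, \<theta> z))"
      using tdiff_cont[OF Suc.prems(2)] h(1) Suc.prems(3) tdiff_dom[OF Suc.prems(2)]
      by (intro cont_onI cont_onD[of TP X2 "vtop Y" n D2]) (auto simp: cont_on_def)
    show "cdiff k TP X Y (Suc i) (dq_dom X i D) (\<lambda>z. h (fst z, \<Theta> z))"
      by (rule Suc.IH[OF h(2) \<Theta> D])
  next
    fix p x y t assume z: "(p, x) \<in> D" "y \<in> topspace (lv X i)" "(p, istep X x y t) \<in> D"
    have "(p, \<Theta> (p, Node x y t)) \<in> dq_dom X2 n D2" using D z by simp
    then show "g (fst (p, istep X x y t), \<theta> (p, istep X x y t)) = g (fst (p, x), \<theta> (p, x)) +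
       scale Y t (h (fst (p, Node x y t), \<Theta> (p, Node x y t)))"
      using h(3) by (simp add: \<Theta>_def \<theta>'(2)[OF z])
  qed
qed

lemma tdiff_ilin:
  assumes "ilin X i X2 n l" "D \<subseteq> topspace TP \<times> topspace (lv X i)"
  shows "tdiff n k TP X X2 i D (\<lambda>z. l (snd z))"
  using assms(1)
proof (induction n arbitrary: l)
  case 0
  have "cdiff k TP X X2 i D (\<lambda>z. base (l (snd z)))"
  proof (rule cdiff_lin[where l = "\<lambda>w. base (l w)", OF _ _ assms(2)])
    show "continuous_map (lv X i) (vtop X2) (\<lambda>w. base (l w))"
      using 0 by (intro cont_base) (simp add: ilin_def)
    show "base (l (istep X x y t)) = base (l x) + scale X2 t (base (l y))"
      if "x \<in> topspace (lv X i)" "y \<in> topspace (lv X i)" for x y t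
      using that 0 ilin_in[OF 0 that(1)] ilin_in[OF 0 that(2)] by (auto simp: ilin_def lv_0)
  qed
  then show ?case using ilin_in[OF 0] assms(2) by (fastforce simp: lv_0)
next
  case (Suc n)
  have N: "\<exists>a b t. l x = Node a b t" if "x \<in> topspace (lv X i)" for x
    using ilin_in[OF Suc.prems that] by (auto simp: lv_Suc)
  have c: "continuous_map (lv X i) (lv X2 (Suc n)) l" using Suc.prems by (simp add: ilin_def)
  have s: "l (istep X x y t) = istep X2 (l x) (l y) t"
    if "x \<in> topspace (lv X i)" "y \<in> topspace (lv X i)" for x y t
    using that Suc.prems by (simp add: ilin_def)
  have 1: "ilin X i X2 n (\<lambda>w. pnt (l w))" unfolding ilin_def
  proof (intro conjI ballI allI)
    show "pnt (l (istep X x y t)) = istep X2 (pnt (l x)) (pnt (l y)) t"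
      if "x \<in> topspace (lv X i)" "y \<in> topspace (lv X i)" for x y t
      using N[OF that(1)] N[OF that(2)] s[OF that] by auto
  qed (rule cont_pnt[OF c])
  have 2: "ilin X i X2 n (\<lambda>w. dir (l w))" unfolding ilin_def
  proof (intro conjI ballI allI)
    show "dir (l (istep X x y t)) = istep X2 (dir (l x)) (dir (l y)) t"
      if "x \<in> topspace (lv X i)" "y \<in> topspace (lv X i)" for x y t
      using N[OF that(1)] N[OF that(2)] s[OF that] by auto
  qed (rule cont_dir[OF c])
  have 3: "cdiff k TP X fld i D (\<lambda>z. par (l (snd z)))"
  proof (rule cdiff_lin[where l = "\<lambda>w. par (l w)", OF _ _ assms(2)])
    show "continuous_map (lv X i) (vtop fld) (\<lambda>w. par (l w))" using cont_par[OF c] by simp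
    show "par (l (istep X x y t)) = par (l x) + scale fld t (par (l y))"
      if "x \<in> topspace (lv X i)" "y \<in> topspace (lv X i)" for x y t
      using N[OF that(1)] N[OF that(2)] s[OF that] by auto
  qed
  show ?case using Suc.IH[OF 1] Suc.IH[OF 2] 3 N assms(2) by auto
qed

lemma tdiff_cong:
  "tdiff n k TP X X2 i D \<phi> \<Longrightarrow> (\<And>z. z \<in> D \<Longrightarrow> \<phi> z = \<phi>' z) \<Longrightarrow> tdiff n k TP X X2 i D \<phi>'"
proof (induction n arbitrary: \<phi> \<phi>')
  case 0 then show ?case using cdiff_cong[of k TP X X2 i D "\<lambda>z. base (\<phi> z)" "\<lambda>z. base (\<phi>' z)"] by auto
next
  case (Suc n)
  then show ?case using cdiff_cong[of k TP X fld i D "\<lambda>z. par (\<phi> z)" "\<lambda>z. par (\<phi>' z)"]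
     Suc.IH[of "\<lambda>z. pnt (\<phi> z)" "\<lambda>z. pnt (\<phi>' z)"] Suc.IH[of "\<lambda>z. dir (\<phi> z)" "\<lambda>z. dir (\<phi>' z)"] by simp
qed

lemma tdiff_iadd:
  assumes "tvs X2" "tdiff n k TP X X2 i D \<theta>" "tdiff n k TP X X2 i D \<theta>'"
  shows "tdiff n k TP X X2 i D (\<lambda>z. iadd (\<theta> z) (\<theta>' z))"
  using assms(2,3)
proof (induction n arbitrary: \<theta> \<theta>')
  case 0
  then have "cdiff k TP X X2 i D (\<lambda>z. base (\<theta> z) + base (\<theta>' z))"
    by (intro cdiff_add assms) auto
  moreover have "base (\<theta> z) + base (\<theta>' z) = base (iadd (\<theta> z) (\<theta>' z))" if "z \<in> D" for z
    using 0 that by fastforce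
  ultimately have "cdiff k TP X X2 i D (\<lambda>z. base (iadd (\<theta> z) (\<theta>' z)))" by (rule cdiff_cong)
  then show ?case using 0 by fastforce
next
  case (Suc n)
  have N: "\<exists>a b t a' b' t'. \<theta> z = Node a b t \<and> \<theta>' z = Node a' b' t'" if "z \<in> D" for z
    using Suc.prems that by auto
  have 1: "tdiff n k TP X X2 i D (\<lambda>z. iadd (pnt (\<theta> z)) (pnt (\<theta>' z)))"
    and 2: "tdiff n k TP X X2 i D (\<lambda>z. iadd (dir (\<theta> z)) (dir (\<theta>' z)))"
    using Suc by auto
  have 3: "cdiff k TP X fld i D (\<lambda>z. par (\<theta> z) + par (\<theta>' z))"
    using Suc.prems by (intro cdiff_add tvs_fld) auto
  have "tdiff (Suc n) k TP X X2 i D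
     (\<lambda>z. Node (iadd (pnt (\<theta> z)) (pnt (\<theta>' z))) (iadd (dir (\<theta> z)) (dir (\<theta>' z))) (par (\<theta> z) + par (\<theta>' z)))"
    using 1 2 3 by simp
  then show ?case by (rule tdiff_cong) (use N in fastforce)
qed

lemma tdiff_iscale:
  assumes "tvs X2" "cdiff k TP X fld i D a" "tdiff n k TP X X2 i D \<theta>"
  shows "tdiff n k TP X X2 i D (\<lambda>z. iscale (scale X2) (a z) (\<theta> z))"
  using assms(3)
proof (induction n arbitrary: \<theta>)
  case 0
  then have "cdiff k TP X X2 i D (\<lambda>z. scale X2 (a z) (base (\<theta> z)))"
    by (intro cdiff_scale assms) auto
  moreover have "scale X2 (a z) (base (\<theta> z)) = base (iscale (scale X2) (a z) (\<theta> z))" if "z \<in> D" for z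
    using 0 that by fastforce
  ultimately have "cdiff k TP X X2 i D (\<lambda>z. base (iscale (scale X2) (a z) (\<theta> z)))" by (rule cdiff_cong)
  then show ?case using 0 by fastforce
next
  case (Suc n)
  have N: "\<exists>a b t. \<theta> z = Node a b t" if "z \<in> D" for z
    using Suc.prems that by auto
  have 1: "tdiff n k TP X X2 i D (\<lambda>z. iscale (scale X2) (a z) (pnt (\<theta> z)))"
    and 2: "tdiff n k TP X X2 i D (\<lambda>z. iscale (scale X2) (a z) (dir (\<theta> z)))"
    using Suc by auto
  have 3: "cdiff k TP X fld i D (\<lambda>z. a z * par (\<theta> z))"
    using Suc.prems by (intro cdiff_mult assms) auto
  have "tdiff (Suc n) k TP X X2 i D
     (\<lambda>z. Node (iscale (scale X2) (a z) (pnt (\<theta> z))) (iscale (scale X2) (a z) (dir (\<theta> z))) (a z * par (\<theta> z)))"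
    using 1 2 3 by simp
  then show ?case by (rule tdiff_cong) (use N in fastforce)
qed

text \<open>The map \<open>(x, y, t) \<mapsto> x + t y\<close> multiplies two entries and is not
  linear, so the chain rule takes the place of \<open>cdiff_precomp\<close>.\<close>

lemma cdiff_istep:
  assumes "tvs X" "cdiff k TP X Y i D g"
  shows "cdiff k TP X Y (Suc i) (dq_dom X i D) (\<lambda>z. g (fst z, istep X (pnt (snd z)) (dir (snd z)) (par (snd z))))"
proof -
  have D: "dq_dom X i D \<subseteq> topspace TP \<times> topspace (lv X (Suc i))"
    by (rule dq_dom_subset[OF cdiff_dom[OF assms(2)]])
  show ?thesis
    by (rule cdiff_chain[OF assms(2)])
      (auto intro!: tdiff_iadd tdiff_iscale assms(1) cdiff_par[OF D] tdiff_ilin[OF ilin_pnt D] tdiff_ilin[OF ilin_dir D]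
       elim!: dq_domE)
qed

text \<open>The quotient is \<open>- h / (q(x) q(x + t y))\<close>. The two reciprocals in it belong
  to functions that are differentiable of the smaller order \<open>k\<close>, so the induction
  hypothesis covers them.\<close>

lemma cdiff_inverse:
  assumes "tvs X" "cdiff k TP X fld i D q" "\<And>z. z \<in> D \<Longrightarrow> q z \<noteq> 0"
  shows "cdiff k TP X fld i D (\<lambda>z. inverse (q z))"
  using assms(2,3)
proof (induction k arbitrary: i D q)
  case 0
  then show ?case by (auto simp: cont_on_def intro!: cont_inverse)
next
  case (Suc k)
  obtain h where h: "cont_on TP X TK i D q" "cdiff k TP X fld (Suc i) (dq_dom X i D) h"
    "\<And>p x y t. (p, x) \<in> D \<Longrightarrow> y \<in> topspace (lv X i) \<Longrightarrow> (p, istep X x y t) \<in> D \<Longrightarrow>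
      q (p, istep X x y t) = q (p, x) + t * (h (p, Node x y t))"
    using Suc.prems(1) by (rule cdiff_SucE_fld) blast
  let ?a = "\<lambda>z. q (fst z, pnt (snd z))"
  let ?b = "\<lambda>z. q (fst z, istep X (pnt (snd z)) (dir (snd z)) (par (snd z)))"
  show ?case
  proof (rule cdiff_SucI)
    show "cont_on TP X (vtop fld) i D (\<lambda>z. inverse (q z))"
      using h(1) Suc.prems(2) by (auto simp: cont_on_def intro!: cont_inverse)
    have 1: "cdiff k TP X fld (Suc i) (dq_dom X i D) (\<lambda>z. inverse (?a z))"
      by (rule Suc.IH[OF cdiff_pnt[OF cdiff_SucD[OF Suc.prems(1)]]]) (auto elim!: dq_domE dest: Suc.prems(2))
    have 2: "cdiff k TP X fld (Suc i) (dq_dom X i D) (\<lambda>z. inverse (?b z))"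
      by (rule Suc.IH[OF cdiff_istep[OF assms(1) cdiff_SucD[OF Suc.prems(1)]]]) (auto elim!: dq_domE dest: Suc.prems(2))
    show "cdiff k TP X fld (Suc i) (dq_dom X i D) (\<lambda>z. (- 1) * (h z * (inverse (?a z) * inverse (?b z))))"
      using cdiff_const_scale[OF tvs_fld cdiff_mult[OF h(2) cdiff_mult[OF 1 2]], of "- 1"] by simp
  next
    fix p x y t assume z: "(p, x) \<in> D" "y \<in> topspace (lv X i)" "(p, istep X x y t) \<in> D"
    have nz: "q (p, x) \<noteq> 0" "q (p, istep X x y t) \<noteq> 0" using Suc.prems(2) z by auto
    let ?z = "(p, Node x y t)"
    have "inverse (q (p, istep X x y t)) =
       inverse (q (p, x)) + t * (- 1 * (h ?z * (inverse (q (p, x)) * inverse (q (p, istep X x y t)))))"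
      using division_ring_inverse_diff[OF nz] by (simp add: h(3)[OF z] algebra_simps)
    then show "inverse (q (p, istep X x y t)) =
       inverse (q (p, x)) + scale fld t (- 1 * (h ?z * (inverse (?a ?z) * inverse (?b ?z))))"
      by simp
  qed
qed

section \<open>Uniqueness and locality of difference quotients\<close>

lemma open_dq_dom:
  assumes "tvs X" "openin (prod_topology TP (lv X i)) D"
  shows "openin (prod_topology TP (lv X (Suc i))) (dq_dom X i D)"
proof -
  let ?S = "prod_topology TP (lv X (Suc i))"
  have D: "D \<subseteq> topspace TP \<times> topspace (lv X i)"
    using openin_subset[OF assms(2)] by simp
  have c: "continuous_map ?S TP fst" "continuous_map ?S (lv X (Suc i)) snd"
    by (rule continuous_map_fst, rule continuous_map_snd)
  have "continuous_map ?S (prod_topology TP (lv X i)) (\<lambda>z. (fst z, pnt (snd z)))"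
    by (intro continuous_map_pairedI c cont_pnt)
  from openin_continuous_map_preimage[OF this assms(2)]
  have 1: "openin ?S {z \<in> topspace ?S. (fst z, pnt (snd z)) \<in> D}" .
  have "continuous_map ?S (prod_topology TP (lv X i)) (\<lambda>z. (fst z, istep X (pnt (snd z)) (dir (snd z)) (par (snd z))))"
    by (intro continuous_map_pairedI c cont_iadd cont_iscale assms(1) cont_pnt[OF c(2)] cont_dir[OF c(2)] cont_par[OF c(2)])
  from openin_continuous_map_preimage[OF this assms(2)]
  have 2: "openin ?S {z \<in> topspace ?S. (fst z, istep X (pnt (snd z)) (dir (snd z)) (par (snd z))) \<in> D}" .
  have eq: "dq_dom X i D = {z \<in> topspace ?S. (fst z, pnt (snd z)) \<in> D} \<inter>
    {z \<in> topspace ?S. (fst z, istep X (pnt (snd z)) (dir (snd z)) (par (snd z))) \<in> D}"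
    using D by (auto simp: lv_Suc elim!: dq_domE)
  show ?thesis unfolding eq using 1 2 by (rule openin_Int)
qed

lemma cont_on_path:
  assumes X: "tvs X" and D: "openin (prod_topology TP (lv X i)) D"
    and h: "cont_on TP X T (Suc i) (dq_dom X i D) h" and z: "(p, Node x y 0) \<in> dq_dom X i D"
  obtains A where "openin TK A" "0 \<in> A" "\<And>t. t \<in> A \<Longrightarrow> (p, Node x y t) \<in> dq_dom X i D"
    "continuous_map (subtopology TK A) T (\<lambda>t. h (p, Node x y t))"
proof -
  have xy: "x \<in> topspace (lv X i)" "y \<in> topspace (lv X i)" "p \<in> topspace TP"
    using z openin_subset[OF D] by auto
  have cp: "continuous_map TK (prod_topology TP (lv X (Suc i))) (\<lambda>s. (p, Node x y s))"
    using xy by (intro continuous_map_pairedI cont_Node) (auto intro: cont_const)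
  define A where "A = {s \<in> topspace TK. (p, Node x y s) \<in> dq_dom X i D}"
  have A: "openin TK A"
    unfolding A_def by (rule openin_continuous_map_preimage[OF cp open_dq_dom[OF X D]])
  have "continuous_map (subtopology TK A) T (\<lambda>s. h (p, Node x y s))"
    using h by (intro cont_on_comp[OF cont_on_map continuous_map_from_subtopology[OF cp]]) (auto simp: A_def)
  then show ?thesis using that[OF A] z by (auto simp: A_def)
qed

text \<open>The set of agreement is closed in \<open>A\<close>; if it missed 0, its complement would
  be the open singleton \<open>{0}\<close>.\<close>

lemma eq_at_0:
  assumes H: "Hausdorff_space T" and A: "openin TK A" "0 \<in> A"
    and c: "continuous_map (subtopology TK A) T a" "continuous_map (subtopology TK A) T b"
    and eq: "\<And>t. t \<in> A \<Longrightarrow> t \<noteq> 0 \<Longrightarrow> a t = b t"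
  shows "a 0 = b 0"
proof (rule ccontr)
  assume n: "a 0 \<noteq> b 0"
  have "closedin (subtopology TK A) {s \<in> topspace (subtopology TK A). a s = b s}"
    by (rule closedin_continuous_maps_eq[OF H c])
  then have "openin (subtopology TK A) (A - {s \<in> A. a s = b s})"
    by (auto simp: closedin_def)
  then have "openin TK (A - {s \<in> A. a s = b s})"
    using A(1) openin_trans_full by blast
  moreover have "A - {s \<in> A. a s = b s} = {0}"
    using A(2) n eq by auto
  ultimately show False using not_open_singleton by metis
qed

lemma cont_on_eq_at_0:
  assumes X: "tvs X" and H: "Hausdorff_space T" and D: "openin (prod_topology TP (lv X i)) D"
    and h: "cont_on TP X T (Suc i) (dq_dom X i D) h1" "cont_on TP X T (Suc i) (dq_dom X i D) h2"
    and eq: "\<And>p x y t. (p, Node x y t) \<in> dq_dom X i D \<Longrightarrow> t \<noteq> 0 \<Longrightarrow> h1 (p, Node x y t) = h2 (p, Node x y t)"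
    and z: "z \<in> dq_dom X i D"
  shows "h1 z = h2 z"
proof -
  obtain p x y t where z': "z = (p, Node x y t)" using z by (auto elim: dq_domE)
  show ?thesis
  proof (cases "t = 0")
    case True
    have w: "(p, Node x y 0) \<in> dq_dom X i D" using z z' True by blast
    show ?thesis
    proof (rule cont_on_path[OF X D h(1) w], rule cont_on_path[OF X D h(2) w])
      fix A B assume A: "openin TK A" "0 \<in> A" "\<And>t. t \<in> A \<Longrightarrow> (p, Node x y t) \<in> dq_dom X i D"
          "continuous_map (subtopology TK A) T (\<lambda>t. h1 (p, Node x y t))"
        and B: "openin TK B" "0 \<in> B" "continuous_map (subtopology TK B) T (\<lambda>t. h2 (p, Node x y t))"
      have "h1 (p, Node x y 0) = h2 (p, Node x y 0)"
      proof (rule eq_at_0[OF H, of "A \<inter> B"])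
        show "h1 (p, Node x y t) = h2 (p, Node x y t)" if "t \<in> A \<inter> B" "t \<noteq> 0" for t
          by (rule eq[OF A(3) that(2)]) (use that in blast)
      qed (use A B in \<open>auto intro: continuous_map_from_subtopology_mono\<close>)
      then show ?thesis using z' True by simp
    qed
  qed (use eq z z' in auto)
qed

lemma dq_unique:
  assumes X: "tvs X" and Y: "tvs Y"
    and D: "openin (prod_topology TP (lv X i)) D" "openin (prod_topology TP (lv X i)) D'"
    and h: "cont_on TP X (vtop Y) (Suc i) (dq_dom X i D) h1" "cont_on TP X (vtop Y) (Suc i) (dq_dom X i D') h2"
    and dq: "dq_rel X Y i D g h1" "dq_rel X Y i D' g h2"
    and z: "z \<in> dq_dom X i D" "z \<in> dq_dom X i D'"
  shows "h1 z = h2 z"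
proof (rule cont_on_eq_at_0[OF X tvs_Hausdorff[OF Y], where D = "D \<inter> D'"])
  show "openin (prod_topology TP (lv X i)) (D \<inter> D')" using D by (rule openin_Int)
  show "cont_on TP X (vtop Y) (Suc i) (dq_dom X i (D \<inter> D')) h1"
    by (rule cont_on_subset[OF h(1) dq_dom_mono]) simp
  show "cont_on TP X (vtop Y) (Suc i) (dq_dom X i (D \<inter> D')) h2"
    by (rule cont_on_subset[OF h(2) dq_dom_mono]) simp
  show "z \<in> dq_dom X i (D \<inter> D')" using z by (metis dq_dom_Int IntI)
  fix p x y t assume a: "(p, Node x y t) \<in> dq_dom X i (D \<inter> D')" and t: "t \<noteq> 0"
  then have "g (p, x) + scale Y t (h1 (p, Node x y t)) = g (p, x) + scale Y t (h2 (p, Node x y t))"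
    using dq unfolding dq_rel_def by (metis mem_dq_dom IntE)
  then show "h1 (p, Node x y t) = h2 (p, Node x y t)"
    using scale_cancel[OF Y t] by simp
qed

text \<open>Not immediate, as a quotient compares the values at \<open>x\<close> and
  \<open>x + t y\<close>, and these need not lie in a common member of the given family of small
  sets. For \<open>t \<noteq> 0\<close> the explicit formula is differentiable without a common set;
  for \<open>t = 0\<close> both points coincide, and one small set around \<open>x\<close> suffices
  nearby.\<close>

lemma cdiff_local:
  assumes X: "tvs X" and Y: "tvs Y" and D: "openin (prod_topology TP (lv X i)) D"
    and loc: "\<And>z. z \<in> D \<Longrightarrow> \<exists>D'. openin (prod_topology TP (lv X i)) D' \<and> z \<in> D' \<and> D' \<subseteq> D \<and> cdiff k TP X Y i D' g"
  shows "cdiff k TP X Y i D g"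
  using D loc
proof (induction k arbitrary: i D g)
  have cl: "cont_on TP X (vtop Y) i D g" if D: "openin (prod_topology TP (lv X i)) D"
    and l: "\<And>z. z \<in> D \<Longrightarrow> \<exists>D'. openin (prod_topology TP (lv X i)) D' \<and> z \<in> D' \<and> D' \<subseteq> D \<and> cont_on TP X (vtop Y) i D' g"
    for i D g
  proof -
    let ?S = "prod_topology TP (lv X i)"
    define \<D> where "\<D> = {D'. openin ?S D' \<and> D' \<subseteq> D \<and> cont_on TP X (vtop Y) i D' g}"
    have ts: "topspace (subtopology ?S D) = D" using openin_subset[OF D] by auto
    have "continuous_map (subtopology ?S D) (vtop Y) g"
    proof (rule pasting_lemma[where I = \<D> and T = id and f = "\<lambda>_. g"])
      show "openin (subtopology ?S D) (id D')" if "D' \<in> \<D>" for D'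
        using that D by (auto simp: \<D>_def openin_subtopology)
      show "continuous_map (subtopology (subtopology ?S D) (id D')) (vtop Y) g" if "D' \<in> \<D>" for D'
      proof -
        have "D \<inter> D' = D'" using that by (auto simp: \<D>_def)
        then show ?thesis using that by (simp add: \<D>_def subtopology_subtopology cont_on_def)
      qed
      show "\<exists>j. j \<in> \<D> \<and> x \<in> id j \<and> g x = g x" if "x \<in> topspace (subtopology ?S D)" for x
        using l[of x] that unfolding ts by (auto simp: \<D>_def)
    qed simp
    then show ?thesis using openin_subset[OF D] by (simp add: cont_on_def)
  qed
  case 0
  then show ?case using cl[of i D g] by simp
next
  case (Suc k)
  let ?S = "\<lambda>i. prod_topology TP (lv X i)"
  have cl: "cdiff k TP X Y i D g"
    by (rule Suc.IH[OF Suc.prems(1)]) (metis Suc.prems(2) cdiff_SucD)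
  have "\<exists>D' h. openin (?S i) D' \<and> z \<in> D' \<and> D' \<subseteq> D \<and> dq_rel X Y i D' g h \<and> cdiff k TP X Y (Suc i) (dq_dom X i D') h"
    if "z \<in> D" for z
    using Suc.prems(2)[OF that] by auto
  then obtain N H where N: "\<And>z. z \<in> D \<Longrightarrow> openin (?S i) (N z)" "\<And>z. z \<in> D \<Longrightarrow> z \<in> N z" "\<And>z. z \<in> D \<Longrightarrow> N z \<subseteq> D"
    and H: "\<And>z. z \<in> D \<Longrightarrow> dq_rel X Y i (N z) g (H z)"
      "\<And>z. z \<in> D \<Longrightarrow> cdiff k TP X Y (Suc i) (dq_dom X i (N z)) (H z)" by metis
  define quo where "quo \<zeta> = scale Y (inverse (par (snd \<zeta>)))
     (g (fst \<zeta>, istep X (pnt (snd \<zeta>)) (dir (snd \<zeta>)) (par (snd \<zeta>))) - g (fst \<zeta>, pnt (snd \<zeta>)))" for \<zeta>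
  \<comment> \<open>At parameter 0 the local quotient is taken from the base point of the triple, a
    choice that jumps from point to point. Uniqueness shows that the value agrees with every
    \<open>H z\<close> defined there.\<close>
  define h where "h \<zeta> = (if par (snd \<zeta>) \<noteq> 0 then quo \<zeta> else H (fst \<zeta>, pnt (snd \<zeta>)) \<zeta>)" for \<zeta>
  have h_eq: "h \<zeta> = H z \<zeta>" if z: "z \<in> D" and \<zeta>: "\<zeta> \<in> dq_dom X i (N z)" for z \<zeta>
  proof (cases "par (snd \<zeta>) = 0")
    case False
    obtain p x y t where [simp]: "\<zeta> = (p, Node x y t)" using \<zeta> by (auto elim: dq_domE)
    show ?thesis using H(1)[OF z] False \<zeta> by (simp add: h_def quo_def dq_rel_def scale_simps[OF Y])
  next
    case True
    obtain p x y t where \<zeta>_eq: "\<zeta> = (p, Node x y t)" using \<zeta> by (auto elim: dq_domE)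
    have px: "(p, x) \<in> D" "y \<in> topspace (lv X i)" using \<zeta> N(3)[OF z] by (auto simp: \<zeta>_eq)
    have "x \<in> topspace (lv X i)" using px openin_subset[OF Suc.prems(1)] by auto
    then have "\<zeta> \<in> dq_dom X i (N (p, x))"
      using px N(2)[OF px(1)] True by (simp add: \<zeta>_eq istep_0[OF X])
    from dq_unique[OF X Y N(1)[OF px(1)] N(1)[OF z] cdiff_cont[OF H(2)[OF px(1)]] cdiff_cont[OF H(2)[OF z]]
        H(1)[OF px(1)] H(1)[OF z] this \<zeta>]
    show ?thesis using True by (simp add: h_def \<zeta>_eq)
  qed
  have hH: "cdiff k TP X Y (Suc i) (dq_dom X i (N z)) h" if "z \<in> D" for z
    by (rule cdiff_cong[OF H(2)[OF that]]) (use h_eq[OF that] in simp)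
  show ?case
  proof (rule cdiff_SucI[OF cdiff_cont[OF cl]])
    show "cdiff k TP X Y (Suc i) (dq_dom X i D) h"
    proof (rule Suc.IH[OF open_dq_dom[OF X Suc.prems(1)]])
      fix \<zeta> assume \<zeta>: "\<zeta> \<in> dq_dom X i D"
      then obtain p x y t where \<zeta>_eq: "\<zeta> = (p, Node x y t)" by (auto elim: dq_domE)
      have px: "(p, x) \<in> D" "y \<in> topspace (lv X i)" using \<zeta> by (auto simp: \<zeta>_eq)
      have x: "x \<in> topspace (lv X i)" using px openin_subset[OF Suc.prems(1)] by auto
      show "\<exists>D'. openin (?S (Suc i)) D' \<and> \<zeta> \<in> D' \<and> D' \<subseteq> dq_dom X i D \<and> cdiff k TP X Y (Suc i) D' h"
      proof (cases "t = 0")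
        case True
        then have "\<zeta> \<in> dq_dom X i (N (p, x))"
          using px N(2)[OF px(1)] x by (simp add: \<zeta>_eq istep_0[OF X])
        then show ?thesis
          using open_dq_dom[OF X N(1)[OF px(1)]] dq_dom_mono[OF N(3)[OF px(1)]] hH[OF px(1)] by blast
      next
        case False
        \<comment> \<open>Where the parameter is invertible, \<open>quo\<close> is built from
          differentiable operations.\<close>
        define A where "A = dq_dom X i D \<inter> {\<zeta> \<in> topspace (?S (Suc i)). par (snd \<zeta>) \<in> - {0}}"
        have "openin TK (- {0})"
          using closedin_Hausdorff_singleton[OF Hausdorff_TK, of 0] by (simp add: closedin_def Compl_eq_Diff_UNIV)
        then have A: "openin (?S (Suc i)) A"
          unfolding A_def
          by (intro openin_Int open_dq_dom[OF X Suc.prems(1)] openin_continuous_map_preimage[of _ TK])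
            (auto intro: cont_par continuous_map_snd)
        have AD: "A \<subseteq> dq_dom X i D" by (auto simp: A_def)
        have "cdiff k TP X Y (Suc i) A quo"
          unfolding quo_def
          by (intro cdiff_scale[OF Y] cdiff_diff[OF Y] cdiff_inverse[OF X] cdiff_par
              cdiff_subset[OF cdiff_pnt[OF cl] AD] cdiff_subset[OF cdiff_istep[OF X cl] AD])
            (auto simp: A_def)
        then have "cdiff k TP X Y (Suc i) A h"
          by (rule cdiff_cong) (auto simp: A_def h_def)
        moreover have "\<zeta> \<in> A" using \<zeta> False px x openin_subset[OF Suc.prems(1)] by (auto simp: A_def \<zeta>_eq)
        ultimately show ?thesis using A AD by blast
      qed
    qed
  next
    fix p x y t assume z: "(p, x) \<in> D" "y \<in> topspace (lv X i)" "(p, istep X x y t) \<in> D"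
    have x: "x \<in> topspace (lv X i)" using z openin_subset[OF Suc.prems(1)] by auto
    show "g (p, istep X x y t) = g (p, x) + scale Y t (h (p, Node x y t))"
      using x z by (cases "t = 0") (auto simp: h_def quo_def istep_0[OF X] scale_simps[OF Y])
  qed
qed

section \<open>Agreement with the selected iterated quotients\<close>

lemma idom_subset: "U \<subseteq> topspace (vtop X) \<Longrightarrow> idom TK X U j \<subseteq> topspace (lv X j)"
  by (induction j) auto

lemma dq_dom_idom: "dq_dom X j (A \<times> idom TK X U j) = A \<times> idom TK X U (Suc j)"
  by (auto elim!: dq_domE)

lemma open_idom:
  assumes "tvs X" "openin (vtop X) U"
  shows "openin (lv X j) (idom TK X U j)"
proof (induction j)
  case 0
  have "openin (lv X 0) {w \<in> topspace (lv X 0). base w \<in> U}"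
    by (rule openin_continuous_map_preimage[OF cont_base[OF cont_ident] assms(2)])
  moreover have "{w \<in> topspace (lv X 0). base w \<in> U} = Base ` U"
    using openin_subset[OF assms(2)] by (auto simp: lv_0)
  ultimately show ?case by simp
next
  case (Suc j)
  let ?S = "lv X (Suc j)"
  have 1: "openin ?S {w \<in> topspace ?S. pnt w \<in> idom TK X U j}"
    by (rule openin_continuous_map_preimage[OF cont_pnt[OF cont_ident] Suc.IH])
  have 2: "openin ?S {w \<in> topspace ?S. istep X (pnt w) (dir w) (par w) \<in> idom TK X U j}"
    by (rule openin_continuous_map_preimage[OF cont_iadd[OF assms(1) cont_pnt[OF cont_ident]
          cont_iscale[OF assms(1) cont_par[OF cont_ident] cont_dir[OF cont_ident]]] Suc.IH])
  have eq: "idom TK X U (Suc j) = {w \<in> topspace ?S. pnt w \<in> idom TK X U j} \<inter>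
     {w \<in> topspace ?S. istep X (pnt w) (dir w) (par w) \<in> idom TK X U j}"
    using openin_subset[OF Suc.IH] by (auto simp: lv_Suc)
  show ?case unfolding eq using 1 2 by (rule openin_Int)
qed

lemma cont_on_idom:
  assumes "cont_on TP X T j (A \<times> idom TK X U j) (\<lambda>z. g (fst z) (snd z))" "p \<in> A"
  shows "continuous_map (idom_top TK X U j) T (g p)"
proof -
  have p: "p \<in> topspace TP \<or> idom TK X U j = {}" using assms by (auto simp: cont_on_def)
  have "continuous_map (idom_top TK X U j) T (\<lambda>w. (\<lambda>z. g (fst z) (snd z)) (p, w))"
  proof (cases "idom TK X U j = {}")
    case True then show ?thesis by (simp add: idom_top_def)
  next
    case False
    then have "p \<in> topspace TP" using p by auto
    then show ?thesis
      using assms by (intro cont_onD[OF assms(1)]) (auto simp: idom_top_def intro: cont_ident_sub)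
  qed
  then show ?thesis by simp
qed

lemma Node_in_idom [simp]: "Node x y t \<in> idom TK X U (Suc j) \<longleftrightarrow>
    x \<in> idom TK X U j \<and> y \<in> topspace (lv X j) \<and> istep X x y t \<in> idom TK X U j"
  by auto

declare idom.simps(2) [simp del] iter_dquot.simps(2) [simp del]

text \<open>A one-point parameter space turns the calculus with parameters into the ordinary
  one.\<close>

lemma cont_on_unit_idom:
  fixes X :: "('k, 'v::ab_group_add) tvs"
  assumes "U \<subseteq> topspace (vtop X)"
  shows "cont_on (discrete_topology {()}) X T j ({()} \<times> idom TK X U j) (\<lambda>z. h (snd z)) \<longleftrightarrow>
    continuous_map (idom_top TK X U j) T h" (is "?r \<longleftrightarrow> ?l")
proof
  assume l: ?l
  show ?r
  proof (rule cont_onI)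
    fix S :: "(unit \<times> ('v, 'k) iter) topology"
    assume S: "topspace S = {()} \<times> idom TK X U j" "continuous_map S (lv X j) snd"
    have "snd z \<in> idom TK X U j" if "z \<in> topspace S" for z
      using that unfolding S(1) by (simp add: mem_Times_iff)
    then show "continuous_map S T (\<lambda>z. h (snd z))"
      by (rule cont_on_comp[OF l[unfolded idom_top_def] S(2)])
  qed (use idom_subset[OF assms, of j] in auto)
next
  assume ?r
  from cont_on_idom[of _ _ _ _ _ _ "\<lambda>_. h", OF this] show ?l by simp
qed

lemma is_dquot_iff:
  assumes "tvs X" "tvs Y" "U \<subseteq> topspace (vtop X)"
  shows "is_dquot TK X Y U j g h \<longleftrightarrow> h \<in> extensional (idom TK X U (Suc j)) \<and>
    cont_on (discrete_topology {()}) X (vtop Y) (Suc j) ({()} \<times> idom TK X U (Suc j)) (\<lambda>z. h (snd z)) \<and>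
    dq_rel X Y j ({()} \<times> idom TK X U j) (\<lambda>z. g (snd z)) (\<lambda>z. h (snd z))"
proof -
  have "g (istep X x y t) = g x + scale Y t (h (Node x y t)) \<longleftrightarrow>
     (t \<noteq> 0 \<longrightarrow> h (Node x y t) = scale Y (1 / t) (g (istep X x y t) - g x))"
    if "Node x y t \<in> idom TK X U (Suc j)" for x y t
  proof (cases "t = 0")
    case True
    have "x \<in> topspace (lv X j)" using that idom_subset[OF assms(3), of j] by auto
    then show ?thesis using that True istep_0[OF assms(1), of x j y] by (simp add: scale_simps[OF assms(2)])
  next
    case False
    have "scale Y t (scale Y (1 / t) (g (istep X x y t) - g x)) = g (istep X x y t) - g x"
      using False by (simp add: scale_simps(3,4)[OF assms(2)])
    then have "h (Node x y t) = scale Y (1 / t) (g (istep X x y t) - g x) \<longleftrightarrow>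
      scale Y t (h (Node x y t)) = g (istep X x y t) - g x"
      using scale_cancel[OF assms(2) False] by metis
    then show ?thesis using False by (auto simp: algebra_simps)
  qed
  then show ?thesis
    unfolding is_dquot_def cont_on_unit_idom[OF assms(3)] dq_rel_def dq_dom_idom by auto
qed

lemma is_dquot_unique:
  assumes "tvs X" "tvs Y" "openin (vtop X) U" "is_dquot TK X Y U j g h1" "is_dquot TK X Y U j g h2"
  shows "h1 = h2"
proof -
  note iff = is_dquot_iff[OF assms(1,2) openin_subset[OF assms(3)]]
  have o: "openin (prod_topology (discrete_topology {()}) (lv X j)) ({()} \<times> idom TK X U j)"
    using open_idom[OF assms(1,3)] by (simp add: openin_prod_Times_iff)
  note c = assms(4,5)[unfolded iff dq_dom_idom[symmetric]]
  have "h1 w = h2 w" if "w \<in> idom TK X U (Suc j)" for w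
    using dq_unique[OF assms(1,2) o o, of "\<lambda>z. h1 (snd z)" "\<lambda>z. h2 (snd z)" "\<lambda>z. g (snd z)" "((), w)"] c that
    unfolding dq_dom_idom by simp
  moreover have "h1 w = h2 w" if "w \<notin> idom TK X U (Suc j)" for w
  proof -
    have "h1 \<in> extensional (idom TK X U (Suc j))" "h2 \<in> extensional (idom TK X U (Suc j))"
      using assms(4,5) unfolding is_dquot_def by blast+
    then show ?thesis using that unfolding extensional_def by simp
  qed
  ultimately show ?thesis by blast
qed

lemma is_dquot_iter_dquot:
  assumes "tvs X" "tvs Y" "openin (vtop X) U" "is_dquot TK X Y U j (iter_dquot TK X Y U f j) h"
  shows "iter_dquot TK X Y U f (Suc j) = h"
  unfolding iter_dquot.simps
proof (rule the_equality)
  show "h' = h" if "is_dquot TK X Y U j (iter_dquot TK X Y U f j) h'" for h'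
    by (rule is_dquot_unique[OF assms(1-3) that assms(4)])
qed (rule assms(4))

text \<open>An abstract quotient of the whole family must coincide, for each fixed parameter, with
  the selected one. The selected quotients thereby inherit joint continuity in parameter and
  point.\<close>

lemma cdiff_iter_dquot:
  assumes X: "tvs X" and Y: "tvs Y" and U: "openin (vtop X) U"
    and "cdiff k TP X Y 0 (A \<times> idom TK X U 0) (\<lambda>z. f (fst z) (base (snd z)))" "m \<le> k"
  shows "cdiff (k - m) TP X Y m (A \<times> idom TK X U m) (\<lambda>z. iter_dquot TK X Y U (f (fst z)) m (snd z))"
    "p \<in> A \<Longrightarrow> m < k \<Longrightarrow> is_dquot TK X Y U m (iter_dquot TK X Y U (f p) m) (iter_dquot TK X Y U (f p) (Suc m))"
proof -
  have step: "cdiff k TP X Y (Suc m) (A \<times> idom TK X U (Suc m)) (\<lambda>z. iter_dquot TK X Y U (f (fst z)) (Suc m) (snd z)) \<and>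
      (\<forall>p\<in>A. is_dquot TK X Y U m (iter_dquot TK X Y U (f p) m) (iter_dquot TK X Y U (f p) (Suc m)))"
    if c: "cdiff (Suc k) TP X Y m (A \<times> idom TK X U m) (\<lambda>z. iter_dquot TK X Y U (f (fst z)) m (snd z))" for m k
  proof -
    obtain h where h: "cdiff k TP X Y (Suc m) (A \<times> idom TK X U (Suc m)) h"
      "\<And>p x y t. p \<in> A \<Longrightarrow> Node x y t \<in> idom TK X U (Suc m) \<Longrightarrow>
        iter_dquot TK X Y U (f p) m (istep X x y t) = iter_dquot TK X Y U (f p) m x + scale Y t (h (p, Node x y t))"
      using c by (rule cdiff_SucE) (simp add: dq_dom_idom)
    \<comment> \<open>Restriction to the domain supplies the extensionality demanded by
      \<open>is_dquot\<close>.\<close>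
    define H where "H p = restrict (\<lambda>w. h (p, w)) (idom TK X U (Suc m))" for p
    have cH: "cdiff k TP X Y (Suc m) (A \<times> idom TK X U (Suc m)) (\<lambda>z. H (fst z) (snd z))"
      by (rule cdiff_cong[OF h(1)]) (auto simp: H_def simp del: idom.simps)
    have dq: "is_dquot TK X Y U m (iter_dquot TK X Y U (f p) m) (H p)" if p: "p \<in> A" for p
    proof -
      have "continuous_map (idom_top TK X U (Suc m)) (vtop Y) (H p)"
        by (rule cont_on_idom[OF cdiff_cont[OF cH] p])
      then have "cont_on (discrete_topology {()}) X (vtop Y) (Suc m) ({()} \<times> idom TK X U (Suc m)) (\<lambda>z. H p (snd z))"
        by (simp only: cont_on_unit_idom[OF openin_subset[OF U]])
      then show ?thesis
        unfolding is_dquot_iff[OF X Y openin_subset[OF U]] dq_rel_def dq_dom_idom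
        using h(2)[OF p] by (auto simp: H_def simp del: idom.simps)
    qed
    have eq: "iter_dquot TK X Y U (f p) (Suc m) = H p" if "p \<in> A" for p
      by (rule is_dquot_iter_dquot[OF X Y U dq[OF that]])
    show ?thesis
      using dq eq by (auto intro: cdiff_cong[OF cH] simp del: idom.simps iter_dquot.simps)
  qed
  have main: "cdiff (k - m) TP X Y m (A \<times> idom TK X U m) (\<lambda>z. iter_dquot TK X Y U (f (fst z)) m (snd z))"
    if "m \<le> k" for m
    using that
  proof (induction m)
    case 0
    show ?case by (simp del: idom.simps, rule cdiff_cong[OF assms(4)]) auto
  next
    case (Suc m)
    then have "cdiff (Suc (k - Suc m)) TP X Y m (A \<times> idom TK X U m) (\<lambda>z. iter_dquot TK X Y U (f (fst z)) m (snd z))"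
      by (simp add: Suc_diff_Suc)
    from step[OF this] show ?case by blast
  qed
  show "cdiff (k - m) TP X Y m (A \<times> idom TK X U m) (\<lambda>z. iter_dquot TK X Y U (f (fst z)) m (snd z))"
    using main assms(5) .
  show "is_dquot TK X Y U m (iter_dquot TK X Y U (f p) m) (iter_dquot TK X Y U (f p) (Suc m))" if "p \<in> A" "m < k"
  proof -
    have "cdiff (Suc (k - Suc m)) TP X Y m (A \<times> idom TK X U m) (\<lambda>z. iter_dquot TK X Y U (f (fst z)) m (snd z))"
      using main[of m] that by (simp add: Suc_diff_Suc)
    from step[OF this] show ?thesis using that by blast
  qed
qed

text \<open>The induction counts the orders that remain, so with \<open>j\<close> orders left it
  speaks of level \<open>k - j\<close>. This is how differentiability is concluded from a given
  chain of candidates for the quotients.\<close>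

lemma cdiff_of_seq:
  assumes "\<And>m. m \<le> k \<Longrightarrow> cont_on TP X (vtop Y) m (A \<times> idom TK X U m) (H m)"
    "\<And>m. m < k \<Longrightarrow> dq_rel X Y m (A \<times> idom TK X U m) (H m) (H (Suc m))"
  shows "cdiff k TP X Y 0 (A \<times> idom TK X U 0) (H 0)"
proof -
  have "cdiff j TP X Y (k - j) (A \<times> idom TK X U (k - j)) (H (k - j))" if "j \<le> k" for j
    using that
  proof (induction j)
    case 0 then show ?case using assms(1)[of k] by (simp del: idom.simps)
  next
    case (Suc j)
    have e: "Suc (k - Suc j) = k - j" using Suc.prems by simp
    have "cdiff j TP X Y (Suc (k - Suc j)) (dq_dom X (k - Suc j) (A \<times> idom TK X U (k - Suc j))) (H (Suc (k - Suc j)))"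
      unfolding dq_dom_idom e using Suc by simp
    moreover have "dq_rel X Y (k - Suc j) (A \<times> idom TK X U (k - Suc j)) (H (k - Suc j)) (H (Suc (k - Suc j)))"
      using Suc.prems by (intro assms(2)) auto
    ultimately show ?case
      unfolding cdiff.simps using assms(1)[of "k - Suc j"] by auto
  qed
  from this[of k] show ?thesis by simp
qed

text \<open>The bridge between the definition of \<open>Ck\<close> and the calculus with parameters:
  locality, restriction and the chain rule reach \<open>Ck\<close> through it.\<close>

lemma Ck_nat_iff_cdiff:
  assumes X: "tvs X" and Y: "tvs Y" and U: "openin (vtop X) U"
  shows "Ck_nat TK X Y U f k \<longleftrightarrow>
    cdiff k (discrete_topology {()}) X Y 0 ({()} \<times> idom TK X U 0) (\<lambda>z. f (base (snd z)))"
proof -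
  let ?it = "iter_dquot TK X Y U f" and ?TP = "discrete_topology {()}"
  have c0: "cont_on ?TP X (vtop Y) 0 ({()} \<times> idom TK X U 0) (\<lambda>z. ?it 0 (snd z)) \<longleftrightarrow>
     continuous_map (subtopology (vtop X) U) (vtop Y) f" (is "?l \<longleftrightarrow> ?r")
  proof
    assume ?l
    then have "continuous_map (subtopology (lv X 0) (idom TK X U 0)) (vtop Y) (?it 0)"
      by (simp only: cont_on_unit_idom[OF openin_subset[OF U]] idom_top_def)
    then have "continuous_map (subtopology (vtop X) U) (vtop Y) (\<lambda>x. ?it 0 (Base x))"
      by (rule cont_on_comp) (auto intro: cont_Base cont_ident_sub)
    then show ?r by (rule cont_cong) auto
  next
    assume r: ?r
    have "cont_on ?TP X (vtop Y) 0 ({()} \<times> idom TK X U 0) (\<lambda>z. f (base (snd z)))"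
      using openin_subset[OF U]
      by (intro cont_onI cont_on_comp[OF r, of _ "\<lambda>z. base (snd z)"]) (auto intro: cont_base)
    then show ?l by (rule cont_on_cong) auto
  qed
  have cj: "continuous_map (idom_top TK X U j) (vtop Y) (?it j) \<longleftrightarrow>
     cont_on ?TP X (vtop Y) j ({()} \<times> idom TK X U j) (\<lambda>z. ?it j (snd z))" for j
    by (simp only: cont_on_unit_idom[OF openin_subset[OF U]])
  have ex: "(\<exists>h. is_dquot TK X Y U j (?it j) h) \<longleftrightarrow>
    cont_on ?TP X (vtop Y) (Suc j) ({()} \<times> idom TK X U (Suc j)) (\<lambda>z. ?it (Suc j) (snd z)) \<and>
    dq_rel X Y j ({()} \<times> idom TK X U j) (\<lambda>z. ?it j (snd z)) (\<lambda>z. ?it (Suc j) (snd z)) \<and>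
    ?it (Suc j) \<in> extensional (idom TK X U (Suc j))" for j
    using is_dquot_iter_dquot[OF X Y U, of j f] is_dquot_iff[OF X Y openin_subset[OF U], of j "?it j"]
    by metis
  show ?thesis
  proof
    assume C: "Ck_nat TK X Y U f k"
    have m: "Ck_nat TK X Y U f j \<Longrightarrow> m \<le> j \<Longrightarrow> Ck_nat TK X Y U f m" for j m
      by (induction j) (auto simp: le_Suc_eq simp del: iter_dquot.simps idom.simps)
    have Sm: "(\<exists>h. is_dquot TK X Y U m (?it m) h)" if "m < k" for m
      using m[OF C, of "Suc m"] that by (simp del: iter_dquot.simps)
    have "cdiff k ?TP X Y 0 ({()} \<times> idom TK X U 0) (\<lambda>z. ?it 0 (snd z))"
    proof (rule cdiff_of_seq[where H = "\<lambda>m z. ?it m (snd z)"])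
      show "cont_on ?TP X (vtop Y) m ({()} \<times> idom TK X U m) (\<lambda>z. ?it m (snd z))" if "m \<le> k" for m
      proof (cases m)
        case 0 then show ?thesis using c0 m[OF C, of 0] by simp
      next
        case (Suc n) then show ?thesis using Sm[of n] that ex[of n] by simp
      qed
      show "dq_rel X Y m ({()} \<times> idom TK X U m) (\<lambda>z. ?it m (snd z)) (\<lambda>z. ?it (Suc m) (snd z))" if "m < k" for m
        using Sm[OF that] ex[of m] by blast
    qed
    then show "cdiff k ?TP X Y 0 ({()} \<times> idom TK X U 0) (\<lambda>z. f (base (snd z)))"
      by (rule cdiff_cong) auto
  next
    assume C: "cdiff k ?TP X Y 0 ({()} \<times> idom TK X U 0) (\<lambda>z. f (base (snd z)))"
    note I = cdiff_iter_dquot[OF X Y U, of k ?TP "{()}" "\<lambda>_. f", OF C]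
    have "Ck_nat TK X Y U f m" if "m \<le> k" for m
      using that
    proof (induction m)
      case 0
      show ?case using cdiff_cont[OF I(1)[of 0]] c0 by simp
    next
      case (Suc m)
      then show ?case
        using cdiff_cont[OF I(1)[of m]] cj[of m] I(2)[of m "()"] by (auto simp del: iter_dquot.simps)
    qed
    then show "Ck_nat TK X Y U f k" by simp
  qed
qed

end

section \<open>Function spaces\<close>

lemma topspace_initial_topology [simp]: "topspace (initial_topology S J f T) = S"
  by (auto simp: initial_topology_def)

lemma continuous_map_into_initial_topology:
  assumes "\<And>x. x \<in> topspace \<Theta> \<Longrightarrow> g x \<in> S"
    "\<And>j. j \<in> J \<Longrightarrow> continuous_map \<Theta> (T j) (\<lambda>x. f j (g x))"
  shows "continuous_map \<Theta> (initial_topology S J f T) g"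
  unfolding initial_topology_def
proof (rule continuous_on_generated_topo)
  show "g ` topspace \<Theta> \<subseteq> \<Union> (insert S {f j -` V \<inter> S |j V. j \<in> J \<and> openin (T j) V})"
    using assms(1) by auto
  fix U assume "U \<in> insert S {f j -` V \<inter> S |j V. j \<in> J \<and> openin (T j) V}"
  then consider "U = S" | j V where "U = f j -` V \<inter> S" "j \<in> J" "openin (T j) V" by auto
  then show "openin \<Theta> (g -` U \<inter> topspace \<Theta>)"
  proof cases
    case 1
    then have "g -` U \<inter> topspace \<Theta> = topspace \<Theta>" using assms(1) by auto
    then show ?thesis by simp
  next
    case 2
    have "g -` U \<inter> topspace \<Theta> = {x \<in> topspace \<Theta>. f j (g x) \<in> V}" using 2 assms(1) by auto
    then show ?thesis using openin_continuous_map_preimage[OF assms(2) 2(3)] 2 by simp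
  qed
qed

lemma continuous_map_from_initial_topology:
  assumes "j \<in> J" "\<And>x. x \<in> S \<Longrightarrow> f j x \<in> topspace (T j)"
  shows "continuous_map (initial_topology S J f T) (T j) (f j)"
  unfolding continuous_map
proof (intro conjI allI impI)
  show "f j ` topspace (initial_topology S J f T) \<subseteq> topspace (T j)" using assms by auto
  fix V assume "openin (T j) V"
  moreover have "{x \<in> topspace (initial_topology S J f T). f j x \<in> V} = f j -` V \<inter> S" by auto
  ultimately show "openin (initial_topology S J f T) {x \<in> topspace (initial_topology S J f T). f j x \<in> V}"
    unfolding initial_topology_def using assms(1) by (auto intro!: topology_generated_by_Basis)
qed

lemma topspace_compact_open_topology:
  "topspace (compact_open_topology X Y) = {f \<in> extensional (topspace X). continuous_map X Y f}"
proof -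
  have "\<exists>K V. A = {f. f \<in> extensional (topspace X) \<and> continuous_map X Y f \<and> f ` K \<subseteq> V} \<and> compactin X K \<and> openin Y V"
    if "A = {f. f \<in> extensional (topspace X) \<and> continuous_map X Y f}" for A
    by (rule exI[of _ "{}"], rule exI[of _ "{}"]) (simp add: that)
  then show ?thesis
    unfolding compact_open_topology_def topology_generated_by_topspace by blast
qed

lemma openin_compact_open_subbasis:
  assumes "compactin X K" "openin Y V"
  shows "openin (compact_open_topology X Y) {f \<in> topspace (compact_open_topology X Y). f ` K \<subseteq> V}"
  unfolding topspace_compact_open_topology
  unfolding compact_open_topology_def
  by (rule topology_generated_by_Basis) (use assms in auto)

text \<open>If \<open>g \<theta>\<close> maps a compact set into \<open>V\<close>, the tube lemma
  applied to the joint map yields a neighbourhood of \<open>\<theta>\<close> with the same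
  property.\<close>

lemma continuous_map_into_compact_open:
  assumes "continuous_map (prod_topology \<Theta> X) Y (\<lambda>z. g (fst z) (snd z))"
    "\<And>\<theta>. \<theta> \<in> topspace \<Theta> \<Longrightarrow> g \<theta> \<in> extensional (topspace X)"
  shows "continuous_map \<Theta> (compact_open_topology X Y) g"
proof -
  have g: "g \<theta> \<in> topspace (compact_open_topology X Y)" if "\<theta> \<in> topspace \<Theta>" for \<theta>
  proof -
    have "continuous_map X (prod_topology \<Theta> X) (\<lambda>x. (\<theta>, x))"
      using that by (intro continuous_map_pairedI) (auto simp: continuous_map_id[unfolded id_def])
    from continuous_map_compose[OF this assms(1)] show ?thesis
      using assms(2)[OF that] by (simp add: topspace_compact_open_topology o_def)
  qed
  show ?thesis
    unfolding compact_open_topology_def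
  proof (rule continuous_on_generated_topo)
    show "g ` topspace \<Theta> \<subseteq> \<Union> {{f. f \<in> extensional (topspace X) \<and> continuous_map X Y f \<and> f ` K \<subseteq> V} |K V. compactin X K \<and> openin Y V}"
      using g unfolding compact_open_topology_def topology_generated_by_topspace by blast
    fix U assume "U \<in> {{f. f \<in> extensional (topspace X) \<and> continuous_map X Y f \<and> f ` K \<subseteq> V} |K V. compactin X K \<and> openin Y V}"
    then obtain K V where U: "U = {f. f \<in> extensional (topspace X) \<and> continuous_map X Y f \<and> f ` K \<subseteq> V}"
      and K: "compactin X K" and V: "openin Y V" by auto
    define W where "W = {z \<in> topspace (prod_topology \<Theta> X). g (fst z) (snd z) \<in> V}"
    have W: "openin (prod_topology \<Theta> X) W"
      unfolding W_def by (rule openin_continuous_map_preimage[OF assms(1) V])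
    show "openin \<Theta> (g -` U \<inter> topspace \<Theta>)"
    proof (subst openin_subopen, intro ballI)
      fix \<theta> assume \<theta>: "\<theta> \<in> g -` U \<inter> topspace \<Theta>"
      have "{\<theta>} \<times> K \<subseteq> W" using \<theta> compactin_subset_topspace[OF K] by (auto simp: W_def U)
      then obtain A B where "openin \<Theta> A" "openin X B" "\<theta> \<in> A" "K \<subseteq> B" "A \<times> B \<subseteq> W"
        using tube_lemma_right[OF W K, of \<theta>] \<theta> by auto
      moreover have "A \<subseteq> g -` U \<inter> topspace \<Theta>"
      proof
        fix \<theta>' assume \<theta>': "\<theta>' \<in> A"
        then have t: "\<theta>' \<in> topspace \<Theta>" using \<open>openin \<Theta> A\<close> openin_subset by blast
        have "(\<theta>', x) \<in> W" if "x \<in> K" for x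
          using \<open>K \<subseteq> B\<close> \<open>A \<times> B \<subseteq> W\<close> \<theta>' that by blast
        then have "g \<theta>' x \<in> V" if "x \<in> K" for x
          using that by (auto simp: W_def)
        then show "\<theta>' \<in> g -` U \<inter> topspace \<Theta>"
          using g[OF t] t unfolding U topspace_compact_open_topology by blast
      qed
      ultimately show "\<exists>T. openin \<Theta> T \<and> \<theta> \<in> T \<and> T \<subseteq> g -` U \<inter> topspace \<Theta>" by blast
    qed
  qed
qed

text \<open>Local compactness provides a compact neighbourhood of the point inside the preimage of
  \<open>V\<close>. The subbasic set for it bounds the values of all nearby functions at all nearby
  points.\<close>

lemma continuous_map_eval_compact_open:
  assumes "locally_compact_space X" "Hausdorff_space X"
  shows "continuous_map (prod_topology (compact_open_topology X Y) X) Y (\<lambda>z. (fst z) (snd z))"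
  unfolding continuous_map
proof (intro conjI allI impI)
  let ?C = "compact_open_topology X Y"
  show "(\<lambda>z. (fst z) (snd z)) ` topspace (prod_topology ?C X) \<subseteq> topspace Y"
    using continuous_map_image_subset_topspace by (fastforce simp: topspace_compact_open_topology)
  fix V assume V: "openin Y V"
  let ?A = "{z \<in> topspace (prod_topology ?C X). (fst z) (snd z) \<in> V}"
  show "openin (prod_topology ?C X) ?A"
  proof (subst openin_subopen, intro ballI)
    fix z assume z: "z \<in> ?A"
    obtain f x where [simp]: "z = (f, x)" by force
    have f: "continuous_map X Y f" "f x \<in> V" "x \<in> topspace X" "f \<in> topspace ?C"
      using z by (auto simp: topspace_compact_open_topology)
    have "neighbourhood_base_of (compactin X) X"
      using assms locally_compact_space_neighbourhood_base by blast
    then obtain O' K where O': "openin X O'" "compactin X K" "x \<in> O'" "O' \<subseteq> K" "K \<subseteq> {y \<in> topspace X. f y \<in> V}"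
      unfolding neighbourhood_base_of
      using openin_continuous_map_preimage[OF f(1) V] f(2,3) by (metis (mono_tags, lifting) mem_Collect_eq)
    let ?N = "{f \<in> topspace ?C. f ` K \<subseteq> V} \<times> O'"
    have "openin (prod_topology ?C X) ?N"
      using openin_compact_open_subbasis[OF O'(2) V] O'(1) by (simp add: openin_prod_Times_iff)
    moreover have "z \<in> ?N" using O' f by auto
    moreover have "?N \<subseteq> ?A" using O'(4) openin_subset[OF O'(1)] by (auto simp: image_subset_iff subset_iff)
    ultimately show "\<exists>T. openin (prod_topology ?C X) T \<and> z \<in> T \<and> T \<subseteq> ?A" by blast
  qed
qed

context top_field
begin

section \<open>Spaces of differentiable functions and joint continuity\<close>

lemma lv_homeo_0: "lv X 0 homeomorphic_space vtop X"
proof -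
  have "homeomorphic_maps (lv X 0) (vtop X) base Base"
    unfolding homeomorphic_maps_def using cont_base[OF cont_ident] cont_Base[OF cont_ident]
    by (auto simp: lv_0)
  then show ?thesis using homeomorphic_space_def by blast
qed

lemma lv_homeo_Suc: "lv X (Suc j) homeomorphic_space prod_topology (lv X j) (prod_topology (lv X j) TK)"
proof -
  have "continuous_map (prod_topology (lv X j) (prod_topology (lv X j) TK)) (lv X (Suc j))
     (\<lambda>z. Node (fst z) (fst (snd z)) (snd (snd z)))"
    by (intro cont_Node continuous_map_fst cont_fst[OF continuous_map_snd] cont_snd[OF continuous_map_snd])
  then have "homeomorphic_maps (lv X (Suc j)) (prod_topology (lv X j) (prod_topology (lv X j) TK))
     (\<lambda>w. (pnt w, dir w, par w)) (\<lambda>z. Node (fst z) (fst (snd z)) (snd (snd z)))"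
    unfolding homeomorphic_maps_def using cont_triple by (auto simp: lv_Suc)
  then show ?thesis using homeomorphic_space_def by blast
qed

lemma Hausdorff_lv: "Hausdorff_space (vtop X) \<Longrightarrow> Hausdorff_space (lv X j)"
proof (induction j)
  case 0 then show ?case using homeomorphic_Hausdorff_space[OF lv_homeo_0] by blast
next
  case (Suc j)
  then show ?case
    by (simp add: homeomorphic_Hausdorff_space[OF lv_homeo_Suc] Hausdorff_TK Hausdorff_space_prod_topology)
qed

lemma locally_compact_lv:
  "locally_compact_space TK \<Longrightarrow> locally_compact_space (vtop X) \<Longrightarrow> locally_compact_space (lv X j)"
proof (induction j)
  case 0 then show ?case using homeomorphic_locally_compact_space[OF lv_homeo_0] by blast
next
  case (Suc j)
  then show ?case
    by (simp add: homeomorphic_locally_compact_space[OF lv_homeo_Suc] locally_compact_space_prod_topology)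
qed

lemma Cr_open_cong:
  assumes "tvs Z" "tvs E" "openin (vtop Z) V" "\<And>x. x \<in> V \<Longrightarrow> g x = g' x" "Ck TK Z E r V g"
  shows "Ck TK Z E r V g'"
proof -
  have "Ck_nat TK Z E V g' j" if "Ck_nat TK Z E V g j" for j
    using that unfolding Ck_nat_iff_cdiff[OF assms(1-3)] by (rule cdiff_cong) (use assms(4) in auto)
  then show ?thesis using assms(5) by (simp add: Ck_def)
qed

lemma topspace_Cr_open_top [simp]: "topspace (Cr_open_top TK r Z E V) = Cr_open TK r Z E V"
  by (simp add: Cr_open_top_def)

lemma Ck_iter_dquot:
  assumes "tvs Z" "tvs E" "openin (vtop Z) V" "Ck_nat TK Z E V \<gamma> k" "m \<le> k"
  shows "continuous_map (idom_top TK Z V m) (vtop E) (iter_dquot TK Z E V \<gamma> m)"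
    "iter_dquot TK Z E V \<gamma> m \<in> extensional (idom TK Z V m)"
    "m < k \<Longrightarrow> is_dquot TK Z E V m (iter_dquot TK Z E V \<gamma> m) (iter_dquot TK Z E V \<gamma> (Suc m))"
proof -
  note C = assms(4)[unfolded Ck_nat_iff_cdiff[OF assms(1-3)]]
  note I = cdiff_iter_dquot[OF assms(1-3), of k "discrete_topology {()}" "{()}" "\<lambda>_. \<gamma>", OF C]
  show "continuous_map (idom_top TK Z V m) (vtop E) (iter_dquot TK Z E V \<gamma> m)"
    using cdiff_cont[OF I(1)[OF assms(5)]] by (simp only: cont_on_unit_idom[OF openin_subset[OF assms(3)]])
  show "iter_dquot TK Z E V \<gamma> m \<in> extensional (idom TK Z V m)"
  proof (cases m)
    case (Suc n)
    then have "is_dquot TK Z E V n (iter_dquot TK Z E V \<gamma> n) (iter_dquot TK Z E V \<gamma> (Suc n))"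
      using I(2)[of n "()"] assms(5) by auto
    then show ?thesis unfolding is_dquot_def Suc by blast
  qed simp
  show "is_dquot TK Z E V m (iter_dquot TK Z E V \<gamma> m) (iter_dquot TK Z E V \<gamma> (Suc m))" if "m < k"
    using I(2)[of m "()"] that by auto
qed

text \<open>The exponential law: a map into \<open>C\<^sup>r(V, E)\<close> is continuous as soon as the associated map of two
  variables is \<open>C\<^sup>r\<close> in the second variable, jointly continuously; evaluation has this property
  because \<open>V\<close> is locally compact.\<close>

lemma cdiff_eval_Cr_open:
  assumes Z: "tvs Z" and E: "tvs E" and V: "openin (vtop Z) V"
    and lc: "locally_compact_space TK" "locally_compact_space (vtop Z)" and j: "enat j \<le> r"
  shows "cdiff j (Cr_open_top TK r Z E V) Z E 0 (Cr_open TK r Z E V \<times> idom TK Z V 0) (\<lambda>z. (fst z) (base (snd z)))"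
proof -
  let ?T = "Cr_open_top TK r Z E V" and ?A = "Cr_open TK r Z E V"
  let ?H = "\<lambda>m z. iter_dquot TK Z E V (fst z) m (snd z)"
  have jm: "Ck_nat TK Z E V \<gamma> m" if "m \<le> j" "\<gamma> \<in> ?A" for m \<gamma>
    using that j by (auto simp: Cr_open_def Ck_def) (meson enat_ord_simps(1) order_trans)
  have top: "topspace (idom_top TK Z V m) = idom TK Z V m" for m
    using idom_subset[OF openin_subset[OF V], of m] by (auto simp: idom_top_def)
  have "cdiff j ?T Z E 0 (?A \<times> idom TK Z V 0) (?H 0)"
  proof (rule cdiff_of_seq)
    fix m assume m: "m \<le> j"
    have mr: "enat m \<le> r" using m j by (meson enat_ord_simps(1) order_trans)
    let ?C = "compact_open_topology (idom_top TK Z V m) (vtop E)"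
    have lcV: "locally_compact_space (idom_top TK Z V m)" "Hausdorff_space (idom_top TK Z V m)"
      unfolding idom_top_def
      using locally_compact_space_open_subset locally_compact_lv[OF lc] Hausdorff_lv[OF tvs_Hausdorff[OF Z]]
        open_idom[OF Z V] Hausdorff_space_subtopology by blast+
    have c: "continuous_map ?T ?C (\<lambda>\<gamma>. iter_dquot TK Z E V \<gamma> m)"
      unfolding Cr_open_top_def
      by (rule continuous_map_from_initial_topology[where f = "\<lambda>j \<gamma>. iter_dquot TK Z E V \<gamma> j" and j = m])
        (use mr Ck_iter_dquot[OF Z E V jm[OF m] order_refl] in \<open>auto simp: topspace_compact_open_topology top\<close>)
    show "cont_on ?T Z (vtop E) m (?A \<times> idom TK Z V m) (?H m)"
    proof (rule cont_onI)
      show "?A \<times> idom TK Z V m \<subseteq> topspace ?T \<times> topspace (lv Z m)"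
        using idom_subset[OF openin_subset[OF V], of m] by auto
      fix S
      assume S: "topspace S = ?A \<times> idom TK Z V m" "continuous_map S ?T fst" "continuous_map S (lv Z m) snd"
      have "continuous_map S (prod_topology ?C (idom_top TK Z V m)) (\<lambda>z. (iter_dquot TK Z E V (fst z) m, snd z))"
        unfolding idom_top_def
        by (intro continuous_map_pairedI cont_comp[OF c[unfolded idom_top_def] S(2)] continuous_map_into_subtopology S(3))
          (auto simp: S(1))
      from cont_comp[OF continuous_map_eval_compact_open[OF lcV] this] show "continuous_map S (vtop E) (?H m)" by simp
    qed
  next
    fix m assume m: "m < j"
    show "dq_rel Z E m (?A \<times> idom TK Z V m) (?H m) (?H (Suc m))"
      unfolding dq_rel_def dq_dom_idom
    proof (intro allI impI)
      fix p x y t assume a: "(p, Node x y t) \<in> ?A \<times> idom TK Z V (Suc m)"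
      have "is_dquot TK Z E V m (iter_dquot TK Z E V p m) (iter_dquot TK Z E V p (Suc m))"
        using Ck_iter_dquot(3)[OF Z E V jm[of j p]] m a by auto
      then show "iter_dquot TK Z E V (fst (p, istep Z x y t)) m (snd (p, istep Z x y t)) =
       iter_dquot TK Z E V (fst (p, x)) m (snd (p, x)) +
       scale E t (iter_dquot TK Z E V (fst (p, Node x y t)) (Suc m) (snd (p, Node x y t)))"
        unfolding is_dquot_iff[OF Z E openin_subset[OF V]] dq_rel_def dq_dom_idom using a by auto
    qed
  qed
  then show ?thesis by (rule cdiff_cong) auto
qed

lemma cdiff_Ck_nat:
  assumes "tvs Z" "tvs E" "openin (vtop Z) V" "\<theta> \<in> A"
    and c: "cdiff j \<Theta> Z E 0 (A \<times> idom TK Z V 0) (\<lambda>z. G (fst z) (base (snd z)))"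
  shows "Ck_nat TK Z E V (G \<theta>) j"
\<comment> \<open>For empty \<open>V\<close> the domain of the family is empty, and the hypothesis
  no longer tells that \<open>\<theta>\<close> belongs to the parameter space.\<close>
proof (cases "V = {}")
  case True
  then have "cdiff j (discrete_topology {()}) Z E 0 ({()} \<times> idom TK Z V 0) (\<lambda>z. 0)"
    using cdiff_param[OF assms(2), of "discrete_topology {()}" "\<lambda>_. 0" "{()} \<times> idom TK Z V 0"] tvs_zero[OF assms(2)]
    by auto
  then show ?thesis unfolding Ck_nat_iff_cdiff[OF assms(1-3)] by (rule cdiff_cong) (use True in auto)
next
  case False
  then have "\<theta> \<in> topspace \<Theta>" using cdiff_dom[OF c] assms(4) by fastforce
  moreover have "ilin Z 0 Z 0 (\<lambda>w. w)" by (auto simp: ilin_def intro: cont_ident)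
  ultimately have "cdiff j (discrete_topology {()}) Z E 0 ({()} \<times> idom TK Z V 0) (\<lambda>z. G (fst (\<theta>, snd z)) (base (snd (\<theta>, snd z))))"
    using idom_subset[OF openin_subset[OF assms(3)], of 0] assms(4)
    by (intro cdiff_precomp[OF c, of Z 0 "\<lambda>w. w" _ "\<lambda>_. \<theta>"]) auto
  then show ?thesis unfolding Ck_nat_iff_cdiff[OF assms(1-3)] by simp
qed

lemma continuous_map_into_Cr_open:
  assumes Z: "tvs Z" and E: "tvs E" and V: "openin (vtop Z) V"
    and c: "\<And>j. enat j \<le> r \<Longrightarrow> cdiff j \<Theta> Z E 0 (topspace \<Theta> \<times> idom TK Z V 0) (\<lambda>z. G (fst z) (base (snd z)))"
    and 0: "\<And>\<theta> x. \<theta> \<in> topspace \<Theta> \<Longrightarrow> x \<notin> V \<Longrightarrow> G \<theta> x = 0"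
  shows "continuous_map \<Theta> (Cr_open_top TK r Z E V) G"
  unfolding Cr_open_top_def
proof (rule continuous_map_into_initial_topology)
  have Ck: "Ck_nat TK Z E V (G \<theta>) j" if "enat j \<le> r" "\<theta> \<in> topspace \<Theta>" for j \<theta>
    by (rule cdiff_Ck_nat[OF Z E V that(2) c[OF that(1)]])
  show "G \<theta> \<in> Cr_open TK r Z E V" if "\<theta> \<in> topspace \<Theta>" for \<theta>
    using 0 that Ck by (auto simp: Cr_open_def Ck_def)
  have top: "topspace (idom_top TK Z V m) = idom TK Z V m" for m
    using idom_subset[OF openin_subset[OF V], of m] by (auto simp: idom_top_def)
  fix j assume "j \<in> {j. enat j \<le> r}"
  then have j: "enat j \<le> r" by simp
  show "continuous_map \<Theta> (compact_open_topology (idom_top TK Z V j) (vtop E)) (\<lambda>x. iter_dquot TK Z E V (G x) j)"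
  proof (rule continuous_map_into_compact_open)
    have "cont_on \<Theta> Z (vtop E) j (topspace \<Theta> \<times> idom TK Z V j) (\<lambda>z. iter_dquot TK Z E V (G (fst z)) j (snd z))"
      by (rule cdiff_cont[OF cdiff_iter_dquot(1)[OF Z E V c[OF j] order_refl]])
    then show "continuous_map (prod_topology \<Theta> (idom_top TK Z V j)) (vtop E) (\<lambda>z. iter_dquot TK Z E V (G (fst z)) j (snd z))"
      unfolding cont_on_def idom_top_def
      by (metis prod_topology_subtopology(2))
    show "iter_dquot TK Z E V (G \<theta>) j \<in> extensional (topspace (idom_top TK Z V j))" if "\<theta> \<in> topspace \<Theta>" for \<theta>
      unfolding top by (rule Ck_iter_dquot(2)[OF Z E V Ck[OF j that] order_refl])
  qed
qed

text \<open>The properties of charts on which the topology of \<open>Cr_top\<close> rests. They pass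
  directly to \<open>open_submanifold\<close>, so \<open>M\<close> and the members of a cover are
  handled by the same lemmas.\<close>

definition charts_ok :: "('k, 'z::ab_group_add, 'm) manifold \<Rightarrow> bool" where
  "charts_ok M \<longleftrightarrow> tvs (model M) \<and> locally_compact_space TK \<and> locally_compact_space (vtop (model M)) \<and>
    (\<forall>(U, \<kappa>)\<in>atlas M. openin (vtop (model M)) (\<kappa> ` U) \<and> inj_on \<kappa> U \<and> U \<subseteq> topspace (mtop M)) \<and>
    topspace (mtop M) \<subseteq> (\<Union>c\<in>atlas M. fst c)"

lemma topspace_Cr_top [simp]: "topspace (Cr_top TK r M E) = Cr_fun TK r M E"
  by (simp add: Cr_top_def)

lemma charts_okD:
  assumes "charts_ok M" "(U, \<kappa>) \<in> atlas M"
  shows "openin (vtop (model M)) (\<kappa> ` U)" "inj_on \<kappa> U" "U \<subseteq> topspace (mtop M)"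
  using assms by (auto simp: charts_ok_def)

lemma ext0_in_Cr_open:
  assumes M: "charts_ok M" and E: "tvs E" and "(U, \<kappa>) \<in> atlas M" "\<gamma> \<in> Cr_fun TK r M E"
  shows "ext0 (\<kappa> ` U) (\<gamma> \<circ> inv_into U \<kappa>) \<in> Cr_open TK r (model M) E (\<kappa> ` U)"
proof -
  have "Ck TK (model M) E r (\<kappa> ` U) (\<gamma> \<circ> inv_into U \<kappa>)"
    using assms(3,4) by (auto simp: Cr_fun_def)
  then have "Ck TK (model M) E r (\<kappa> ` U) (ext0 (\<kappa> ` U) (\<gamma> \<circ> inv_into U \<kappa>))"
    by (rule Cr_open_cong[rotated 4]) (use M E charts_okD[OF M assms(3)] in \<open>auto simp: charts_ok_def ext0_def\<close>)
  then show ?thesis by (auto simp: Cr_open_def ext0_def)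
qed

lemma continuous_map_Cr_top_chart:
  assumes M: "charts_ok M" and E: "tvs E" and U: "(U, \<kappa>) \<in> atlas M"
  shows "continuous_map (Cr_top TK r M E) (Cr_open_top TK r (model M) E (\<kappa> ` U))
     (\<lambda>\<gamma>. ext0 (\<kappa> ` U) (\<gamma> \<circ> inv_into U \<kappa>))"
  unfolding Cr_top_def
  using continuous_map_from_initial_topology[OF U, of "Cr_fun TK r M E"
      "\<lambda>(U, \<kappa>) \<gamma>. ext0 (\<kappa> ` U) (\<gamma> \<circ> inv_into U \<kappa>)" "\<lambda>(U, \<kappa>). Cr_open_top TK r (model M) E (\<kappa> ` U)"]
    ext0_in_Cr_open[OF M E U] by simp

lemma cdiff_eval_Cr:
  assumes M: "charts_ok M" and E: "tvs E" and U: "(U, \<kappa>) \<in> atlas M" and j: "enat j \<le> r"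
  shows "cdiff j (Cr_top TK r M E) (model M) E 0 (Cr_fun TK r M E \<times> idom TK (model M) (\<kappa> ` U) 0)
    (\<lambda>z. (fst z) (inv_into U \<kappa> (base (snd z))))"
proof -
  have Z: "tvs (model M)" and lc: "locally_compact_space TK" "locally_compact_space (vtop (model M))"
    using M by (auto simp: charts_ok_def)
  have il: "ilin (model M) 0 (model M) 0 (\<lambda>w. w)" by (auto simp: ilin_def intro: cont_ident)
  let ?\<alpha> = "\<lambda>\<gamma>. ext0 (\<kappa> ` U) (\<gamma> \<circ> inv_into U \<kappa>)"
  have "cdiff j (Cr_top TK r M E) (model M) E 0 (Cr_fun TK r M E \<times> idom TK (model M) (\<kappa> ` U) 0)
    (\<lambda>z. (fst (?\<alpha> (fst z), snd z)) (base (snd (?\<alpha> (fst z), snd z))))"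
    by (rule cdiff_precomp[OF cdiff_eval_Cr_open[OF Z E charts_okD(1)[OF M U] lc j] il continuous_map_Cr_top_chart[OF M E U]])
      (use idom_subset[OF openin_subset[OF charts_okD(1)[OF M U]], of 0] ext0_in_Cr_open[OF M E U] in auto)
  then show ?thesis by (rule cdiff_cong) (auto simp: ext0_def)
qed

text \<open>The exponential law in charts. Continuity of restriction, of the vector space operations
  and of multiplication by a cutoff is reduced to differentiability in the chart variable.\<close>

lemma continuous_map_into_Cr:
  assumes M: "charts_ok M" and E: "tvs E"
    and c: "\<And>U \<kappa> j. (U, \<kappa>) \<in> atlas M \<Longrightarrow> enat j \<le> r \<Longrightarrow> cdiff j \<Theta> (model M) E 0
      (topspace \<Theta> \<times> idom TK (model M) (\<kappa> ` U) 0) (\<lambda>z. G (fst z) (inv_into U \<kappa> (base (snd z))))"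
    and 0: "\<And>\<theta> x. \<theta> \<in> topspace \<Theta> \<Longrightarrow> x \<notin> topspace (mtop M) \<Longrightarrow> G \<theta> x = 0"
  shows "continuous_map \<Theta> (Cr_top TK r M E) G"
  unfolding Cr_top_def
proof (rule continuous_map_into_initial_topology)
  have Z: "tvs (model M)" using M by (auto simp: charts_ok_def)
  show "G \<theta> \<in> Cr_fun TK r M E" if \<theta>: "\<theta> \<in> topspace \<Theta>" for \<theta>
  proof -
    have "Ck_nat TK (model M) E (\<kappa> ` U) (G \<theta> \<circ> inv_into U \<kappa>) j" if "(U, \<kappa>) \<in> atlas M" "enat j \<le> r" for U \<kappa> j
      using cdiff_Ck_nat[OF Z E charts_okD(1)[OF M that(1)] \<theta>, of j \<Theta> "\<lambda>\<theta>. G \<theta> \<circ> inv_into U \<kappa>"] c[OF that]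
      by (simp add: o_def)
    then show ?thesis using 0 \<theta> by (auto simp: Cr_fun_def Ck_def)
  qed
  fix c' assume c': "c' \<in> atlas M"
  obtain U \<kappa> where [simp]: "c' = (U, \<kappa>)" by force
  have U: "(U, \<kappa>) \<in> atlas M" using c' by simp
  have "continuous_map \<Theta> (Cr_open_top TK r (model M) E (\<kappa> ` U)) (\<lambda>x. ext0 (\<kappa> ` U) (G x \<circ> inv_into U \<kappa>))"
  proof (rule continuous_map_into_Cr_open[OF Z E charts_okD(1)[OF M U]])
    show "cdiff j \<Theta> (model M) E 0 (topspace \<Theta> \<times> idom TK (model M) (\<kappa> ` U) 0)
          (\<lambda>z. ext0 (\<kappa> ` U) (G (fst z) \<circ> inv_into U \<kappa>) (base (snd z)))" if "enat j \<le> r" for j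
      by (rule cdiff_cong[OF c[OF U that]]) (auto simp: ext0_def)
  qed (auto simp: ext0_def)
  then show "continuous_map \<Theta> (case c' of (U, \<kappa>) \<Rightarrow> Cr_open_top TK r (model M) E (\<kappa> ` U))
     (\<lambda>x. (case c' of (U, \<kappa>) \<Rightarrow> \<lambda>\<gamma>. ext0 (\<kappa> ` U) (\<gamma> \<circ> inv_into U \<kappa>)) (G x))" by simp
qed

lemma continuous_map_Cr_eval:
  assumes M: "charts_ok M" and E: "tvs E" and x: "x \<in> topspace (mtop M)"
  shows "continuous_map (Cr_top TK r M E) (vtop E) (\<lambda>\<gamma>. \<gamma> x)"
proof -
  obtain c where "c \<in> atlas M" "x \<in> fst c" using x M by (auto simp: charts_ok_def)
  then obtain U \<kappa> where U: "(U, \<kappa>) \<in> atlas M" "x \<in> U" by (metis prod.collapse)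
  have in': "\<kappa> x \<in> topspace (vtop (model M))" using openin_subset[OF charts_okD(1)[OF M U(1)]] U(2) by auto
  have 0: "enat 0 \<le> r" by (simp flip: zero_enat_def)
  have "continuous_map (Cr_top TK r M E) (Cr_top TK r M E) (\<lambda>\<gamma>. \<gamma>)" by (rule cont_ident)
  from cont_onD[OF cdiff_cont[OF cdiff_eval_Cr[OF M E U(1) 0]] this, of "\<lambda>_. Base (\<kappa> x)"]
  show ?thesis using in' U charts_okD(2)[OF M U(1)] by simp
qed

lemma cdiff_eval_comp:
  assumes M: "charts_ok M" and E: "tvs E" and U: "(U, \<kappa>) \<in> atlas M" and j: "enat j \<le> r"
    and \<alpha>: "continuous_map \<Theta> (Cr_top TK r M E) \<alpha>"
  shows "cdiff j \<Theta> (model M) E 0 (topspace \<Theta> \<times> idom TK (model M) (\<kappa> ` U) 0)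
    (\<lambda>z. \<alpha> (fst z) (inv_into U \<kappa> (base (snd z))))"
proof -
  have il: "ilin (model M) 0 (model M) 0 (\<lambda>w. w)" by (auto simp: ilin_def intro: cont_ident)
  have "\<alpha> p \<in> Cr_fun TK r M E" if "p \<in> topspace \<Theta>" for p
    using \<alpha> that continuous_map_image_subset_topspace by fastforce
  then have "cdiff j \<Theta> (model M) E 0 (topspace \<Theta> \<times> idom TK (model M) (\<kappa> ` U) 0)
    (\<lambda>z. fst (\<alpha> (fst z), snd z) (inv_into U \<kappa> (base (snd (\<alpha> (fst z), snd z)))))"
    by (intro cdiff_precomp[OF cdiff_eval_Cr[OF M E U j] il \<alpha>])
      (use idom_subset[OF openin_subset[OF charts_okD(1)[OF M U]], of 0] in auto)
  then show ?thesis by simp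
qed

end

section \<open>Valued fields\<close>

locale valued =
  fixes av :: "'k::field \<Rightarrow> real"
  assumes valued_field: "valued_field av"
begin

abbreviation "VT \<equiv> valued_topology av"

lemma av_props:
  "0 \<le> av x" "av x = 0 \<longleftrightarrow> x = 0" "av (x * y) = av x * av y" "av (x + y) \<le> av x + av y"
  using valued_field by (auto simp: valued_field_def absolute_value_def)

lemma av_zero [simp]: "av 0 = 0"
  by (simp add: av_props)

lemma av_pos: "x \<noteq> 0 \<Longrightarrow> 0 < av x"
  using av_props(1,2)[of x] by linarith

lemma av_1 [simp]: "av 1 = 1"
  using av_props(3)[of 1 1] av_pos[of 1] by simp

lemma av_minus [simp]: "av (- x) = av x"
proof -
  have "av (-1) * av (-1) = 1" using av_props(3)[of "-1" "-1"] by simp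
  then have "av (-1) = 1" using av_props(1)[of "-1"] by (metis abs_of_nonneg abs_mult_self_eq mult_1 power2_eq_1_iff power2_eq_square abs_minus_cancel abs_one)
  then show ?thesis using av_props(3)[of "-1" x] by simp
qed

lemma av_minus_commute: "av (x - y) = av (y - x)"
  using av_minus[of "x - y"] by simp

lemma av_inverse: "av (inverse x) = inverse (av x)"
proof (cases "x = 0")
  case False
  then have "av (inverse x) * av x = 1" using av_props(3)[of "inverse x" x] by simp
  then show ?thesis by (metis inverse_unique mult.commute)
qed simp

lemma av_divide: "av (x / y) = av x / av y"
  by (simp add: divide_inverse av_props(3) av_inverse)

lemma av_triangle: "av (x - z) \<le> av (x - y) + av (y - z)"
  using av_props(4)[of "x - y" "y - z"] by simp

lemma metric: "Metric_space UNIV (\<lambda>x y. av (x - y))"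
  by (unfold_locales) (auto simp: av_props av_minus_commute av_triangle)

sublocale M: Metric_space UNIV "\<lambda>x y. av (x - y)"
  by (rule metric)

lemma openin_VT: "openin VT U \<longleftrightarrow> (\<forall>x\<in>U. \<exists>e>0. \<forall>y. av (y - x) < e \<longrightarrow> y \<in> U)"
  unfolding valued_topology_def M.openin_mtopology M.mball_def
  by (auto simp: subset_iff av_minus_commute)

lemma openin_ball: "openin VT {y. av (y - x) < e}"
  using M.openin_mball[of x e] by (simp add: M.mball_def valued_topology_def av_minus_commute)

lemma topspace_VT [simp]: "topspace VT = UNIV"
  by (simp add: valued_topology_def)

lemma continuous_map_VT2:
  assumes "\<And>x y e. e > 0 \<Longrightarrow> \<exists>d>0. \<forall>x' y'. av (x' - x) < d \<longrightarrow> av (y' - y) < d \<longrightarrow> av (f x' y' - f x y) < e"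
  shows "continuous_map (prod_topology VT VT) VT (\<lambda>(x, y). f x y)"
  unfolding continuous_map
proof (intro conjI allI impI)
  fix U assume U: "openin VT U"
  show "openin (prod_topology VT VT) {x \<in> topspace (prod_topology VT VT). (case x of (x, y) \<Rightarrow> f x y) \<in> U}"
    unfolding openin_prod_topology_alt
  proof (intro allI impI)
    fix x y assume "(x, y) \<in> {x \<in> topspace (prod_topology VT VT). (case x of (x, y) \<Rightarrow> f x y) \<in> U}"
    then obtain e where e: "e > 0" "\<And>z. av (z - f x y) < e \<Longrightarrow> z \<in> U"
      using U unfolding openin_VT by auto
    obtain d where d: "d > 0" "\<And>x' y'. av (x' - x) < d \<Longrightarrow> av (y' - y) < d \<Longrightarrow> av (f x' y' - f x y) < e"
      using assms[OF e(1), of x y] by blast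
    show "\<exists>A B. openin VT A \<and> openin VT B \<and> x \<in> A \<and> y \<in> B \<and>
       A \<times> B \<subseteq> {x \<in> topspace (prod_topology VT VT). (case x of (x, y) \<Rightarrow> f x y) \<in> U}"
      by (rule exI[of _ "{x'. av (x' - x) < d}"], rule exI[of _ "{y'. av (y' - y) < d}"])
        (use d e in \<open>auto simp: openin_ball\<close>)
  qed
qed auto

lemma topological_field_VT: "topological_field VT"
  unfolding topological_field_def
proof (intro conjI)
  show "topspace VT = UNIV" by simp
  show "Hausdorff_space VT" unfolding valued_topology_def by (rule M.Hausdorff_space_mtopology)
  show "VT \<noteq> discrete_topology UNIV" using valued_field by (simp add: valued_field_def)
  show "continuous_map (prod_topology VT VT) VT (\<lambda>(x, y). x + y)"
  proof (rule continuous_map_VT2)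
    fix x y :: 'k and e :: real assume e: "e > 0"
    have "av (x' + y' - (x + y)) < e" if "av (x' - x) < e / 2" "av (y' - y) < e / 2" for x' y'
      using that av_props(4)[of "x' - x" "y' - y"] by (simp add: algebra_simps)
    then show "\<exists>d>0. \<forall>x' y'. av (x' - x) < d \<longrightarrow> av (y' - y) < d \<longrightarrow> av (x' + y' - (x + y)) < e"
      using e by (intro exI[of _ "e / 2"]) auto
  qed
  show "continuous_map VT VT uminus"
    unfolding continuous_map
  proof (intro conjI allI impI)
    fix U assume U: "openin VT U"
    show "openin VT {x \<in> topspace VT. - x \<in> U}"
      unfolding openin_VT
    proof
      fix x assume "x \<in> {x \<in> topspace VT. - x \<in> U}"
      then obtain e where "e > 0" "\<And>y. av (y - (- x)) < e \<Longrightarrow> y \<in> U" using U openin_VT by auto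
      moreover have "av (- y - (- x)) = av (y - x)" for y using av_minus[of "y - x"] by (simp add: algebra_simps)
      ultimately show "\<exists>e>0. \<forall>y. av (y - x) < e \<longrightarrow> y \<in> {x \<in> topspace VT. - x \<in> U}" by auto
    qed
  qed simp
  show "continuous_map (prod_topology VT VT) VT (\<lambda>(x, y). x * y)"
  proof (rule continuous_map_VT2)
    fix x y :: 'k and e :: real assume e: "e > 0"
    \<comment> \<open>The error is at most \<open>d^2 + d (av x + av y)\<close>, and
      \<open>d \<le> 1\<close> bounds \<open>d^2\<close> by \<open>d\<close>.\<close>
    define d where "d = min 1 (e / (av x + av y + 1))"
    have p: "av x + av y + 1 > 0" using av_props(1)[of x] av_props(1)[of y] by linarith
    have "d \<le> e / (av x + av y + 1)" by (simp add: d_def)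
    then have "d * (av x + av y + 1) \<le> e" using p by (simp only: pos_le_divide_eq)
    moreover have "d > 0" "d \<le> 1" using p e by (auto simp: d_def)
    ultimately have d: "d > 0" "d \<le> 1" "d * (av x + av y + 1) \<le> e" by auto
    have "av (x' * y' - x * y) < e" if h: "av (x' - x) < d" "av (y' - y) < d" for x' y'
    proof -
      have "x' * y' - x * y = (x' - x) * (y' - y) + ((x' - x) * y + x * (y' - y))" by (simp add: algebra_simps)
      then have "av (x' * y' - x * y) \<le> av (x' - x) * av (y' - y) + (av (x' - x) * av y + av x * av (y' - y))"
        using av_props(4)[of "(x' - x) * (y' - y)" "(x' - x) * y + x * (y' - y)"]
          av_props(4)[of "(x' - x) * y" "x * (y' - y)"] by (simp add: av_props(3))
      moreover have "av (x' - x) * av (y' - y) < d * 1"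
        by (rule mult_strict_mono) (use h d av_props(1) in \<open>auto intro: less_le_trans\<close>)
      moreover have "av (x' - x) * av y \<le> d * av y" "av x * av (y' - y) \<le> av x * d"
        using h av_props(1) by (auto intro: mult_left_mono mult_right_mono)
      ultimately show ?thesis using d(3) by (simp add: algebra_simps)
    qed
    then show "\<exists>d>0. \<forall>x' y'. av (x' - x) < d \<longrightarrow> av (y' - y) < d \<longrightarrow> av (x' * y' - x * y) < e"
      using d by blast
  qed
  show "continuous_map (subtopology VT (- {0})) VT inverse"
    unfolding continuous_map
  proof (intro conjI allI impI)
    fix U assume U: "openin VT U"
    let ?A = "{x \<in> topspace (subtopology VT (- {0})). inverse x \<in> U}"
    have "openin VT ?A"
      unfolding openin_VT
    proof
      fix x assume x: "x \<in> ?A"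
      then obtain e where e: "e > 0" "\<And>y. av (y - inverse x) < e \<Longrightarrow> y \<in> U" using U openin_VT by auto
      have ax: "av x > 0" using x av_pos by auto
      \<comment> \<open>The first bound keeps \<open>av y\<close> above \<open>av x / 2\<close>, so
        that the reciprocal of \<open>av x\<close> times \<open>av y\<close> is at most 2 over the
        square of \<open>av x\<close>; the second bound compensates this factor.\<close>
      define d where "d = min (av x / 2) (e * (av x * av x) / 2)"
      have d: "d > 0" using ax e by (auto simp: d_def)
      have "y \<in> ?A" if y: "av (y - x) < d" for y
      proof -
        have "av x \<le> av (x - y) + av y" using av_props(4)[of "x - y" y] by simp
        then have ay: "av y > av x / 2" using y by (auto simp: d_def av_minus_commute)
        then have y0: "y \<noteq> 0" using ax by auto
        have "inverse y - inverse x = inverse y * ((x - y) * inverse x)"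
          using y0 x by (simp add: field_simps)
        then have "av (inverse y - inverse x) = av (y - x) * (inverse (av y) * inverse (av x))"
          by (simp add: av_props(3) av_inverse av_minus_commute)
        also have "\<dots> < (e * (av x * av x) / 2) * (2 / (av x * av x))"
        proof (rule mult_less_le_imp_less)
          show "av (y - x) < e * (av x * av x) / 2" using y by (simp add: d_def)
          have "inverse (av y) \<le> inverse (av x / 2)" using ay ax by (intro le_imp_inverse_le) auto
          then show "inverse (av y) * inverse (av x) \<le> 2 / (av x * av x)"
            using ax by (simp add: field_simps)
          show "0 \<le> av (y - x)" "0 < inverse (av y) * inverse (av x)" using av_props(1) ax av_pos[OF y0] by auto
        qed
        also have "\<dots> = e" using ax by simp
        finally show ?thesis using e y0 by simp
      qed
      then show "\<exists>e>0. \<forall>y. av (y - x) < e \<longrightarrow> y \<in> ?A" using d by blast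
    qed
    then show "openin (subtopology VT (- {0})) ?A"
      by (auto simp: openin_subtopology)
  qed simp
qed

sublocale top_field VT
  by unfold_locales (rule topological_field_VT)

text \<open>If all nonzero elements had absolute value at least 1, the unit ball around 0 would be
  an open singleton. The powers of an element of absolute value below 1 then become arbitrarily
  small.\<close>

lemma small_elt:
  assumes "e > 0"
  obtains c where "c \<noteq> 0" "av c < e"
proof -
  have "\<exists>c. c \<noteq> 0 \<and> av c < 1"
  proof (rule ccontr)
    assume n: "\<nexists>c. c \<noteq> 0 \<and> av c < 1"
    have "openin VT {0}" unfolding openin_VT using n by (auto intro!: exI[of _ 1])
    then show False using not_open_singleton by blast
  qed
  then obtain c where c: "c \<noteq> 0" "av c < 1" by blast
  have p: "av (c ^ n) = av c ^ n" for n by (induction n) (auto simp: av_props)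
  obtain n where "av c ^ n < e" using real_arch_pow_inv[OF assms c(2)] by blast
  then show ?thesis using that[of "c ^ n"] c p by simp
qed

lemma large_elt: obtains c where "c \<noteq> 0" "R < av c"
proof -
  have "0 < inverse (max R 1)" by simp
  then obtain c where c: "c \<noteq> 0" "av c < inverse (max R 1)" by (rule small_elt)
  then have "max R 1 < inverse (av c)" using av_pos[of c] by (metis inverse_inverse_eq less_imp_inverse_less)
  then show ?thesis using that[of "inverse c"] c by (simp add: av_inverse)
qed

lemma openin_prodE:
  assumes "openin (prod_topology A B) W" "(a, b) \<in> W"
  obtains U V where "openin A U" "openin B V" "a \<in> U" "b \<in> V" "U \<times> V \<subseteq> W"
  using assms(1)[unfolded openin_prod_topology_alt, rule_format, OF assms(2)] that by blast

lemma tvs_scale_nbhd: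
  assumes X: "tvs X" and W: "openin (vtop X) W" "scale X t0 v0 \<in> W" "v0 \<in> topspace (vtop X)"
  obtains e B where "e > 0" "openin (vtop X) B" "v0 \<in> B" "\<And>t v. av (t - t0) < e \<Longrightarrow> v \<in> B \<Longrightarrow> scale X t v \<in> W"
proof -
  have c: "continuous_map (prod_topology VT (vtop X)) (vtop X) (\<lambda>z. scale X (fst z) (snd z))"
    by (intro tvs_cont_scale X continuous_map_fst continuous_map_snd)
  have o: "openin (prod_topology VT (vtop X)) {z \<in> topspace (prod_topology VT (vtop X)). scale X (fst z) (snd z) \<in> W}"
    by (rule openin_continuous_map_preimage[OF c W(1)])
  have "(t0, v0) \<in> {z \<in> topspace (prod_topology VT (vtop X)). scale X (fst z) (snd z) \<in> W}" using W by auto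
  from openin_prodE[OF o this] obtain A B where AB: "openin VT A" "openin (vtop X) B" "t0 \<in> A" "v0 \<in> B"
    "A \<times> B \<subseteq> {z \<in> topspace (prod_topology VT (vtop X)). scale X (fst z) (snd z) \<in> W}" by blast
  from AB(1,3) obtain e where e: "e > 0" "\<And>t. av (t - t0) < e \<Longrightarrow> t \<in> A" unfolding openin_VT by blast
  have "scale X t v \<in> W" if "av (t - t0) < e" "v \<in> B" for t v using AB(5) e(2)[OF that(1)] that(2) by auto
  then show ?thesis using that[OF e(1) AB(2,4)] by blast
qed

text \<open>Continuity at the origin handles small scalars only. Writing \<open>t v\<close> as
  \<open>(t / c)(c v)\<close> with a large \<open>c\<close> reduces bounded scalars to small ones.
  This substitutes for compactness of balls, which the larger field need not have.\<close>

lemma tvs_bounded: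
  assumes X: "tvs X" and W: "openin (vtop X) W" "0 \<in> W"
  obtains B where "openin (vtop X) B" "0 \<in> B" "\<And>t v. av t \<le> R \<Longrightarrow> v \<in> B \<Longrightarrow> scale X t v \<in> W"
proof -
  have "scale X 0 0 \<in> W" using W by (simp add: scale_simps[OF X])
  from tvs_scale_nbhd[OF X W(1) this tvs_zero[OF X]] obtain e B where eB: "e > 0" "openin (vtop X) B" "0 \<in> B"
    "\<And>t v. av (t - 0) < e \<Longrightarrow> v \<in> B \<Longrightarrow> scale X t v \<in> W" by blast
  obtain c where c: "c \<noteq> 0" "R / e < av c" using large_elt by blast
  have cc: "continuous_map (vtop X) (vtop X) (\<lambda>v. scale X c v)"
    by (intro tvs_cont_scale X) (auto intro: cont_ident)
  show ?thesis
  proof (rule that)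
    show "openin (vtop X) {v \<in> topspace (vtop X). scale X c v \<in> B}"
      by (rule openin_continuous_map_preimage[OF cc eB(2)])
    show "0 \<in> {v \<in> topspace (vtop X). scale X c v \<in> B}" using eB(3) tvs_zero[OF X] by (simp add: scale_simps[OF X])
    fix t v assume t: "av t \<le> R" and v: "v \<in> {v \<in> topspace (vtop X). scale X c v \<in> B}"
    have "av (t / c) < e" using t c eB(1) av_pos[OF c(1)] by (simp add: av_divide field_simps)
    then have "scale X (t / c) (scale X c v) \<in> W" using eB(4) v by auto
    then show "scale X t v \<in> W" using c by (simp add: scale_simps[OF X])
  qed
qed

lemma tvs_add_nbhd:
  assumes X: "tvs X" and W: "openin (vtop X) W" "v0 + w0 \<in> W" "v0 \<in> topspace (vtop X)" "w0 \<in> topspace (vtop X)"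
  obtains A B where "openin (vtop X) A" "openin (vtop X) B" "v0 \<in> A" "w0 \<in> B"
    "\<And>v w. v \<in> A \<Longrightarrow> w \<in> B \<Longrightarrow> v + w \<in> W"
proof -
  have c: "continuous_map (prod_topology (vtop X) (vtop X)) (vtop X) (\<lambda>z. fst z + snd z)"
    by (intro tvs_cont_add X continuous_map_fst continuous_map_snd)
  have o: "openin (prod_topology (vtop X) (vtop X)) {z \<in> topspace (prod_topology (vtop X) (vtop X)). fst z + snd z \<in> W}"
    by (rule openin_continuous_map_preimage[OF c W(1)])
  have "(v0, w0) \<in> {z \<in> topspace (prod_topology (vtop X) (vtop X)). fst z + snd z \<in> W}" using W by auto
  from openin_prodE[OF o this] obtain A B where AB: "openin (vtop X) A" "openin (vtop X) B" "v0 \<in> A" "w0 \<in> B"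
    "A \<times> B \<subseteq> {z \<in> topspace (prod_topology (vtop X) (vtop X)). fst z + snd z \<in> W}" .
  moreover have "v + w \<in> W" if "v \<in> A" "w \<in> B" for v w using AB(5) that by auto
  ultimately show ?thesis using that by blast
qed

lemma tvs_translate:
  assumes X: "tvs X" and W: "openin (vtop X) W" and a: "a \<in> topspace (vtop X)"
  shows "openin (vtop X) {v \<in> topspace (vtop X). a + v \<in> W}"
  by (rule openin_continuous_map_preimage[OF tvs_cont_add[OF X cont_const[OF a] cont_ident] W])

end

lemma (in top_field) tvs_subspace:
  assumes X: "tvs X" and S: "0 \<in> S" "S \<subseteq> topspace (vtop X)" "\<And>x y. x \<in> S \<Longrightarrow> y \<in> S \<Longrightarrow> x + y \<in> S"
    "\<And>c x. x \<in> S \<Longrightarrow> scale X c x \<in> S"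
  shows "tvs \<lparr>scale = scale X, vtop = subtopology (vtop X) S\<rparr>"
proof -
  interpret vector_space "scale X" by (rule tvs_vs[OF X])
  have ts: "topspace (subtopology (vtop X) S) = S" using S by auto
  have "subspace S" using S by (auto simp: subspace_def)
  moreover have "continuous_map (prod_topology (subtopology (vtop X) S) (subtopology (vtop X) S)) (subtopology (vtop X) S) (\<lambda>(x, y). x + y)"
    using S continuous_map_from_subtopology[of _ _ "\<lambda>(x, y). x + y"] X
    by (auto simp: topological_vector_space_def continuous_map_in_subtopology simp flip: subtopology_Times)
  moreover have "continuous_map (prod_topology TK (subtopology (vtop X) S)) (subtopology (vtop X) S) (\<lambda>(t, x). scale X t x)"
    using S continuous_map_from_subtopology[of _ _ "\<lambda>(t, x). scale X t x"] X
    by (auto simp: topological_vector_space_def continuous_map_in_subtopology prod_topology_subtopology)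
  ultimately show ?thesis
    using X by (simp add: topological_vector_space_def Int_absorb1[OF S(2)] Hausdorff_space_subtopology vector_space_axioms)
qed

text \<open>A continuous operation maps into the topspace, so continuity already makes the topspace
  a linear subspace.\<close>

lemma (in top_field) tvsI_cont:
  assumes "vector_space (scale X)" "0 \<in> topspace (vtop X)" "Hausdorff_space (vtop X)"
    "continuous_map (prod_topology (vtop X) (vtop X)) (vtop X) (\<lambda>z. fst z + snd z)"
    "continuous_map (prod_topology TK (vtop X)) (vtop X) (\<lambda>z. scale X (fst z) (snd z))"
  shows "tvs X"
proof -
  interpret vector_space "scale X" by (rule assms(1))
  have "subspace (topspace (vtop X))"
    unfolding subspace_def
    using assms(2) continuous_map_image_subset_topspace[OF assms(4)] continuous_map_image_subset_topspace[OF assms(5)]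
    by (fastforce simp: image_subset_iff)
  then show ?thesis using assms by (simp add: topological_vector_space_def case_prod_unfold)
qed

lemma vector_space_fun_scale: "vector_space s \<Longrightarrow> vector_space (fun_scale s)"
  by (simp add: vector_space_def fun_scale_def fun_eq_iff)

section \<open>Function spaces over the larger of two valued fields\<close>

locale two_valued = K: valued av + F: valued av'
  for av :: "'k::field \<Rightarrow> real" and av' :: "'a::field \<Rightarrow> real" +
  fixes emb :: "'a \<Rightarrow> 'k"
  assumes emb: "field_hom emb" and av_emb: "\<And>x. av' x = av (emb x)"
    and lcF: "locally_compact_space (valued_topology av')"
begin

abbreviation "res \<equiv> restrict_scalars emb"

lemma emb_simps: "emb 1 = 1" "emb (x + y) = emb x + emb y" "emb (x * y) = emb x * emb y"
  using emb by (auto simp: field_hom_def)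

lemma emb_diff: "emb (x - y) = emb x - emb y"
  using emb_simps(2)[of "x - y" y] by simp

lemma cont_emb: "continuous_map F.VT K.VT emb"
  unfolding continuous_map
proof (intro conjI allI impI)
  fix U assume U: "openin K.VT U"
  show "openin F.VT {x \<in> topspace F.VT. emb x \<in> U}"
    unfolding F.openin_VT
  proof
    fix x assume "x \<in> {x \<in> topspace F.VT. emb x \<in> U}"
    then obtain e where "e > 0" "\<And>y. av (y - emb x) < e \<Longrightarrow> y \<in> U" using U K.openin_VT by auto
    then show "\<exists>e>0. \<forall>y. av' (y - x) < e \<longrightarrow> y \<in> {x \<in> topspace F.VT. emb x \<in> U}"
      by (auto simp: av_emb emb_diff)
  qed
qed simp

lemma tvs_res:
  assumes "K.tvs E"
  shows "F.tvs (res E)"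
proof (rule F.tvsI_cont)
  interpret vector_space "scale E" by (rule K.tvs_vs[OF assms])
  show "vector_space (scale (res E))"
    by unfold_locales (simp_all add: restrict_scalars_def emb_simps scale_left_distrib scale_right_distrib)
  show "0 \<in> topspace (vtop (res E))" using K.tvs_zero[OF assms] by (simp add: restrict_scalars_def)
  show "Hausdorff_space (vtop (res E))" using K.tvs_Hausdorff[OF assms] by (simp add: restrict_scalars_def)
  show "continuous_map (prod_topology (vtop (res E)) (vtop (res E))) (vtop (res E)) (\<lambda>z. fst z + snd z)"
    unfolding restrict_scalars_def by (simp, intro K.tvs_cont_add assms continuous_map_fst continuous_map_snd)
  show "continuous_map (prod_topology F.VT (vtop (res E))) (vtop (res E)) (\<lambda>z. scale (res E) (fst z) (snd z))"
    unfolding restrict_scalars_def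
    by (simp, intro K.tvs_cont_scale assms K.cont_comp[OF cont_emb] continuous_map_fst continuous_map_snd)
qed

lemma vtop_res [simp]: "vtop (res E) = vtop E"
  and scale_res: "scale (res E) a v = scale E (emb a) v"
  by (auto simp: restrict_scalars_def)

abbreviation "CrM r M E \<equiv> \<lparr>scale = fun_scale (scale E), vtop = Cr_top F.VT r M (res E)\<rparr>"

text \<open>Every continuity statement goes through \<open>continuous_map_into_Cr\<close>: sums and
  multiples of evaluations are differentiable in the chart variable, continuously in the functions
  and scalars. Point evaluations separate functions.\<close>

lemma tvs_CrM:
  assumes M: "F.charts_ok M" and E: "K.tvs E"
  shows "K.tvs (CrM r M E)"
proof (rule K.tvsI_cont)
  let ?T = "Cr_top F.VT r M (res E)"
  note rE = tvs_res[OF E]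
  have Z: "F.tvs (model M)" using M by (simp add: F.charts_ok_def)
  note off = Cr_fun_def
  show "vector_space (scale (CrM r M E))"
    using vector_space_fun_scale[OF K.tvs_vs[OF E]] by simp
  have "continuous_map (discrete_topology {()}) ?T (\<lambda>_. 0)"
  proof (rule F.continuous_map_into_Cr[OF M rE])
    fix U \<kappa> j assume U: "(U, \<kappa>) \<in> atlas M"
    have D: "topspace (discrete_topology {()}) \<times> idom F.VT (model M) (\<kappa> ` U) 0
      \<subseteq> topspace (discrete_topology {()}) \<times> topspace (F.lv (model M) 0)"
      using F.idom_subset[OF openin_subset[OF F.charts_okD(1)[OF M U]], of 0] by blast
    show "F.cdiff j (discrete_topology {()}) (model M) (res E) 0
          (topspace (discrete_topology {()}) \<times> idom F.VT (model M) (\<kappa> ` U) 0)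
          (\<lambda>z. 0 (inv_into U \<kappa> (base (snd z))))"
      using F.cdiff_param[OF rE _ D, of "\<lambda>_. 0" j] F.tvs_zero[OF rE] by simp
  qed simp
  from continuous_map_image_subset_topspace[OF this] show "0 \<in> topspace (vtop (CrM r M E))"
    unfolding topspace_discrete_topology by simp
  show "Hausdorff_space (vtop (CrM r M E))"
    unfolding Hausdorff_space_def
  proof (intro allI impI)
    fix \<gamma> \<eta> assume a: "\<gamma> \<in> topspace (vtop (CrM r M E)) \<and> \<eta> \<in> topspace (vtop (CrM r M E)) \<and> \<gamma> \<noteq> \<eta>"
    then obtain x where x: "\<gamma> x \<noteq> \<eta> x" by blast
    then have xM: "x \<in> topspace (mtop M)" using a by (auto simp: Cr_fun_def)
    have c: "continuous_map ?T (vtop E) (\<lambda>\<gamma>. \<gamma> x)" using F.continuous_map_Cr_eval[OF M rE xM] by simp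
    have "\<gamma> x \<in> topspace (vtop E)" "\<eta> x \<in> topspace (vtop E)"
      using a continuous_map_image_subset_topspace[OF c] by auto
    then obtain A B where AB: "openin (vtop E) A" "openin (vtop E) B" "\<gamma> x \<in> A" "\<eta> x \<in> B" "disjnt A B"
      using K.tvs_Hausdorff[OF E] x unfolding Hausdorff_space_def by metis
    show "\<exists>U V. openin (vtop (CrM r M E)) U \<and> openin (vtop (CrM r M E)) V \<and> \<gamma> \<in> U \<and> \<eta> \<in> V \<and> disjnt U V"
      using openin_continuous_map_preimage[OF c AB(1)] openin_continuous_map_preimage[OF c AB(2)] a AB
      by (intro exI[of _ "{\<gamma> \<in> topspace ?T. \<gamma> x \<in> A}"] exI[of _ "{\<gamma> \<in> topspace ?T. \<gamma> x \<in> B}"])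
        (auto simp: disjnt_iff)
  qed
  let ?P = "prod_topology ?T ?T"
  have "continuous_map ?P ?T (\<lambda>z. fst z + snd z)"
  proof (rule F.continuous_map_into_Cr[OF M rE])
    fix U \<kappa> j assume U: "(U, \<kappa>) \<in> atlas M" "enat j \<le> r"
    show "F.cdiff j ?P (model M) (res E) 0 (topspace ?P \<times> idom F.VT (model M) (\<kappa> ` U) 0)
          (\<lambda>z. (fst (fst z) + snd (fst z)) (inv_into U \<kappa> (base (snd z))))"
      using F.cdiff_add[OF rE F.cdiff_eval_comp[OF M rE U continuous_map_fst] F.cdiff_eval_comp[OF M rE U continuous_map_snd]]
      by simp
  qed (auto simp: Cr_fun_def)
  then show "continuous_map (prod_topology (vtop (CrM r M E)) (vtop (CrM r M E))) (vtop (CrM r M E)) (\<lambda>z. fst z + snd z)"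
    by simp
  let ?Q = "prod_topology K.VT ?T"
  have "continuous_map ?Q ?T (\<lambda>z. fun_scale (scale E) (fst z) (snd z))"
  proof (rule F.continuous_map_into_Cr[OF M rE])
    fix U \<kappa> j assume U: "(U, \<kappa>) \<in> atlas M" "enat j \<le> r"
    show "F.cdiff j ?Q (model M) (res E) 0 (topspace ?Q \<times> idom F.VT (model M) (\<kappa> ` U) 0)
          (\<lambda>z. (fun_scale (scale E) (fst (fst z)) (snd (fst z))) (inv_into U \<kappa> (base (snd z))))"
      unfolding fun_scale_def
    \<comment> \<open>A scalar of the larger field acts as a parameter of a map that is linear over
      the smaller field.\<close>
    proof (rule F.cdiff_postcomp[where L = "\<lambda>p. scale E (fst p)"])
      show "continuous_map (prod_topology ?Q (vtop (res E))) (vtop (res E)) (\<lambda>z. scale E (fst (fst z)) (snd z))"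
        by (simp, intro K.tvs_cont_scale E K.cont_fst[OF continuous_map_fst] continuous_map_snd)
      show "F.cdiff j ?Q (model M) (res E) 0 (topspace ?Q \<times> idom F.VT (model M) (\<kappa> ` U) 0)
         (\<lambda>z. snd (fst z) (inv_into U \<kappa> (base (snd z))))"
        by (rule F.cdiff_eval_comp[OF M rE U continuous_map_snd])
    qed (simp add: scale_res K.scale_simps[OF E] mult.commute)
  qed (auto simp: Cr_fun_def fun_scale_def K.scale_simps[OF E])
  then show "continuous_map (prod_topology K.VT (vtop (CrM r M E))) (vtop (CrM r M E)) (\<lambda>z. scale (CrM r M E) (fst z) (snd z))"
    by simp
qed

end

section \<open>Manifolds and compactly supported functions\<close>

context top_field
begin

section \<open>Restriction of charts to open subsets\<close>

lemma Ck_subset: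
  assumes "tvs Z" "tvs E" "openin (vtop Z) V" "openin (vtop Z) V'" "V' \<subseteq> V" "Ck TK Z E r V g"
  shows "Ck TK Z E r V' g"
proof -
  have "Ck_nat TK Z E V' g j" if "Ck_nat TK Z E V g j" for j
    using that unfolding Ck_nat_iff_cdiff[OF assms(1-3)] Ck_nat_iff_cdiff[OF assms(1,2,4)]
    by (rule cdiff_subset) (use assms(5) in auto)
  then show ?thesis using assms(6) by (simp add: Ck_def)
qed

lemma chart_props:
  assumes "is_chart T Z (U, \<kappa>)"
  shows "openin T U" "openin (vtop Z) (\<kappa> ` U)" "inj_on \<kappa> U" "U \<subseteq> topspace T"
    "homeomorphic_map (subtopology T U) (subtopology (vtop Z) (\<kappa> ` U)) \<kappa>"
    "W \<subseteq> U \<Longrightarrow> openin T W \<Longrightarrow> openin (vtop Z) (\<kappa> ` W)"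
proof -
  show 1: "openin T U" "openin (vtop Z) (\<kappa> ` U)"
    and h: "homeomorphic_map (subtopology T U) (subtopology (vtop Z) (\<kappa> ` U)) \<kappa>"
    using assms by (auto simp: is_chart_def)
  show U: "U \<subseteq> topspace T" using openin_subset[OF 1(1)] .
  have tU: "topspace (subtopology T U) = U" using U by auto
  show "inj_on \<kappa> U" using homeomorphic_imp_injective_map[OF h] unfolding tU .
  show "openin (vtop Z) (\<kappa> ` W)" if W: "W \<subseteq> U" "openin T W"
  proof -
    have "W = W \<inter> U" using W by auto
    then have "openin (subtopology T U) W" using W by (metis openin_subtopology)
    then have "openin (subtopology (vtop Z) (\<kappa> ` U)) (\<kappa> ` W)"
      using homeomorphic_map_openness_eq[OF h] by blast
    then show ?thesis by (rule openin_trans_full[OF _ 1(2)])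
  qed
qed

text \<open>Restricted charts stay compatible, so maximality puts them into the atlas. An open
  submanifold keeps only the charts inside \<open>W\<close>, and these must still cover
  \<open>W\<close>.\<close>

lemma restrict_chart:
  assumes M: "Cr_manifold TK r M" and c: "(U, \<kappa>) \<in> atlas M" and W: "openin (mtop M) W"
  shows "(U \<inter> W, restrict \<kappa> (U \<inter> W)) \<in> atlas M"
proof -
  have Z: "tvs (model M)" using M by (simp add: Cr_manifold_def)
  have ch: "is_chart (mtop M) (model M) d" if "d \<in> atlas M" for d using M that by (simp add: Cr_manifold_def)
  note k = chart_props[OF ch[OF c]]
  have UW: "openin (mtop M) (U \<inter> W)" using k(1) W by (rule openin_Int)
  let ?\<kappa> = "restrict \<kappa> (U \<inter> W)"
  have im: "?\<kappa> ` (U \<inter> W) = \<kappa> ` (U \<inter> W)" by auto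
  have inj: "inj_on \<kappa> (U \<inter> W)" "inj_on ?\<kappa> (U \<inter> W)" using k(3) by (auto simp: inj_on_def)
  have sub: "\<kappa> ` (U \<inter> W) \<subseteq> topspace (vtop (model M))" using openin_subset[OF k(2)] by auto
  have "homeomorphic_map (subtopology (subtopology (mtop M) U) W) (subtopology (subtopology (vtop (model M)) (\<kappa> ` U)) (\<kappa> ` (U \<inter> W))) \<kappa>"
    by (rule homeomorphic_map_subtopologies[OF k(5)]) (use k(4) openin_subset[OF k(2)] in auto)
  moreover have "\<kappa> ` U \<inter> \<kappa> ` (U \<inter> W) = \<kappa> ` (U \<inter> W)" by auto
  ultimately have "homeomorphic_map (subtopology (mtop M) (U \<inter> W)) (subtopology (vtop (model M)) (\<kappa> ` (U \<inter> W))) \<kappa>"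
    by (simp add: subtopology_subtopology)
  then have h: "homeomorphic_map (subtopology (mtop M) (U \<inter> W)) (subtopology (vtop (model M)) (?\<kappa> ` (U \<inter> W))) ?\<kappa>"
    unfolding im by (rule homeomorphic_map_eq) auto
  have chart: "is_chart (mtop M) (model M) (U \<inter> W, ?\<kappa>)"
    using h UW k(6)[OF _ UW] im unfolding is_chart_def by auto
  have "compatible_charts TK (model M) r (U \<inter> W, ?\<kappa>) d" if d: "d \<in> atlas M" for d
  proof -
    obtain U' \<kappa>' where d': "d = (U', \<kappa>')" by force
    note k' = chart_props[OF ch[OF d, unfolded d']]
    have "compatible_charts TK (model M) r (U, \<kappa>) (U', \<kappa>')" using M c d d' by (auto simp: Cr_manifold_def)
    then have C: "Ck TK (model M) (model M) r (\<kappa> ` (U \<inter> U')) (\<kappa>' \<circ> inv_into U \<kappa>)"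
      "Ck TK (model M) (model M) r (\<kappa>' ` (U \<inter> U')) (\<kappa> \<circ> inv_into U' \<kappa>')"
      by (auto simp: compatible_charts_def)
    have o: "openin (vtop (model M)) (\<kappa> ` (U \<inter> U'))"
      by (rule k(6)[OF _ openin_Int[OF k(1) k'(1)]]) auto
    have o': "openin (vtop (model M)) (\<kappa>' ` (U \<inter> U'))"
      by (rule k'(6)[OF _ openin_Int[OF k(1) k'(1)]]) auto
    have oW: "openin (vtop (model M)) (\<kappa> ` (U \<inter> W \<inter> U'))"
      by (rule k(6)[OF _ openin_Int[OF UW k'(1)]]) auto
    have oW': "openin (vtop (model M)) (\<kappa>' ` (U \<inter> W \<inter> U'))"
      by (rule k'(6)[OF _ openin_Int[OF UW k'(1)]]) auto
    have "Ck TK (model M) (model M) r (\<kappa> ` (U \<inter> W \<inter> U')) (\<kappa>' \<circ> inv_into (U \<inter> W) ?\<kappa>)"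
    proof (rule Cr_open_cong[OF Z Z oW])
      show "Ck TK (model M) (model M) r (\<kappa> ` (U \<inter> W \<inter> U')) (\<kappa>' \<circ> inv_into U \<kappa>)"
        by (rule Ck_subset[OF Z Z o oW _ C(1)]) auto
      fix x assume "x \<in> \<kappa> ` (U \<inter> W \<inter> U')"
      then obtain y where y: "x = \<kappa> y" "y \<in> U \<inter> W" by auto
      then have "inv_into U \<kappa> x = y" "inv_into (U \<inter> W) ?\<kappa> x = y"
        using k(3) inv_into_f_f[OF inj(2) y(2)] by auto
      then show "(\<kappa>' \<circ> inv_into U \<kappa>) x = (\<kappa>' \<circ> inv_into (U \<inter> W) ?\<kappa>) x" by simp
    qed
    moreover have "?\<kappa> ` (U \<inter> W \<inter> U') = \<kappa> ` (U \<inter> W \<inter> U')" by auto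
    moreover have "Ck TK (model M) (model M) r (\<kappa>' ` (U \<inter> W \<inter> U')) (?\<kappa> \<circ> inv_into U' \<kappa>')"
    proof (rule Cr_open_cong[OF Z Z oW'])
      show "Ck TK (model M) (model M) r (\<kappa>' ` (U \<inter> W \<inter> U')) (\<kappa> \<circ> inv_into U' \<kappa>')"
        by (rule Ck_subset[OF Z Z o' oW' _ C(2)]) auto
      fix x assume "x \<in> \<kappa>' ` (U \<inter> W \<inter> U')"
      then obtain y where y: "x = \<kappa>' y" "y \<in> U \<inter> W" "y \<in> U'" by auto
      then show "(\<kappa> \<circ> inv_into U' \<kappa>') x = (?\<kappa> \<circ> inv_into U' \<kappa>') x"
        using k'(3) by simp
    qed
    ultimately show ?thesis unfolding compatible_charts_def d' by simp
  qed
  then show ?thesis using M chart unfolding Cr_manifold_def by blast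
qed

lemma charts_ok_manifold:
  assumes M: "Cr_manifold TK r M" and lc: "locally_compact_space TK" "locally_compact_space (vtop (model M))"
  shows "charts_ok M" "openin (mtop M) W \<Longrightarrow> charts_ok (open_submanifold M W)"
    "openin (mtop M) W \<Longrightarrow> x \<in> W \<Longrightarrow> \<exists>U \<kappa>. (U, \<kappa>) \<in> atlas M \<and> x \<in> U \<and> U \<subseteq> W"
proof -
  have Z: "tvs (model M)" using M by (simp add: Cr_manifold_def)
  have ch: "is_chart (mtop M) (model M) d" if "d \<in> atlas M" for d using M that by (simp add: Cr_manifold_def)
  have un: "(\<Union>c\<in>atlas M. fst c) = topspace (mtop M)" using M by (simp add: Cr_manifold_def)
  have pr: "openin (vtop (model M)) (\<kappa> ` U) \<and> inj_on \<kappa> U \<and> U \<subseteq> topspace (mtop M)" if "(U, \<kappa>) \<in> atlas M" for U \<kappa>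
    using chart_props(2-4)[OF ch[OF that]] by blast
  show "charts_ok M"
    unfolding charts_ok_def using Z lc pr un by auto
  have sh: "\<exists>U \<kappa>. (U, \<kappa>) \<in> atlas M \<and> x \<in> U \<and> U \<subseteq> W" if W: "openin (mtop M) W" and x: "x \<in> W" for W x
  proof -
    have "x \<in> (\<Union>c\<in>atlas M. fst c)" using openin_subset[OF W] x unfolding un by auto
    then obtain c where c: "c \<in> atlas M" "x \<in> fst c" by blast
    obtain U \<kappa> where [simp]: "c = (U, \<kappa>)" by force
    have "(U \<inter> W, restrict \<kappa> (U \<inter> W)) \<in> atlas M" using restrict_chart[OF M _ W] c by simp
    then show ?thesis using c x by (intro exI[of _ "U \<inter> W"] exI[of _ "restrict \<kappa> (U \<inter> W)"]) auto
  qed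
  then show "openin (mtop M) W \<Longrightarrow> x \<in> W \<Longrightarrow> \<exists>U \<kappa>. (U, \<kappa>) \<in> atlas M \<and> x \<in> U \<and> U \<subseteq> W" .
  show "charts_ok (open_submanifold M W)" if W: "openin (mtop M) W"
  proof -
    have "x \<in> (\<Union>c\<in>{c \<in> atlas M. fst c \<subseteq> W}. fst c)" if "x \<in> W" for x
      using sh[OF W that] by force
    then show ?thesis
      unfolding charts_ok_def open_submanifold_def using Z lc pr openin_subset[OF W] by (auto simp: subset_iff)
  qed
qed

end

text \<open>Finitely many open sets, each meeting finitely many members, cover \<open>K\<close>. An
  open set that meets the closure of \<open>U i\<close> also meets \<open>U i\<close>, so the count
  extends to closures.\<close>

lemma rc_cover_finite_meets:
  assumes cover: "rc_cover T I U" and K: "compactin T K"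
  shows "finite {i \<in> I. T closure_of U i \<inter> K \<noteq> {}}" "finite {i \<in> I. U i \<inter> K \<noteq> {}}"
proof -
  have "\<exists>W. openin T W \<and> x \<in> W \<and> finite {i \<in> I. U i \<inter> W \<noteq> {}}" if "x \<in> K" for x
    using cover compactin_subset_topspace[OF K] that unfolding rc_cover_def by blast
  then have "\<forall>x\<in>K. \<exists>W. openin T W \<and> x \<in> W \<and> finite {i \<in> I. U i \<inter> W \<noteq> {}}" by blast
  from bchoice[OF this] obtain N where N: "\<And>x. x \<in> K \<Longrightarrow> openin T (N x)" "\<And>x. x \<in> K \<Longrightarrow> x \<in> N x"
    "\<And>x. x \<in> K \<Longrightarrow> finite {i \<in> I. U i \<inter> N x \<noteq> {}}" by blast
  obtain F where F: "finite F" "F \<subseteq> N ` K" "K \<subseteq> \<Union>F"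
    using compactinD[OF K, of "N ` K"] N(1,2) by blast
  have "{i \<in> I. T closure_of U i \<inter> K \<noteq> {}} \<subseteq> (\<Union>A\<in>F. {i \<in> I. U i \<inter> A \<noteq> {}})"
  proof
    fix i assume "i \<in> {i \<in> I. T closure_of U i \<inter> K \<noteq> {}}"
    then obtain x where x: "i \<in> I" "x \<in> T closure_of U i" "x \<in> K" by blast
    then obtain A where A: "A \<in> F" "x \<in> A" using F(3) by blast
    then have "openin T A" using F(2) N(1) by blast
    then have "U i \<inter> A \<noteq> {}" using x(2) A(2) unfolding in_closure_of by blast
    then show "i \<in> (\<Union>A\<in>F. {i \<in> I. U i \<inter> A \<noteq> {}})" using A(1) x(1) by blast
  qed
  moreover have "finite (\<Union>A\<in>F. {i \<in> I. U i \<inter> A \<noteq> {}})" using F N(3) by blast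
  ultimately show 1: "finite {i \<in> I. T closure_of U i \<inter> K \<noteq> {}}" by (rule finite_subset)
  have "U i \<subseteq> T closure_of U i" if "i \<in> I" for i
    using cover that openin_subset closure_of_subset unfolding rc_cover_def by metis
  then have "{i \<in> I. U i \<inter> K \<noteq> {}} \<subseteq> {i \<in> I. T closure_of U i \<inter> K \<noteq> {}}" by fast
  then show "finite {i \<in> I. U i \<inter> K \<noteq> {}}" using 1 by (rule finite_subset)
qed

section \<open>Compactly supported functions with the box topology\<close>

locale test_functions = two_valued av av' emb
  for av :: "'k::field \<Rightarrow> real" and av' :: "'a::field \<Rightarrow> real" and emb :: "'a \<Rightarrow> 'k" +
  fixes r :: enat and M :: "('a, 'z::ab_group_add, 'm) manifold" and E :: "('k, 'e::ab_group_add) tvs"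
    and I :: "'i set" and U :: "'i \<Rightarrow> 'm set"
  assumes M: "Cr_manifold F.VT r M" and lcZ: "locally_compact_space (vtop (model M))"
    and E: "K.tvs E" and cover: "rc_cover (mtop M) I U"
begin

abbreviation "CM \<equiv> Cr_fun F.VT r M (res E)"
abbreviation "CcM \<equiv> Crc_fun F.VT r M (res E)"
abbreviation "Ct \<equiv> Cr_top F.VT r M (res E)"
abbreviation "Ti i \<equiv> Cr_top F.VT r (open_submanifold M (U i)) (res E)"
abbreviation "TV i \<equiv> CrM r (open_submanifold M (U i)) E"
abbreviation "XM \<equiv> Crc F.VT emb r M E I U"
abbreviation "rst i \<equiv> ext0 (U i)"
abbreviation "CKM K \<equiv> CrK_fun F.VT r M (res E) K"
abbreviation "XK K \<equiv> CrK F.VT emb r M E K"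

lemma openU: "i \<in> I \<Longrightarrow> openin (mtop M) (U i)"
  using cover by (simp add: rc_cover_def)

lemma HM: "Hausdorff_space (mtop M)"
  using M by (simp add: Cr_manifold_def)

lemma ok: "F.charts_ok M" and ok': "i \<in> I \<Longrightarrow> F.charts_ok (open_submanifold M (U i))"
  using F.charts_ok_manifold[OF M lcF lcZ] openU by blast+

lemma rE: "F.tvs (res E)" by (rule tvs_res[OF E])

lemma tvs_CM: "K.tvs (CrM r M E)" by (rule tvs_CrM[OF ok E])
lemma tvs_TV: "i \<in> I \<Longrightarrow> K.tvs (TV i)" by (rule tvs_CrM[OF ok' E])

lemma compactin_closed: "compactin (mtop M) K \<Longrightarrow> closedin (mtop M) K"
  using HM compactin_imp_closedin by blast

lemma finite_meets: "compactin (mtop M) K \<Longrightarrow> finite {i \<in> I. U i \<inter> K \<noteq> {}}"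
  by (rule rc_cover_finite_meets(2)[OF cover])

lemma Cr_off: "\<gamma> \<in> CM \<Longrightarrow> x \<notin> topspace (mtop M) \<Longrightarrow> \<gamma> x = 0"
  by (simp add: Cr_fun_def)

text \<open>A compact set is closed here, so it contains the support once it contains the points
  where the function is nonzero. The pointwise condition is the one that computations use.\<close>

lemma CrK_iff:
  assumes "compactin (mtop M) K"
  shows "\<gamma> \<in> CKM K \<longleftrightarrow> \<gamma> \<in> CM \<and> (\<forall>x. x \<notin> K \<longrightarrow> \<gamma> x = 0)"
proof -
  have "support (mtop M) \<gamma> \<subseteq> K \<longleftrightarrow> {x \<in> topspace (mtop M). \<gamma> x \<noteq> 0} \<subseteq> K"
    unfolding support_def using compactin_closed[OF assms]
    using closure_of_minimal[of _ K "mtop M"] closure_of_subset[of "{x \<in> topspace (mtop M). \<gamma> x \<noteq> 0}" "mtop M"]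
    by blast
  then show ?thesis unfolding CrK_fun_def using Cr_off by auto
qed

lemma Crc_iff: "\<gamma> \<in> CcM \<longleftrightarrow> \<gamma> \<in> CM \<and> (\<exists>K. compactin (mtop M) K \<and> (\<forall>x. x \<notin> K \<longrightarrow> \<gamma> x = 0))"
proof
  assume "\<gamma> \<in> CcM"
  then have "\<gamma> \<in> CM" "compactin (mtop M) (support (mtop M) \<gamma>)" by (auto simp: Crc_fun_def)
  moreover have "\<forall>x. x \<notin> support (mtop M) \<gamma> \<longrightarrow> \<gamma> x = 0"
    using CrK_iff[OF calculation(2)] calculation(1) by (auto simp: CrK_fun_def)
  ultimately show "\<gamma> \<in> CM \<and> (\<exists>K. compactin (mtop M) K \<and> (\<forall>x. x \<notin> K \<longrightarrow> \<gamma> x = 0))" by blast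
next
  assume "\<gamma> \<in> CM \<and> (\<exists>K. compactin (mtop M) K \<and> (\<forall>x. x \<notin> K \<longrightarrow> \<gamma> x = 0))"
  then obtain K where K: "\<gamma> \<in> CM" "compactin (mtop M) K" "\<gamma> \<in> CKM K" using CrK_iff by blast
  have "closedin (mtop M) (support (mtop M) \<gamma>)" by (simp add: support_def)
  moreover have "support (mtop M) \<gamma> \<subseteq> K" using K(3) by (simp add: CrK_fun_def)
  ultimately have "compactin (mtop M) (support (mtop M) \<gamma>)" using K(2) closed_compactin by blast
  then show "\<gamma> \<in> CcM" using K(1) by (simp add: Crc_fun_def)
qed

lemma CKM_Crc: "compactin (mtop M) K \<Longrightarrow> CKM K \<subseteq> CcM"
  using CrK_iff[of K] by (auto simp: Crc_iff)

lemma CM_add: "\<gamma> \<in> CM \<Longrightarrow> \<eta> \<in> CM \<Longrightarrow> \<gamma> + \<eta> \<in> CM"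
  using K.tvs_add[OF tvs_CM] by simp

lemma CM_scale: "\<gamma> \<in> CM \<Longrightarrow> fun_scale (scale E) c \<gamma> \<in> CM"
  using K.tvs_scale[OF tvs_CM] by simp

lemma CM_0: "0 \<in> CM"
  using K.tvs_zero[OF tvs_CM] by simp

lemma fs_0: "fun_scale (scale E) c 0 = 0" "fun_scale (scale E) c \<gamma> x = scale E c (\<gamma> x)"
  by (auto simp: fun_scale_def fun_eq_iff K.scale_simps[OF E])

lemma CcM_add: "\<gamma> \<in> CcM \<Longrightarrow> \<eta> \<in> CcM \<Longrightarrow> \<gamma> + \<eta> \<in> CcM"
proof -
  assume "\<gamma> \<in> CcM" "\<eta> \<in> CcM"
  then obtain K L where a: "\<gamma> \<in> CM" "\<eta> \<in> CM" "compactin (mtop M) K" "\<forall>x. x \<notin> K \<longrightarrow> \<gamma> x = 0"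
    "compactin (mtop M) L" "\<forall>x. x \<notin> L \<longrightarrow> \<eta> x = 0" unfolding Crc_iff by blast
  then show ?thesis unfolding Crc_iff
    by (intro conjI CM_add exI[of _ "K \<union> L"] compactin_Un) auto
qed

lemma CcM_scale: "\<gamma> \<in> CcM \<Longrightarrow> fun_scale (scale E) c \<gamma> \<in> CcM"
  unfolding Crc_iff by (auto simp: fs_0 CM_scale K.scale_simps[OF E])

lemma CcM_0: "0 \<in> CcM"
  unfolding Crc_iff by (auto simp: CM_0 intro: exI[of _ "{}"])

lemma vs_fun: "vector_space (fun_scale (scale E))"
  by (rule vector_space_fun_scale[OF K.tvs_vs[OF E]])

lemma CcM_diff: "\<gamma> \<in> CcM \<Longrightarrow> \<eta> \<in> CcM \<Longrightarrow> \<gamma> - \<eta> \<in> CcM"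
proof -
  assume a: "\<gamma> \<in> CcM" "\<eta> \<in> CcM"
  interpret vector_space "fun_scale (scale E)" by (rule vs_fun)
  show ?thesis using CcM_add[OF a(1) CcM_scale[OF a(2), of "-1"]] by simp
qed

lemma CKM_subspace:
  assumes "compactin (mtop M) K"
  shows "0 \<in> CKM K" "\<gamma> \<in> CKM K \<Longrightarrow> \<eta> \<in> CKM K \<Longrightarrow> \<gamma> + \<eta> \<in> CKM K"
    "\<gamma> \<in> CKM K \<Longrightarrow> fun_scale (scale E) c \<gamma> \<in> CKM K" "CKM K \<subseteq> CM"
proof -
  show "0 \<in> CKM K" "\<gamma> \<in> CKM K \<Longrightarrow> \<eta> \<in> CKM K \<Longrightarrow> \<gamma> + \<eta> \<in> CKM K" "CKM K \<subseteq> CM"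
    using CM_add CM_0 by (auto simp: CrK_iff[OF assms])
  show "\<gamma> \<in> CKM K \<Longrightarrow> fun_scale (scale E) c \<gamma> \<in> CKM K"
    using CM_scale by (simp add: CrK_iff[OF assms] fs_0(2) K.scale_simps[OF E])
qed

lemma tvs_XK:
  assumes "compactin (mtop M) K"
  shows "K.tvs (XK K)"
  using K.tvs_subspace[OF tvs_CM, of "CKM K"] CKM_subspace[OF assms] by (simp add: CrK_def)

lemma topspace_XK: "compactin (mtop M) K \<Longrightarrow> topspace (vtop (XK K)) = CKM K"
  using CKM_subspace(4)[of K] by (auto simp: CrK_def)

lemma scale_X [simp]: "scale XM = fun_scale (scale E)" "scale (XK K) = fun_scale (scale E)"
  by (auto simp: Crc_def CrK_def)

lemma rst_simps: "rst i (\<gamma> + \<eta>) = rst i \<gamma> + rst i \<eta>" "rst i (\<gamma> - \<eta>) = rst i \<gamma> - rst i \<eta>" "rst i 0 = 0"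
  "rst i (fun_scale (scale E) c \<gamma>) = fun_scale (scale E) c (rst i \<gamma>)"
  by (auto simp: ext0_def fun_eq_iff fun_scale_def K.scale_simps[OF E])

lemma cont_rst:
  assumes i: "i \<in> I"
  shows "continuous_map Ct (Ti i) (rst i)"
proof (rule F.continuous_map_into_Cr[OF ok'[OF i] rE])
  fix A \<kappa> j assume A: "(A, \<kappa>) \<in> atlas (open_submanifold M (U i))" and j: "enat j \<le> r"
  then have A': "(A, \<kappa>) \<in> atlas M" "A \<subseteq> U i" by (auto simp: open_submanifold_def)
  have "F.cdiff j Ct (model M) (res E) 0 (topspace Ct \<times> idom F.VT (model M) (\<kappa> ` A) 0)
     (\<lambda>z. (fst z) (inv_into A \<kappa> (base (snd z))))"
    by (rule F.cdiff_eval_comp[OF ok rE A'(1) j F.cont_ident])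
  then have "F.cdiff j Ct (model M) (res E) 0 (topspace Ct \<times> idom F.VT (model M) (\<kappa> ` A) 0)
     (\<lambda>z. rst i (fst z) (inv_into A \<kappa> (base (snd z))))"
  proof (rule F.cdiff_cong)
    fix z assume "z \<in> topspace Ct \<times> idom F.VT (model M) (\<kappa> ` A) 0"
    then have "inv_into A \<kappa> (base (snd z)) \<in> A" by (auto intro: inv_into_into)
    then show "fst z (inv_into A \<kappa> (base (snd z))) = rst i (fst z) (inv_into A \<kappa> (base (snd z)))"
      using A'(2) by (auto simp: ext0_def)
  qed
  then show "F.cdiff j Ct (model (open_submanifold M (U i))) (res E) 0
     (topspace Ct \<times> idom F.VT (model (open_submanifold M (U i))) (\<kappa> ` A) 0) (\<lambda>z. rst i (fst z) (inv_into A \<kappa> (base (snd z))))"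
    by (simp add: open_submanifold_def)
qed (use Cr_off in \<open>auto simp: open_submanifold_def ext0_def\<close>)

lemma rst_in: "i \<in> I \<Longrightarrow> \<gamma> \<in> CM \<Longrightarrow> rst i \<gamma> \<in> topspace (Ti i)"
  using continuous_map_image_subset_topspace[OF cont_rst] by auto

definition emb_sum :: "('m \<Rightarrow> 'e) \<Rightarrow> 'i \<Rightarrow> 'm \<Rightarrow> 'e" where
  "emb_sum \<gamma> = (\<lambda>i. if i \<in> I then rst i \<gamma> else 0)"

lemma emb_sum_in: "\<gamma> \<in> CcM \<Longrightarrow> emb_sum \<gamma> \<in> direct_sum I Ti"
proof -
  assume a: "\<gamma> \<in> CcM"
  then obtain K where K: "\<gamma> \<in> CM" "compactin (mtop M) K" "\<forall>x. x \<notin> K \<longrightarrow> \<gamma> x = 0" unfolding Crc_iff by blast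
  have "{i \<in> I. emb_sum \<gamma> i \<noteq> 0} \<subseteq> {i \<in> I. U i \<inter> K \<noteq> {}}"
    using K(3) by (auto simp: emb_sum_def ext0_def fun_eq_iff)
  then have "finite {i \<in> I. emb_sum \<gamma> i \<noteq> 0}" using finite_meets[OF K(2)] finite_subset by blast
  then show ?thesis using rst_in[OF _ K(1)] by (auto simp: direct_sum_def emb_sum_def)
qed

lemma finite_rst: "\<gamma> \<in> CcM \<Longrightarrow> finite {i \<in> I. rst i \<gamma> \<noteq> 0}"
  using emb_sum_in[of \<gamma>] by (auto simp: direct_sum_def emb_sum_def elim: rev_finite_subset)

lemma vtop_X: "vtop XM = pullback_topology CcM emb_sum (direct_sum_topology I Ti)"
  by (simp add: Crc_def emb_sum_def[abs_def])

lemma openin_sub_XM: "openin (vtop XM) G \<Longrightarrow> G \<subseteq> CcM"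
  unfolding vtop_X openin_pullback_topology by blast

definition zero_nbhds :: "('i \<Rightarrow> ('m \<Rightarrow> 'e) set) \<Rightarrow> bool" where
  "zero_nbhds W \<longleftrightarrow> (\<forall>i\<in>I. openin (Ti i) (W i) \<and> 0 \<in> W i)"

text \<open>Removes the direct sum: the box topology is described by boxes around functions only.
  For the converse direction each such box has to be extended to an open set \<open>B\<close> of the
  direct sum, whose elements need not come from functions.\<close>

lemma openin_XM: "openin (vtop XM) G \<longleftrightarrow> G \<subseteq> CcM \<and>
    (\<forall>\<gamma>\<in>G. \<exists>W. zero_nbhds W \<and> (\<forall>\<eta>\<in>CcM. (\<forall>i\<in>I. rst i (\<eta> - \<gamma>) \<in> W i) \<longrightarrow> \<eta> \<in> G))" (is "?l \<longleftrightarrow> ?r")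
proof
  assume l: ?l
  then obtain O' where O': "openin (direct_sum_topology I Ti) O'" "G = emb_sum -` O' \<inter> CcM"
    unfolding vtop_X openin_pullback_topology by blast
  show ?r
  proof (intro conjI ballI)
    show "G \<subseteq> CcM" using O' by auto
    fix \<gamma> assume \<gamma>: "\<gamma> \<in> G"
    then have "emb_sum \<gamma> \<in> O'" "\<gamma> \<in> CcM" using O' by auto
    from bspec[OF conjunct2[OF O'(1)[unfolded openin_direct_sum_topology]] this(1)]
    obtain W where W': "(\<forall>i\<in>I. openin (Ti i) (W i) \<and> 0 \<in> W i) \<and>
      (\<forall>y\<in>direct_sum I Ti. (\<forall>i\<in>I. y i \<in> W i) \<longrightarrow> emb_sum \<gamma> + y \<in> O')" by (rule exE)
    note W = conjunct1[OF W'] conjunct2[OF W', rule_format]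
    have "\<eta> \<in> G" if \<eta>: "\<eta> \<in> CcM" "\<forall>i\<in>I. rst i (\<eta> - \<gamma>) \<in> W i" for \<eta>
    proof -
      have "emb_sum \<gamma> + emb_sum (\<eta> - \<gamma>) \<in> O'"
        using W(2)[OF emb_sum_in[OF CcM_diff[OF \<eta>(1) \<open>\<gamma> \<in> CcM\<close>]]] \<eta>(2) by (simp add: emb_sum_def)
      moreover have "emb_sum \<gamma> + emb_sum (\<eta> - \<gamma>) = emb_sum \<eta>"
        by (auto simp: emb_sum_def fun_eq_iff rst_simps)
      ultimately show ?thesis using O'(2) \<eta>(1) by simp
    qed
    then show "\<exists>W. zero_nbhds W \<and> (\<forall>\<eta>\<in>CcM. (\<forall>i\<in>I. rst i (\<eta> - \<gamma>) \<in> W i) \<longrightarrow> \<eta> \<in> G)"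
      using W(1) unfolding zero_nbhds_def by blast
  qed
next
  assume r: ?r
  then obtain W where W: "\<And>\<gamma>. \<gamma> \<in> G \<Longrightarrow> zero_nbhds (W \<gamma>)"
    "\<And>\<gamma> \<eta>. \<gamma> \<in> G \<Longrightarrow> \<eta> \<in> CcM \<Longrightarrow> \<forall>i\<in>I. rst i (\<eta> - \<gamma>) \<in> W \<gamma> i \<Longrightarrow> \<eta> \<in> G" by metis
  define B where "B \<gamma> = {x \<in> direct_sum I Ti. \<forall>i\<in>I. x i - rst i \<gamma> \<in> W \<gamma> i}" for \<gamma>
  have "openin (direct_sum_topology I Ti) (B \<gamma>)" if \<gamma>: "\<gamma> \<in> G" for \<gamma>
    unfolding openin_direct_sum_topology
  proof (intro conjI ballI)
    show "B \<gamma> \<subseteq> direct_sum I Ti" by (auto simp: B_def)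
    fix x assume x: "x \<in> B \<gamma>"
    have gC: "\<gamma> \<in> CM" using \<gamma> r Crc_iff by blast
    have a: "x i - rst i \<gamma> \<in> topspace (Ti i)" if "i \<in> I" for i
      using x that W(1)[OF \<gamma>] openin_subset unfolding B_def zero_nbhds_def by blast
    define W' where "W' i = {v \<in> topspace (Ti i). (x i - rst i \<gamma>) + v \<in> W \<gamma> i}" for i
    show "\<exists>W. (\<forall>i\<in>I. openin (Ti i) (W i) \<and> 0 \<in> W i) \<and> (\<forall>y\<in>direct_sum I Ti. (\<forall>i\<in>I. y i \<in> W i) \<longrightarrow> x + y \<in> B \<gamma>)"
    proof (intro exI[of _ W'] conjI ballI impI)
      fix i assume i: "i \<in> I"
      show "openin (Ti i) (W' i)"
        unfolding W'_def using K.tvs_translate[OF tvs_TV[OF i], of "W \<gamma> i"] W(1)[OF \<gamma>] a[OF i] i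
        by (simp add: zero_nbhds_def)
      show "0 \<in> W' i" using x i K.tvs_zero[OF tvs_TV[OF i]] by (simp add: W'_def B_def)
    next
      fix y assume y: "y \<in> direct_sum I Ti" "\<forall>i\<in>I. y i \<in> W' i"
      have "x + y \<in> direct_sum I Ti"
      proof -
        have "x \<in> direct_sum I Ti" using x by (simp add: B_def)
        moreover have "{i \<in> I. (x + y) i \<noteq> 0} \<subseteq> {i \<in> I. x i \<noteq> 0} \<union> {i \<in> I. y i \<noteq> 0}" by auto
        moreover have "x i + y i \<in> topspace (Ti i)" if "i \<in> I" for i
          using K.tvs_add[OF tvs_TV[OF that], of "x i" "y i"] calculation(1) y(1) that by (auto simp: direct_sum_def)
        ultimately show ?thesis using y(1) unfolding direct_sum_def
          by (auto intro: rev_finite_subset[OF finite_UnI])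
      qed
      moreover have "x i + y i - rst i \<gamma> \<in> W \<gamma> i" if "i \<in> I" for i
        using y(2) that by (auto simp: W'_def algebra_simps)
      ultimately show "x + y \<in> B \<gamma>" by (simp add: B_def)
    qed
  qed
  then have o: "openin (direct_sum_topology I Ti) (\<Union>\<gamma>\<in>G. B \<gamma>)" by blast
  have "G = emb_sum -` (\<Union>\<gamma>\<in>G. B \<gamma>) \<inter> CcM"
  proof (intro equalityI subsetI)
    fix \<gamma> assume \<gamma>: "\<gamma> \<in> G"
    then have "\<gamma> \<in> CcM" using r by blast
    moreover have "emb_sum \<gamma> \<in> B \<gamma>" using emb_sum_in[OF calculation] W(1)[OF \<gamma>] by (simp add: B_def emb_sum_def zero_nbhds_def)
    ultimately show "\<gamma> \<in> emb_sum -` (\<Union>\<gamma>\<in>G. B \<gamma>) \<inter> CcM" using \<gamma> by auto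
  next
    fix \<eta> assume "\<eta> \<in> emb_sum -` (\<Union>\<gamma>\<in>G. B \<gamma>) \<inter> CcM"
    then obtain \<gamma> where g: "\<gamma> \<in> G" "emb_sum \<eta> \<in> B \<gamma>" "\<eta> \<in> CcM" by auto
    then have "\<forall>i\<in>I. rst i (\<eta> - \<gamma>) \<in> W \<gamma> i" by (simp add: B_def emb_sum_def rst_simps)
    then show "\<eta> \<in> G" using W(2) g by blast
  qed
  then show ?l unfolding vtop_X openin_pullback_topology using o by blast
qed

lemma openin_Ti [simp]: "openin (Ti i) (Cr_fun F.VT r (open_submanifold M (U i)) (res E))"
  using openin_topspace[of "Ti i"] by simp

lemma topspace_XM [simp]: "topspace (vtop XM) = CcM"
proof -
  have "openin (vtop XM) CcM"
    unfolding openin_XM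
    using K.tvs_zero[OF tvs_TV] openin_topspace
    by (intro conjI ballI exI[of _ "\<lambda>i. topspace (Ti i)"]) (auto simp: zero_nbhds_def)
  then show ?thesis using openin_sub_XM[OF openin_topspace] openin_subset by blast
qed

text \<open>Each \<open>W i\<close> is open, so the box can be recentred, component by component, at
  any of its points.\<close>

lemma open_box:
  assumes W: "zero_nbhds W" and \<gamma>: "\<gamma> \<in> CcM"
  shows "openin (vtop XM) {\<eta> \<in> CcM. \<forall>i\<in>I. rst i (\<eta> - \<gamma>) \<in> W i}"
  unfolding openin_XM
proof (intro conjI ballI)
  show "{\<eta> \<in> CcM. \<forall>i\<in>I. rst i (\<eta> - \<gamma>) \<in> W i} \<subseteq> CcM" by auto
  fix \<eta> assume \<eta>: "\<eta> \<in> {\<eta> \<in> CcM. \<forall>i\<in>I. rst i (\<eta> - \<gamma>) \<in> W i}"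
  define W' where "W' i = {v \<in> topspace (Ti i). rst i (\<eta> - \<gamma>) + v \<in> W i}" for i
  have "openin (Ti i) (W' i)" "0 \<in> W' i" if i: "i \<in> I" for i
  proof -
    have "rst i (\<eta> - \<gamma>) \<in> topspace (Ti i)"
      using \<eta> i W openin_subset unfolding zero_nbhds_def by blast
    then show "openin (Ti i) (W' i)"
      unfolding W'_def using K.tvs_translate[OF tvs_TV[OF i], of "W i"] W i by (simp add: zero_nbhds_def)
    show "0 \<in> W' i" using \<eta> i K.tvs_zero[OF tvs_TV[OF i]] by (simp add: W'_def)
  qed
  moreover have "rst i (\<eta>' - \<gamma>) \<in> W i" if "rst i (\<eta>' - \<eta>) \<in> W' i" for \<eta>' i
  proof -
    have "rst i (\<eta> - \<gamma>) + rst i (\<eta>' - \<eta>) = rst i (\<eta>' - \<gamma>)" by (simp add: rst_simps)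
    then show ?thesis using that by (simp add: W'_def)
  qed
  ultimately show "\<exists>W'. zero_nbhds W' \<and> (\<forall>\<eta>'\<in>CcM. (\<forall>i\<in>I. rst i (\<eta>' - \<eta>) \<in> W' i) \<longrightarrow>
      \<eta>' \<in> {\<eta> \<in> CcM. \<forall>i\<in>I. rst i (\<eta> - \<gamma>) \<in> W i})"
    by (intro exI[of _ W']) (auto simp: zero_nbhds_def)
qed

lemma mem_box: "zero_nbhds W \<Longrightarrow> \<gamma> \<in> CcM \<Longrightarrow> \<gamma> \<in> {\<eta> \<in> CcM. \<forall>i\<in>I. rst i (\<eta> - \<gamma>) \<in> W i}"
  by (auto simp: zero_nbhds_def rst_simps)

text \<open>A point lies in some \<open>U i\<close>, and that single component of a box decides.
  Evaluations separate functions and later transport identities between values of quotients.\<close>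

lemma cont_XM_eval:
  assumes x: "x \<in> topspace (mtop M)"
  shows "continuous_map (vtop XM) (vtop E) (\<lambda>\<gamma>. \<gamma> x)"
  unfolding continuous_map
proof (intro conjI allI impI)
  have cE: "continuous_map Ct (vtop E) (\<lambda>\<gamma>. \<gamma> x)" using F.continuous_map_Cr_eval[OF ok rE x] by simp
  have inE: "\<gamma> x \<in> topspace (vtop E)" if "\<gamma> \<in> CM" for \<gamma>
    using continuous_map_image_subset_topspace[OF cE] that by auto
  then show "(\<lambda>\<gamma>. \<gamma> x) ` topspace (vtop XM) \<subseteq> topspace (vtop E)" using Crc_iff by auto
  obtain i where i: "i \<in> I" "x \<in> U i" using cover x unfolding rc_cover_def by blast
  have xi: "x \<in> topspace (mtop (open_submanifold M (U i)))" using x i by (simp add: open_submanifold_def)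
  have c: "continuous_map (Ti i) (vtop E) (\<lambda>\<gamma>. \<gamma> x)" using F.continuous_map_Cr_eval[OF ok'[OF i(1)] rE xi] by simp
  fix A assume A: "openin (vtop E) A"
  show "openin (vtop XM) {\<gamma> \<in> topspace (vtop XM). \<gamma> x \<in> A}"
    unfolding openin_XM
  proof (intro conjI ballI)
    fix \<gamma> assume \<gamma>: "\<gamma> \<in> {\<gamma> \<in> topspace (vtop XM). \<gamma> x \<in> A}"
    then have g: "\<gamma> \<in> CM" using Crc_iff by auto
    define W where "W j = (if j = i then {v \<in> topspace (Ti i). \<gamma> x + v x \<in> A} else topspace (Ti j))" for j
    have "openin (Ti i) {v \<in> topspace (Ti i). \<gamma> x + v x \<in> A}"
      by (rule openin_continuous_map_preimage[OF K.tvs_cont_add[OF E K.cont_const[OF inE[OF g]] c] A])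
    then have "zero_nbhds W" using \<gamma> K.tvs_zero[OF tvs_TV] by (auto simp: zero_nbhds_def W_def)
    moreover have "\<eta> \<in> {\<gamma> \<in> topspace (vtop XM). \<gamma> x \<in> A}" if "\<eta> \<in> CcM" "\<forall>i\<in>I. rst i (\<eta> - \<gamma>) \<in> W i" for \<eta>
      using that i by (auto simp: W_def ext0_def)
    ultimately show "\<exists>W. zero_nbhds W \<and> (\<forall>\<eta>\<in>CcM. (\<forall>i\<in>I. rst i (\<eta> - \<gamma>) \<in> W i) \<longrightarrow> \<eta> \<in> {\<gamma> \<in> topspace (vtop XM). \<gamma> x \<in> A})"
      by blast
  qed auto
qed

text \<open>The delicate point is scalar multiplication: one neighbourhood of the scalar
  \<open>t0\<close> has to serve infinitely many components.\<close>

lemma tvs_XM: "K.tvs XM"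
proof (rule K.tvsI_cont)
  show "vector_space (scale XM)" using vs_fun by simp
  show "0 \<in> topspace (vtop XM)" using CcM_0 by simp
  show "Hausdorff_space (vtop XM)"
    unfolding Hausdorff_space_def
  proof (intro allI impI)
    fix \<gamma> \<eta> assume a: "\<gamma> \<in> topspace (vtop XM) \<and> \<eta> \<in> topspace (vtop XM) \<and> \<gamma> \<noteq> \<eta>"
    then obtain x where x: "\<gamma> x \<noteq> \<eta> x" by blast
    then have xM: "x \<in> topspace (mtop M)" using a Cr_off Crc_iff by (metis topspace_XM)
    note c = cont_XM_eval[OF xM]
    have "\<gamma> x \<in> topspace (vtop E)" "\<eta> x \<in> topspace (vtop E)"
      using a continuous_map_image_subset_topspace[OF c] by auto
    then obtain A B where AB: "openin (vtop E) A" "openin (vtop E) B" "\<gamma> x \<in> A" "\<eta> x \<in> B" "disjnt A B"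
      using K.tvs_Hausdorff[OF E] x unfolding Hausdorff_space_def by metis
    show "\<exists>U V. openin (vtop XM) U \<and> openin (vtop XM) V \<and> \<gamma> \<in> U \<and> \<eta> \<in> V \<and> disjnt U V"
      using openin_continuous_map_preimage[OF c AB(1)] openin_continuous_map_preimage[OF c AB(2)] a AB
      by (intro exI[of _ "{\<gamma> \<in> topspace (vtop XM). \<gamma> x \<in> A}"] exI[of _ "{\<gamma> \<in> topspace (vtop XM). \<gamma> x \<in> B}"])
        (auto simp: disjnt_iff)
  qed
  let ?P = "prod_topology (vtop XM) (vtop XM)"
  show "continuous_map ?P (vtop XM) (\<lambda>z. fst z + snd z)"
    unfolding continuous_map
  proof (intro conjI allI impI)
    show "(\<lambda>z. fst z + snd z) ` topspace ?P \<subseteq> topspace (vtop XM)" using CcM_add by auto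
    fix G assume G: "openin (vtop XM) G"
    show "openin ?P {z \<in> topspace ?P. fst z + snd z \<in> G}"
      unfolding openin_prod_topology_alt
    proof (intro allI impI)
      fix \<gamma> \<eta> assume "(\<gamma>, \<eta>) \<in> {z \<in> topspace ?P. fst z + snd z \<in> G}"
      then have a: "\<gamma> \<in> CcM" "\<eta> \<in> CcM" "\<gamma> + \<eta> \<in> G" by auto
      then obtain W where W: "zero_nbhds W" "\<And>\<theta>. \<theta> \<in> CcM \<Longrightarrow> \<forall>i\<in>I. rst i (\<theta> - (\<gamma> + \<eta>)) \<in> W i \<Longrightarrow> \<theta> \<in> G"
        using G unfolding openin_XM by meson
      have "\<exists>A B. openin (Ti i) A \<and> openin (Ti i) B \<and> 0 \<in> A \<and> 0 \<in> B \<and> (\<forall>v\<in>A. \<forall>w\<in>B. v + w \<in> W i)" if i: "i \<in> I" for i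
      proof -
        have "openin (vtop (TV i)) (W i)" "0 + 0 \<in> W i" using W(1) i by (auto simp: zero_nbhds_def)
        from K.tvs_add_nbhd[OF tvs_TV[OF i] this K.tvs_zero[OF tvs_TV[OF i]] K.tvs_zero[OF tvs_TV[OF i]]]
        show ?thesis by (metis tvs.select_convs(2))
      qed
      then obtain A B where AB: "zero_nbhds A" "zero_nbhds B" "\<And>i v w. i \<in> I \<Longrightarrow> v \<in> A i \<Longrightarrow> w \<in> B i \<Longrightarrow> v + w \<in> W i"
        unfolding zero_nbhds_def by metis
      let ?A = "{\<theta> \<in> CcM. \<forall>i\<in>I. rst i (\<theta> - \<gamma>) \<in> A i}" and ?B = "{\<theta> \<in> CcM. \<forall>i\<in>I. rst i (\<theta> - \<eta>) \<in> B i}"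
      have "\<theta> + \<theta>' \<in> G" if "\<theta> \<in> ?A" "\<theta>' \<in> ?B" for \<theta> \<theta>'
      proof (rule W(2))
        show "\<theta> + \<theta>' \<in> CcM" using that CcM_add by auto
        have "rst i (\<theta> + \<theta>' - (\<gamma> + \<eta>)) = rst i (\<theta> - \<gamma>) + rst i (\<theta>' - \<eta>)" for i by (simp add: rst_simps algebra_simps)
        then show "\<forall>i\<in>I. rst i (\<theta> + \<theta>' - (\<gamma> + \<eta>)) \<in> W i" using that AB(3) by auto
      qed
      then show "\<exists>A B. openin (vtop XM) A \<and> openin (vtop XM) B \<and> \<gamma> \<in> A \<and> \<eta> \<in> B \<and>
         A \<times> B \<subseteq> {z \<in> topspace ?P. fst z + snd z \<in> G}"
        using open_box[OF AB(1) a(1)] open_box[OF AB(2) a(2)] mem_box[OF AB(1) a(1)] mem_box[OF AB(2) a(2)]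
        by (intro exI[of _ ?A] exI[of _ ?B] conjI) auto
    qed
  qed
  let ?Q = "prod_topology K.VT (vtop XM)"
  let ?s = "fun_scale (scale E)"
  interpret fs: vector_space ?s by (rule vs_fun)
  show "continuous_map ?Q (vtop XM) (\<lambda>z. scale XM (fst z) (snd z))"
    unfolding continuous_map scale_X
  proof (intro conjI allI impI)
    show "(\<lambda>z. ?s (fst z) (snd z)) ` topspace ?Q \<subseteq> topspace (vtop XM)" using CcM_scale by auto
    fix G assume G: "openin (vtop XM) G"
    show "openin ?Q {z \<in> topspace ?Q. ?s (fst z) (snd z) \<in> G}"
      unfolding openin_prod_topology_alt
    proof (intro allI impI)
      fix t0 \<gamma> assume "(t0, \<gamma>) \<in> {z \<in> topspace ?Q. ?s (fst z) (snd z) \<in> G}"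
      then have a: "\<gamma> \<in> CcM" "?s t0 \<gamma> \<in> G" by auto
      then obtain W where W: "zero_nbhds W" "\<And>\<theta>. \<theta> \<in> CcM \<Longrightarrow> \<forall>i\<in>I. rst i (\<theta> - ?s t0 \<gamma>) \<in> W i \<Longrightarrow> \<theta> \<in> G"
        using G unfolding openin_XM by meson
      have g: "rst i \<gamma> \<in> topspace (vtop (TV i))" if "i \<in> I" for i using rst_in[OF that] a(1) Crc_iff by auto
      \<comment> \<open>Where \<open>\<gamma>\<close> vanishes on \<open>U i\<close>, boundedness of
        scalars near \<open>t0\<close> allows the fixed radius 1. Only finitely many components
        remain that may demand a smaller radius.\<close>
      have "\<exists>e B. e > 0 \<and> openin (Ti i) B \<and> 0 \<in> B \<and>
        (\<forall>t v. av (t - t0) < e \<longrightarrow> v \<in> B \<longrightarrow> ?s t (rst i \<gamma> + v) - ?s t0 (rst i \<gamma>) \<in> W i) \<and>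
        (rst i \<gamma> = 0 \<longrightarrow> e = 1)" if i: "i \<in> I" for i
      proof (cases "rst i \<gamma> = 0")
        case True
        have "openin (vtop (TV i)) (W i)" "0 \<in> W i" using W(1) i by (auto simp: zero_nbhds_def)
        from K.tvs_bounded[OF tvs_TV[OF i] this, of "av t0 + 1"] obtain B where B: "openin (Ti i) B" "0 \<in> B"
          "\<And>t v. av t \<le> av t0 + 1 \<Longrightarrow> v \<in> B \<Longrightarrow> ?s t v \<in> W i" by auto
        have "av t \<le> av t0 + 1" if "av (t - t0) < 1" for t
          using that K.av_props(4)[of "t - t0" t0] by simp
        then show ?thesis using B True by (intro exI[of _ 1] exI[of _ B]) auto
      next
        case False
        let ?W = "{w \<in> topspace (Ti i). - ?s t0 (rst i \<gamma>) + w \<in> W i}"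
        have m: "- ?s t0 (rst i \<gamma>) \<in> topspace (vtop (TV i))"
          using K.tvs_scale[OF tvs_TV[OF i] g[OF i], of "- t0"] by simp
        have oW: "openin (vtop (TV i)) ?W"
          using K.tvs_translate[OF tvs_TV[OF i], of "W i", OF _ m] W(1) i by (simp add: zero_nbhds_def)
        have "scale (TV i) t0 (rst i \<gamma>) \<in> ?W"
          using K.tvs_scale[OF tvs_TV[OF i] g[OF i], of t0] W(1) i by (simp add: zero_nbhds_def)
        from K.tvs_scale_nbhd[OF tvs_TV[OF i] oW this g[OF i]] obtain e B where eB: "e > 0" "openin (Ti i) B" "rst i \<gamma> \<in> B"
          "\<And>t v. av (t - t0) < e \<Longrightarrow> v \<in> B \<Longrightarrow> ?s t v \<in> ?W" by auto
        have "openin (Ti i) {v \<in> topspace (Ti i). rst i \<gamma> + v \<in> B}"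
          using K.tvs_translate[OF tvs_TV[OF i], of B, OF _ g[OF i]] eB(2) by simp
        then show ?thesis using eB(1,3) K.tvs_zero[OF tvs_TV[OF i]] False eB(4)
          by (intro exI[of _ e] exI[of _ "{v \<in> topspace (Ti i). rst i \<gamma> + v \<in> B}"]) auto
      qed
      then obtain e B where eB: "\<And>i. i \<in> I \<Longrightarrow> e i > (0::real)" "zero_nbhds B"
        "\<And>i t v. i \<in> I \<Longrightarrow> av (t - t0) < e i \<Longrightarrow> v \<in> B i \<Longrightarrow> ?s t (rst i \<gamma> + v) - ?s t0 (rst i \<gamma>) \<in> W i"
        "\<And>i. i \<in> I \<Longrightarrow> rst i \<gamma> = 0 \<Longrightarrow> e i = 1"
        unfolding zero_nbhds_def by metis
      \<comment> \<open>The inserted 1 covers the components with radius 1 and keeps the set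
        nonempty.\<close>
      define d where "d = Min (insert 1 (e ` {i \<in> I. rst i \<gamma> \<noteq> 0}))"
      have fin: "finite (insert 1 (e ` {i \<in> I. rst i \<gamma> \<noteq> 0}))" using finite_rst[OF a(1)] by simp
      have d: "d > 0" unfolding d_def using fin eB(1) by (subst Min_gr_iff) auto
      have de: "d \<le> e i" if "i \<in> I" for i
        unfolding d_def using fin eB(4)[OF that] that by (cases "rst i \<gamma> = 0") (auto intro: Min_le)
      let ?A = "{t. av (t - t0) < d}" and ?B = "{\<theta> \<in> CcM. \<forall>i\<in>I. rst i (\<theta> - \<gamma>) \<in> B i}"
      have "?s t \<theta> \<in> G" if "t \<in> ?A" "\<theta> \<in> ?B" for t \<theta>
      proof (rule W(2))
        show "?s t \<theta> \<in> CcM" using that CcM_scale by auto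
        show "\<forall>i\<in>I. rst i (?s t \<theta> - ?s t0 \<gamma>) \<in> W i"
        proof
          fix i assume i: "i \<in> I"
          have "?s t (rst i \<gamma> + rst i (\<theta> - \<gamma>)) - ?s t0 (rst i \<gamma>) \<in> W i"
            using that i de[OF i] by (intro eB(3)) auto
          then show "rst i (?s t \<theta> - ?s t0 \<gamma>) \<in> W i" by (simp add: rst_simps)
        qed
      qed
      then show "\<exists>A B. openin K.VT A \<and> openin (vtop XM) B \<and> t0 \<in> A \<and> \<gamma> \<in> B \<and>
         A \<times> B \<subseteq> {z \<in> topspace ?Q. ?s (fst z) (snd z) \<in> G}"
        using K.openin_ball[of t0 d] d open_box[OF eB(2) a(1)] mem_box[OF eB(2) a(1)]
        by (intro exI[of _ ?A] exI[of _ ?B] conjI) auto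
    qed
  qed
qed

end

section \<open>Finite-dimensional spaces and bump functions\<close>

context valued
begin

lemma closedin_ball: "closedin VT {t. av (t - c) \<le> R}"
proof -
  have "{t. av (t - c) \<le> R} = M.mcball c R" by (auto simp: M.mcball_def av_minus_commute)
  then show ?thesis using M.closedin_mcball[of c R] by (simp add: valued_topology_def)
qed

text \<open>A compact neighbourhood of 0 contains a small closed ball; multiplication by a large
  \<open>c\<close> blows it up to the desired radius.\<close>

lemma compactin_ball:
  assumes lc: "locally_compact_space VT"
  shows "compactin VT {t. av t \<le> R}"
proof -
  obtain O' K where OK: "openin VT O'" "compactin VT K" "0 \<in> O'" "O' \<subseteq> K"
    using lc unfolding locally_compact_space_def by (metis UNIV_I topspace_VT)
  obtain e where e: "e > 0" "\<And>y. av (y - 0) < e \<Longrightarrow> y \<in> O'"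
    using OK(1,3) unfolding openin_VT by blast
  obtain c where c: "c \<noteq> 0" "R / e < av c" using large_elt by blast
  have "compactin VT {t. av (t - 0) \<le> R / av c}"
  proof (rule closed_compactin[OF OK(2) _ closedin_ball])
    have "R / av c < e" using c e(1) av_pos[OF c(1)] by (simp add: field_simps)
    then show "{t. av (t - 0) \<le> R / av c} \<subseteq> K" using e(2) OK(4) by (auto dest: le_less_trans)
  qed
  moreover have "continuous_map VT VT (\<lambda>t. c * t)" by (intro cont_mult cont_ident) simp
  ultimately have "compactin VT ((\<lambda>t. c * t) ` {t. av (t - 0) \<le> R / av c})" by (rule image_compactin)
  moreover have "(\<lambda>t. c * t) ` {t. av (t - 0) \<le> R / av c} = {t. av t \<le> R}"
  proof (intro equalityI subsetI)
    fix t assume "t \<in> {t. av t \<le> R}"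
    then have "t / c \<in> {t. av (t - 0) \<le> R / av c}" using av_pos[OF c(1)] by (simp add: av_divide divide_right_mono)
    moreover have "t = c * (t / c)" using c by simp
    ultimately show "t \<in> (\<lambda>t. c * t) ` {t. av (t - 0) \<le> R / av c}" by blast
  next
    fix t assume "t \<in> (\<lambda>t. c * t) ` {t. av (t - 0) \<le> R / av c}"
    then show "t \<in> {t. av t \<le> R}" using av_pos[OF c(1)] by (auto simp: av_props(3) field_simps)
  qed
  ultimately show ?thesis by simp
qed

lemma cont_lincomb:
  assumes Z: "tvs Z" and B: "finite B" "B \<subseteq> topspace (vtop Z)" and "\<And>b. b \<in> B \<Longrightarrow> continuous_map T VT (c b)"
  shows "continuous_map T (vtop Z) (\<lambda>x. \<Sum>b\<in>B. scale Z (c b x) b)"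
  using B assms(4)
proof (induction B)
  case empty then show ?case using tvs_zero[OF Z] by simp
next
  case (insert b B)
  then show ?case by (auto intro!: tvs_cont_add[OF Z] tvs_cont_scale[OF Z])
qed

text \<open>Coordinates exist algebraically; their continuity is a consequence of local compactness
  of the field. They are shown to be bounded near 0, and linearity turns this into continuity at
  every point.\<close>

lemma fd_coordinates:
  assumes Z: "tvs Z" and fd: "finite_dimensional_tvs Z" and lc: "locally_compact_space VT"
  obtains B c where "finite B" "B \<subseteq> topspace (vtop Z)"
    "\<And>b x y t. x \<in> topspace (vtop Z) \<Longrightarrow> y \<in> topspace (vtop Z) \<Longrightarrow> c b (x + scale Z t y) = c b x + t * c b y"
    "\<And>x. x \<in> topspace (vtop Z) \<Longrightarrow> x = (\<Sum>b\<in>B. scale Z (c b x) b)"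
    "\<And>b. b \<in> B \<Longrightarrow> continuous_map (vtop Z) VT (c b)"
proof -
  interpret vector_space "scale Z" by (rule tvs_vs[OF Z])
  let ?Z = "topspace (vtop Z)"
  have sub: "subspace ?Z" using Z by (simp add: topological_vector_space_def)
  obtain A where A: "finite A" "A \<subseteq> ?Z" "span A = ?Z" using fd by (auto simp: finite_dimensional_tvs_def)
  obtain B where B: "B \<subseteq> ?Z" "independent B" "?Z \<subseteq> span B" by (rule basis_exists)
  have finB: "finite B" using independent_span_bound[OF A(1) B(2)] B(1) A(3) by auto
  have spB: "span B = ?Z" using B(1,3) span_minimal[OF B(1) sub] by auto
  define c where "c b x = representation B x b" for b x
  have lin: "c b (x + scale Z t y) = c b x + t * c b y" if "x \<in> ?Z" "y \<in> ?Z" for b x y t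
  proof -
    have "x \<in> span B" "y \<in> span B" using that spB by auto
    then show ?thesis
      by (simp add: c_def representation_add[OF B(2)] representation_scale[OF B(2)] span_scale)
  qed
  have rec: "x = (\<Sum>b\<in>B. scale Z (c b x) b)" if "x \<in> ?Z" for x
    using sum_representation_eq[OF B(2), of x B] finB that spB by (simp add: c_def)
  have c_sum: "c b (\<Sum>b\<in>B. scale Z (t b) b) = t b" if "b \<in> B" for b t
  proof -
    have "c b (\<Sum>b\<in>B. scale Z (t b) b) = (\<Sum>a\<in>B. c b (scale Z (t a) a))"
      unfolding c_def using representation_sum[OF B(2), of B "\<lambda>b. scale Z (t b) b"] by (simp add: span_base span_scale)
    also have "\<dots> = (\<Sum>a\<in>B. if a = b then t b else 0)"
    proof (rule sum.cong[OF refl])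
      fix a assume a: "a \<in> B"
      show "c b (scale Z (t a) a) = (if a = b then t b else 0)"
        unfolding c_def using representation_scale[OF B(2) span_base[OF a], of "t a"] representation_basis[OF B(2) a] by auto
    qed
    finally show ?thesis using that finB by simp
  qed
  define T where "T t = (\<Sum>b\<in>B. scale Z (t b) b)" for t
  have contT: "continuous_map (product_topology (\<lambda>_. VT) B) (vtop Z) T"
    unfolding T_def by (intro cont_lincomb[OF Z finB B(1)] continuous_map_product_projection)
  \<comment> \<open>The image of \<open>{t. t b = 1, |t a| \<le> 1}\<close> is compact and misses 0, which bounds the coordinates near 0.\<close>
  have "\<exists>O'. openin (vtop Z) O' \<and> 0 \<in> O' \<and> (\<forall>x\<in>O'. \<forall>a\<in>B. av (c a x) < 1)"
  proof -
    have "\<exists>O'. openin (vtop Z) O' \<and> 0 \<in> O' \<and> (\<forall>t x. av t \<le> 1 \<longrightarrow> x \<in> O' \<longrightarrow>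
        scale Z t x \<notin> T ` (\<Pi>\<^sub>E a\<in>B. if a = b then {1} else {t. av t \<le> 1}))" if b: "b \<in> B" for b
    proof -
      let ?S = "\<Pi>\<^sub>E a\<in>B. if a = b then {1} else {t. av t \<le> 1}"
      have "compactin (product_topology (\<lambda>_. VT) B) ?S"
        by (simp add: compactin_PiE compactin_ball[OF lc])
      then have "compactin (vtop Z) (T ` ?S)" by (rule image_compactin[OF _ contT])
      then have cl: "closedin (vtop Z) (T ` ?S)" using compactin_imp_closedin tvs_Hausdorff[OF Z] by blast
      have "T t \<noteq> 0" if "t \<in> ?S" for t
      proof
        assume "T t = 0"
        moreover have "t b = 1" using that b by (auto simp: PiE_iff)
        moreover have "c b 0 = 0" by (simp add: c_def representation_zero)
        ultimately show False using c_sum[OF b, of t] by (simp add: T_def)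
      qed
      then have "0 \<in> ?Z - T ` ?S" using tvs_zero[OF Z] by auto
      moreover have "openin (vtop Z) (?Z - T ` ?S)" using cl by blast
      ultimately obtain O' where "openin (vtop Z) O'" "0 \<in> O'" "\<And>t v. av t \<le> 1 \<Longrightarrow> v \<in> O' \<Longrightarrow> scale Z t v \<in> ?Z - T ` ?S"
        using tvs_bounded[OF Z, of _ 1] by metis
      then show ?thesis by blast
    qed
    then have "\<forall>b\<in>B. \<exists>O'. openin (vtop Z) O' \<and> 0 \<in> O' \<and> (\<forall>t x. av t \<le> 1 \<longrightarrow> x \<in> O' \<longrightarrow>
        scale Z t x \<notin> T ` (\<Pi>\<^sub>E a\<in>B. if a = b then {1} else {t. av t \<le> 1}))" by blast
    from bchoice[OF this] obtain N where N0: "\<forall>b\<in>B. openin (vtop Z) (N b) \<and> 0 \<in> N b \<and> (\<forall>t x. av t \<le> 1 \<longrightarrow> x \<in> N b \<longrightarrow>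
        scale Z t x \<notin> T ` (\<Pi>\<^sub>E a\<in>B. if a = b then {1} else {t. av t \<le> 1}))" by (rule exE)
    have N: "openin (vtop Z) (N b)" "0 \<in> N b"
      "av t \<le> 1 \<Longrightarrow> x \<in> N b \<Longrightarrow> scale Z t x \<notin> T ` (\<Pi>\<^sub>E a\<in>B. if a = b then {1} else {t. av t \<le> 1})"
      if "b \<in> B" for b t x
      using bspec[OF N0 that] by blast+
    define O' where "O' = ?Z \<inter> (\<Inter>b\<in>B. N b)"
    have o: "openin (vtop Z) O'"
    proof (cases "B = {}")
      case False
      then have "openin (vtop Z) (\<Inter>b\<in>B. N b)" using finB N(1) by (intro openin_Inter) auto
      then show ?thesis by (auto simp: O'_def)
    qed (simp add: O'_def)
    have "av (c a x) < 1" if x: "x \<in> O'" and a: "a \<in> B" for x a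
    proof (rule ccontr)
      assume n: "\<not> av (c a x) < 1"
      \<comment> \<open>Division by a coordinate of largest absolute value moves \<open>x\<close>
        into the compact set belonging to the index \<open>m\<close>, where its image was seen to
        stay away from 0.\<close>
      obtain m where m: "m \<in> B" "\<And>b. b \<in> B \<Longrightarrow> av (c b x) \<le> av (c m x)"
      proof -
        have "Max ((\<lambda>b. av (c b x)) ` B) \<in> (\<lambda>b. av (c b x)) ` B" by (rule Max_in) (use finB a in auto)
        then obtain m where "m \<in> B" "Max ((\<lambda>b. av (c b x)) ` B) = av (c m x)" by auto
        then show ?thesis using that finB by (metis Max_ge finite_imageI imageI)
      qed
      have m1: "av (c m x) \<ge> 1" using n m(2)[OF a] by simp
      then have m0: "c m x \<noteq> 0" by auto
      define t where "t = restrict (\<lambda>b. c b x / c m x) B"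
      have "t \<in> (\<Pi>\<^sub>E a\<in>B. if a = m then {1} else {t. av t \<le> 1})"
        using m0 m(2) m1 by (auto simp: t_def av_divide)
      then have "T t \<in> T ` (\<Pi>\<^sub>E a\<in>B. if a = m then {1} else {t. av t \<le> 1})" by (rule imageI)
      moreover have "T t = scale Z (1 / c m x) x"
      proof -
        have "scale Z (1 / c m x) x = scale Z (1 / c m x) (\<Sum>b\<in>B. scale Z (c b x) b)"
          using rec x by (simp add: O'_def)
        also have "\<dots> = T t" by (auto simp: T_def t_def scale_sum_right intro!: sum.cong)
        finally show ?thesis by simp
      qed
      moreover have "av (1 / c m x) \<le> 1" using m1 by (simp add: av_divide)
      moreover have "x \<in> N m" using x m(1) by (auto simp: O'_def)
      ultimately show False using N(3)[OF m(1), of "1 / c m x" x] by simp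
    qed
    then show ?thesis using o N(2) tvs_zero[OF Z] by (intro exI[of _ O']) (auto simp: O'_def)
  qed
  then obtain O' where O': "openin (vtop Z) O'" "0 \<in> O'" "\<And>x a. x \<in> O' \<Longrightarrow> a \<in> B \<Longrightarrow> av (c a x) < 1" by blast
  have "continuous_map (vtop Z) VT (c b)" if b: "b \<in> B" for b
    unfolding continuous_map
  proof (intro conjI allI impI)
    fix G assume G: "openin VT G"
    show "openin (vtop Z) {x \<in> ?Z. c b x \<in> G}"
    proof (subst openin_subopen, intro ballI)
      fix x assume x: "x \<in> {x \<in> ?Z. c b x \<in> G}"
      then obtain e where e: "e > 0" "\<And>y. av (y - c b x) < e \<Longrightarrow> y \<in> G" using G unfolding openin_VT by blast
      \<comment> \<open>A bound 1 on \<open>O'\<close> becomes the bound \<open>1 / av s < e\<close>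
        for vectors whose multiple by \<open>s\<close> lies in \<open>O'\<close>.\<close>
      obtain s where s: "s \<noteq> 0" "1 / e < av s" using large_elt by blast
      have se: "1 / av s < e" using s e(1) av_pos[OF s(1)] by (simp add: field_simps)
      let ?A = "{y \<in> ?Z. scale Z s (y - x) \<in> O'}"
      have "openin (vtop Z) ?A"
        using x by (intro openin_continuous_map_preimage[OF _ O'(1)] tvs_cont_scale[OF Z] tvs_cont_diff[OF Z] cont_ident) auto
      moreover have "x \<in> ?A" using x O'(2) by simp
      moreover have "c b y \<in> G" if y: "y \<in> ?A" for y
      proof -
        have yx: "y - x \<in> ?Z" using y x subspace_diff[OF sub] by auto
        have "c b (0 + scale Z s (y - x)) = c b 0 + s * c b (y - x)" by (rule lin[OF tvs_zero[OF Z] yx])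
        then have "av (s * c b (y - x)) < 1" using O'(3)[OF _ b, of "scale Z s (y - x)"] y
          by (simp add: c_def representation_zero)
        then have "av (c b (y - x)) < 1 / av s" using av_pos[OF s(1)] by (simp add: av_props(3) field_simps)
        moreover have "c b (x + scale Z 1 (y - x)) = c b x + 1 * c b (y - x)" by (rule lin) (use x yx in auto)
        ultimately show ?thesis using e(2)[of "c b y"] se by simp
      qed
      ultimately show "\<exists>T. openin (vtop Z) T \<and> x \<in> T \<and> T \<subseteq> {x \<in> ?Z. c b x \<in> G}"
        by (intro exI[of _ ?A]) auto
    qed
  qed simp
  then show ?thesis using that[OF finB B(1) lin rec] by blast
qed

lemma lincomb_nbhd:
  assumes Z: "tvs Z" and B: "finite B" "B \<subseteq> topspace (vtop Z)" and "openin (vtop Z) V" "z0 \<in> V"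
  shows "\<exists>e>0. \<forall>t. (\<forall>b\<in>B. av (t b) < e) \<longrightarrow> z0 + (\<Sum>b\<in>B. scale Z (t b) b) \<in> V"
  using B assms(4,5)
proof (induction B arbitrary: V)
  case empty then show ?case by (auto intro: exI[of _ 1])
next
  case (insert b B)
  have z0: "z0 \<in> topspace (vtop Z)" using insert.prems openin_subset by blast
  have b: "b \<in> topspace (vtop Z)" using insert.prems by simp
  have "z0 + 0 \<in> V" using insert.prems by simp
  from tvs_add_nbhd[OF Z insert.prems(2) this z0 tvs_zero[OF Z]] obtain A N where
    A: "openin (vtop Z) A" "z0 \<in> A" and N: "openin (vtop Z) N" "0 \<in> N" and AN: "\<And>v w. v \<in> A \<Longrightarrow> w \<in> N \<Longrightarrow> v + w \<in> V"
    by metis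
  have "scale Z 0 b \<in> N" using N(2) by (simp add: scale_simps[OF Z])
  from tvs_scale_nbhd[OF Z N(1) this b] obtain e1 where e1: "e1 > 0" "\<And>t. av t < e1 \<Longrightarrow> scale Z t b \<in> N"
    by (metis diff_zero)
  obtain e2 where e2: "e2 > 0" "\<And>t. \<forall>b\<in>B. av (t b) < e2 \<Longrightarrow> z0 + (\<Sum>b\<in>B. scale Z (t b) b) \<in> A"
    using insert.IH[OF _ A] insert.prems by blast
  have "z0 + (\<Sum>b\<in>insert b B. scale Z (t b) b) \<in> V" if t: "\<forall>a\<in>insert b B. av (t a) < min e1 e2" for t
  proof -
    have "(z0 + (\<Sum>b\<in>B. scale Z (t b) b)) + scale Z (t b) b \<in> V"
      using t by (intro AN e1(2) e2(2)) auto
    then show ?thesis using insert.hyps by (simp add: algebra_simps)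
  qed
  then show ?case using e1(1) e2(1) by (intro exI[of _ "min e1 e2"]) auto
qed

text \<open>A bump function near 0 on the field itself; \<open>bump_tvs\<close> transports it along coordinates.\<close>

definition field_bump :: "real \<Rightarrow> ('k \<Rightarrow> 'k) \<Rightarrow> bool" where
  "field_bump e \<psi> \<longleftrightarrow> (\<forall>k. cdiff k (discrete_topology {()}) fld fld 0 ({()} \<times> idom VT fld UNIV 0) (\<lambda>z. \<psi> (base (snd z)))) \<and>
    (\<exists>d>0. \<forall>x. av x < d \<longrightarrow> \<psi> x = 1) \<and> (\<forall>x. e \<le> av x \<longrightarrow> \<psi> x = 0)"

text \<open>A product of one-dimensional bumps in the coordinates centred at \<open>z0\<close>. The
  support lies in a closed polydisc, the continuous image of a compact set of coordinates.\<close>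

lemma bump_tvs:
  assumes Z: "tvs Z" and fd: "finite_dimensional_tvs Z" and lc: "locally_compact_space VT"
    and bump: "\<And>e. e > 0 \<Longrightarrow> \<exists>\<psi>. field_bump e \<psi>" and V: "openin (vtop Z) V" "z0 \<in> V"
  obtains \<rho> A C where "\<And>k. cdiff k (discrete_topology {()}) Z fld 0 ({()} \<times> idom VT Z (topspace (vtop Z)) 0) (\<lambda>z. \<rho> (base (snd z)))"
    "openin (vtop Z) A" "z0 \<in> A" "\<And>x. x \<in> A \<Longrightarrow> \<rho> x = 1"
    "compactin (vtop Z) C" "C \<subseteq> V" "\<And>x. x \<in> topspace (vtop Z) \<Longrightarrow> x \<notin> C \<Longrightarrow> \<rho> x = 0"
proof -
  let ?Z = "topspace (vtop Z)"
  obtain B c where B: "finite B" "B \<subseteq> ?Z"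
    and lin: "\<And>b x y t. x \<in> ?Z \<Longrightarrow> y \<in> ?Z \<Longrightarrow> c b (x + scale Z t y) = c b x + t * c b y"
    and rec: "\<And>x. x \<in> ?Z \<Longrightarrow> x = (\<Sum>b\<in>B. scale Z (c b x) b)"
    and cont: "\<And>b. b \<in> B \<Longrightarrow> continuous_map (vtop Z) VT (c b)"
    using fd_coordinates[OF Z fd lc] by blast
  have z0: "z0 \<in> ?Z" using V openin_subset by blast
  obtain e0 where e0: "e0 > 0" "\<And>t. \<forall>b\<in>B. av (t b) < e0 \<Longrightarrow> z0 + (\<Sum>b\<in>B. scale Z (t b) b) \<in> V"
    using lincomb_nbhd[OF Z B V] by blast
  \<comment> \<open>Strictly below \<open>e0\<close>, so that the closed polydisc of radius
    \<open>e\<close> still lies in \<open>V\<close>.\<close>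
  obtain e where e: "e > 0" "e < e0" using dense[OF e0(1)] by blast
  obtain \<psi> where \<psi>: "field_bump e \<psi>" using bump[OF e(1)] by auto
  then obtain d where d: "d > 0" "\<And>x. av x < d \<Longrightarrow> \<psi> x = 1" by (auto simp: field_bump_def)
  define \<rho> where "\<rho> x = (\<Prod>b\<in>B. \<psi> (c b x - c b z0))" for x
  define C where "C = {x \<in> ?Z. \<forall>b\<in>B. c b x - c b z0 \<in> {t. av (t - 0) \<le> e}}"
  define A where "A = {x \<in> ?Z. \<forall>b\<in>B. c b x - c b z0 \<in> {t. av (t - 0) < d}}"
  have cd: "continuous_map (vtop Z) VT (\<lambda>x. c b x - c b z0)" if "b \<in> B" for b
    using tvs_cont_diff[OF tvs_fld, of "vtop Z" "c b" "\<lambda>_. c b z0"] cont[OF that] by simp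
  have rec': "x = z0 + (\<Sum>b\<in>B. scale Z (c b x - c b z0) b)" if "x \<in> ?Z" for x
  proof -
    have "(\<Sum>b\<in>B. scale Z (c b x - c b z0) b) = (\<Sum>b\<in>B. scale Z (c b x + - c b z0) b)" by simp
    also have "\<dots> = (\<Sum>b\<in>B. scale Z (c b x) b) - (\<Sum>b\<in>B. scale Z (c b z0) b)"
      unfolding scale_simps(6,8)[OF Z] by (simp add: sum_subtractf)
    finally show ?thesis using rec[OF that, symmetric] rec[OF z0, symmetric] by simp
  qed
  show ?thesis
  proof (rule that)
    let ?D = "{()} \<times> idom VT Z ?Z 0" and ?U = "discrete_topology {()}"
    have D: "?D \<subseteq> topspace ?U \<times> topspace (lv Z 0)" by auto
    have 1: "cdiff k ?U Z fld 0 ?D (\<lambda>z. \<psi> (c b (base (snd z)) - c b z0))" if b: "b \<in> B" for k b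
    proof -
      have l: "cdiff k ?U Z fld 0 ?D (\<lambda>z. c b (base (snd z)))"
      proof (rule cdiff_lin[where l = "\<lambda>w. c b (base w)", OF _ _ D])
        show "continuous_map (lv Z 0) (vtop fld) (\<lambda>w. c b (base w))"
          using cont_comp[OF cont[OF b] cont_base[OF cont_ident]] by simp
      qed (auto simp: lv_0 lin)
      have "cdiff k ?U Z fld 0 ?D (\<lambda>z. c b (base (snd z)) - c b z0)"
        by (rule cdiff_diff[OF tvs_fld l cdiff_param[OF tvs_fld _ D, of "\<lambda>_. c b z0"]]) simp
      then have "tdiff 0 k ?U Z fld 0 ?D (\<lambda>z. Base (c b (base (snd z)) - c b z0))" by simp
      moreover have "cdiff k ?U fld fld 0 ({()} \<times> idom VT fld UNIV 0) (\<lambda>z. \<psi> (base (snd z)))"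
        using \<psi> by (simp add: field_bump_def)
      ultimately show ?thesis
        using cdiff_chain[of k ?U fld fld 0 "{()} \<times> idom VT fld UNIV 0" "\<lambda>z. \<psi> (base (snd z))"
            Z 0 ?D "\<lambda>z. Base (c b (base (snd z)) - c b z0)"] by simp
    qed
    have "cdiff k ?U Z fld 0 ?D (\<lambda>z. \<Prod>b\<in>B'. \<psi> (c b (base (snd z)) - c b z0))" if "finite B'" "B' \<subseteq> B" for k B'
      using that
    proof (induction B')
      case empty then show ?case using cdiff_param[OF tvs_fld _ D, of "\<lambda>_. 1"] by simp
    next
      case (insert b B')
      then show ?case using cdiff_mult[OF 1[of b k] insert.IH] by simp
    qed
    then show "cdiff k ?U Z fld 0 ?D (\<lambda>z. \<rho> (base (snd z)))" for k using B(1) by (simp add: \<rho>_def)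
    show "openin (vtop Z) A"
    proof (cases "B = {}")
      case False
      have "A = (\<Inter>b\<in>B. {x \<in> ?Z. c b x - c b z0 \<in> {t. av (t - 0) < d}})" using False by (auto simp: A_def)
      moreover have "openin (vtop Z) (\<Inter>b\<in>B. {x \<in> ?Z. c b x - c b z0 \<in> {t. av (t - 0) < d}})"
        by (rule openin_INT2[OF B(1) False openin_continuous_map_preimage[OF cd openin_ball]])
      ultimately show ?thesis by simp
    qed (simp add: A_def)
    show "z0 \<in> A" using z0 d by (simp add: A_def)
    show "\<rho> x = 1" if "x \<in> A" for x using that d(2) by (simp add: A_def \<rho>_def)
    show CV: "C \<subseteq> V"
    proof
      fix x assume x: "x \<in> C"
      then have "z0 + (\<Sum>b\<in>B. scale Z (c b x - c b z0) b) \<in> V" using e(2) by (intro e0(2)) (fastforce simp: C_def)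
      then show "x \<in> V" using rec'[of x] x by (simp add: C_def)
    qed
    show "\<rho> x = 0" if h: "x \<in> ?Z" "x \<notin> C" for x
    proof -
      obtain b where b: "b \<in> B" "e \<le> av (c b x - c b z0)" using h by (force simp: C_def)
      then have "\<psi> (c b x - c b z0) = 0" using \<psi> by (simp add: field_bump_def)
      then show ?thesis using b(1) B(1) by (auto simp: \<rho>_def)
    qed
    show "compactin (vtop Z) C"
    proof (rule closed_compactin)
      let ?T = "\<lambda>t. z0 + (\<Sum>b\<in>B. scale Z (t b) b)"
      have "continuous_map (product_topology (\<lambda>_. VT) B) (vtop Z) ?T"
        by (intro tvs_cont_add[OF Z] cont_lincomb[OF Z B] continuous_map_product_projection) (simp_all add: z0)
      moreover have "compactin (product_topology (\<lambda>_. VT) B) (\<Pi>\<^sub>E b\<in>B. {t. av t \<le> e})"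
        by (simp add: compactin_PiE compactin_ball[OF lc])
      ultimately show "compactin (vtop Z) (?T ` (\<Pi>\<^sub>E b\<in>B. {t. av t \<le> e}))" by (rule image_compactin[rotated])
      show "C \<subseteq> ?T ` (\<Pi>\<^sub>E b\<in>B. {t. av t \<le> e})"
      proof
        fix x assume x: "x \<in> C"
        have "x = ?T (restrict (\<lambda>b. c b x - c b z0) B)"
          using rec'[of x] x by (simp add: C_def)
        moreover have "restrict (\<lambda>b. c b x - c b z0) B \<in> (\<Pi>\<^sub>E b\<in>B. {t. av t \<le> e})"
          using x by (auto simp: C_def)
        ultimately show "x \<in> ?T ` (\<Pi>\<^sub>E b\<in>B. {t. av t \<le> e})" by blast
      qed
      show "closedin (vtop Z) C"
      proof (cases "B = {}")
        case False
        have "C = (\<Inter>b\<in>B. {x \<in> ?Z. c b x - c b z0 \<in> {t. av (t - 0) \<le> e}})" using False by (auto simp: C_def)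
        moreover have "closedin (vtop Z) (\<Inter>b\<in>B. {x \<in> ?Z. c b x - c b z0 \<in> {t. av (t - 0) \<le> e}})"
          by (rule closedin_INT[OF False closedin_continuous_map_preimage[OF cd closedin_ball]])
        ultimately show ?thesis by simp
      qed (simp add: C_def)
    qed
  qed
qed

text \<open>The bump is 1 on the neighbourhood \<open>A\<close> and 0 off the compact set
  \<open>C\<close>, hence \<open>A \<subseteq> C\<close>.\<close>

lemma fd_locally_compact:
  assumes Z: "tvs Z" and fd: "finite_dimensional_tvs Z" and lc: "locally_compact_space VT"
    and bump: "\<And>e. e > 0 \<Longrightarrow> \<exists>\<psi>. field_bump e \<psi>"
  shows "locally_compact_space (vtop Z)"
  unfolding locally_compact_space_def
proof
  fix x assume x: "x \<in> topspace (vtop Z)"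
  obtain \<rho> A C where "openin (vtop Z) A" "x \<in> A" "\<And>x. x \<in> A \<Longrightarrow> \<rho> x = (1::'k)"
    "compactin (vtop Z) C" "\<And>x. x \<in> topspace (vtop Z) \<Longrightarrow> x \<notin> C \<Longrightarrow> \<rho> x = 0"
    using bump_tvs[OF Z fd lc bump openin_topspace x] by metis
  moreover have "A \<subseteq> C" using calculation openin_subset by (metis subset_iff zero_neq_one)
  ultimately show "\<exists>U K. openin (vtop Z) U \<and> compactin (vtop Z) K \<and> x \<in> U \<and> U \<subseteq> K" by blast
qed

text \<open>The component \<open>{0}\<close> is compact, so local compactness gives an open and
  closed neighbourhood of 0 inside the ball. Its indicator function is locally constant, and
  \<open>cdiff_local\<close> makes it differentiable of every order.\<close>

lemma field_bump_totally_disconnected: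
  assumes lc: "locally_compact_space VT" and td: "totally_disconnected_space VT" and e: "e > 0"
  shows "\<exists>\<psi>. field_bump e \<psi>"
proof -
  have "{0} \<in> connected_components_of VT"
    using td connected_component_in_connected_components_of[of VT 0] by (simp add: totally_disconnected_space_def)
  moreover have "{0} \<subseteq> {y. av (y - 0) < e}" using e by simp
  ultimately obtain A B where AB: "openin VT A" "openin VT B" "disjnt A B" "A \<union> B = topspace VT" "{0} \<subseteq> A"
    "A \<subseteq> {y. av (y - 0) < e}"
    using wilder_locally_compact_component_thm[OF lc Hausdorff_TK _ _ openin_ball] by (metis compactin_sing topspace_VT UNIV_I)
  define \<psi> where "\<psi> x = (if x \<in> A then 1 else (0::'k))" for x
  let ?U = "discrete_topology {()}" and ?D = "{()} \<times> idom VT fld UNIV 0"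
  have "cdiff k ?U fld fld 0 ?D (\<lambda>z. \<psi> (base (snd z)))" for k
  proof (rule cdiff_local[OF tvs_fld tvs_fld])
    have o: "openin (prod_topology ?U (lv fld 0)) ({()} \<times> idom VT fld S 0)" if "openin VT S" for S
      using open_idom[OF tvs_fld, of S 0] that by (simp add: openin_prod_Times_iff)
    show "openin (prod_topology ?U (lv fld 0)) ?D" by (rule o) (use openin_topspace[of VT] in simp)
    fix z assume z: "z \<in> ?D"
    have c: "cdiff k ?U fld fld 0 ({()} \<times> idom VT fld S 0) (\<lambda>z. \<psi> (base (snd z)))" if "\<And>x. x \<in> S \<Longrightarrow> \<psi> x = t" for S t
    proof -
      have "cdiff k ?U fld fld 0 ({()} \<times> idom VT fld S 0) (\<lambda>z. t)"
        by (rule cdiff_param[OF tvs_fld, where c = "\<lambda>_. t"]) (use idom_subset[of S fld 0] in auto)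
      then show ?thesis by (rule cdiff_cong) (use that in auto)
    qed
    have "\<And>x. x \<in> A \<Longrightarrow> \<psi> x = 1" "\<And>x. x \<in> B \<Longrightarrow> \<psi> x = 0"
      using AB(3) by (auto simp: \<psi>_def disjnt_iff)
    note cA = c[of A 1, OF this(1)] and cB = c[of B 0, OF this(2)]
    have "base (snd z) \<in> A \<or> base (snd z) \<in> B" using AB(4) by auto
    then show "\<exists>D'. openin (prod_topology ?U (lv fld 0)) D' \<and> z \<in> D' \<and> D' \<subseteq> ?D \<and> cdiff k ?U fld fld 0 D' (\<lambda>z. \<psi> (base (snd z)))"
    proof
      assume "base (snd z) \<in> A"
      then show ?thesis using o[OF AB(1)] cA z
        by (intro exI[of _ "{()} \<times> idom VT fld A 0"]) auto
    next
      assume "base (snd z) \<in> B"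
      then show ?thesis using o[OF AB(2)] cB z
        by (intro exI[of _ "{()} \<times> idom VT fld B 0"]) auto
    qed
  qed
  moreover have "\<exists>d>0. \<forall>x. av x < d \<longrightarrow> \<psi> x = 1"
    using AB(1,5) unfolding openin_VT \<psi>_def by (metis diff_zero insert_subset)
  moreover have "\<psi> x = 0" if "e \<le> av x" for x using AB(6) that by (auto simp: \<psi>_def)
  ultimately show ?thesis unfolding field_bump_def by blast
qed

end

text \<open>The function \<open>x^(-n) exp(-1/x)\<close>, continued by 0. Carrying the power along
  makes the family closed under differentiation up to linear combinations, so one induction shows
  smoothness of all members.\<close>

definition flat :: "nat \<Rightarrow> real \<Rightarrow> real" where
  "flat n x = (if x > 0 then (1 / x) ^ n * exp (- (1 / x)) else 0)"

lemma flat_tendsto_0: "(flat n \<longlongrightarrow> 0) (at 0)"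
proof -
  have "((\<lambda>u::real. u ^ n / exp u) \<longlongrightarrow> 0) at_top" by (rule tendsto_power_div_exp_0)
  from filterlim_compose[OF this filterlim_inverse_at_top_right]
  have "((\<lambda>x::real. inverse x ^ n / exp (inverse x)) \<longlongrightarrow> 0) (at_right 0)" .
  then have r: "(flat n \<longlongrightarrow> 0) (at_right 0)"
    by (rule Lim_transform_eventually)
      (auto simp: flat_def exp_minus field_simps eventually_at_filter)
  have l: "(flat n \<longlongrightarrow> 0) (at_left 0)"
    by (rule Lim_transform_eventually[OF tendsto_const[of 0]]) (auto simp: flat_def eventually_at_filter)
  show ?thesis using l r by (simp add: filterlim_split_at)
qed

lemma flat_deriv: "(flat n has_real_derivative (- real n * flat (Suc n) x + flat (Suc (Suc n)) x)) (at x)"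
proof -
  consider "x > 0" | "x < 0" | "x = 0" by linarith
  then show ?thesis
  proof cases
    case 1
    have d0: "((\<lambda>x. 1 / x) has_real_derivative (- ((1 / x) * (1 / x)))) (at x)"
      using 1 by (auto intro!: derivative_eq_intros simp: field_simps)
    have d1: "((\<lambda>x. (1 / x) ^ n) has_real_derivative (- real n * (1 / x) ^ Suc n)) (at x)"
    proof (rule DERIV_cong[OF DERIV_power[OF d0]])
      have aux: "c * (- (q * q) * q ^ m) = - c * q ^ Suc (Suc m)" for c q :: real and m by simp
      show "real n * (- (1 / x * (1 / x)) * (1 / x) ^ (n - Suc 0)) = - real n * (1 / x) ^ Suc n"
        using aux[of "real n" "1 / x" "n - 1"] by (cases n) simp_all
    qed
    have d2: "((\<lambda>x. exp (- (1 / x))) has_real_derivative (exp (- (1 / x)) * ((1 / x) * (1 / x)))) (at x)"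
      by (rule DERIV_cong[OF DERIV_fun_exp[OF DERIV_minus[OF d0]]]) simp
    have "((\<lambda>x. (1 / x) ^ n * exp (- (1 / x))) has_real_derivative (- real n * flat (Suc n) x + flat (Suc (Suc n)) x)) (at x)"
      by (rule DERIV_cong[OF DERIV_mult[OF d1 d2]]) (use 1 in \<open>simp add: flat_def mult_ac\<close>)
    then show ?thesis
      by (rule has_field_derivative_transform_within_open[of _ _ _ "{0<..}"]) (use 1 in \<open>auto simp: flat_def\<close>)
  next
    case 2
    have "((\<lambda>x. 0) has_real_derivative (- real n * flat (Suc n) x + flat (Suc (Suc n)) x)) (at x)"
      using 2 by (auto simp: flat_def)
    then show ?thesis
      by (rule has_field_derivative_transform_within_open[of _ _ _ "{..<0}"]) (use 2 in \<open>auto simp: flat_def\<close>)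
  next
    case 3
    \<comment> \<open>At 0 the difference quotient of \<open>flat n\<close> is
      \<open>flat (Suc n)\<close> itself, which tends to 0.\<close>
    have "((\<lambda>h. (flat n (0 + h) - flat n 0) / h) \<longlongrightarrow> 0) (at 0)"
      by (rule Lim_transform_eventually[OF flat_tendsto_0[of "Suc n"]])
        (auto simp: flat_def eventually_at_filter)
    then show ?thesis using 3 by (simp add: DERIV_def flat_def)
  qed
qed

lemma flat_pos: "x > 0 \<Longrightarrow> flat 0 x > 0" and flat_nonneg: "flat 0 x \<ge> 0" and flat_zero: "x \<le> 0 \<Longrightarrow> flat n x = 0"
  by (auto simp: flat_def)

text \<open>The absolute value need not correspond to the usual one on the real line, so everything
  is transported by continuity of the field isomorphism \<open>h\<close> and of its inverse
  alone.\<close>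

locale real_valued = valued +
  fixes h :: "'a \<Rightarrow> real"
  assumes hom: "field_hom h" and homeo: "homeomorphic_map VT euclideanreal h"
begin

definition g where "g = inv h"

lemma bij_h: "bij h"
  using homeomorphic_imp_injective_map[OF homeo] homeomorphic_imp_surjective_map[OF homeo] by (simp add: bij_def)

lemma hg [simp]: "h (g s) = s" and gh [simp]: "g (h x) = x"
  using bij_h by (auto simp: g_def bij_def surj_f_inv_f)

lemma cont_h: "continuous_map VT euclideanreal h"
  using homeo homeomorphic_imp_continuous_map by blast

lemma cont_g: "continuous_map euclideanreal VT g"
proof -
  obtain g' where g': "homeomorphic_maps VT euclideanreal h g'" using homeo homeomorphic_map_maps by blast
  then have "g' s = g s" for s by (metis UNIV_I gh hg homeomorphic_maps_def topspace_euclidean)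
  then have "g' = g" by blast
  then show ?thesis using g' by (simp add: homeomorphic_maps_def)
qed

lemma h_simps: "h 1 = 1" "h (x + y) = h x + h y" "h (x * y) = h x * h y" "h 0 = 0" "h (x - y) = h x - h y"
  "h x = h y \<longleftrightarrow> x = y"
proof -
  show 1: "h 1 = 1" "\<And>x y. h (x + y) = h x + h y" "h (x * y) = h x * h y" using hom by (auto simp: field_hom_def)
  show "h 0 = 0" using 1(2)[of 0 0] by simp
  show "h (x - y) = h x - h y" using 1(2)[of "x - y" y] by simp
  show "h x = h y \<longleftrightarrow> x = y" by (metis gh)
qed

lemma g_simps: "g (s + t) = g s + g t" "g (s * t) = g s * g t" "g (s - t) = g s - g t"
  by (metis h_simps(2) hg gh, metis h_simps(3) hg gh, metis h_simps(5) hg gh)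

abbreviation "pt \<equiv> discrete_topology {()}"
abbreviation "ivl \<equiv> top_of_set {0..1::real}"

text \<open>The interval is compact, so by the tube lemma the integrands at \<open>w\<close> and
  \<open>w0\<close> are uniformly close for \<open>w\<close> near \<open>w0\<close>.\<close>

lemma cont_on_integral:
  assumes c: "cont_on ivl X VT i ({0..1} \<times> D) G" and D: "D \<subseteq> topspace (lv X i)"
  shows "cont_on pt X VT i ({()} \<times> D) (\<lambda>z. g (integral {0..1} (\<lambda>s. h (G (s, snd z)))))"
    "w \<in> D \<Longrightarrow> (\<lambda>s. h (G (s, w))) integrable_on {0..1}"
proof -
  have int: "continuous_on {0..1} (\<lambda>s. h (G (s, w)))" if "w \<in> D" for w
  proof -
    have "continuous_map ivl VT (\<lambda>s. G (s, w))"
      by (rule cont_onD[OF c]) (use that D in \<open>auto simp: cont_ident\<close>)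
    from cont_comp[OF cont_h this] show ?thesis by simp
  qed
  then show "w \<in> D \<Longrightarrow> (\<lambda>s. h (G (s, w))) integrable_on {0..1}"
    by (rule integrable_continuous_interval)
  let ?S = "subtopology (lv X i) D"
  have tS: "topspace ?S = D" using D by auto
  have "continuous_map ?S Met_TC.mtopology (\<lambda>w. integral {0..1} (\<lambda>s. h (G (s, w))))"
    unfolding Met_TC.continuous_map_to_metric tS
  proof (intro ballI allI impI)
    fix w0 and \<epsilon> :: real assume w0: "w0 \<in> D" and \<epsilon>: "\<epsilon> > 0"
    let ?P = "prod_topology ivl ?S"
    have c1: "continuous_map ?P VT (\<lambda>z. G (fst z, snd z))"
      by (rule cont_onD[OF c continuous_map_fst])
        (use continuous_map_into_fulltopology[OF continuous_map_snd] in \<open>auto simp: D\<close>)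
    have c2: "continuous_map ?P VT (\<lambda>z. G (fst z, w0))"
      by (rule cont_onD[OF c continuous_map_fst]) (use w0 D in auto)
    have "continuous_map ?P euclideanreal (\<lambda>z. h (G (fst z, snd z)) - h (G (fst z, w0)))"
      by (intro continuous_map_diff cont_comp[OF cont_h c1] cont_comp[OF cont_h c2])
    from openin_continuous_map_preimage[OF this, of "{- (\<epsilon>/2)<..<\<epsilon>/2}"]
    have o: "openin ?P {z \<in> topspace ?P. h (G (fst z, snd z)) - h (G (fst z, w0)) \<in> {- (\<epsilon>/2)<..<\<epsilon>/2}}" by simp
    have C: "compactin ivl {0..1}" by (simp add: compactin_subtopology)
    have w: "w0 \<in> topspace ?S" using w0 tS by simp
    have sub: "{0..1} \<times> {w0} \<subseteq> {z \<in> topspace ?P. h (G (fst z, snd z)) - h (G (fst z, w0)) \<in> {- (\<epsilon>/2)<..<\<epsilon>/2}}"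
      using w0 \<epsilon> D by auto
    obtain A B where AB: "openin ?S B" "{0..1} \<subseteq> A" "w0 \<in> B"
      "A \<times> B \<subseteq> {z \<in> topspace ?P. h (G (fst z, snd z)) - h (G (fst z, w0)) \<in> {- (\<epsilon>/2)<..<\<epsilon>/2}}"
      using tube_lemma_left[OF o C w sub] by blast
    have "integral {0..1} (\<lambda>s. h (G (s, w))) \<in> Met_TC.mball (integral {0..1} (\<lambda>s. h (G (s, w0)))) \<epsilon>" if w: "w \<in> B" for w
    proof -
      have wD: "w \<in> D" using w AB(1) openin_subset tS by blast
      have b: "norm (h (G (s, w)) - h (G (s, w0))) \<le> \<epsilon> / 2" if "s \<in> {0..1}" for s
      proof -
        have "(s, w) \<in> A \<times> B" using that w AB(2) by auto
        then have "h (G (s, w)) - h (G (s, w0)) \<in> {- (\<epsilon>/2)<..<\<epsilon>/2}" using AB(4) by fastforce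
        then show ?thesis unfolding real_norm_def greaterThanLessThan_iff by linarith
      qed
      have "norm (integral {0..1} (\<lambda>s. h (G (s, w)) - h (G (s, w0)))) \<le> \<epsilon> / 2 * (1 - 0)"
        by (rule integral_bound) (use int[OF wD] int[OF w0] b in \<open>auto intro: continuous_on_diff\<close>)
      moreover have "integral {0..1} (\<lambda>s. h (G (s, w)) - h (G (s, w0))) =
         integral {0..1} (\<lambda>s. h (G (s, w))) - integral {0..1} (\<lambda>s. h (G (s, w0)))"
        by (rule integral_diff[OF integrable_continuous_interval[OF int[OF wD]] integrable_continuous_interval[OF int[OF w0]]])
      ultimately show ?thesis using \<epsilon> by (simp add: dist_real_def abs_minus_commute)
    qed
    then show "\<exists>U. openin ?S U \<and> w0 \<in> U \<and> (\<forall>y\<in>U. integral {0..1} (\<lambda>s. h (G (s, y))) \<in> Met_TC.mball (integral {0..1} (\<lambda>s. h (G (s, w0)))) \<epsilon>)"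
      using AB(1,3) by blast
  qed
  then have "continuous_map ?S VT (\<lambda>w. g (integral {0..1} (\<lambda>s. h (G (s, w)))))"
    using cont_comp[OF cont_g] by simp
  note cS = this
  show "cont_on pt X VT i ({()} \<times> D) (\<lambda>z. g (integral {0..1} (\<lambda>s. h (G (s, snd z)))))"
  proof (rule cont_onI)
    fix S assume S: "topspace S = {()} \<times> D" "continuous_map S (lv X i) snd"
    have "snd z \<in> D" if "z \<in> topspace S" for z using that unfolding S(1) by (simp add: mem_Times_iff)
    then show "continuous_map S VT (\<lambda>z. g (integral {0..1} (\<lambda>s. h (G (s, snd z)))))"
      by (rule cont_on_comp[OF cS S(2)])
  qed (use D in auto)
qed

text \<open>The integration variable is the parameter of \<open>cdiff\<close>. As the integral is
  linear, the integral of the quotients is a quotient of the integral.\<close>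

lemma cdiff_integral:
  assumes "cdiff k ivl X fld i ({0..1} \<times> D) G" "D \<subseteq> topspace (lv X i)"
  shows "cdiff k pt X fld i ({()} \<times> D) (\<lambda>z. g (integral {0..1} (\<lambda>s. h (G (s, snd z)))))"
  using assms
proof (induction k arbitrary: i D G)
  case 0
  then show ?case using cont_on_integral(1)[of X i D G] by simp
next
  case (Suc k)
  obtain H where H: "cont_on ivl X VT i ({0..1} \<times> D) G" "cdiff k ivl X fld (Suc i) (dq_dom X i ({0..1} \<times> D)) H"
    "\<And>p x y t. (p, x) \<in> {0..1} \<times> D \<Longrightarrow> y \<in> topspace (lv X i) \<Longrightarrow> (p, istep X x y t) \<in> {0..1} \<times> D \<Longrightarrow>
      G (p, istep X x y t) = G (p, x) + t * (H (p, Node x y t))"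
    using Suc.prems(1) by (rule cdiff_SucE_fld) blast
  define D' where "D' = {Node x y t | x y t. x \<in> D \<and> y \<in> topspace (lv X i) \<and> istep X x y t \<in> D}"
  have d: "dq_dom X i ({()} \<times> D) = {()} \<times> D'" "dq_dom X i ({0..1::real} \<times> D) = {0..1} \<times> D'"
    by (auto simp: D'_def elim!: dq_domE)
  have D': "D' \<subseteq> topspace (lv X (Suc i))" using Suc.prems(2) by (auto simp: D'_def)
  have cH: "cont_on ivl X VT (Suc i) ({0..1} \<times> D') H" using cdiff_cont[OF H(2)] by (simp add: d)
  show ?case
  proof (rule cdiff_SucI)
    show "cont_on pt X (vtop fld) i ({()} \<times> D) (\<lambda>z. g (integral {0..1} (\<lambda>s. h (G (s, snd z)))))"
      using cont_on_integral(1)[OF H(1) Suc.prems(2)] by simp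
    show "cdiff k pt X fld (Suc i) (dq_dom X i ({()} \<times> D)) (\<lambda>z. g (integral {0..1} (\<lambda>s. h (H (s, snd z)))))"
      unfolding d by (rule Suc.IH[OF _ D']) (use H(2) d in simp)
    fix p x y t assume z: "(p, x) \<in> {()} \<times> D" "y \<in> topspace (lv X i)" "(p, istep X x y t) \<in> {()} \<times> D"
    have w: "x \<in> D" "Node x y t \<in> D'" using z by (auto simp: D'_def)
    have "integral {0..1} (\<lambda>s. h (G (s, istep X x y t))) = integral {0..1} (\<lambda>s. h (G (s, x)) + h t * h (H (s, Node x y t)))"
      by (rule integral_cong) (use z H(3) in \<open>simp add: h_simps\<close>)
    also have "\<dots> = integral {0..1} (\<lambda>s. h (G (s, x))) + h t * integral {0..1} (\<lambda>s. h (H (s, Node x y t)))"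
    proof -
      have "(\<lambda>s. h t * h (H (s, Node x y t))) integrable_on {0..1}"
        using integrable_cmul[OF cont_on_integral(2)[OF cH D' w(2)], of "h t"] by simp
      from integral_add[OF cont_on_integral(2)[OF H(1) Suc.prems(2) w(1)] this] show ?thesis by simp
    qed
    finally show "g (integral {0..1} (\<lambda>s. h (G (s, snd (p, istep X x y t))))) =
       g (integral {0..1} (\<lambda>s. h (G (s, snd (p, x))))) +
       scale fld t (g (integral {0..1} (\<lambda>s. h (H (s, snd (p, Node x y t))))))"
      by (simp add: g_simps)
  qed
qed

abbreviation "fsmooth k F \<equiv> cdiff k pt fld fld 0 ({()} \<times> idom VT fld UNIV 0) (\<lambda>z. F (base (snd z)))"

lemma tdiff_Base: "cdiff k TP X X2 i D a \<Longrightarrow> tdiff 0 k TP X X2 i D (\<lambda>z. Base (a z))"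
  by simp

lemma fsmooth_comp:
  assumes "fsmooth k F" "cdiff k TP X fld i D a"
  shows "cdiff k TP X fld i D (\<lambda>z. F (a z))"
proof -
  have il: "ilin fld 0 fld 0 (\<lambda>w. w)" by (auto simp: ilin_def intro: cont_ident)
  have "cdiff k TP fld fld 0 (topspace TP \<times> idom VT fld UNIV 0) (\<lambda>z. F (base (snd ((\<lambda>_. ()) (fst z), snd z))))"
    by (rule cdiff_precomp[OF assms(1) il]) (use idom_subset[of UNIV fld 0] in \<open>auto intro: cont_const\<close>)
  then have "cdiff k TP fld fld 0 (topspace TP \<times> idom VT fld UNIV 0) (\<lambda>z. F (base (snd z)))" by simp
  from cdiff_chain[OF this tdiff_Base, of X i D a] assms(2) cdiff_dom[OF assms(2)] show ?thesis by auto
qed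

text \<open>Hadamard's formula: \<open>f(a + t b) - f(a)\<close> is \<open>t b\<close> times the
  integral of \<open>f'(a + s t b)\<close> over \<open>s\<close> in \<open>[0, 1]\<close>. The
  resulting quotient makes sense for \<open>t = 0\<close> and inherits the differentiability of
  \<open>f'\<close>.\<close>

lemma fsmooth_deriv:
  assumes f: "\<And>x. (f has_real_derivative f' x) (at x)" and f': "fsmooth k (\<lambda>x. g (f' (h x)))"
  shows "fsmooth (Suc k) (\<lambda>x. g (f (h x)))"
proof (rule cdiff_SucI)
  let ?D = "{()} \<times> idom VT fld UNIV 0" and ?D1 = "idom VT fld UNIV (Suc 0)"
  have D: "?D \<subseteq> topspace pt \<times> topspace (lv fld 0)" using idom_subset[of UNIV fld 0] by auto
  have D1: "?D1 \<subseteq> topspace (lv fld (Suc 0))" using idom_subset[of UNIV fld "Suc 0"] by auto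
  have cf: "continuous_map euclideanreal euclideanreal f"
    using DERIV_isCont[OF f] by (simp add: continuous_on_eq_continuous_at)
  have cF: "continuous_map VT VT (\<lambda>x. g (f (h x)))"
    by (rule cont_comp[OF cont_g cont_comp[OF cf cont_h]])
  have "cont_on pt fld VT 0 ?D (\<lambda>z. g (f (h (base (snd z)))))"
  proof (rule cont_onI[OF D])
    fix S assume "continuous_map S (lv fld 0) snd"
    from cont_comp[OF cF, of S "\<lambda>z. base (snd z)"] cont_base[OF this]
    show "continuous_map S VT (\<lambda>z. g (f (h (base (snd z)))))" by simp
  qed
  then show "cont_on pt fld (vtop fld) 0 ?D (\<lambda>z. g (f (h (base (snd z)))))" by simp
  let ?G = "\<lambda>z. g (f' (h (base (pnt (snd z)) + g (fst z) * (par (snd z) * base (dir (snd z))))))"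
  have lin: "cdiff k TP fld fld (Suc 0) D (\<lambda>z. base (sel (snd z)))"
    if "D \<subseteq> topspace TP \<times> topspace (lv fld (Suc 0))" "sel = pnt \<or> sel = dir" for TP :: "'p topology" and D sel
  proof (rule cdiff_lin[where l = "\<lambda>w. base (sel w)", OF _ _ that(1)])
    show "continuous_map (lv fld (Suc 0)) (vtop fld) (\<lambda>w. base (sel w))"
      using that(2) cont_base[OF cont_pnt[OF cont_ident], of fld] cont_base[OF cont_dir[OF cont_ident], of fld] by auto
    show "base (sel (istep fld x y t)) = base (sel x) + scale fld t (base (sel y))"
      if "x \<in> topspace (lv fld (Suc 0))" "y \<in> topspace (lv fld (Suc 0))" for x y t
      using that \<open>sel = pnt \<or> sel = dir\<close> unfolding lv_Suc lv_0 by auto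
  qed
  have D1': "{0..1} \<times> ?D1 \<subseteq> topspace ivl \<times> topspace (lv fld (Suc 0))" using D1 by auto
  have cg: "continuous_map ivl VT g" by (rule continuous_map_from_subtopology[OF cont_g])
  \<comment> \<open>The argument of \<open>f'\<close> is polynomial in the entries of
    \<open>(x, y, t)\<close> and in \<open>g s\<close>, hence differentiable with \<open>s\<close>
    as parameter.\<close>
  have "cdiff k ivl fld fld (Suc 0) ({0..1} \<times> ?D1) ?G"
    using D1' cg
    by (intro fsmooth_comp[OF f'] cdiff_add[OF tvs_fld] cdiff_mult lin cdiff_par cdiff_param[OF tvs_fld]) auto
  from cdiff_integral[OF this D1]
  have "cdiff k pt fld fld (Suc 0) ({()} \<times> ?D1)
     (\<lambda>z. base (dir (snd z)) * g (integral {0..1} (\<lambda>s. h (?G (s, snd z)))))"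
    by (intro cdiff_mult lin) (use D1 in auto)
  then show "cdiff k pt fld fld (Suc 0) (dq_dom fld 0 ?D)
     (\<lambda>z. base (dir (snd z)) * g (integral {0..1} (\<lambda>s. h (?G (s, snd z)))))"
    by (simp only: dq_dom_idom)
  fix p x y t assume z: "(p, x) \<in> ?D" "y \<in> topspace (lv fld 0)" "(p, istep fld x y t) \<in> ?D"
  obtain a b where ab: "x = Base a" "y = Base b" using z(1,2) unfolding lv_0 by auto
  let ?\<phi> = "\<lambda>s. f (h a + s * (h t * h b))"
  have der: "(?\<phi> has_vector_derivative (h t * h b) * f' (h a + s * (h t * h b))) (at s within {0..1})" for s
  proof -
    have "((\<lambda>s. h a + s * (h t * h b)) has_real_derivative (h t * h b)) (at s within {0..1})"
      by (auto intro!: derivative_eq_intros)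
    from DERIV_chain2[OF f this] show ?thesis
      by (simp add: has_real_derivative_iff_has_vector_derivative mult.commute)
  qed
  have "((\<lambda>s. (h t * h b) * f' (h a + s * (h t * h b))) has_integral (?\<phi> 1 - ?\<phi> 0)) {0..1}"
    by (rule fundamental_theorem_of_calculus) (use der in auto)
  from integral_unique[OF this]
  have "(h t * h b) * integral {0..1} (\<lambda>s. f' (h a + s * (h t * h b))) = f (h a + h t * h b) - f (h a)"
    by simp
  then have "f (h (a + t * b)) = f (h a) + h t * (h b * integral {0..1} (\<lambda>s. f' (h a + s * (h t * h b))))"
    by (simp add: h_simps mult.assoc)
  then have "g (f (h (a + t * b))) = g (f (h a)) + t * (b * g (integral {0..1} (\<lambda>s. f' (h a + s * (h t * h b)))))"
    by (simp add: g_simps)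
  then show "g (f (h (base (snd (p, istep fld x y t))))) = g (f (h (base (snd (p, x))))) +
     scale fld t (base (dir (snd (p, Node x y t))) * g (integral {0..1} (\<lambda>s. h (?G (s, snd (p, Node x y t))))))"
    by (simp add: ab h_simps)
qed

lemma fsmooth_flat: "fsmooth k (\<lambda>x. g (flat n (h x)))"
proof (induction k arbitrary: n)
  case 0
  show ?case
  proof -
    have cf: "continuous_map euclideanreal euclideanreal (flat n)"
      using flat_deriv by (auto simp: continuous_on_eq_continuous_at intro: DERIV_isCont)
    have cF: "continuous_map VT VT (\<lambda>x. g (flat n (h x)))"
      by (rule cont_comp[OF cont_g cont_comp[OF cf cont_h]])
    have "cont_on pt fld VT 0 ({()} \<times> idom VT fld UNIV 0) (\<lambda>z. g (flat n (h (base (snd z)))))"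
    proof (rule cont_onI)
      show "{()} \<times> idom VT fld UNIV 0 \<subseteq> topspace pt \<times> topspace (lv fld 0)" using idom_subset[of UNIV fld 0] by auto
      fix S assume "continuous_map S (lv fld 0) snd"
      from cont_comp[OF cF, of S "\<lambda>z. base (snd z)"] cont_base[OF this]
      show "continuous_map S VT (\<lambda>z. g (flat n (h (base (snd z)))))" by simp
    qed
    then show ?thesis by simp
  qed
next
  case (Suc k)
  have "fsmooth k (\<lambda>x. g (- real n) * g (flat (Suc n) (h x)) + g (flat (Suc (Suc n)) (h x)))"
    using cdiff_add[OF tvs_fld cdiff_const_scale[OF tvs_fld Suc.IH, of "g (- real n)"] Suc.IH] by simp
  then have "fsmooth k (\<lambda>x. g (- real n * flat (Suc n) (h x) + flat (Suc (Suc n)) (h x)))"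
    by (simp only: g_simps)
  then show ?case by (rule fsmooth_deriv[OF flat_deriv])
qed

lemma field_bump_real:
  assumes e: "e > 0"
  shows "\<exists>\<psi>. field_bump e \<psi>"
proof -
  let ?u = "\<lambda>x. g (flat 0 (h x))"
  have "openin euclideanreal {s \<in> topspace euclideanreal. g s \<in> {y. av (y - 0) < e}}"
    by (rule openin_continuous_map_preimage[OF cont_g openin_ball])
  then have "open {s. av (g s) < e}" by simp
  moreover have "(0::real) \<in> {s. av (g s) < e}" using e by (simp, metis gh h_simps(4) av_zero)
  ultimately obtain c where c: "c > 0" "\<And>s. \<bar>s\<bar> < c \<Longrightarrow> av (g s) < e"
    unfolding open_dist by (auto simp: dist_real_def)
  have far: "c \<le> \<bar>h x\<bar>" if "e \<le> av x" for x
    using c(2)[of "h x"] that by (force simp: not_less[symmetric])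
  \<comment> \<open>Scaled so that \<open>\<bar>h x\<bar> \<le> c / 2\<close> gives
    \<open>h (X x) \<le> 1\<close> and \<open>\<bar>h x\<bar> \<ge> c\<close> gives
    \<open>h (X x) \<ge> 4\<close>. Squaring avoids the absolute value, which is not smooth at
    0.\<close>
  define X where "X x = (g (2 / c) * x) * (g (2 / c) * x)" for x
  have hX: "h (X x) = (2 / c * h x)\<^sup>2" for x by (simp add: X_def h_simps power2_eq_square)
  \<comment> \<open>The usual smooth transition from 1, where \<open>X\<close> is at most 1, to 0,
    where it is at least 4. As \<open>4 - X\<close> and \<open>X - 1\<close> are never both at most
    0, the denominator does not vanish.\<close>
  define \<psi> where "\<psi> x = ?u (g 4 - X x) * inverse (?u (g 4 - X x) + ?u (X x - g 1))" for x
  have nz: "?u (g 4 - X x) + ?u (X x - g 1) \<noteq> 0" for x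
  proof -
    have "h (?u (g 4 - X x) + ?u (X x - g 1)) > 0"
    proof (cases "h (X x) < 4")
      case True then show ?thesis
        using flat_pos[of "4 - h (X x)"] flat_nonneg[of "h (X x) - 1"] by (simp add: h_simps)
    next
      case False then show ?thesis
        using flat_nonneg[of "4 - h (X x)"] flat_pos[of "h (X x) - 1"] by (simp add: h_simps)
    qed
    then show ?thesis using h_simps(4) by (metis less_irrefl)
  qed
  have eq: "(2 / c * \<bar>h x\<bar>)\<^sup>2 = h (X x)" for x
    unfolding hX by (simp only: power_mult_distrib power2_abs)
  have "fsmooth k \<psi>" for k
  proof -
    let ?D = "{()} \<times> idom VT fld UNIV 0"
    have D: "?D \<subseteq> topspace pt \<times> topspace (lv fld 0)" using idom_subset[of UNIV fld 0] by auto
    have cst: "cdiff k pt fld fld 0 ?D (\<lambda>z. c)" for c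
      by (rule cdiff_param[OF tvs_fld _ D, of "\<lambda>_. c"]) simp
    have sX: "cdiff k pt fld fld 0 ?D (\<lambda>z. X (base (snd z)))"
      unfolding X_def using cdiff_base[OF D] by (intro cdiff_mult cst) auto
    show ?thesis
      unfolding \<psi>_def
      by (intro cdiff_mult cdiff_inverse[OF tvs_fld] cdiff_add[OF tvs_fld] fsmooth_comp[OF fsmooth_flat]
          cdiff_diff[OF tvs_fld] cst sX nz)
  qed
  moreover have "\<psi> x = 0" if "e \<le> av x" for x
  proof -
    have "2 \<le> 2 / c * \<bar>h x\<bar>" using far[OF that] c(1) by (simp add: field_simps)
    then have "2\<^sup>2 \<le> (2 / c * \<bar>h x\<bar>)\<^sup>2" by (rule power_mono) simp
    then have "4 \<le> h (X x)" unfolding eq by simp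
    then have "?u (g 4 - X x) = g 0" using flat_zero[of "4 - h (X x)" 0] by (simp add: h_simps)
    then show ?thesis using gh[of 0] by (simp add: \<psi>_def h_simps)
  qed
  moreover have "\<exists>d>0. \<forall>x. av x < d \<longrightarrow> \<psi> x = 1"
  proof -
    have "openin VT {x \<in> topspace VT. h x \<in> {-(c/2)<..<c/2}}"
      by (rule openin_continuous_map_preimage[OF cont_h]) simp
    moreover have "0 \<in> {x \<in> topspace VT. h x \<in> {-(c/2)<..<c/2}}" using c(1) by (simp add: h_simps)
    ultimately obtain d where d: "d > 0" "\<And>x. av (x - 0) < d \<Longrightarrow> x \<in> {x \<in> topspace VT. h x \<in> {-(c/2)<..<c/2}}"
      unfolding openin_VT by blast
    have "\<psi> x = 1" if "av x < d" for x
    proof -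
      have "\<bar>h x\<bar> < c / 2" using d(2)[of x] that by auto
      then have "2 / c * \<bar>h x\<bar> \<le> 1" using c(1) by (simp add: field_simps)
      then have "(2 / c * \<bar>h x\<bar>)\<^sup>2 \<le> 1\<^sup>2" by (rule power_mono) (use c(1) in simp)
      then have "h (X x) \<le> 1" unfolding eq by simp
      then have "?u (X x - g 1) = g 0" using flat_zero[of "h (X x) - 1" 0] by (simp add: h_simps)
      then have "?u (X x - g 1) = 0" using gh[of 0] by (simp add: h_simps)
      then show ?thesis using nz[of x] by (simp add: \<psi>_def)
    qed
    then show ?thesis using d(1) by blast
  qed
  ultimately show ?thesis unfolding field_bump_def by blast
qed

end

section \<open>Cutoff operators\<close>

locale cutoffs = test_functions av av' emb r M E I U
  for av :: "'k::field \<Rightarrow> real" and av' :: "'a::field \<Rightarrow> real" and emb :: "'a \<Rightarrow> 'k"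
    and r :: enat and M :: "('a, 'z::ab_group_add, 'm) manifold" and E :: "('k, 'e::ab_group_add) tvs"
    and I :: "'i set" and U :: "'i \<Rightarrow> 'm set" +
  assumes fd: "finite_dimensional_tvs (model M)" and bump: "\<And>e. e > 0 \<Longrightarrow> \<exists>\<psi>. F.field_bump e \<psi>"
begin

section \<open>Multiplication operators and their control\<close>

definition mul :: "('m \<Rightarrow> 'a) \<Rightarrow> ('m \<Rightarrow> 'e) \<Rightarrow> 'm \<Rightarrow> 'e" where
  "mul m \<gamma> = (\<lambda>x. scale E (emb (m x)) (\<gamma> x))"

lemma emb_01: "emb 0 = 0" "emb 1 = 1"
proof -
  have "emb (0 + 0) = emb 0 + emb 0" by (rule emb_simps(2))
  then show "emb 0 = 0" by (metis add_0 add_right_cancel)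
qed (rule emb_simps(1))

lemma mul_simps: "mul m (\<gamma> + \<eta>) = mul m \<gamma> + mul m \<eta>" "mul m (\<gamma> - \<eta>) = mul m \<gamma> - mul m \<eta>" "mul m 0 = 0"
  "m x = 1 \<Longrightarrow> mul m \<gamma> x = \<gamma> x" "m x = 0 \<Longrightarrow> mul m \<gamma> x = 0" "\<gamma> x = 0 \<Longrightarrow> mul m \<gamma> x = 0"
  "mul m (fun_scale (scale E) c \<gamma>) = fun_scale (scale E) c (mul m \<gamma>)"
  by (auto simp: mul_def fun_eq_iff emb_01 fun_scale_def K.scale_simps[OF E] mult.commute)

text \<open>A bump in a chart inside \<open>U i\<close>, extended by 0. In any chart of
  \<open>M\<close> the product is differentiable on the overlap with the chart of the bump, and it
  is 0 off the compact set \<open>C\<close>; \<open>cdiff_local\<close> joins these two open parts.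
  The source is \<open>Ti i\<close> because nothing outside \<open>U i\<close> enters the
  product.\<close>

lemma local_multiplier:
  assumes i: "i \<in> I" and p: "p \<in> U i"
  obtains m A C where "openin (mtop M) A" "p \<in> A" "\<And>x. x \<in> A \<Longrightarrow> m x = 1" "compactin (mtop M) C" "C \<subseteq> U i"
    "\<And>x. x \<notin> C \<Longrightarrow> m x = 0" "continuous_map (Ti i) Ct (mul m)"
proof -
  have Z: "F.tvs (model M)" using M by (simp add: Cr_manifold_def)
  have ch: "is_chart (mtop M) (model M) d" if "d \<in> atlas M" for d using M that by (simp add: Cr_manifold_def)
  obtain A0 \<kappa> where A0: "(A0, \<kappa>) \<in> atlas M" "p \<in> A0" "A0 \<subseteq> U i"
    using F.charts_ok_manifold(3)[OF M lcF lcZ openU[OF i] p] by blast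
  note k = F.chart_props[OF ch[OF A0(1)]]
  let ?V = "\<kappa> ` A0" and ?Z = "topspace (vtop (model M))"
  have VZ: "?V \<subseteq> ?Z" using openin_subset[OF k(2)] .
  obtain \<rho> A' C' where \<rho>: "\<And>k. F.cdiff k (discrete_topology {()}) (model M) F.fld 0 ({()} \<times> idom F.VT (model M) ?Z 0) (\<lambda>z. \<rho> (base (snd z)))"
    and A': "openin (vtop (model M)) A'" "\<kappa> p \<in> A'" "\<And>x. x \<in> A' \<Longrightarrow> \<rho> x = 1"
    and C': "compactin (vtop (model M)) C'" "C' \<subseteq> ?V" "\<And>x. x \<in> ?Z \<Longrightarrow> x \<notin> C' \<Longrightarrow> \<rho> x = 0"
    using F.bump_tvs[OF Z fd lcF bump k(2), of "\<kappa> p"] A0(2) by blast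
  define m where "m x = (if x \<in> A0 then \<rho> (\<kappa> x) else 0)" for x
  have tA0: "topspace (subtopology (mtop M) A0) = A0" using k(4) by auto
  have tV: "topspace (subtopology (vtop (model M)) ?V) = ?V" using VZ by auto
  obtain g where g: "homeomorphic_maps (subtopology (mtop M) A0) (subtopology (vtop (model M)) ?V) \<kappa> g"
    using k(5) homeomorphic_map_maps by blast
  have gk: "g (\<kappa> x) = x" if "x \<in> A0" for x using g that tA0 by (simp add: homeomorphic_maps_def)
  define A where "A = {x \<in> A0. \<kappa> x \<in> A'}"
  have cont\<kappa>: "continuous_map (subtopology (mtop M) A0) (vtop (model M)) \<kappa>"
    using g by (auto simp: homeomorphic_maps_def intro: continuous_map_into_fulltopology)
  have "openin (subtopology (mtop M) A0) A"
    using openin_continuous_map_preimage[OF cont\<kappa> A'(1)] unfolding tA0 A_def .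
  then have A_open: "openin (mtop M) A" by (rule openin_trans_full[OF _ k(1)])
  define C where "C = g ` C'"
  have "compactin (subtopology (mtop M) A0) C"
    unfolding C_def using g C'(1,2) by (intro image_compactin[of "subtopology (vtop (model M)) ?V"])
      (auto simp: compactin_subtopology homeomorphic_maps_def)
  then have C: "compactin (mtop M) C" "C \<subseteq> A0" by (auto simp: compactin_subtopology)
  have m0: "m x = 0" if "x \<notin> C" for x
  proof (cases "x \<in> A0")
    case True
    then have "\<kappa> x \<notin> C'" using that gk[OF True] by (metis C_def imageI)
    then show ?thesis using True C'(3) VZ by (auto simp: m_def)
  qed (simp add: m_def)
  have "continuous_map (Ti i) Ct (mul m)"
  proof (rule F.continuous_map_into_Cr[OF ok rE])
    fix U' \<kappa>' j assume U': "(U', \<kappa>') \<in> atlas M" and j: "enat j \<le> r"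
    note k' = F.chart_props[OF ch[OF U']]
    let ?T = "topspace (Ti i)" and ?S = "prod_topology (Ti i) (F.lv (model M) 0)"
    let ?f = "\<lambda>z. mul m (fst z) (inv_into U' \<kappa>' (base (snd z)))"
    let ?D = "\<lambda>W. ?T \<times> idom F.VT (model M) (\<kappa>' ` W) 0"
    have o: "openin ?S (?D W)" "openin (vtop (model M)) (\<kappa>' ` W)" if "openin (mtop M) W" "W \<subseteq> U'" for W
      using F.open_idom[OF Z k'(6)[OF that(2,1)], of 0] k'(6)[OF that(2,1)] by (auto simp: openin_prod_Times_iff)
    have W1: "openin (mtop M) (U' \<inter> A0)" "U' \<inter> A0 \<subseteq> U'" using k(1) k'(1) by auto
    have W2: "openin (mtop M) (U' - C)" "U' - C \<subseteq> U'" using k'(1) compactin_closed[OF C(1)] by auto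
    have inv': "inv_into U' \<kappa>' (\<kappa>' x) = x" if "x \<in> U'" for x using k'(3) that by simp
    have D2: "F.cdiff j (Ti i) (model M) (res E) 0 (?D (U' - C)) ?f"
    proof (rule F.cdiff_cong)
      show "F.cdiff j (Ti i) (model M) (res E) 0 (?D (U' - C)) (\<lambda>z. 0)"
        using F.cdiff_param[OF rE, of "Ti i" "\<lambda>_. 0" "?D (U' - C)" "model M" 0 j] F.tvs_zero[OF rE]
          openin_subset[OF o(1)[OF W2]] by simp
      fix z assume "z \<in> ?D (U' - C)"
      then obtain x where x: "x \<in> U' - C" "snd z = Base (\<kappa>' x)" by auto
      then show "0 = ?f z" using m0[of x] by (simp add: inv' mul_simps)
    qed
    have D1: "F.cdiff j (Ti i) (model M) (res E) 0 (?D (U' \<inter> A0)) ?f"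
    proof -
      have "compatible_charts F.VT (model M) r (U', \<kappa>') (A0, \<kappa>)" using M U' A0(1) by (auto simp: Cr_manifold_def)
      then have "Ck F.VT (model M) (model M) r (\<kappa>' ` (U' \<inter> A0)) (\<kappa> \<circ> inv_into U' \<kappa>')"
        by (simp add: compatible_charts_def)
      then have \<phi>0: "F.cdiff j (discrete_topology {()}) (model M) (model M) 0 ({()} \<times> idom F.VT (model M) (\<kappa>' ` (U' \<inter> A0)) 0)
          (\<lambda>z. (\<kappa> \<circ> inv_into U' \<kappa>') (base (snd z)))"
        using j unfolding Ck_def F.Ck_nat_iff_cdiff[OF Z Z o(2)[OF W1], symmetric] by blast
      have il: "F.ilin (model M) 0 (model M) 0 (\<lambda>w. w)" by (auto simp: F.ilin_def intro: F.cont_ident)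
      have lift: "F.cdiff j (Ti i) (model M) Y 0 (?T \<times> D) (\<lambda>z. q (snd z))"
        if "F.cdiff j (discrete_topology {()}) (model M) Y 0 ({()} \<times> D) (\<lambda>z. q (snd z))" for Y :: "('a, 'y::ab_group_add) tvs" and D q
        using F.cdiff_precomp[OF that il, of "Ti i" "\<lambda>_. ()" "?T \<times> D"] F.cdiff_dom[OF that] by auto
      let ?\<theta> = "\<lambda>z. Base ((\<kappa> \<circ> inv_into U' \<kappa>') (base (snd z)))"
      \<comment> \<open>The change of charts carries the statement from the chart \<open>A0\<close>,
        where bump and function are known to be differentiable, to the chart
        \<open>U'\<close>.\<close>
      have \<phi>: "F.tdiff 0 j (Ti i) (model M) (model M) 0 (?D (U' \<inter> A0)) ?\<theta>"
        using F.cdiff_precomp[OF \<phi>0 il, of "Ti i" "\<lambda>_. ()" "?D (U' \<inter> A0)"] openin_subset[OF o(1)[OF W1]] by auto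
      let ?DV = "?T \<times> idom F.VT (model M) ?V 0"
      have DV: "?DV \<subseteq> topspace (Ti i) \<times> topspace (F.lv (model M) 0)" using F.idom_subset[OF VZ, of 0] by auto
      have \<rho>': "F.cdiff j (Ti i) (model M) F.fld 0 ?DV (\<lambda>z. \<rho> (base (snd z)))"
        using F.cdiff_precomp[OF \<rho>[of j] il, of "Ti i" "\<lambda>_. ()" ?DV] DV VZ by auto
      have "(A0, \<kappa>) \<in> atlas (open_submanifold M (U i))" using A0 by (simp add: open_submanifold_def)
      from F.cdiff_eval_comp[OF ok'[OF i] rE this j F.cont_ident]
      have ev: "F.cdiff j (Ti i) (model M) (res E) 0 ?DV (\<lambda>z. (fst z) (inv_into A0 \<kappa> (base (snd z))))"
        by (simp add: open_submanifold_def)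
      have D12: "(p, ?\<theta> (p, w)) \<in> ?DV" if "(p, w) \<in> ?D (U' \<inter> A0)" for p w
        using that by (auto simp: inv')
      show ?thesis
      proof (rule F.cdiff_cong[OF F.cdiff_chain[OF F.cdiff_scale[OF rE \<rho>' ev] \<phi> D12]])
        fix z assume "z \<in> ?D (U' \<inter> A0)"
        then obtain x where x: "x \<in> U'" "x \<in> A0" "snd z = Base (\<kappa>' x)" by auto
        then show "scale (res E) (\<rho> (base (snd (fst z, ?\<theta> z)))) (fst (fst z, ?\<theta> z) (inv_into A0 \<kappa> (base (snd (fst z, ?\<theta> z))))) = ?f z"
          using k(3) by (simp add: inv' mul_def m_def scale_res)
      qed
    qed
    show "F.cdiff j (Ti i) (model M) (res E) 0 (?D U') ?f"
    proof (rule F.cdiff_local[OF Z rE o(1)[OF k'(1)]])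
      fix z assume z: "z \<in> ?D U'"
      then obtain x where x: "x \<in> U'" "snd z = Base (\<kappa>' x)" by auto
      show "\<exists>D'. openin ?S D' \<and> z \<in> D' \<and> D' \<subseteq> ?D U' \<and> F.cdiff j (Ti i) (model M) (res E) 0 D' ?f"
      proof (cases "x \<in> C")
        case True
        then show ?thesis using o(1)[OF W1] D1 z x C(2)
          by (intro exI[of _ "?D (U' \<inter> A0)"]) (auto simp: mem_Times_iff)
      next
        case False
        then show ?thesis using o(1)[OF W2] D2 z x
          by (intro exI[of _ "?D (U' - C)"]) (auto simp: mem_Times_iff)
      qed
    qed simp
  next
    fix \<theta> x assume "x \<notin> topspace (mtop M)"
    then have "x \<notin> C" using compactin_subset_topspace[OF C(1)] by auto
    then show "mul m \<theta> x = 0" using m0 by (simp add: mul_simps)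
  qed
  then show ?thesis
    using A0 A' C m0 by (intro that[of A m C, OF A_open]) (auto simp: A_def m_def)
qed

text \<open>Continuity at 0 expressed by the components with index in \<open>B\<close> alone.
  Recording \<open>B\<close> is what later permits a single box neighbourhood for infinitely many
  cutoffs.\<close>

definition controlled :: "'i set \<Rightarrow> ('m \<Rightarrow> 'a) \<Rightarrow> bool" where
  "controlled B m \<longleftrightarrow> (\<forall>\<gamma>\<in>CM. mul m \<gamma> \<in> CM) \<and>
    (\<forall>G. openin Ct G \<longrightarrow> 0 \<in> G \<longrightarrow> (\<exists>W. zero_nbhds W \<and> (\<forall>\<gamma>\<in>CM. (\<forall>i\<in>B. rst i \<gamma> \<in> W i) \<longrightarrow> mul m \<gamma> \<in> G)))"

lemma zero_nbhds_Int: "zero_nbhds W \<Longrightarrow> zero_nbhds W' \<Longrightarrow> zero_nbhds (\<lambda>i. W i \<inter> W' i)"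
  by (auto simp: zero_nbhds_def)

lemma zero_nbhds_top: "zero_nbhds (\<lambda>i. topspace (Ti i))"
  using K.tvs_zero[OF tvs_TV] by (auto simp: zero_nbhds_def)

lemma controlled_0: "controlled B (\<lambda>_. 0)"
proof -
  have "mul (\<lambda>_. 0) \<gamma> = 0" for \<gamma> by (auto simp: fun_eq_iff mul_simps)
  then show ?thesis using CM_0 zero_nbhds_top by (auto simp: controlled_def)
qed

text \<open>Since \<open>m\<close> vanishes off \<open>U i\<close>, the product depends on one
  component only, the restriction to \<open>U i\<close>.\<close>

lemma controlled_local:
  assumes i: "i \<in> B" "B \<subseteq> I" and C: "C \<subseteq> U i" "\<And>x. x \<notin> C \<Longrightarrow> m x = 0" and c: "continuous_map (Ti i) Ct (mul m)"
  shows "controlled B m"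
proof -
  have iI: "i \<in> I" using i by auto
  have e: "mul m (rst i \<gamma>) = mul m \<gamma>" for \<gamma>
  proof
    fix x show "mul m (rst i \<gamma>) x = mul m \<gamma> x"
    proof (cases "x \<in> U i")
      case False
      then have "m x = 0" using C by blast
      then show ?thesis by (simp add: mul_simps)
    qed (simp add: mul_def ext0_def)
  qed
  have 1: "mul m \<gamma> \<in> CM" if "\<gamma> \<in> CM" for \<gamma>
    using continuous_map_image_subset_topspace[OF c] rst_in[OF iI that] e[of \<gamma>] by (auto simp: image_subset_iff)
  have "\<exists>W. zero_nbhds W \<and> (\<forall>\<gamma>\<in>CM. (\<forall>i\<in>B. rst i \<gamma> \<in> W i) \<longrightarrow> mul m \<gamma> \<in> G)" if G: "openin Ct G" "0 \<in> G" for G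
  proof -
    define W where "W j = (if j = i then {\<eta> \<in> topspace (Ti i). mul m \<eta> \<in> G} else topspace (Ti j))" for j
    have "zero_nbhds W"
      using openin_continuous_map_preimage[OF c G(1)] G(2) K.tvs_zero[OF tvs_TV]
      by (auto simp: zero_nbhds_def W_def mul_simps)
    moreover have "mul m \<gamma> \<in> G" if "\<gamma> \<in> CM" "\<forall>i\<in>B. rst i \<gamma> \<in> W i" for \<gamma>
    proof -
      have "rst i \<gamma> \<in> W i" using that(2) i(1) by blast
      then have "mul m (rst i \<gamma>) \<in> G" by (simp add: W_def)
      then show ?thesis by (simp only: e)
    qed
    ultimately show ?thesis by blast
  qed
  then show ?thesis using 1 by (simp add: controlled_def)
qed

text \<open>The combination is \<open>1 - (1 - m1)(1 - m2)\<close>: it is 1 wherever one of the two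
  is 1, and 0 where both vanish. Finite joins of this kind take the place of a partition of
  unity.\<close>

lemma controlled_join:
  assumes B: "B \<subseteq> I" "finite B" and m: "controlled B m1" "controlled B m2"
  shows "controlled B (\<lambda>x. m1 x + m2 x - m1 x * m2 x)"
proof -
  let ?m = "\<lambda>x. m1 x + m2 x - m1 x * m2 x"
  have e: "mul ?m \<gamma> = (mul m1 \<gamma> + mul m2 \<gamma>) + fun_scale (scale E) (-1) (mul m1 (mul m2 \<gamma>))" for \<gamma>
    by (auto simp: mul_def fun_eq_iff fun_scale_def emb_diff emb_simps algebra_simps K.scale_simps[OF E])
      (simp add: emb_simps(2) emb_simps(3) K.scale_simps(6)[OF E] diff_conv_add_uminus K.scale_simps(8)[OF E] del: add_uminus_conv_diff)
  have 1: "mul ?m \<gamma> \<in> CM" if "\<gamma> \<in> CM" for \<gamma>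
    unfolding e using that m by (intro CM_add CM_scale) (auto simp: controlled_def)
  have "\<exists>W. zero_nbhds W \<and> (\<forall>\<gamma>\<in>CM. (\<forall>i\<in>B. rst i \<gamma> \<in> W i) \<longrightarrow> mul ?m \<gamma> \<in> G)" if G: "openin Ct G" "0 \<in> G" for G
  proof -
    have z: "0 \<in> topspace (vtop (CrM r M E))" by (rule K.tvs_zero[OF tvs_CM])
    have split: "\<exists>G1 G2. openin Ct G1 \<and> 0 \<in> G1 \<and> openin Ct G2 \<and> 0 \<in> G2 \<and> (\<forall>v\<in>G1. \<forall>w\<in>G2. v + w \<in> G)"
      if "openin Ct G" "0 \<in> G" for G
    proof -
      have a: "openin (vtop (CrM r M E)) G" "0 + 0 \<in> G" using that by simp_all
      from K.tvs_add_nbhd[OF tvs_CM a z z] show ?thesis by (metis tvs.select_convs(2))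
    qed
    from split[OF G] obtain G1 G2 where G1: "openin Ct G1" "0 \<in> G1" and G2: "openin Ct G2" "0 \<in> G2"
      and G12: "\<And>v w. v \<in> G1 \<Longrightarrow> w \<in> G2 \<Longrightarrow> v + w \<in> G" by blast
    from split[OF G1] obtain G3 G4 where G3: "openin Ct G3" "0 \<in> G3" and G4: "openin Ct G4" "0 \<in> G4"
      and G34: "\<And>v w. v \<in> G3 \<Longrightarrow> w \<in> G4 \<Longrightarrow> v + w \<in> G1" by blast
    obtain G5 where G5: "openin Ct G5" "0 \<in> G5" "\<And>t v. av t \<le> 1 \<Longrightarrow> v \<in> G5 \<Longrightarrow> fun_scale (scale E) t v \<in> G2"
      using K.tvs_bounded[OF tvs_CM, of G2 1] G2 by auto
    have m1: "\<exists>W. zero_nbhds W \<and> (\<forall>\<gamma>\<in>CM. (\<forall>i\<in>B. rst i \<gamma> \<in> W i) \<longrightarrow> mul m1 \<gamma> \<in> G)"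
      and m2: "\<exists>W. zero_nbhds W \<and> (\<forall>\<gamma>\<in>CM. (\<forall>i\<in>B. rst i \<gamma> \<in> W i) \<longrightarrow> mul m2 \<gamma> \<in> G)"
      if "openin Ct G" "0 \<in> G" for G
      using m that unfolding controlled_def by blast+
    from m1[OF G3] obtain W3 where W3: "zero_nbhds W3" "\<And>\<gamma>. \<gamma> \<in> CM \<Longrightarrow> \<forall>i\<in>B. rst i \<gamma> \<in> W3 i \<Longrightarrow> mul m1 \<gamma> \<in> G3" by blast
    from m2[OF G4] obtain W4 where W4: "zero_nbhds W4" "\<And>\<gamma>. \<gamma> \<in> CM \<Longrightarrow> \<forall>i\<in>B. rst i \<gamma> \<in> W4 i \<Longrightarrow> mul m2 \<gamma> \<in> G4" by blast
    from m1[OF G5(1,2)] obtain W5 where W5: "zero_nbhds W5" "\<And>\<gamma>. \<gamma> \<in> CM \<Longrightarrow> \<forall>i\<in>B. rst i \<gamma> \<in> W5 i \<Longrightarrow> mul m1 \<gamma> \<in> G5" by blast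
    \<comment> \<open>The product of \<open>m1\<close> and \<open>m2\<close> acts as
      \<open>mul m1\<close> after \<open>mul m2\<close>, so the inner result has to satisfy the
      conditions \<open>W5\<close> of the outer one; these are finitely many, hence open.\<close>
    define G6 where "G6 = {\<theta> \<in> topspace Ct. \<forall>i\<in>B. rst i \<theta> \<in> W5 i}"
    have "openin Ct G6"
    proof (cases "B = {}")
      case True then show ?thesis using openin_topspace[of Ct] by (simp add: G6_def)
    next
      case False
      have "openin Ct {\<theta> \<in> topspace Ct. rst i \<theta> \<in> W5 i}" if "i \<in> B" for i
        using W5(1) that B(1) by (intro openin_continuous_map_preimage[OF cont_rst]) (auto simp: zero_nbhds_def)
      from openin_INT2[OF B(2) False this] have "openin Ct (\<Inter>i\<in>B. {\<theta> \<in> topspace Ct. rst i \<theta> \<in> W5 i})" by simp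
      moreover have "G6 = (\<Inter>i\<in>B. {\<theta> \<in> topspace Ct. rst i \<theta> \<in> W5 i})" using False by (auto simp: G6_def)
      ultimately show ?thesis by simp
    qed
    moreover have "0 \<in> G6" using W5(1) B(1) CM_0 by (auto simp: G6_def rst_simps zero_nbhds_def)
    ultimately have "\<exists>W. zero_nbhds W \<and> (\<forall>\<gamma>\<in>CM. (\<forall>i\<in>B. rst i \<gamma> \<in> W i) \<longrightarrow> mul m2 \<gamma> \<in> G6)" by (rule m2)
    then obtain W6 where W6: "zero_nbhds W6" "\<And>\<gamma>. \<gamma> \<in> CM \<Longrightarrow> \<forall>i\<in>B. rst i \<gamma> \<in> W6 i \<Longrightarrow> mul m2 \<gamma> \<in> G6" by blast
    have "mul ?m \<gamma> \<in> G" if \<gamma>: "\<gamma> \<in> CM" "\<forall>i\<in>B. rst i \<gamma> \<in> W3 i \<inter> (W4 i \<inter> W6 i)" for \<gamma>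
    proof -
      have "mul m2 \<gamma> \<in> G6" using W6(2) \<gamma> by blast
      then have "mul m1 (mul m2 \<gamma>) \<in> G5" by (intro W5(2)) (auto simp: G6_def)
      then have "fun_scale (scale E) (-1) (mul m1 (mul m2 \<gamma>)) \<in> G2" by (intro G5(3)) auto
      moreover have "mul m1 \<gamma> + mul m2 \<gamma> \<in> G1" using W3(2) W4(2) \<gamma> by (intro G34) blast+
      ultimately show ?thesis unfolding e by (intro G12)
    qed
    then show ?thesis using zero_nbhds_Int[OF W3(1) zero_nbhds_Int[OF W4(1) W6(1)]] by blast
  qed
  then show ?thesis using 1 by (simp add: controlled_def)
qed

text \<open>Each point of \<open>C\<close> has a neighbourhood on which some local multiplier is 1;
  finitely many of these are joined. A point of \<open>C\<close> uses only members that meet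
  \<open>C\<close>, so the controlling index set remains finite.\<close>

lemma compact_cutoff:
  assumes C: "compactin (mtop M) C"
  obtains m where "\<And>x. x \<in> C \<Longrightarrow> m x = 1" "\<And>x. x \<notin> (\<Union>i\<in>{i \<in> I. U i \<inter> C \<noteq> {}}. U i) \<Longrightarrow> m x = 0"
    "controlled {i \<in> I. U i \<inter> C \<noteq> {}} m"
proof -
  let ?B = "{i \<in> I. U i \<inter> C \<noteq> {}}"
  have B: "finite ?B" "?B \<subseteq> I" using finite_meets[OF C] by auto
  have "\<forall>p\<in>C. \<exists>A. openin (mtop M) A \<and> p \<in> A \<and>
     (\<exists>m. (\<forall>x\<in>A. m x = 1) \<and> (\<forall>x. x \<notin> (\<Union>i\<in>?B. U i) \<longrightarrow> m x = 0) \<and> controlled ?B m)"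
  proof
    fix p assume p: "p \<in> C"
    obtain i where i: "i \<in> I" "p \<in> U i"
      using cover compactin_subset_topspace[OF C] p unfolding rc_cover_def by blast
    obtain m A C' where mA: "openin (mtop M) A" "p \<in> A" "\<And>x. x \<in> A \<Longrightarrow> m x = 1" "C' \<subseteq> U i"
      "\<And>x. x \<notin> C' \<Longrightarrow> m x = 0" "continuous_map (Ti i) Ct (mul m)"
      using local_multiplier[OF i] by metis
    have iB: "i \<in> ?B" using i p by auto
    have "controlled ?B m" by (rule controlled_local[OF iB B(2) mA(4-6)])
    moreover have "m x = 0" if "x \<notin> (\<Union>i\<in>?B. U i)" for x using mA(4,5) iB that by blast
    ultimately show "\<exists>A. openin (mtop M) A \<and> p \<in> A \<and>
       (\<exists>m. (\<forall>x\<in>A. m x = 1) \<and> (\<forall>x. x \<notin> (\<Union>i\<in>?B. U i) \<longrightarrow> m x = 0) \<and> controlled ?B m)"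
      using mA(1-3) by (intro exI[of _ A] exI[of _ m] conjI) auto
  qed
  from bchoice[OF this] obtain A where A: "\<forall>p\<in>C. openin (mtop M) (A p) \<and> p \<in> A p \<and>
     (\<exists>m. (\<forall>x\<in>A p. m x = 1) \<and> (\<forall>x. x \<notin> (\<Union>i\<in>?B. U i) \<longrightarrow> m x = 0) \<and> controlled ?B m)" by (rule exE)
  have "\<exists>\<F>. finite \<F> \<and> \<F> \<subseteq> A ` C \<and> C \<subseteq> \<Union>\<F>"
    by (rule compactinD[OF C]) (use A in auto)
  then obtain \<F> where \<F>: "finite \<F>" "\<F> \<subseteq> A ` C" "C \<subseteq> \<Union>\<F>" by blast
  have "\<exists>m. (\<forall>x\<in>\<Union>\<F>. m x = 1) \<and> (\<forall>x. x \<notin> (\<Union>i\<in>?B. U i) \<longrightarrow> m x = 0) \<and> controlled ?B m"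
    using \<F>(1,2)
  proof (induction \<F>)
    case empty then show ?case using controlled_0 by (intro exI[of _ "\<lambda>_. 0"]) auto
  next
    case (insert G \<F>)
    then obtain m1 where m1: "\<forall>x\<in>\<Union>\<F>. m1 x = 1" "\<forall>x. x \<notin> (\<Union>i\<in>?B. U i) \<longrightarrow> m1 x = 0" "controlled ?B m1" by auto
    obtain p where "p \<in> C" "G = A p" using insert.prems by auto
    then obtain m2 where m2: "\<forall>x\<in>G. m2 x = 1" "\<forall>x. x \<notin> (\<Union>i\<in>?B. U i) \<longrightarrow> m2 x = 0" "controlled ?B m2"
      using A by blast
    show ?case
    proof (intro exI[of _ "\<lambda>x. m1 x + m2 x - m1 x * m2 x"] conjI controlled_join[OF B(2,1) m1(3) m2(3)])
      show "\<forall>x\<in>\<Union>(insert G \<F>). m1 x + m2 x - m1 x * m2 x = 1" using m1(1) m2(1) by auto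
      show "\<forall>x. x \<notin> (\<Union>i\<in>?B. U i) \<longrightarrow> m1 x + m2 x - m1 x * m2 x = 0" using m1(2) m2(2) by simp
    qed
  qed
  then show ?thesis using \<F>(3) that by (meson subsetD)
qed

text \<open>A cutoff leads from the box topology to the space of functions supported in
  \<open>K\<close>, where the hypotheses on \<open>f\<close> apply.\<close>

lemma cont_mul:
  assumes m: "controlled B m" and K: "compactin (mtop M) K" "\<And>x. x \<notin> K \<Longrightarrow> m x = 0" and B: "B \<subseteq> I"
  shows "continuous_map (vtop XM) (vtop (XK K)) (mul m)" "\<gamma> \<in> CcM \<Longrightarrow> mul m \<gamma> \<in> CKM K"
proof -
  show in': "mul m \<gamma> \<in> CKM K" if "\<gamma> \<in> CcM" for \<gamma>
    using that m K(2) unfolding CrK_iff[OF K(1)] Crc_iff controlled_def by (auto simp: mul_simps)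
  have inC: "mul m \<gamma> \<in> CM" if "\<gamma> \<in> CcM" for \<gamma> using in'[OF that] CrK_iff[OF K(1)] by blast
  have "continuous_map (vtop XM) Ct (mul m)"
    unfolding continuous_map
  proof (intro conjI allI impI)
    show "mul m ` topspace (vtop XM) \<subseteq> topspace Ct" using inC by auto
    fix G assume G: "openin Ct G"
    show "openin (vtop XM) {\<gamma> \<in> topspace (vtop XM). mul m \<gamma> \<in> G}"
      unfolding openin_XM
    proof (intro conjI ballI)
      fix \<gamma> assume "\<gamma> \<in> {\<gamma> \<in> topspace (vtop XM). mul m \<gamma> \<in> G}"
      then have \<gamma>: "\<gamma> \<in> CcM" "mul m \<gamma> \<in> G" by auto
      have "openin Ct {\<theta> \<in> topspace Ct. mul m \<gamma> + \<theta> \<in> G}"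
        using K.tvs_translate[OF tvs_CM, of G "mul m \<gamma>"] G inC[OF \<gamma>(1)] by simp
      moreover have "0 \<in> {\<theta> \<in> topspace Ct. mul m \<gamma> + \<theta> \<in> G}" using CM_0 \<gamma>(2) by simp
      ultimately have "\<exists>W. zero_nbhds W \<and> (\<forall>\<eta>\<in>CM. (\<forall>i\<in>B. rst i \<eta> \<in> W i) \<longrightarrow> mul m \<eta> \<in> {\<theta> \<in> topspace Ct. mul m \<gamma> + \<theta> \<in> G})"
        by (rule m[unfolded controlled_def, THEN conjunct2, rule_format])
      then obtain W where W: "zero_nbhds W"
        "\<And>\<eta>. \<eta> \<in> CM \<Longrightarrow> \<forall>i\<in>B. rst i \<eta> \<in> W i \<Longrightarrow> mul m \<eta> \<in> {\<theta> \<in> topspace Ct. mul m \<gamma> + \<theta> \<in> G}" by blast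
      have "\<eta> \<in> {\<gamma> \<in> topspace (vtop XM). mul m \<gamma> \<in> G}" if \<eta>: "\<eta> \<in> CcM" "\<forall>i\<in>I. rst i (\<eta> - \<gamma>) \<in> W i" for \<eta>
      proof -
        have "mul m \<gamma> + mul m (\<eta> - \<gamma>) \<in> G"
          using W(2)[of "\<eta> - \<gamma>"] CcM_diff[OF \<eta>(1) \<gamma>(1)] \<eta>(2) B Crc_iff by blast
        then show ?thesis using \<eta>(1) by (simp add: mul_simps)
      qed
      then show "\<exists>W. zero_nbhds W \<and> (\<forall>\<eta>\<in>CcM. (\<forall>i\<in>I. rst i (\<eta> - \<gamma>) \<in> W i) \<longrightarrow> \<eta> \<in> {\<gamma> \<in> topspace (vtop XM). mul m \<gamma> \<in> G})"
        using W(1) by blast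
    qed auto
  qed
  then show "continuous_map (vtop XM) (vtop (XK K)) (mul m)"
    using in' by (auto simp: CrK_def intro!: continuous_map_into_subtopology)
qed

text \<open>The cutoff \<open>m l\<close> constrains only indices in \<open>B l\<close>, and an
  index \<open>i\<close> is constrained by finitely many \<open>l\<close>. The constraints at
  \<open>i\<close> therefore intersect in an open set, and all together they form one box.\<close>

lemma uniform_cutoff_nbhd:
  assumes m: "\<And>l. l \<in> L \<Longrightarrow> controlled (B l) (m l)" and B: "\<And>i. i \<in> I \<Longrightarrow> finite {l \<in> L. i \<in> B l}"
    and BI: "\<And>l. l \<in> L \<Longrightarrow> B l \<subseteq> I" and G: "\<And>l. l \<in> L \<Longrightarrow> openin Ct (G l) \<and> 0 \<in> G l"
  obtains W where "zero_nbhds W" "\<And>l \<gamma>. l \<in> L \<Longrightarrow> \<gamma> \<in> CM \<Longrightarrow> \<forall>i\<in>I. rst i \<gamma> \<in> W i \<Longrightarrow> mul (m l) \<gamma> \<in> G l"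
proof -
  have "\<forall>l\<in>L. \<exists>W. zero_nbhds W \<and> (\<forall>\<gamma>\<in>CM. (\<forall>i\<in>B l. rst i \<gamma> \<in> W i) \<longrightarrow> mul (m l) \<gamma> \<in> G l)"
    using m G unfolding controlled_def by blast
  from bchoice[OF this] obtain W where W: "\<forall>l\<in>L. zero_nbhds (W l) \<and> (\<forall>\<gamma>\<in>CM. (\<forall>i\<in>B l. rst i \<gamma> \<in> W l i) \<longrightarrow> mul (m l) \<gamma> \<in> G l)"
    by (rule exE)
  define W' where "W' i = topspace (Ti i) \<inter> (\<Inter>l\<in>{l \<in> L. i \<in> B l}. W l i)" for i
  have "openin (Ti i) (W' i)" if i: "i \<in> I" for i
  proof (cases "{l \<in> L. i \<in> B l} = {}")
    case True
    then have "W' i = topspace (Ti i)" by (auto simp: W'_def)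
    then show ?thesis using openin_topspace by metis
  next
    case False
    have "openin (Ti i) (W l i)" if "l \<in> {l \<in> L. i \<in> B l}" for l using W that i by (auto simp: zero_nbhds_def)
    from openin_INT2[OF B[OF i] False this] show ?thesis unfolding W'_def by (intro openin_Int) auto
  qed
  moreover have "0 \<in> W' i" if "i \<in> I" for i
    using W K.tvs_zero[OF tvs_TV[OF that]] that by (auto simp: W'_def zero_nbhds_def)
  ultimately have "zero_nbhds W'" by (simp add: zero_nbhds_def)
  moreover have "mul (m l) \<gamma> \<in> G l" if "l \<in> L" "\<gamma> \<in> CM" "\<forall>i\<in>I. rst i \<gamma> \<in> W' i" for l \<gamma>
  proof -
    have "\<forall>i\<in>B l. rst i \<gamma> \<in> W l i" using that BI[OF that(1)] by (auto simp: W'_def)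
    then show ?thesis using W that(1,2) by blast
  qed
  ultimately show ?thesis using that by blast
qed

end

section \<open>Points of the iterated domains as trees\<close>

primrec leaves :: "('v, 'k) iter \<Rightarrow> 'v set" where
  "leaves (Base x) = {x}"
| "leaves (Node x y t) = leaves x \<union> leaves y"

primrec agree_on :: "'m set \<Rightarrow> ('m \<Rightarrow> 'e, 'k) iter \<Rightarrow> ('m \<Rightarrow> 'e, 'k) iter \<Rightarrow> bool" where
  "agree_on S (Base x) w \<longleftrightarrow> (\<exists>x'. w = Base x' \<and> (\<forall>p\<in>S. x p = x' p))"
| "agree_on S (Node x y t) w \<longleftrightarrow> (\<exists>x' y'. w = Node x' y' t \<and> agree_on S x x' \<and> agree_on S y y')"

text \<open>The leaf reached by \<open>pnt\<close> alone is the base point and is measured by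
  \<open>B\<close>; all other leaves are directions and are measured by \<open>S\<close>.\<close>

primrec in_box :: "('k \<Rightarrow> real) \<Rightarrow> 'v set \<Rightarrow> 'v set \<Rightarrow> real \<Rightarrow> ('v, 'k) iter \<Rightarrow> bool" where
  "in_box av B S R (Base x) \<longleftrightarrow> x \<in> B"
| "in_box av B S R (Node x y t) \<longleftrightarrow> in_box av B S R x \<and> in_box av S S R y \<and> av t \<le> R"

text \<open>Parameters are merely kept within distance 1, because a bound on them is all that the
  rescaling asks for.\<close>

primrec near :: "('k \<Rightarrow> real) \<Rightarrow> 'v::minus set \<Rightarrow> ('v, 'k::minus) iter \<Rightarrow> ('v, 'k) iter \<Rightarrow> bool" where
  "near av S (Base x) w \<longleftrightarrow> base w - x \<in> S"
| "near av S (Node x y t) w \<longleftrightarrow> near av S x (pnt w) \<and> near av S y (dir w) \<and> av (par w - t) < 1"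

primrec spine :: "('v, 'k) iter \<Rightarrow> 'v" where
  "spine (Base x) = x"
| "spine (Node x y t) = spine x"

text \<open>The point over \<open>x\<close> whose directions and parameters are all 0; quotients of
  positive order vanish there.\<close>

primrec bpoint :: "'v::zero \<Rightarrow> nat \<Rightarrow> ('v, 'k::zero) iter" where
  "bpoint x 0 = Base x"
| "bpoint x (Suc m) = Node (bpoint x m) (bpoint 0 m) 0"

text \<open>A leaf \<open>b\<close> of the second tree is replaced by \<open>a + c (b - a)\<close>,
  with \<open>a\<close> the corresponding leaf of the reference tree; parameters are those of the
  second tree. For a cutoff \<open>c\<close> the result equals \<open>b\<close> where the cutoff is
  1 and leaves the reference \<open>a\<close> only inside the support of the cutoff.\<close>

primrec cut :: "('v::ab_group_add \<Rightarrow> 'v) \<Rightarrow> ('v, 'k) iter \<Rightarrow> ('v, 'k) iter \<Rightarrow> ('v, 'k) iter" where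
  "cut c (Base x) w = Base (x + c (base w - x))"
| "cut c (Node x y t) w = Node (cut c x (pnt w)) (cut c y (dir w)) (par w)"

lemma finite_leaves: "finite (leaves w)"
  by (induction w) auto

context top_field
begin

lemma lv_leaves: "w \<in> topspace (lv X m) \<Longrightarrow> leaves w \<subseteq> topspace (vtop X)"
  by (induction m arbitrary: w) (fastforce simp: lv_0 lv_Suc)+

lemma lv_change: "w \<in> topspace (lv X m) \<Longrightarrow> leaves w \<subseteq> topspace (vtop X') \<Longrightarrow> w \<in> topspace (lv X' m)"
  by (induction m arbitrary: w) (fastforce simp: lv_0 lv_Suc)+

lemma leaves_istep:
  assumes "x \<in> topspace (lv X m)" "y \<in> topspace (lv X m)" "leaves x \<subseteq> S" "leaves y \<subseteq> S"
    "\<And>a b t. a \<in> S \<Longrightarrow> b \<in> S \<Longrightarrow> a + scale X t b \<in> S"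
  shows "leaves (istep X x y t) \<subseteq> S"
  using assms(1-4)
proof (induction m arbitrary: x y)
  case 0 then show ?case using assms(5) by (auto simp: lv_0)
next
  case (Suc m)
  then obtain a b s a' b' s' where [simp]: "x = Node a b s" "y = Node a' b' s'"
    and *: "a \<in> topspace (lv X m)" "b \<in> topspace (lv X m)" "a' \<in> topspace (lv X m)" "b' \<in> topspace (lv X m)"
    by (auto simp: lv_Suc)
  show ?case using Suc.IH[OF *(1,3)] Suc.IH[OF *(2,4)] Suc.prems by simp
qed

lemma agree_on_istep:
  assumes "x \<in> topspace (lv X m)" "y \<in> topspace (lv X m)" "agree_on S x x'" "agree_on S y y'"
    "\<And>a a' b b' p. a p = a' p \<Longrightarrow> b p = b' p \<Longrightarrow> (a + scale X t b) p = (a' + scale X t b') p"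
  shows "agree_on S (istep X x y t) (istep X x' y' t)"
  using assms(1-4)
proof (induction m arbitrary: x y x' y')
  case 0
  then obtain a b where [simp]: "x = Base a" "y = Base b" by (auto simp: lv_0)
  obtain a' b' where [simp]: "x' = Base a'" "y' = Base b'" and "\<forall>p\<in>S. a p = a' p" "\<forall>p\<in>S. b p = b' p"
    using 0 by auto
  then show ?case using assms(5)[of a _ a' b b'] by simp
next
  case (Suc m)
  then obtain a b s c d u where [simp]: "x = Node a b s" "y = Node c d u"
    and *: "a \<in> topspace (lv X m)" "b \<in> topspace (lv X m)" "c \<in> topspace (lv X m)" "d \<in> topspace (lv X m)"
    by (auto simp: lv_Suc)
  obtain a' b' c' d' where [simp]: "x' = Node a' b' s" "y' = Node c' d' u"
    and "agree_on S a a'" "agree_on S b b'" "agree_on S c c'" "agree_on S d d'" using Suc.prems by auto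
  then show ?case using Suc.IH[OF *(1,3)] Suc.IH[OF *(2,4)] by simp
qed

lemma lv_incl:
  assumes "continuous_map (vtop X) (vtop X') (\<lambda>x. x)"
  shows "continuous_map (lv X m) (lv X' m) (\<lambda>w. w)"
proof (induction m)
  case 0
  have "continuous_map (lv X 0) (lv X' 0) (\<lambda>w. Base (base w))"
    by (rule cont_Base[OF cont_comp[OF assms cont_base[OF cont_ident]]])
  then show ?case by (rule cont_cong) (auto simp: lv_0)
next
  case (Suc m)
  have "continuous_map (lv X (Suc m)) (lv X' (Suc m)) (\<lambda>w. Node (pnt w) (dir w) (par w))"
    by (intro cont_Node cont_comp[OF Suc.IH cont_pnt[OF cont_ident]] cont_comp[OF Suc.IH cont_dir[OF cont_ident]]
        cont_par[OF cont_ident])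
  then show ?case by (rule cont_cong) (auto simp: lv_Suc)
qed

lemma cont_cut:
  assumes X: "tvs X" and u: "u \<in> topspace (lv X m)" and c: "continuous_map (vtop X) (vtop X') c"
    and i: "leaves u \<subseteq> topspace (vtop X')" "tvs X'"
  shows "continuous_map (lv X m) (lv X' m) (cut c u)"
  using u i(1)
proof (induction m arbitrary: u)
  case 0
  then obtain x where x: "u = Base x" "x \<in> topspace (vtop X)" "x \<in> topspace (vtop X')" by (auto simp: lv_0)
  have "continuous_map (lv X 0) (vtop X) (\<lambda>w. base w - x)"
    by (intro tvs_cont_diff[OF X] cont_base[OF cont_ident]) (use x in auto)
  from cont_comp[OF c this] show ?case
    unfolding x(1) cut.simps by (intro cont_Base tvs_cont_add[OF i(2)] cont_const x(3))
next
  case (Suc m)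
  then obtain x y t where [simp]: "u = Node x y t" and xy: "x \<in> topspace (lv X m)" "y \<in> topspace (lv X m)"
    by (auto simp: lv_Suc)
  have "continuous_map (lv X (Suc m)) (lv X' (Suc m)) (\<lambda>w. Node (cut c x (pnt w)) (cut c y (dir w)) (par w))"
    using Suc.prems
    by (intro cont_Node cont_comp[OF Suc.IH[OF xy(1)] cont_pnt[OF cont_ident]] cont_comp[OF Suc.IH[OF xy(2)] cont_dir[OF cont_ident]]
        cont_par[OF cont_ident]) auto
  then show ?case by simp
qed

lemma cut_self: "c 0 = 0 \<Longrightarrow> cut c u u = u"
  by (induction u) auto

text \<open>On \<open>S\<close> the operator \<open>c\<close> does nothing, so
  \<open>a + c (b - a)\<close> is \<open>b\<close> there for any reference leaf
  \<open>a\<close>.\<close>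

lemma agree_on_cut:
  assumes "u \<in> topspace (lv X m)" "w \<in> topspace (lv X m)" "\<And>\<gamma> p. p \<in> S \<Longrightarrow> c \<gamma> p = \<gamma> p"
  shows "agree_on S w (cut c u w)"
  using assms(1,2)
proof (induction m arbitrary: u w)
  case 0 then show ?case using assms(3) by (fastforce simp: lv_0)
next
  case (Suc m) then show ?case by (fastforce simp: lv_Suc)
qed

lemma bpoint_in: "tvs X \<Longrightarrow> x \<in> topspace (vtop X) \<Longrightarrow> bpoint x m \<in> topspace (lv X m)"
  by (induction m arbitrary: x) (auto simp: tvs_zero)

lemma istep_bpoint: "tvs X \<Longrightarrow> x \<in> topspace (vtop X) \<Longrightarrow> istep X (bpoint x m) (bpoint 0 m) t = bpoint x m"
proof (induction m arbitrary: x)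
  case 0 then show ?case by (simp add: scale_simps)
next
  case (Suc m)
  then show ?case using Suc.IH[OF Suc.prems] Suc.IH[OF Suc.prems(1) tvs_zero[OF Suc.prems(1)]] by simp
qed

lemma bpoint_idom: "tvs X \<Longrightarrow> U \<subseteq> topspace (vtop X) \<Longrightarrow> x \<in> U \<Longrightarrow> bpoint x m \<in> idom TK X U m"
proof (induction m)
  case (Suc m)
  then have "x \<in> topspace (vtop X)" by auto
  with Suc show ?case by (auto simp: istep_bpoint bpoint_in tvs_zero)
qed auto

lemma spine_idom: "w \<in> idom TK X U m \<Longrightarrow> spine w \<in> U"
  by (induction m arbitrary: w) (auto simp: idom.simps(2))

lemma spine_leaves: "spine w \<in> leaves w"
  by (induction w) auto

text \<open>The identities behind the rescaling: the second one leaves \<open>x + t y\<close>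
  unchanged while the parameter shrinks, the first one lets the rescaling commute with steps at the
  next level.\<close>

lemma iscale_istep:
  assumes "tvs X" "x \<in> topspace (lv X m)" "y \<in> topspace (lv X m)"
  shows "iscale (scale X) b (istep X x y t) = istep X (iscale (scale X) b x) (iscale (scale X) b y) t"
    "b \<noteq> 0 \<Longrightarrow> istep X x (iscale (scale X) b y) (t / b) = istep X x y t"
  using assms(2,3)
proof (induction m arbitrary: x y)
  case 0
  { case 1 then show ?case by (auto simp: lv_0 scale_simps[OF assms(1)] mult.commute) }
  { case 2 then show ?case by (auto simp: lv_0 scale_simps[OF assms(1)]) }
next
  case (Suc m)
  { case 1
    then obtain a b' s c d u where [simp]: "x = Node a b' s" "y = Node c d u"
    and *: "a \<in> topspace (lv X m)" "b' \<in> topspace (lv X m)" "c \<in> topspace (lv X m)" "d \<in> topspace (lv X m)"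
    by (auto simp: lv_Suc)
    show ?case using Suc.IH(1)[OF *(1,3)] Suc.IH(1)[OF *(2,4)] by (simp add: algebra_simps) }
  { case 2
    then obtain a b' s c d u where [simp]: "x = Node a b' s" "y = Node c d u"
    and *: "a \<in> topspace (lv X m)" "b' \<in> topspace (lv X m)" "c \<in> topspace (lv X m)" "d \<in> topspace (lv X m)"
    by (auto simp: lv_Suc)
    show ?case using Suc.IH(2)[OF 2(1) *(1,3)] Suc.IH(2)[OF 2(1) *(2,4)] 2(1) by simp }
qed

end

context valued
begin

lemma in_box_mono: "in_box av B S R w \<Longrightarrow> B \<subseteq> B' \<Longrightarrow> S \<subseteq> S' \<Longrightarrow> R \<le> R' \<Longrightarrow> in_box av B' S' R' w"
  by (induction w arbitrary: B B') auto

lemma in_box_iscale: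
  assumes "in_box av B S R w"
  shows "in_box av (scale X b ` B) (scale X b ` S) (av b * R) (iscale (scale X) b w)"
  using assms by (induction w arbitrary: B) (auto simp: av_props intro: mult_left_mono)

lemma open_near:
  assumes X: "tvs X" and S: "openin (vtop X) S" and u: "u \<in> topspace (lv X m)"
  shows "openin (lv X m) {w \<in> topspace (lv X m). near av S u w}"
  using u
proof (induction m arbitrary: u)
  case 0
  then obtain x where x: "u = Base x" "x \<in> topspace (vtop X)" by (auto simp: lv_0)
  have "continuous_map (lv X 0) (vtop X) (\<lambda>w. base w - x)"
    by (intro tvs_cont_diff[OF X] cont_base[OF cont_ident]) (use x in auto)
  from openin_continuous_map_preimage[OF this S] show ?case by (simp add: x(1))
next
  case (Suc m)
  then obtain x y t where u: "u = Node x y t" and xy: "x \<in> topspace (lv X m)" "y \<in> topspace (lv X m)"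
    by (auto simp: lv_Suc)
  let ?T = "topspace (lv X (Suc m))"
  have 1: "openin (lv X (Suc m)) {w \<in> ?T. pnt w \<in> {w \<in> topspace (lv X m). near av S x w}}"
    by (rule openin_continuous_map_preimage[OF cont_pnt[OF cont_ident] Suc.IH[OF xy(1)]])
  have 2: "openin (lv X (Suc m)) {w \<in> ?T. dir w \<in> {w \<in> topspace (lv X m). near av S y w}}"
    by (rule openin_continuous_map_preimage[OF cont_dir[OF cont_ident] Suc.IH[OF xy(2)]])
  have 3: "openin (lv X (Suc m)) {w \<in> ?T. par w \<in> {s. av (s - t) < 1}}"
    by (rule openin_continuous_map_preimage[OF cont_par[OF cont_ident] openin_ball])
  have eq: "{w \<in> ?T. near av S u w} = {w \<in> ?T. pnt w \<in> {w \<in> topspace (lv X m). near av S x w}} \<inter>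
     ({w \<in> ?T. dir w \<in> {w \<in> topspace (lv X m). near av S y w}} \<inter> {w \<in> ?T. par w \<in> {s. av (s - t) < 1}})"
    by (auto simp: u lv_Suc)
  show ?case unfolding eq by (intro openin_Int 1 2 3)
qed

lemma near_self: "0 \<in> S \<Longrightarrow> u \<in> topspace (lv X m) \<Longrightarrow> near av S u (u :: ('v::ab_group_add, 'k) iter)"
  by (induction u arbitrary: m) (case_tac m; auto simp: lv_0 lv_Suc)+

text \<open>The directions and parameters of the centre are 0, so intersecting neighbourhoods lets
  one zero neighbourhood and one bound serve all entries at once.\<close>

lemma box_nbhd:
  assumes X: "tvs X"
  shows "openin (lv X m) N \<Longrightarrow> x \<in> topspace (vtop X) \<Longrightarrow> bpoint x m \<in> N \<Longrightarrow>
    \<exists>S e. openin (vtop X) S \<and> 0 \<in> S \<and> e > 0 \<and>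
      (\<forall>w\<in>topspace (lv X m). in_box av {a. a - x \<in> S} S e w \<longrightarrow> w \<in> N)"
proof (induction m arbitrary: N x)
  case 0
  have c: "continuous_map (vtop X) (lv X 0) (\<lambda>v. Base (x + v))"
    by (intro cont_Base tvs_cont_add[OF X] cont_ident cont_const 0)
  let ?S = "{v \<in> topspace (vtop X). Base (x + v) \<in> N}"
  have "openin (vtop X) ?S" by (rule openin_continuous_map_preimage[OF c 0(1)])
  moreover have "0 \<in> ?S" using 0 tvs_zero[OF X] by simp
  moreover have "w \<in> N" if "w \<in> topspace (lv X 0)" "in_box av {a. a - x \<in> ?S} ?S 1 w" for w
    using that by (auto simp: lv_0)
  ultimately show ?case by (intro exI[of _ ?S] exI[of _ 1]) auto
next
  case (Suc m)
  let ?P = "prod_topology (lv X m) (prod_topology (lv X m) VT)"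
  have "continuous_map ?P (lv X (Suc m)) (\<lambda>z. Node (fst z) (fst (snd z)) (snd (snd z)))"
    by (intro cont_Node continuous_map_fst cont_fst[OF continuous_map_snd] cont_snd[OF continuous_map_snd])
  from openin_continuous_map_preimage[OF this Suc.prems(1)]
  have o: "openin ?P {z \<in> topspace ?P. Node (fst z) (fst (snd z)) (snd (snd z)) \<in> N}" .
  have z: "(bpoint x m, (bpoint 0 m, 0)) \<in> {z \<in> topspace ?P. Node (fst z) (fst (snd z)) (snd (snd z)) \<in> N}"
    using Suc.prems bpoint_in[OF X] tvs_zero[OF X] by auto
  from openin_prodE[OF o z] obtain A B' where A: "openin (lv X m) A" and o': "openin (prod_topology (lv X m) VT) B'"
    and A': "bpoint x m \<in> A" and z': "(bpoint 0 m, 0) \<in> B'"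
    and AB': "A \<times> B' \<subseteq> {z \<in> topspace ?P. Node (fst z) (fst (snd z)) (snd (snd z)) \<in> N}" .
  from openin_prodE[OF o' z'] obtain B C where B: "openin (lv X m) B" and C: "openin VT C"
    and B': "bpoint 0 m \<in> B" and C': "0 \<in> C" "B \<times> C \<subseteq> B'" .
  obtain S1 e1 where 1: "openin (vtop X) S1" "0 \<in> S1" "e1 > 0"
    "\<And>w. w \<in> topspace (lv X m) \<Longrightarrow> in_box av {a. a - x \<in> S1} S1 e1 w \<Longrightarrow> w \<in> A"
    using Suc.IH[OF A Suc.prems(2) A'] by blast
  obtain S2 e2 where 2: "openin (vtop X) S2" "0 \<in> S2" "e2 > 0"
    "\<And>w. w \<in> topspace (lv X m) \<Longrightarrow> in_box av {a. a - 0 \<in> S2} S2 e2 w \<Longrightarrow> w \<in> B"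
    using Suc.IH[OF B tvs_zero[OF X] B'] by blast
  obtain e3 where 3: "e3 > 0" "\<And>t. av (t - 0) < e3 \<Longrightarrow> t \<in> C" using C C'(1) unfolding openin_VT by blast
  define e where "e = min (min e1 e2) (e3 / 2)"
  have e: "e > 0" "e \<le> e1" "e \<le> e2" "e < e3" using 1(3) 2(3) 3(1) by (auto simp: e_def min_def)
  have "w \<in> N" if w: "w \<in> topspace (lv X (Suc m))" "in_box av {a. a - x \<in> S1 \<inter> S2} (S1 \<inter> S2) e w" for w
  proof -
    obtain a b t where ab: "w = Node a b t" "a \<in> topspace (lv X m)" "b \<in> topspace (lv X m)" using w(1) by (auto simp: lv_Suc)
    have "in_box av {a. a - x \<in> S1} S1 e1 a" by (rule in_box_mono[of "{a. a - x \<in> S1 \<inter> S2}" "S1 \<inter> S2" e]) (use w ab e in auto)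
    moreover have "in_box av {a. a - 0 \<in> S2} S2 e2 b" by (rule in_box_mono[of "S1 \<inter> S2" "S1 \<inter> S2" e]) (use w ab e in auto)
    moreover have "t \<in> C" using w ab e by (intro 3(2)) auto
    ultimately have "(a, (b, t)) \<in> A \<times> B'" using 1(4) 2(4) ab C'(2) by auto
    then show ?thesis using AB' ab(1) by auto
  qed
  then show ?case using 1 2 e(1) by (intro exI[of _ "S1 \<inter> S2"] exI[of _ e]) (auto intro: openin_Int)
qed

text \<open>If \<open>c\<close> kills \<open>x\<close> and the leaf \<open>a\<close> of
  \<open>u\<close>, then \<open>c (b - x) = c (b - a)\<close>, which is small for \<open>b\<close>
  close to \<open>a\<close>. Cutting \<open>w\<close> over \<open>bpoint x m\<close> thus gives
  small directions, although those of \<open>u\<close> and \<open>w\<close> may be large. The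
  parameters differ from those of \<open>u\<close> by less than 1, whence
  \<open>R + 1\<close>.\<close>

lemma near_in_box:
  assumes "u \<in> topspace (lv X m)" "w \<in> topspace (lv X m)" "near av S u w" "in_box av UNIV UNIV R u"
    "\<And>a. a \<in> leaves u \<Longrightarrow> c a = 0" "c x = 0" and c: "\<And>a. a \<in> S \<Longrightarrow> c a \<in> S'" "\<And>a b. c (a - b) = c a - c b"
  shows "in_box av {a. a - x \<in> S'} S' (R + 1) (cut c (bpoint x m) w)"
proof -
  have base: "c (b - x) \<in> S'" if "c a = 0" "b - a \<in> S" "c x = 0" for a b x
    using c(1)[OF that(2)] that(1,3) by (simp add: c(2))
  have "c 0 = 0" using c(2)[of 0 0] by simp
  \<comment> \<open>The directions of \<open>bpoint x m\<close> are copies of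
    \<open>bpoint 0 m\<close>, so the version at 0 is carried through the induction.\<close>
  then have "in_box av {a. a - x \<in> S'} S' (R + 1) (cut c (bpoint x m) w) \<and>
    in_box av S' S' (R + 1) (cut c (bpoint 0 m) w)"
    using assms(1-6)
  proof (induction m arbitrary: u w x)
    case 0
    then obtain a b where ab: "u = Base a" "w = Base b" by (auto simp: lv_0)
    show ?case using 0 base[of a b x] base[of a b 0] by (simp add: ab)
  next
    case (Suc m)
    then obtain a b t a' b' t' where u: "u = Node a b t" "w = Node a' b' t'"
      and ab: "a \<in> topspace (lv X m)" "b \<in> topspace (lv X m)" "a' \<in> topspace (lv X m)" "b' \<in> topspace (lv X m)"
      by (auto simp: lv_Suc)
    have "av t' \<le> R + 1" using Suc.prems(4,5) av_props(4)[of "t' - t" t] by (simp add: u)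
    moreover have "in_box av {a. a - x \<in> S'} S' (R + 1) (cut c (bpoint x m) a')"
      "in_box av S' S' (R + 1) (cut c (bpoint 0 m) a')"
      using Suc.IH[OF Suc.prems(1) ab(1,3), of x] Suc.prems by (auto simp: u)
    moreover have "in_box av S' S' (R + 1) (cut c (bpoint 0 m) b')"
      using Suc.IH[OF Suc.prems(1) ab(2,4), of 0] Suc.prems by (auto simp: u)
    ultimately show ?case by (simp add: u)
  qed
  then show ?thesis by blast
qed

lemma in_box_bound: "\<exists>R. in_box av UNIV UNIV R w"
proof (induction w)
  case (Node x y t)
  then obtain R R' where "in_box av UNIV UNIV R x" "in_box av UNIV UNIV R' y" by blast
  then have "in_box av UNIV UNIV (max (max R R') (av t)) (Node x y t)"
    using in_box_mono[of UNIV UNIV R x UNIV UNIV "max (max R R') (av t)"]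
      in_box_mono[of UNIV UNIV R' y UNIV UNIV "max (max R R') (av t)"] by simp
  then show ?case by blast
qed simp

end

section \<open>Almost local maps\<close>

lemma in_box_leaves: "in_box av B S R w \<Longrightarrow> leaves w \<subseteq> B \<union> S"
  by (induction w arbitrary: B) fastforce+

lemma in_box_Int: "in_box av B S R w \<Longrightarrow> leaves w \<subseteq> A \<Longrightarrow> in_box av (B \<inter> A) (S \<inter> A) R w"
  by (induction w arbitrary: B) auto

lemma (in valued) tvs_diff_nbhd:
  assumes X: "tvs X" and W: "openin (vtop X) W" "0 \<in> W"
  obtains A where "openin (vtop X) A" "0 \<in> A" "\<And>v w. v \<in> A \<Longrightarrow> w \<in> A \<Longrightarrow> v - w \<in> W"
proof -
  have "continuous_map (prod_topology (vtop X) (vtop X)) (vtop X) (\<lambda>z. fst z - snd z)"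
    by (intro tvs_cont_diff[OF X] continuous_map_fst continuous_map_snd)
  from openin_continuous_map_preimage[OF this W(1)]
  have o: "openin (prod_topology (vtop X) (vtop X)) {z \<in> topspace (prod_topology (vtop X) (vtop X)). fst z - snd z \<in> W}" .
  have "(0, 0) \<in> {z \<in> topspace (prod_topology (vtop X) (vtop X)). fst z - snd z \<in> W}"
    using W(2) tvs_zero[OF X] by simp
  from openin_prodE[OF o this] obtain A B where AB: "openin (vtop X) A" "openin (vtop X) B" "0 \<in> A" "0 \<in> B"
    "A \<times> B \<subseteq> {z \<in> topspace (prod_topology (vtop X) (vtop X)). fst z - snd z \<in> W}" .
  show ?thesis
  proof (rule that[of "A \<inter> B"])
    fix v w assume "v \<in> A \<inter> B" "w \<in> A \<inter> B"
    then have "(v, w) \<in> A \<times> B" by auto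
    then show "v - w \<in> W" using AB(5) by auto
  qed (use AB in \<open>auto intro: openin_Int\<close>)
qed

context test_functions
begin

section \<open>Functions with support in a fixed compact set\<close>

lemma CKM_mono: "compactin (mtop M) K \<Longrightarrow> compactin (mtop M) K' \<Longrightarrow> K \<subseteq> K' \<Longrightarrow> CKM K \<subseteq> CKM K'"
  unfolding subset_iff CrK_iff by metis

lemma finite_CKM:
  assumes "finite A" "A \<subseteq> CcM"
  obtains K where "compactin (mtop M) K" "A \<subseteq> CKM K"
proof -
  have "\<exists>K. compactin (mtop M) K \<and> A \<subseteq> CKM K"
    using assms
  proof (induction A)
    case empty then show ?case by (intro exI[of _ "{}"]) auto
  next
    case (insert a A)
    then obtain K where K: "compactin (mtop M) K" "A \<subseteq> CKM K" by auto
    obtain K' where K': "compactin (mtop M) K'" "a \<in> CKM K'"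
      using insert.prems by (auto simp: Crc_iff CrK_iff)
    have c: "compactin (mtop M) (K \<union> K')" using K K' by (intro compactin_Un)
    show ?case using CKM_mono[OF K(1) c] CKM_mono[OF K'(1) c] K(2) K'(2) c by blast
  qed
  then show ?thesis using that by blast
qed

lemma cont_XK_mono: "CKM K \<subseteq> CKM K' \<Longrightarrow> continuous_map (vtop (XK K)) (vtop (XK K')) (\<lambda>\<gamma>. \<gamma>)"
  by (auto simp: CrK_def intro!: continuous_map_into_subtopology K.cont_ident_sub)

text \<open>Only the finitely many \<open>U i\<close> that meet \<open>K\<close> impose a condition
  on functions supported in \<open>K\<close>; the other components of a difference are 0.\<close>

lemma cont_XK_XM:
  assumes K: "compactin (mtop M) K"
  shows "continuous_map (vtop (XK K)) (vtop XM) (\<lambda>\<gamma>. \<gamma>)"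
  unfolding continuous_map
proof (intro conjI allI impI)
  show "(\<lambda>\<gamma>. \<gamma>) ` topspace (vtop (XK K)) \<subseteq> topspace (vtop XM)"
    using CKM_Crc[OF K] by (simp add: topspace_XK[OF K])
  fix G assume G: "openin (vtop XM) G"
  let ?B = "{i \<in> I. U i \<inter> K \<noteq> {}}"
  show "openin (vtop (XK K)) {\<gamma> \<in> topspace (vtop (XK K)). \<gamma> \<in> G}"
  proof (subst openin_subopen, intro ballI)
    fix \<gamma> assume \<gamma>: "\<gamma> \<in> {\<gamma> \<in> topspace (vtop (XK K)). \<gamma> \<in> G}"
    then obtain W where W: "zero_nbhds W" "\<And>\<eta>. \<eta> \<in> CcM \<Longrightarrow> \<forall>i\<in>I. rst i (\<eta> - \<gamma>) \<in> W i \<Longrightarrow> \<eta> \<in> G"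
      using G unfolding openin_XM by blast
    have g: "\<gamma> \<in> CKM K" using \<gamma> by (simp add: topspace_XK[OF K])
    let ?T = "\<lambda>i. {\<eta> \<in> topspace (vtop (XK K)). rst i (\<eta> - \<gamma>) \<in> W i}"
    have "continuous_map (vtop (XK K)) (Ti i) (\<lambda>\<eta>. rst i (\<eta> - \<gamma>))" if "i \<in> I" for i
    proof -
      have "continuous_map (vtop (XK K)) (vtop (XK K)) (\<lambda>\<eta>. \<eta> - \<gamma>)"
        using \<gamma> by (intro K.tvs_cont_diff[OF tvs_XK[OF K]] K.cont_ident K.cont_const) auto
      then have "continuous_map (vtop (XK K)) Ct (\<lambda>\<eta>. \<eta> - \<gamma>)"
        unfolding CrK_def by (auto intro: continuous_map_into_fulltopology)
      from K.cont_comp[OF cont_rst[OF that] this] show ?thesis .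
    qed
    then have "openin (vtop (XK K)) (?T i)" if "i \<in> ?B" for i
      using that W(1) by (intro openin_continuous_map_preimage[of _ "Ti i"]) (auto simp: zero_nbhds_def)
    then have o: "openin (vtop (XK K)) (topspace (vtop (XK K)) \<inter> (\<Inter>i\<in>?B. ?T i))"
      by (intro openin_Int_Inter) (auto simp: finite_meets[OF K])
    have "\<eta> \<in> G" if \<eta>: "\<eta> \<in> topspace (vtop (XK K)) \<inter> (\<Inter>i\<in>?B. ?T i)" for \<eta>
    proof (rule W(2))
      have e: "\<eta> \<in> CKM K" using \<eta> by (simp add: topspace_XK[OF K])
      then show "\<eta> \<in> CcM" using CKM_Crc[OF K] by blast
      show "\<forall>i\<in>I. rst i (\<eta> - \<gamma>) \<in> W i"
      proof
        fix i assume i: "i \<in> I"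
        show "rst i (\<eta> - \<gamma>) \<in> W i"
        proof (cases "i \<in> ?B")
          case False
          then have "x \<notin> K" if "x \<in> U i" for x using i that by blast
          then have "rst i (\<eta> - \<gamma>) = 0" using e g by (auto simp: CrK_iff[OF K] ext0_def fun_eq_iff)
          then show ?thesis using W(1) i by (simp add: zero_nbhds_def)
        qed (use \<eta> in auto)
      qed
    qed
    moreover have "\<gamma> \<in> topspace (vtop (XK K)) \<inter> (\<Inter>i\<in>?B. ?T i)"
      using \<gamma> W(1) by (auto simp: rst_simps zero_nbhds_def)
    ultimately show "\<exists>T. openin (vtop (XK K)) T \<and> \<gamma> \<in> T \<and> T \<subseteq> {\<gamma> \<in> topspace (vtop (XK K)). \<gamma> \<in> G}"
      using o by (intro exI[of _ "topspace (vtop (XK K)) \<inter> (\<Inter>i\<in>?B. ?T i)"]) auto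
  qed
qed

lemma open_XK:
  assumes K: "compactin (mtop M) K" and Q: "openin (vtop XM) Q"
  shows "openin (vtop (XK K)) (Q \<inter> CKM K)"
proof -
  have "{\<gamma> \<in> topspace (vtop (XK K)). \<gamma> \<in> Q} = Q \<inter> CKM K" by (auto simp: topspace_XK[OF K])
  then show ?thesis using openin_continuous_map_preimage[OF cont_XK_XM[OF K] Q] by simp
qed

lemma lv_XK: "compactin (mtop M) K \<Longrightarrow> w \<in> topspace (K.lv (XK K) m) \<longleftrightarrow> w \<in> topspace (K.lv XM m) \<and> leaves w \<subseteq> CKM K"
  using K.lv_leaves[of w "XK K" m] K.lv_change[of w "XK K" m XM] K.lv_change[of w XM m "XK K"] CKM_Crc[of K]
  by (auto simp: topspace_XK)

text \<open>Functions supported in \<open>K\<close> form a subspace, so the second point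
  \<open>x + t y\<close> adds no condition on supports.\<close>

lemma idom_XK:
  assumes K: "compactin (mtop M) K"
  shows "idom K.VT (XK K) (Q \<inter> CKM K) m = {w \<in> idom K.VT XM Q m. leaves w \<subseteq> CKM K}"
proof (induction m)
  case (Suc m)
  have "leaves (K.istep XM x y t) \<subseteq> CKM K" if "x \<in> topspace (K.lv (XK K) m)" "y \<in> topspace (K.lv (XK K) m)" for x y t
    using K.leaves_istep[of x XM m y "CKM K" t] that CKM_subspace(2,3)[OF K] by (simp add: lv_XK[OF K])
  moreover have "x \<in> topspace (K.lv (XK K) m)" if "x \<in> idom K.VT (XK K) (Q \<inter> CKM K) m" for x
    using K.idom_subset[of "Q \<inter> CKM K" "XK K" m] that by (auto simp: topspace_XK[OF K])
  ultimately show ?case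
    using Suc.IH by (auto simp: idom.simps(2) lv_XK[OF K])
qed auto

lemma open_slot:
  assumes "i \<in> I" "openin (Ti i) A" "0 \<in> A" "\<gamma> \<in> CcM"
  shows "openin (vtop XM) {\<eta> \<in> CcM. rst i (\<eta> - \<gamma>) \<in> A}"
proof -
  let ?W = "\<lambda>k. if k = i then A else topspace (Ti k)"
  have "zero_nbhds ?W" using assms K.tvs_zero[OF tvs_TV] by (auto simp: zero_nbhds_def)
  moreover have "rst k (\<eta> - \<gamma>) \<in> topspace (Ti k)" if "\<eta> \<in> CcM" "k \<in> I" for \<eta> k
    using rst_in[OF that(2), of "\<eta> - \<gamma>"] CcM_diff[OF that(1) assms(4)] Crc_iff by blast
  ultimately show ?thesis
    using open_box[of ?W \<gamma>] assms by (auto elim!: back_subst[of "openin (vtop XM)"])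
qed

end

section \<open>Difference quotients glued over all compact supports\<close>

locale almost_local_map = two_valued av av' emb + MM: cutoffs av av' emb r M E I U + NN: test_functions av av' emb s N FF J V
  for av :: "'k::field \<Rightarrow> real" and av' :: "'a::field \<Rightarrow> real" and emb :: "'a \<Rightarrow> 'k"
    and r :: enat and M :: "('a, 'z::ab_group_add, 'm) manifold" and E :: "('k, 'e::ab_group_add) tvs"
    and I :: "'i set" and U :: "'i \<Rightarrow> 'm set"
    and s :: enat and N :: "('a, 'y::ab_group_add, 'n) manifold" and FF :: "('k, 'f::ab_group_add) tvs"
    and J :: "'j set" and V :: "'j \<Rightarrow> 'n set" +
  fixes k :: nat and Q :: "('m \<Rightarrow> 'e) set" and f :: "('m \<Rightarrow> 'e) \<Rightarrow> 'n \<Rightarrow> 'f"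
  assumes Q: "openin (vtop MM.XM) Q" and f: "f \<in> Q \<rightarrow> NN.CcM"
    and smooth: "\<And>K. compactin (mtop M) K \<Longrightarrow> K.cdiff k (discrete_topology {()}) (MM.XK K) NN.XM 0
      ({()} \<times> idom K.VT (MM.XK K) (Q \<inter> MM.CKM K) 0) (\<lambda>z. f (base (snd z)))"
    and al: "almost_local (mtop M) (mtop N) Q f"
begin

abbreviation "cpt \<equiv> compactin (mtop M)"
abbreviation "D m \<equiv> idom K.VT MM.XM Q m"
abbreviation "DK K m \<equiv> idom K.VT (MM.XK K) (Q \<inter> MM.CKM K) m"
abbreviation "hk K m \<equiv> iter_dquot K.VT (MM.XK K) NN.XM (Q \<inter> MM.CKM K) f m"
abbreviation "pt \<equiv> discrete_topology {()}"

lemma open_QK: "cpt K \<Longrightarrow> openin (vtop (MM.XK K)) (Q \<inter> MM.CKM K)"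
  by (rule MM.open_XK[OF _ Q])

lemma QC: "Q \<subseteq> MM.CcM"
  using openin_subset[OF Q] by simp

lemma hk:
  assumes K: "cpt K"
  shows hk_cont: "m \<le> k \<Longrightarrow> K.cont_on pt (MM.XK K) (vtop NN.XM) m ({()} \<times> DK K m) (\<lambda>z. hk K m (snd z))"
    and hk_dq: "m < k \<Longrightarrow> K.dq_rel (MM.XK K) NN.XM m ({()} \<times> DK K m) (\<lambda>z. hk K m (snd z)) (\<lambda>z. hk K (Suc m) (snd z))"
proof -
  note tX = MM.tvs_XK[OF K] and tY = NN.tvs_XM and o = open_QK[OF K]
  note * = K.cdiff_iter_dquot[OF tX tY o, of k pt "{()}" "\<lambda>_. f" m, OF smooth[OF K]]
  show "m \<le> k \<Longrightarrow> K.cont_on pt (MM.XK K) (vtop NN.XM) m ({()} \<times> DK K m) (\<lambda>z. hk K m (snd z))"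
    using K.cdiff_cont[OF *(1)] by simp
  show "K.dq_rel (MM.XK K) NN.XM m ({()} \<times> DK K m) (\<lambda>z. hk K m (snd z)) (\<lambda>z. hk K (Suc m) (snd z))" if "m < k"
    using *(2)[of "()"] that K.is_dquot_iff[OF tX tY openin_subset[OF o]] by simp
qed

text \<open>The quotient for the larger support is continuous on the smaller space and satisfies the
  same quotient relation there, by induction on the order; uniqueness does the rest.\<close>

lemma hk_mono:
  assumes K: "cpt K" "cpt K'" "K \<subseteq> K'"
  shows "m \<le> k \<Longrightarrow> w \<in> DK K m \<Longrightarrow> hk K m w = hk K' m w"
proof (induction m arbitrary: w)
  case 0
  then have "w \<in> DK K' 0" using MM.CKM_mono[OF K] by auto
  then show ?case using 0 by simp
next
  case (Suc m)
  have sub: "DK K n \<subseteq> DK K' n" for n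
    using MM.CKM_mono[OF K] by (auto simp: MM.idom_XK[OF K(1)] MM.idom_XK[OF K(2)])
  note X = MM.tvs_XK[OF K(1)] and Y = NN.tvs_XM
  have D: "openin (prod_topology pt (K.lv (MM.XK K) m)) ({()} \<times> DK K m)"
    using K.open_idom[OF X open_QK[OF K(1)]] by (simp add: openin_prod_Times_iff)
  have dom: "K.dq_dom (MM.XK K) m ({()} \<times> DK K m) = {()} \<times> DK K (Suc m)" by (rule K.dq_dom_idom)
  have c2: "K.cont_on pt (MM.XK K) (vtop NN.XM) (Suc m) ({()} \<times> DK K (Suc m)) (\<lambda>z. hk K' (Suc m) (snd z))"
  proof (rule K.cont_onI)
    show "{()} \<times> DK K (Suc m) \<subseteq> topspace pt \<times> topspace (K.lv (MM.XK K) (Suc m))"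
      using K.idom_subset[OF openin_subset[OF open_QK[OF K(1)]]] by auto
    fix S assume S: "topspace S = {()} \<times> DK K (Suc m)" "continuous_map S pt fst" "continuous_map S (K.lv (MM.XK K) (Suc m)) snd"
    have c3: "continuous_map S (K.lv (MM.XK K') (Suc m)) snd"
      by (rule K.cont_comp[OF K.lv_incl[OF MM.cont_XK_mono[OF MM.CKM_mono[OF K]]] S(3)])
    have "continuous_map S (vtop NN.XM) (\<lambda>z. hk K' (Suc m) (snd (fst z, snd z)))"
      by (rule K.cont_onD[OF hk_cont[OF K(2) Suc.prems(1)] S(2) c3]) (use sub[of "Suc m"] S(1) in fastforce)
    then show "continuous_map S (vtop NN.XM) (\<lambda>z. hk K' (Suc m) (snd z))" by (simp only: snd_conv)
  qed
  have dq2: "K.dq_rel (MM.XK K) NN.XM m ({()} \<times> DK K m) (\<lambda>z. hk K m (snd z)) (\<lambda>z. hk K' (Suc m) (snd z))"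
    unfolding K.dq_rel_def dom
  proof (intro allI impI)
    fix p x y t assume a: "(p, Node x y t) \<in> {()} \<times> DK K (Suc m)"
    then have n: "Node x y t \<in> DK K (Suc m)" "Node x y t \<in> DK K' (Suc m)"
      using sub[of "Suc m"] by (auto simp del: K.Node_in_idom)
    have "hk K' m (K.istep (MM.XK K') x y t) = hk K' m x + scale NN.XM t (hk K' (Suc m) (Node x y t))"
      using hk_dq[OF K(2), of m] Suc.prems(1) n(2) unfolding K.dq_rel_def K.dq_dom_idom by auto
    moreover have "hk K m x = hk K' m x" "hk K m (K.istep (MM.XK K) x y t) = hk K' m (K.istep (MM.XK K) x y t)"
      using n(1) Suc.prems(1) by (auto intro!: Suc.IH)
    ultimately show "hk K m (snd (p, K.istep (MM.XK K) x y t)) =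
        hk K m (snd (p, x)) + scale NN.XM t (hk K' (Suc m) (snd (p, Node x y t)))"
      by (simp only: snd_conv MM.scale_X NN.scale_X)
  qed
  have "hk K (Suc m) (snd ((), w)) = hk K' (Suc m) (snd ((), w))"
    by (rule K.dq_unique[OF X Y D D _ _ hk_dq[OF K(1)] dq2])
      (use Suc.prems hk_cont[OF K(1) Suc.prems(1)] c2 in \<open>simp_all only: dom, auto\<close>)
  then show ?case by simp
qed

text \<open>The compact set depends on the point, as no single one carries all test functions. The
  value is independent of it, but continuity of \<open>H m\<close> cannot be read off from the
  definition.\<close>

definition H :: "nat \<Rightarrow> ('m \<Rightarrow> 'e, 'k) iter \<Rightarrow> 'n \<Rightarrow> 'f" where
  "H m w = hk (SOME K. cpt K \<and> leaves w \<subseteq> MM.CKM K) m w"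

text \<open>Two admissible compact sets are compared through their union.\<close>

lemma H_eq:
  assumes K: "cpt K" and w: "w \<in> DK K m" and m: "m \<le> k"
  shows "H m w = hk K m w"
proof -
  define K0 where "K0 = (SOME K. cpt K \<and> leaves w \<subseteq> MM.CKM K)"
  have w': "w \<in> D m" "leaves w \<subseteq> MM.CKM K" using w by (auto simp: MM.idom_XK[OF K])
  then have K0: "cpt K0" "leaves w \<subseteq> MM.CKM K0"
    using someI[of "\<lambda>K. cpt K \<and> leaves w \<subseteq> MM.CKM K" K] K by (auto simp: K0_def)
  have c: "cpt (K \<union> K0)" using K K0(1) by (rule compactin_Un)
  have "hk K0 m w = hk (K \<union> K0) m w"
    using K0 w' by (intro hk_mono[OF K0(1) c _ m]) (auto simp: MM.idom_XK)
  also have "\<dots> = hk K m w" using w by (intro hk_mono[OF K c _ m, symmetric]) auto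
  finally show ?thesis by (simp add: H_def K0_def)
qed

lemma D_lv: "w \<in> D m \<Longrightarrow> w \<in> topspace (K.lv MM.XM m)"
  using K.idom_subset[of Q MM.XM m] QC by auto

lemma D_compact:
  assumes "w \<in> D m"
  obtains K where "cpt K" "leaves w \<subseteq> MM.CKM K" "w \<in> DK K m"
proof -
  have "leaves w \<subseteq> MM.CcM" using K.lv_leaves[OF D_lv[OF assms]] by simp
  from MM.finite_CKM[OF finite_leaves this] obtain K where "cpt K" "leaves w \<subseteq> MM.CKM K" .
  then show ?thesis using that assms by (simp add: MM.idom_XK)
qed

lemma H_in:
  assumes "w \<in> D m" "m \<le> k"
  shows "H m w \<in> NN.CcM"
proof -
  from D_compact[OF assms(1)] obtain K where K: "cpt K" "leaves w \<subseteq> MM.CKM K" "w \<in> DK K m" .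
  from K.cont_on_in[OF hk_cont[OF K(1) assms(2)], of "((), w)"] K show ?thesis
    by (simp add: H_eq[OF K(1,3) assms(2)])
qed

lemma H_0: "w \<in> D 0 \<Longrightarrow> H 0 w = f (base w)"
  by (rule D_compact[of w 0]) (simp_all add: H_eq)

lemma H_dq:
  assumes "m < k" "Node x y t \<in> D (Suc m)"
  shows "H m (K.istep MM.XM x y t) = H m x + fun_scale (scale FF) t (H (Suc m) (Node x y t))"
proof -
  from D_compact[OF assms(2)] obtain K where K: "cpt K" "leaves (Node x y t) \<subseteq> MM.CKM K" "Node x y t \<in> DK K (Suc m)" .
  then have "hk K m (K.istep (MM.XK K) x y t) = hk K m x + scale NN.XM t (hk K (Suc m) (Node x y t))"
    using hk_dq[OF K(1) assms(1)] unfolding K.dq_rel_def K.dq_dom_idom by auto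
  moreover have "x \<in> DK K m" "K.istep MM.XM x y t \<in> DK K m" using K(3) by auto
  ultimately show ?thesis using assms(1) H_eq[OF K(1,3)] H_eq[OF K(1), of _ m]
    by (simp only: MM.scale_X NN.scale_X Suc_leI less_imp_le)
qed

text \<open>Moving the parameter leaves the test functions fixed, so one compact set serves the
  whole curve. Continuity along such curves is thus available before that of \<open>H\<close>
  itself.\<close>

lemma H_path:
  assumes m: "m < k" and w: "Node x y 0 \<in> D (Suc m)"
  obtains A where "openin K.VT A" "0 \<in> A" "\<forall>t\<in>A. Node x y t \<in> D (Suc m)"
    "continuous_map (subtopology K.VT A) (vtop NN.XM) (\<lambda>t. H (Suc m) (Node x y t))"
proof -
  from D_compact[OF w] obtain K where K': "cpt K" "leaves (Node x y 0) \<subseteq> MM.CKM K" "Node x y 0 \<in> DK K (Suc m)" .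
  note K = K'(1,3)
  note X = MM.tvs_XK[OF K(1)]
  have D: "openin (prod_topology pt (K.lv (MM.XK K) m)) ({()} \<times> DK K m)"
    using K.open_idom[OF X open_QK[OF K(1)]] by (simp add: openin_prod_Times_iff)
  have m': "Suc m \<le> k" using m by simp
  have c: "K.cont_on pt (MM.XK K) (vtop NN.XM) (Suc m) (K.dq_dom (MM.XK K) m ({()} \<times> DK K m)) (\<lambda>z. hk K (Suc m) (snd z))"
    unfolding K.dq_dom_idom by (rule hk_cont[OF K(1) m'])
  have z: "((), Node x y 0) \<in> K.dq_dom (MM.XK K) m ({()} \<times> DK K m)"
    unfolding K.dq_dom_idom using K(2) by auto
  show ?thesis
  proof (rule K.cont_on_path[OF X D c z])
    fix A assume A: "openin K.VT A" "0 \<in> A" "\<And>t. t \<in> A \<Longrightarrow> ((), Node x y t) \<in> K.dq_dom (MM.XK K) m ({()} \<times> DK K m)"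
      "continuous_map (subtopology K.VT A) (vtop NN.XM) (\<lambda>t. hk K (Suc m) (snd ((), Node x y t)))"
    have A3: "Node x y t \<in> DK K (Suc m)" if "t \<in> A" for t
      using A(3)[OF that] unfolding K.dq_dom_idom by auto
    show ?thesis
    proof (rule that[OF A(1,2)])
      show "\<forall>t\<in>A. Node x y t \<in> D (Suc m)" using A3 by (simp add: MM.idom_XK[OF K(1)] del: K.Node_in_idom)
      show "continuous_map (subtopology K.VT A) (vtop NN.XM) (\<lambda>t. H (Suc m) (Node x y t))"
        by (rule K.cont_cong[OF A(4)]) (use A3 in \<open>simp add: H_eq[OF K(1) _ m'] del: K.Node_in_idom\<close>)
    qed
  qed
qed

text \<open>Identities between difference quotients extend by continuity to the parameter 0.\<close>

lemma H_limit:
  assumes m: "m < k" and w: "Node x y t \<in> D (Suc m)" "Node x' y' (t * d) \<in> D (Suc m)"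
    and T: "Hausdorff_space T" "continuous_map (vtop NN.XM) T L" "continuous_map (vtop NN.XM) T L'"
    and eq: "\<And>t. t \<noteq> 0 \<Longrightarrow> Node x y t \<in> D (Suc m) \<Longrightarrow> Node x' y' (t * d) \<in> D (Suc m) \<Longrightarrow>
      L (H (Suc m) (Node x y t)) = L' (H (Suc m) (Node x' y' (t * d)))"
  shows "L (H (Suc m) (Node x y t)) = L' (H (Suc m) (Node x' y' (t * d)))"
proof (cases "t = 0")
  case True
  have w0: "Node x y 0 \<in> D (Suc m)" "Node x' y' 0 \<in> D (Suc m)" using w True by simp_all
  obtain A where A: "openin K.VT A" "0 \<in> A" "\<forall>t\<in>A. Node x y t \<in> D (Suc m)"
    "continuous_map (subtopology K.VT A) (vtop NN.XM) (\<lambda>t. H (Suc m) (Node x y t))"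
    using H_path[OF m w0(1)] .
  obtain B where B: "openin K.VT B" "0 \<in> B" "\<forall>t\<in>B. Node x' y' t \<in> D (Suc m)"
    "continuous_map (subtopology K.VT B) (vtop NN.XM) (\<lambda>t. H (Suc m) (Node x' y' t))"
    using H_path[OF m w0(2)] .
  have cd: "continuous_map K.VT K.VT (\<lambda>t. t * d)" by (intro K.cont_mult K.cont_ident K.cont_const) simp
  define C where "C = A \<inter> {t \<in> topspace K.VT. t * d \<in> B}"
  have C: "openin K.VT C" "0 \<in> C"
    using A(1,2) B(2) openin_continuous_map_preimage[OF cd B(1)] by (auto simp: C_def)
  have "L (H (Suc m) (Node x y 0)) = L' (H (Suc m) (Node x' y' (0 * d)))"
  proof (rule K.eq_at_0[OF T(1) C])
    show "continuous_map (subtopology K.VT C) T (\<lambda>t. L (H (Suc m) (Node x y t)))"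
      by (rule K.cont_comp[OF T(2) K.cont_on_comp[OF A(4) K.cont_ident_sub]]) (auto simp: C_def)
    show "continuous_map (subtopology K.VT C) T (\<lambda>t. L' (H (Suc m) (Node x' y' (t * d))))"
      by (rule K.cont_comp[OF T(3) K.cont_on_comp[OF B(4) continuous_map_from_subtopology[OF cd]]]) (auto simp: C_def)
    show "L (H (Suc m) (Node x y t)) = L' (H (Suc m) (Node x' y' (t * d)))" if "t \<in> C" "t \<noteq> 0" for t
      using that A(3) B(3) by (intro eq) (auto simp: C_def simp del: K.Node_in_idom)
  qed
  then show ?thesis using True by simp
qed (intro eq w)

text \<open>Almost locality passes to quotients: with equal parameters, \<open>x + t y\<close> and
  \<open>x' + t y'\<close> agree on \<open>S\<close> whenever the entries do. Evaluation at
  \<open>v\<close> is continuous and takes the identity to the parameter 0.\<close>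

lemma H_local:
  assumes loc: "\<And>\<gamma> \<eta> y. \<gamma> \<in> Q \<Longrightarrow> \<eta> \<in> Q \<Longrightarrow> \<forall>x\<in>S. \<gamma> x = \<eta> x \<Longrightarrow> f \<gamma> v = f \<eta> v" and v: "v \<in> topspace (mtop N)"
  shows "m \<le> k \<Longrightarrow> w \<in> D m \<Longrightarrow> w' \<in> D m \<Longrightarrow> agree_on S w w' \<Longrightarrow> H m w v = H m w' v"
proof (induction m arbitrary: w w')
  case 0
  then obtain a a' where a: "w = Base a" "w' = Base a'" "a \<in> Q" "a' \<in> Q" "\<forall>x\<in>S. a x = a' x" by auto
  show ?case using loc[OF a(3-5)] 0 by (simp add: H_0 a)
next
  case (Suc m)
  obtain x y t where w: "w = Node x y t" using Suc.prems(2) by (auto simp: idom.simps(2))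
  then obtain x' y' where w': "w' = Node x' y' t" and ag: "agree_on S x x'" "agree_on S y y'" using Suc.prems(4) by auto
  have m: "m < k" using Suc.prems(1) by simp
  have fs: "fun_scale (scale FF) t g v = scale FF t (g v)" for t g by (simp add: fun_scale_def)
  have lim: "H (Suc m) (Node x y t) v = H (Suc m) (Node x' y' (t * 1)) v"
  proof (rule H_limit[OF m _ _ K.tvs_Hausdorff[OF NN.E] NN.cont_XM_eval[OF v] NN.cont_XM_eval[OF v]])
    show "Node x y t \<in> D (Suc m)" "Node x' y' (t * 1) \<in> D (Suc m)" using Suc.prems(2,3) by (simp_all only: w w' mult_1_right)
    fix t assume t: "t \<noteq> 0" and n: "Node x y t \<in> D (Suc m)" "Node x' y' (t * 1) \<in> D (Suc m)"
    then have n': "Node x' y' t \<in> D (Suc m)" by simp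
    have d: "x \<in> D m" "x' \<in> D m" "K.istep MM.XM x y t \<in> D m" "K.istep MM.XM x' y' t \<in> D m" "y \<in> topspace (K.lv MM.XM m)"
      using n(1) n' by simp_all
    have "agree_on S (K.istep MM.XM x y t) (K.istep MM.XM x' y' t)"
      by (rule K.agree_on_istep[OF D_lv[OF d(1)] d(5) ag]) (simp add: fun_scale_def)
    then have "H m (K.istep MM.XM x y t) v = H m (K.istep MM.XM x' y' t) v" "H m x v = H m x' v"
      using Suc.IH d ag(1) m by simp_all
    then have "scale FF t (H (Suc m) (Node x y t) v) = scale FF t (H (Suc m) (Node x' y' t) v)"
      using H_dq[OF m n(1)] H_dq[OF m n'] by (simp add: fs)
    from K.scale_cancel[OF NN.E t this] show "H (Suc m) (Node x y t) v = H (Suc m) (Node x' y' (t * 1)) v" by simp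
  qed
  then show ?case by (simp add: w w')
qed

text \<open>With zero direction the step \<open>x + t y\<close> is \<open>x\<close>, so the quotient
  is 0 for nonzero \<open>t\<close> and then in the limit. The value 0 is what tolerates
  multiplication by large scalars.\<close>

lemma H_bpoint:
  assumes "Suc m \<le> k" "\<gamma> \<in> Q"
  shows "H (Suc m) (bpoint \<gamma> (Suc m)) = 0"
proof -
  let ?x = "bpoint \<gamma> m" and ?y = "bpoint 0 m"
  have m: "m < k" using assms by simp
  note X = MM.tvs_XM and Y = NN.tvs_XM
  have g: "\<gamma> \<in> topspace (vtop MM.XM)" using assms(2) QC by auto
  have b: "Node ?x ?y 0 \<in> D (Suc m)" using K.bpoint_idom[OF X _ assms(2), of "Suc m"] QC by simp
  have "H (Suc m) (Node ?x ?y 0) = (\<lambda>_. 0) (H (Suc m) (Node ?x ?y (0 * 1)))"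
  proof (rule H_limit[OF m _ _ K.tvs_Hausdorff[OF Y] K.cont_ident K.cont_const[OF K.tvs_zero[OF Y]]])
    fix t assume t: "t \<noteq> 0" and n: "Node ?x ?y t \<in> D (Suc m)"
    have "scale NN.XM t (H (Suc m) (Node ?x ?y t)) = scale NN.XM t 0"
      using H_dq[OF m n] K.istep_bpoint[OF X g, of m t] K.scale_simps(2)[OF Y] by simp
    from K.scale_cancel[OF Y t this] show "H (Suc m) (Node ?x ?y t) = 0" .
  qed (use b in simp_all)
  then show ?thesis by simp
qed

end

context almost_local_map
begin

section \<open>Rescaling of parameters and its effect on values\<close>

abbreviation "discmul C A \<equiv> {fun_scale (scale E) t v | t v. av t \<le> C \<and> v \<in> A}"

text \<open>\<open>e\<close> bounds the parameters after rescaling, \<open>C\<close> bounds the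
  factors put on directions, and \<open>c\<close> is the factor acquired by the value of
  \<open>H m\<close>. Order 0 is tied to \<open>c = 1\<close> because its value at the base point
  need not be 0.\<close>

definition rescales :: "nat \<Rightarrow> real \<Rightarrow> real \<Rightarrow> (('m \<Rightarrow> 'e, 'k) iter \<Rightarrow> ('m \<Rightarrow> 'e, 'k) iter) \<Rightarrow> 'k \<Rightarrow> real \<Rightarrow> bool" where
  "rescales m R e \<phi> c C \<longleftrightarrow> 1 \<le> C \<and> 1 \<le> av c \<and> (m = 0 \<longrightarrow> c = 1) \<and>
    (\<forall>w\<in>topspace (K.lv MM.XM m). \<phi> w \<in> topspace (K.lv MM.XM m)) \<and>
    (\<forall>x\<in>topspace (K.lv MM.XM m). \<forall>y\<in>topspace (K.lv MM.XM m). \<forall>t. \<phi> (K.istep MM.XM x y t) = K.istep MM.XM (\<phi> x) (\<phi> y) t) \<and>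
    (\<forall>w\<in>topspace (K.lv MM.XM m). \<phi> w \<in> D m \<longleftrightarrow> w \<in> D m) \<and>
    (\<forall>w\<in>D m. H m (\<phi> w) = fun_scale (scale FF) c (H m w)) \<and>
    (\<forall>w\<in>topspace (K.lv MM.XM m). \<forall>B A. in_box av B A R w \<longrightarrow> in_box av B (discmul C A) e (\<phi> w))"

text \<open>Replacing \<open>(x, y, t)\<close> by \<open>(x, b y, t / b)\<close> multiplies a difference quotient by \<open>b\<close>; so it
  suffices to control difference quotients for small parameters.\<close>

lemma ex_rescaling: "m \<le> k \<Longrightarrow> 0 < e \<Longrightarrow> \<exists>\<phi> c C. rescales m R e \<phi> c C"
proof (induction m arbitrary: e)
  case 0
  have "fun_scale (scale FF) 1 g = g" for g :: "'n \<Rightarrow> 'f"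
    by (simp add: fun_eq_iff fun_scale_def K.scale_simps[OF NN.E])
  moreover have "in_box av B (discmul 1 A) e w" if "w \<in> topspace (K.lv MM.XM 0)" "in_box av B A R w" for B A w
    using that by (auto simp: K.lv_0)
  ultimately show ?case
    by (intro exI[of _ "\<lambda>w. w"] exI[of _ 1] exI[of _ 1]) (simp add: rescales_def)
next
  case (Suc m)
  let ?L = "topspace (K.lv MM.XM m)" and ?s = "fun_scale (scale E)"
  note X = MM.tvs_XM and Y = NN.tvs_XM
  \<comment> \<open>So large that parameters bounded by \<open>R\<close> are at most
    \<open>e\<close> after division by \<open>b\<close>.\<close>
  obtain b where b: "b \<noteq> 0" "max 1 (R / e) < av b" by (rule K.large_elt)
  then have b1: "1 \<le> av b" "R / e < av b" by auto
  have m: "m \<le> k" "m < k" using Suc.prems(1) by auto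
  have e': "0 < e / av b" using Suc.prems(2) b1(1) by simp
  \<comment> \<open>Multiplying the direction tree by \<open>b\<close> also multiplies the
    parameters inside it, so these have to be brought below \<open>e / av b\<close> first.\<close>
  from Suc.IH[OF m(1) e'] obtain \<phi> c C where "rescales m R (e / av b) \<phi> c C" by (elim exE)
  then have C: "1 \<le> C" "1 \<le> av c" and \<phi>: "\<And>w. w \<in> ?L \<Longrightarrow> \<phi> w \<in> ?L"
    "\<And>x y t. x \<in> ?L \<Longrightarrow> y \<in> ?L \<Longrightarrow> \<phi> (K.istep MM.XM x y t) = K.istep MM.XM (\<phi> x) (\<phi> y) t"
    "\<And>w. w \<in> ?L \<Longrightarrow> \<phi> w \<in> D m \<longleftrightarrow> w \<in> D m" "\<And>w. w \<in> D m \<Longrightarrow> H m (\<phi> w) = fun_scale (scale FF) c (H m w)"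
    "\<And>w B A. w \<in> ?L \<Longrightarrow> in_box av B A R w \<Longrightarrow> in_box av B (discmul C A) (e / av b) (\<phi> w)"
    unfolding rescales_def by blast+
  define \<psi> where "\<psi> w = Node (\<phi> (pnt w)) (iscale ?s b (\<phi> (dir w))) (par w / b)" for w
  have \<psi>_Node: "\<psi> (Node x y t) = Node (\<phi> x) (iscale ?s b (\<phi> y)) (t / b)" for x y t by (simp add: \<psi>_def)
  have lvb: "iscale ?s b w \<in> ?L" if "w \<in> ?L" for w using K.iscale_in_lv[OF X that, of b] by simp
  have st: "K.istep MM.XM (\<phi> x) (iscale ?s b (\<phi> y)) (t / b) = K.istep MM.XM (\<phi> x) (\<phi> y) t" if "x \<in> ?L" "y \<in> ?L" for x y t
    using K.iscale_istep(2)[OF X \<phi>(1)[OF that(1)] \<phi>(1)[OF that(2)] b(1), of t] by simp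
  have dom: "\<psi> (Node x y t) \<in> D (Suc m) \<longleftrightarrow> Node x y t \<in> D (Suc m)" if "x \<in> ?L" "y \<in> ?L" for x y t
    unfolding \<psi>_Node K.Node_in_idom st[OF that]
    using that \<phi>(1,3) \<phi>(2)[OF that, of t, symmetric] K.istep_in_lv[OF X that, of t] lvb by simp
  have "\<psi> w \<in> topspace (K.lv MM.XM (Suc m))" if "w \<in> topspace (K.lv MM.XM (Suc m))" for w
    using that \<phi>(1) lvb by (auto simp: K.lv_Suc \<psi>_Node)
  moreover have "\<psi> (K.istep MM.XM v w t) = K.istep MM.XM (\<psi> v) (\<psi> w) t"
    if vw: "v \<in> topspace (K.lv MM.XM (Suc m))" "w \<in> topspace (K.lv MM.XM (Suc m))" for v w t
  proof -
    obtain x y u x' y' u' where [simp]: "v = Node x y u" "w = Node x' y' u'" and L: "x \<in> ?L" "y \<in> ?L" "x' \<in> ?L" "y' \<in> ?L"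
      using vw unfolding K.lv_Suc by blast
    have "iscale ?s b (K.istep MM.XM (\<phi> y) (\<phi> y') t) = K.istep MM.XM (iscale ?s b (\<phi> y)) (iscale ?s b (\<phi> y')) t"
      using K.iscale_istep(1)[OF X \<phi>(1)[OF L(2)] \<phi>(1)[OF L(4)], of b t] by simp
    then show ?thesis using \<phi>(2)[OF L(1,3)] \<phi>(2)[OF L(2,4)] by (simp add: \<psi>_Node add_divide_distrib)
  qed
  moreover have "\<psi> w \<in> D (Suc m) \<longleftrightarrow> w \<in> D (Suc m)" if "w \<in> topspace (K.lv MM.XM (Suc m))" for w
    using that dom by (auto simp: K.lv_Suc simp del: K.Node_in_idom)
  moreover have "H (Suc m) (\<psi> w) = fun_scale (scale FF) (c * b) (H (Suc m) w)" if w: "w \<in> D (Suc m)" for w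
  proof -
    obtain x y t where [simp]: "w = Node x y t" and L: "x \<in> ?L" "y \<in> ?L"
      using D_lv[OF w] by (auto simp: K.lv_Suc)
    have cs: "continuous_map (vtop NN.XM) (vtop NN.XM) (\<lambda>g. scale NN.XM (c * b) g)"
      by (intro K.tvs_cont_scale[OF Y] K.cont_const K.cont_ident) simp
    \<comment> \<open>For a nonzero parameter both sides come from the multiplied-out quotient
      relation, since the rescaled step leads to the image of the original one.\<close>
    have "scale NN.XM (c * b) (H (Suc m) (Node x y t)) = H (Suc m) (Node (\<phi> x) (iscale ?s b (\<phi> y)) (t * (1 / b)))"
    proof (rule H_limit[OF m(2) _ _ K.tvs_Hausdorff[OF Y] cs K.cont_ident])
      show "Node x y t \<in> D (Suc m)" "Node (\<phi> x) (iscale ?s b (\<phi> y)) (t * (1 / b)) \<in> D (Suc m)"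
        using w dom[OF L, of t] unfolding \<psi>_Node by (simp_all del: K.Node_in_idom)
      fix t assume t: "t \<noteq> 0" and n: "Node x y t \<in> D (Suc m)" "Node (\<phi> x) (iscale ?s b (\<phi> y)) (t * (1 / b)) \<in> D (Suc m)"
      have x: "x \<in> D m" "K.istep MM.XM x y t \<in> D m" using n(1) by simp_all
      let ?h = "H (Suc m) (Node x y t)" and ?h' = "H (Suc m) (Node (\<phi> x) (iscale ?s b (\<phi> y)) (t * (1 / b)))"
      have "fun_scale (scale FF) c (H m x) + scale NN.XM (t / b) ?h' = H m (K.istep MM.XM (\<phi> x) (iscale ?s b (\<phi> y)) (t / b))"
        using H_dq[OF m(2) n(2)] \<phi>(4)[OF x(1)] by simp
      also have "\<dots> = H m (\<phi> (K.istep MM.XM x y t))" using st[OF L] \<phi>(2)[OF L] by simp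
      also have "\<dots> = fun_scale (scale FF) c (H m (K.istep MM.XM x y t))" by (rule \<phi>(4)[OF x(2)])
      also have "\<dots> = fun_scale (scale FF) c (H m x) + scale NN.XM c (scale NN.XM t ?h)"
        using K.scale_simps(5)[OF Y, of c "H m x" "scale NN.XM t ?h"] by (simp only: H_dq[OF m(2) n(1)] NN.scale_X)
      also have "scale NN.XM c (scale NN.XM t ?h) = scale NN.XM (t / b) (scale NN.XM (c * b) ?h)"
        using b(1) by (simp only: K.scale_simps(4)[OF Y]) (simp add: mult.commute)
      finally have "scale NN.XM (t / b) (scale NN.XM (c * b) ?h) = scale NN.XM (t / b) ?h'" by (metis add_left_cancel)
      then show "scale NN.XM (c * b) ?h = ?h'" using K.scale_cancel[OF Y, of "t / b"] t b(1) by simp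
    qed
    then show ?thesis by (simp add: \<psi>_Node)
  qed
  moreover have "in_box av B (discmul (C * av b) A) e (\<psi> w)"
    if w: "w \<in> topspace (K.lv MM.XM (Suc m))" and box: "in_box av B A R w" for w B A
  proof -
    obtain x y t where [simp]: "w = Node x y t" and L: "x \<in> ?L" "y \<in> ?L"
      using w by (auto simp: K.lv_Suc)
    have bx: "in_box av B A R x" "in_box av A A R y" "av t \<le> R" using box by auto
    have C': "C \<le> C * av b" using C(1) b1(1) by (simp add: mult_le_cancel_left1)
    have ev: "e / av b \<le> e" using b1(1) Suc.prems(2) by (simp add: divide_le_eq mult_le_cancel_left1)
    have sub: "discmul C A \<subseteq> discmul (C * av b) A" using C' by fastforce
    have 1: "in_box av B (discmul (C * av b) A) e (\<phi> x)"
      by (rule K.in_box_mono[OF \<phi>(5)[OF L(1) bx(1)] _ sub ev]) simp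
    have sub2: "?s b ` discmul C A \<subseteq> discmul (C * av b) A"
    proof safe
      fix u v assume "av u \<le> C" "v \<in> A"
      then show "\<exists>t v'. ?s b (?s u v) = ?s t v' \<and> av t \<le> C * av b \<and> v' \<in> A"
        using K.scale_simps(4)[OF X, of b u v] b1(1)
        by (intro exI[of _ "b * u"] exI[of _ v]) (simp add: K.av_props(3) mult.commute mult_right_mono)
    qed
    have "b * 1 = b" by simp
    then have sub3: "?s b ` A \<subseteq> discmul (C * av b) A"
      using mult_right_mono[OF C(1), of "av b"] b1(1) by fastforce
    have "in_box av (?s b ` A) (?s b ` discmul C A) (av b * (e / av b)) (iscale ?s b (\<phi> y))"
      using K.in_box_iscale[OF \<phi>(5)[OF L(2) bx(2)], of MM.XM b] by simp
    then have 2: "in_box av (discmul (C * av b) A) (discmul (C * av b) A) e (iscale ?s b (\<phi> y))"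
      by (rule K.in_box_mono[OF _ sub3 sub2]) (use b1(1) in simp)
    have "av (t / b) \<le> e"
    proof -
      have "R < e * av b" using b1(2) Suc.prems(2) by (simp add: divide_less_eq mult.commute)
      then show ?thesis using bx(3) b1(1) by (simp add: K.av_divide divide_le_eq)
    qed
    then show ?thesis using 1 2 by (simp add: \<psi>_Node)
  qed
  moreover have "1 \<le> C * av b" "1 \<le> av (c * b)"
    using C b1(1) mult_mono[of 1 C 1 "av b"] mult_mono[of 1 "av c" 1 "av b"] by (simp_all add: K.av_props(3))
  ultimately have "rescales (Suc m) R e \<psi> (c * b) (C * av b)"
    unfolding rescales_def using C b(1) by (intro conjI) auto
  then show ?case by blast
qed

lemma hk_preimage:
  assumes K: "cpt K" and m: "m \<le> k" and G: "openin (vtop NN.XM) G"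
  shows "openin (K.lv (MM.XK K) m) {w \<in> DK K m. hk K m w \<in> G}"
proof -
  note X = MM.tvs_XK[OF K] and o = open_QK[OF K]
  have "continuous_map (idom_top K.VT (MM.XK K) (Q \<inter> MM.CKM K) m) (vtop NN.XM) (hk K m)"
    using hk_cont[OF K m] K.cont_on_unit_idom[OF openin_subset[OF o]] by blast
  from openin_continuous_map_preimage[OF this G] show ?thesis
    using openin_trans_full K.open_idom[OF X o, of m] K.idom_subset[OF openin_subset[OF o], of m]
    by (auto simp: idom_top_def Int_absorb1)
qed

text \<open>Continuity at \<open>bpoint \<gamma> m\<close> covers small parameters only. Rescaling
  extends it to parameters bounded by \<open>R\<close>, at the cost of a zero neighbourhood
  \<open>A\<close> depending on \<open>R\<close> and of the factor \<open>c\<close> on the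
  values.\<close>

lemma box_control:
  assumes K: "cpt K" and g: "\<gamma> \<in> Q \<inter> MM.CKM K" and m: "m \<le> k"
    and G: "openin (vtop NN.XM) G" "H m (bpoint \<gamma> m) \<in> G"
  obtains A where "openin (vtop (MM.XK K)) A" "0 \<in> A"
    "\<forall>w\<in>topspace (K.lv (MM.XK K) m). in_box av {x. x - \<gamma> \<in> A} A R w \<longrightarrow> w \<in> D m \<and> H m w \<in> G"
proof -
  note X = MM.tvs_XK[OF K] and Y = NN.tvs_XM
  have gX: "\<gamma> \<in> topspace (vtop (MM.XK K))" using g by (simp add: MM.topspace_XK[OF K])
  have bp: "bpoint \<gamma> m \<in> DK K m" by (rule K.bpoint_idom[OF X openin_subset[OF open_QK[OF K]] g])
  \<comment> \<open>Chosen to absorb \<open>c\<close>. For order 0 the factor is 1. For positive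
    order the value at \<open>bpoint \<gamma> m\<close> is 0, and a zero neighbourhood is taken
    whose multiples by scalars of absolute value at most 1, such as \<open>inverse c\<close>, stay
    in \<open>G\<close>.\<close>
  obtain G' where G': "openin (vtop NN.XM) G'" "H m (bpoint \<gamma> m) \<in> G'"
    "\<And>c g. 1 \<le> av c \<Longrightarrow> m = 0 \<longrightarrow> c = 1 \<Longrightarrow> g \<in> NN.CcM \<Longrightarrow> fun_scale (scale FF) c g \<in> G' \<Longrightarrow> g \<in> G"
  proof (cases m)
    case 0
    show ?thesis by (rule that[OF G]) (use 0 K.scale_simps(3)[OF Y] in simp)
  next
    case (Suc n)
    then have H0: "H m (bpoint \<gamma> m) = 0" using H_bpoint[of n \<gamma>] m g by simp
    obtain B where B: "openin (vtop NN.XM) B" "0 \<in> B" "\<And>t g. av t \<le> 1 \<Longrightarrow> g \<in> B \<Longrightarrow> scale NN.XM t g \<in> G"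
      using K.tvs_bounded[OF Y G(1), of 1] G(2) H0 by auto
    show ?thesis
    proof (rule that[OF B(1)])
      fix c g assume c: "1 \<le> av c" "fun_scale (scale FF) c g \<in> B"
      then have "av (inverse c) \<le> 1" "c \<noteq> 0" by (auto simp: K.av_inverse inverse_le_1_iff)
      then show "g \<in> G" using B(3)[of "inverse c" "scale NN.XM c g"] c(2)
        by (simp only: K.scale_simps(4)[OF Y]) (simp add: K.scale_simps(3)[OF Y, simplified] K.scale_simps(4)[OF Y, simplified])
    qed (use H0 B(2) in simp)
  qed
  have oN: "openin (K.lv (MM.XK K) m) {w \<in> DK K m. hk K m w \<in> G'}" by (rule hk_preimage[OF K m G'(1)])
  have "bpoint \<gamma> m \<in> {w \<in> DK K m. hk K m w \<in> G'}" using bp G'(2) H_eq[OF K bp m] by simp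
  from K.box_nbhd[OF X oN gX this] obtain S e where S: "openin (vtop (MM.XK K)) S" "0 \<in> S" "0 < e"
    "\<And>w. w \<in> topspace (K.lv (MM.XK K) m) \<Longrightarrow> in_box av {a. a - \<gamma> \<in> S} S e w \<Longrightarrow> w \<in> DK K m \<and> hk K m w \<in> G'"
    by blast
  from ex_rescaling[OF m S(3), of R] obtain \<phi> c C where "rescales m R e \<phi> c C" by (elim exE)
  then have C: "1 \<le> C" "1 \<le> av c" "m = 0 \<longrightarrow> c = 1"
    and \<phi>: "\<And>w. w \<in> topspace (K.lv MM.XM m) \<Longrightarrow> \<phi> w \<in> topspace (K.lv MM.XM m)"
      "\<And>w. w \<in> topspace (K.lv MM.XM m) \<Longrightarrow> \<phi> w \<in> D m \<longleftrightarrow> w \<in> D m"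
      "\<And>w. w \<in> D m \<Longrightarrow> H m (\<phi> w) = fun_scale (scale FF) c (H m w)"
      "\<And>w B A. w \<in> topspace (K.lv MM.XM m) \<Longrightarrow> in_box av B A R w \<Longrightarrow> in_box av B (discmul C A) e (\<phi> w)"
    unfolding rescales_def by blast+
  obtain A where A: "openin (vtop (MM.XK K)) A" "0 \<in> A" "\<And>t v. av t \<le> C \<Longrightarrow> v \<in> A \<Longrightarrow> scale (MM.XK K) t v \<in> S"
    using K.tvs_bounded[OF X S(1,2), of C] by blast
  have AS: "A \<subseteq> S" using A(3)[of 1] C(1) K.scale_simps(3)[OF X] by auto
  have SK: "S \<subseteq> MM.CKM K" using openin_subset[OF S(1)] by (simp add: MM.topspace_XK[OF K])
  have dA: "discmul C A \<subseteq> S" using A(3) by auto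
  have "w \<in> D m \<and> H m w \<in> G"
    if w: "w \<in> topspace (K.lv (MM.XK K) m)" and box: "in_box av {x. x - \<gamma> \<in> A} A R w" for w
  proof -
    have wL: "w \<in> topspace (K.lv MM.XM m)" "leaves w \<subseteq> MM.CKM K" using w by (simp_all add: MM.lv_XK[OF K])
    \<comment> \<open>Intersecting with \<open>CKM K\<close> keeps track of supports, so that the
      rescaled point is seen to have its leaves in \<open>CKM K\<close> as well.\<close>
    have "in_box av ({x. x - \<gamma> \<in> A} \<inter> MM.CKM K) (discmul C (A \<inter> MM.CKM K)) e (\<phi> w)"
      by (rule \<phi>(4)[OF wL(1) in_box_Int[OF box wL(2)]])
    then have b: "in_box av ({a. a - \<gamma> \<in> S} \<inter> MM.CKM K) S e (\<phi> w)"
      by (rule K.in_box_mono) (use AS dA in auto)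
    have "leaves (\<phi> w) \<subseteq> MM.CKM K" using in_box_leaves[OF b] SK by auto
    then have "\<phi> w \<in> topspace (K.lv (MM.XK K) m)" using \<phi>(1)[OF wL(1)] by (simp add: MM.lv_XK[OF K])
    moreover have "in_box av {a. a - \<gamma> \<in> S} S e (\<phi> w)" by (rule K.in_box_mono[OF b]) auto
    ultimately have \<phi>w: "\<phi> w \<in> DK K m" "hk K m (\<phi> w) \<in> G'" using S(4) by blast+
    then have "\<phi> w \<in> D m" by (simp add: MM.idom_XK[OF K])
    then have wD: "w \<in> D m" using \<phi>(2)[OF wL(1)] by simp
    have "fun_scale (scale FF) c (H m w) \<in> G'" using \<phi>(3)[OF wD] \<phi>w H_eq[OF K \<phi>w(1) m] by simp
    then show ?thesis using G'(3)[OF C(2,3) H_in[OF wD m]] wD by blast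
  qed
  then show ?thesis using that[OF A(1,2)] by blast
qed

text \<open>The covers in \<open>almost_local\<close> are unrelated to the cover \<open>V\<close>
  defining the box topology of the target. Values on \<open>V l\<close> are determined on the union
  of those \<open>U' a\<close> whose partner \<open>V' a\<close> meets \<open>V l\<close>; these are
  finitely many because \<open>V l\<close> is relatively compact.\<close>

lemma cover_data:
  obtains S C where "\<And>l. l \<in> J \<Longrightarrow> cpt (C l)" "\<And>l. l \<in> J \<Longrightarrow> S l \<subseteq> C l"
    "\<And>l \<gamma> \<eta> v. l \<in> J \<Longrightarrow> \<gamma> \<in> Q \<Longrightarrow> \<eta> \<in> Q \<Longrightarrow> \<forall>x\<in>S l. \<gamma> x = \<eta> x \<Longrightarrow> v \<in> V l \<Longrightarrow> f \<gamma> v = f \<eta> v"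
    "\<And>K. cpt K \<Longrightarrow> finite {l \<in> J. C l \<inter> K \<noteq> {}}"
proof -
  from al obtain I' :: "('m set \<times> 'n set) set" and U' V' where cU: "rc_cover (mtop M) I' U'" and cV: "rc_cover (mtop N) I' V'"
    and loc: "\<And>a \<gamma> \<eta> v. a \<in> I' \<Longrightarrow> \<gamma> \<in> Q \<Longrightarrow> \<eta> \<in> Q \<Longrightarrow> \<forall>x\<in>U' a. \<gamma> x = \<eta> x \<Longrightarrow> v \<in> V' a \<Longrightarrow> f \<gamma> v = f \<eta> v"
    unfolding almost_local_def by blast
  define A where "A l = {a \<in> I'. V' a \<inter> V l \<noteq> {}}" for l
  have cl: "T \<subseteq> X closure_of T" if "openin X T" for X :: "'x topology" and T
    by (rule closure_of_subset[OF openin_subset[OF that]])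
  have V: "compactin (mtop N) (mtop N closure_of V l)" "V l \<subseteq> mtop N closure_of V l" if "l \<in> J" for l
    using NN.cover that cl[OF NN.openU[OF that]] by (auto simp: rc_cover_def)
  have V'c: "compactin (mtop N) (mtop N closure_of V' a)" "V' a \<subseteq> mtop N closure_of V' a" if "a \<in> I'" for a
    using cV that cl by (auto simp: rc_cover_def)
  have U'c: "cpt (mtop M closure_of U' a)" "U' a \<subseteq> mtop M closure_of U' a" if "a \<in> I'" for a
    using cU that cl by (auto simp: rc_cover_def)
  show ?thesis
  proof (rule that[of "\<lambda>l. \<Union>a\<in>A l. mtop M closure_of U' a" "\<lambda>l. \<Union>a\<in>A l. U' a"])
    fix l assume l: "l \<in> J"
    have "finite (A l)"
      by (rule finite_subset[OF _ rc_cover_finite_meets(2)[OF cV V(1)[OF l]]]) (use V(2)[OF l] in \<open>auto simp: A_def\<close>)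
    then show "cpt (\<Union>a\<in>A l. mtop M closure_of U' a)"
      using U'c by (intro compactin_Union) (auto simp: A_def)
    show "(\<Union>a\<in>A l. U' a) \<subseteq> (\<Union>a\<in>A l. mtop M closure_of U' a)" using U'c(2) by (fastforce simp: A_def)
    fix \<gamma> \<eta> v assume g: "\<gamma> \<in> Q" "\<eta> \<in> Q" "\<forall>x\<in>(\<Union>a\<in>A l. U' a). \<gamma> x = \<eta> x" "v \<in> V l"
    have "v \<in> topspace (mtop N)" using openin_subset[OF NN.openU[OF l]] g(4) by auto
    then obtain a where a: "a \<in> I'" "v \<in> V' a" using cV unfolding rc_cover_def by blast
    have "a \<in> A l" using a g(4) by (auto simp: A_def)
    then have "\<forall>x\<in>U' a. \<gamma> x = \<eta> x" using g(3) by blast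
    then show "f \<gamma> v = f \<eta> v" by (rule loc[OF a(1) g(1,2) _ a(2)])
  next
    fix K assume K: "cpt K"
    \<comment> \<open>\<open>K\<close> meets finitely many closures of sets \<open>U' a\<close>, and
      the relatively compact partner of each meets finitely many \<open>V l\<close>.\<close>
    let ?A = "{a \<in> I'. mtop M closure_of U' a \<inter> K \<noteq> {}}"
    have "finite (\<Union>a\<in>?A. {l \<in> J. V l \<inter> mtop N closure_of V' a \<noteq> {}})"
      using rc_cover_finite_meets(1)[OF cU K] NN.finite_meets V'c(1) by (intro finite_UN_I) auto
    then show "finite {l \<in> J. (\<Union>a\<in>A l. mtop M closure_of U' a) \<inter> K \<noteq> {}}"
      by (rule finite_subset[rotated]) (use V'c(2) in \<open>fastforce simp: A_def\<close>)
  qed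
qed

text \<open>One cutoff per member \<open>V l\<close> of the target cover, equal to 1 on the set that
  determines \<open>f\<close> there. Finiteness for \<open>B\<close> feeds
  \<open>uniform_cutoff_nbhd\<close>; finiteness for \<open>K\<close> leaves finitely many cutoffs
  that touch the support of a given point.\<close>

lemma cutoff_data:
  obtains S B c K where "\<And>l. l \<in> J \<Longrightarrow> cpt (K l)" "\<And>l x. l \<in> J \<Longrightarrow> x \<in> S l \<Longrightarrow> c l x = 1"
    "\<And>l x. l \<in> J \<Longrightarrow> x \<notin> K l \<Longrightarrow> c l x = 0" "\<And>l. l \<in> J \<Longrightarrow> MM.controlled (B l) (c l)" "\<And>l. B l \<subseteq> I"
    "\<And>l \<gamma> \<eta> v. l \<in> J \<Longrightarrow> \<gamma> \<in> Q \<Longrightarrow> \<eta> \<in> Q \<Longrightarrow> \<forall>x\<in>S l. \<gamma> x = \<eta> x \<Longrightarrow> v \<in> V l \<Longrightarrow> f \<gamma> v = f \<eta> v"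
    "\<And>i. i \<in> I \<Longrightarrow> finite {l \<in> J. i \<in> B l}" "\<And>L. cpt L \<Longrightarrow> finite {l \<in> J. K l \<inter> L \<noteq> {}}"
proof (rule cover_data)
  fix S C assume C: "\<And>l. l \<in> J \<Longrightarrow> cpt (C l)" and SC: "\<And>l. l \<in> J \<Longrightarrow> S l \<subseteq> C l"
    and loc: "\<And>l \<gamma> \<eta> v. l \<in> J \<Longrightarrow> \<gamma> \<in> Q \<Longrightarrow> \<eta> \<in> Q \<Longrightarrow> \<forall>x\<in>S l. \<gamma> x = \<eta> x \<Longrightarrow> v \<in> V l \<Longrightarrow> f \<gamma> v = f \<eta> v"
    and fin: "\<And>K. cpt K \<Longrightarrow> finite {l \<in> J. C l \<inter> K \<noteq> {}}"
  define B where "B l = {i \<in> I. U i \<inter> C l \<noteq> {}}" for l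
  define K where "K l = (\<Union>i\<in>B l. mtop M closure_of U i)" for l
  have cU: "cpt (mtop M closure_of U i)" "U i \<subseteq> mtop M closure_of U i" if "i \<in> I" for i
    using MM.cover that closure_of_subset[OF openin_subset[OF MM.openU[OF that]]] by (auto simp: rc_cover_def)
  have "\<forall>l\<in>J. \<exists>c. (\<forall>x\<in>C l. c x = 1) \<and> (\<forall>x. x \<notin> (\<Union>i\<in>B l. U i) \<longrightarrow> c x = 0) \<and> MM.controlled (B l) c"
  proof
    fix l assume "l \<in> J"
    from MM.compact_cutoff[OF C[OF this], folded B_def]
    show "\<exists>c. (\<forall>x\<in>C l. c x = 1) \<and> (\<forall>x. x \<notin> (\<Union>i\<in>B l. U i) \<longrightarrow> c x = 0) \<and> MM.controlled (B l) c" by metis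
  qed
  from bchoice[OF this] obtain c where c: "\<forall>l\<in>J. (\<forall>x\<in>C l. c l x = 1) \<and> (\<forall>x. x \<notin> (\<Union>i\<in>B l. U i) \<longrightarrow> c l x = 0) \<and> MM.controlled (B l) (c l)"
    by (rule exE)
  show ?thesis
  proof (rule that[of K S c B])
    fix l assume l: "l \<in> J"
    have "finite (B l)" unfolding B_def by (rule MM.finite_meets[OF C[OF l]])
    then show "cpt (K l)" unfolding K_def using cU by (intro compactin_Union) (auto simp: B_def)
    show "c l x = 1" if "x \<in> S l" for x using c l SC[OF l] that by blast
    show "c l x = 0" if "x \<notin> K l" for x
    proof -
      have "x \<notin> (\<Union>i\<in>B l. U i)" using that cU(2) by (auto simp: K_def B_def)
      then show ?thesis using c l by blast
    qed
    show "MM.controlled (B l) (c l)" using c l by blast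
  next
    fix i assume i: "i \<in> I"
    show "finite {l \<in> J. i \<in> B l}"
      by (rule finite_subset[OF _ fin[OF cU(1)[OF i]]]) (use cU(2)[OF i] in \<open>auto simp: B_def\<close>)
  next
    fix L assume L: "cpt L"
    have "finite (\<Union>i\<in>{i \<in> I. mtop M closure_of U i \<inter> L \<noteq> {}}. {l \<in> J. C l \<inter> mtop M closure_of U i \<noteq> {}})"
      using rc_cover_finite_meets(1)[OF MM.cover L] fin cU(1) by (intro finite_UN_I) auto
    then show "finite {l \<in> J. K l \<inter> L \<noteq> {}}"
      by (rule finite_subset[rotated]) (use cU(2) in \<open>fastforce simp: K_def B_def\<close>)
  next
    fix l show "B l \<subseteq> I" by (auto simp: B_def)
  qed (rule loc)
qed

text \<open>A box neighbourhood \<open>W\<close> of the value imposes one condition for each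
  \<open>l \<in> J\<close>. By almost locality each condition may be tested after cutting off with
  \<open>c l\<close>, and the reference tree of the cut is free: \<open>w0\<close> for the finitely
  many critical indices, \<open>bpoint ?\<gamma> m\<close> for the others.\<close>

lemma cont_H:
  assumes m: "m \<le> k"
  shows "continuous_map (idom_top K.VT MM.XM Q m) (vtop NN.XM) (H m)"
proof -
  note X = MM.tvs_XM and Y = NN.tvs_XM
  have tD: "topspace (idom_top K.VT MM.XM Q m) = D m" using D_lv by (auto simp: idom_top_def)
  have loc: "\<exists>N. openin (K.lv MM.XM m) N \<and> w0 \<in> N \<and> (\<forall>w\<in>N \<inter> D m. H m w \<in> G)"
    if w0: "w0 \<in> D m" and G: "openin (vtop NN.XM) G" "H m w0 \<in> G" for w0 G
  proof -
    let ?L = "topspace (K.lv MM.XM m)" and ?\<gamma> = "spine w0"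
    have w0L: "w0 \<in> ?L" by (rule D_lv[OF w0])
    from D_compact[OF w0] obtain Z where Z: "cpt Z" "leaves w0 \<subseteq> MM.CKM Z" "w0 \<in> DK Z m" .
    have \<gamma>: "?\<gamma> \<in> Q" "?\<gamma> \<in> MM.CKM Z" using K.spine_idom[OF w0] K.spine_leaves Z(2) by auto
    obtain R where R: "in_box av UNIV UNIV R w0" using K.in_box_bound by blast
    obtain W where W: "NN.zero_nbhds W" "\<And>\<eta>. \<eta> \<in> NN.CcM \<Longrightarrow> \<forall>l\<in>J. NN.rst l (\<eta> - H m w0) \<in> W l \<Longrightarrow> \<eta> \<in> G"
      using G unfolding NN.openin_XM by blast
    show ?thesis
    proof (rule cutoff_data)
      fix S B c Kc
      assume Kc: "\<And>l. l \<in> J \<Longrightarrow> cpt (Kc l)" and c1: "\<And>l x. l \<in> J \<Longrightarrow> x \<in> S l \<Longrightarrow> c l x = 1"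
        and c0: "\<And>l x. l \<in> J \<Longrightarrow> x \<notin> Kc l \<Longrightarrow> c l x = 0" and ctr: "\<And>l. l \<in> J \<Longrightarrow> MM.controlled (B l) (c l)" and BI: "\<And>l. B l \<subseteq> I"
        and fl: "\<And>l \<gamma> \<eta> v. l \<in> J \<Longrightarrow> \<gamma> \<in> Q \<Longrightarrow> \<eta> \<in> Q \<Longrightarrow> \<forall>x\<in>S l. \<gamma> x = \<eta> x \<Longrightarrow> v \<in> V l \<Longrightarrow> f \<gamma> v = f \<eta> v"
        and fB: "\<And>i. i \<in> I \<Longrightarrow> finite {l \<in> J. i \<in> B l}" and fK: "\<And>L. cpt L \<Longrightarrow> finite {l \<in> J. Kc l \<inter> L \<noteq> {}}"
      \<comment> \<open>The critical indices: for every other \<open>l\<close> the cutoff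
        annihilates all test functions occurring in \<open>w0\<close>.\<close>
      define J0 where "J0 = {l \<in> J. Kc l \<inter> Z \<noteq> {}}"
      \<comment> \<open>Has room for the reference tree, supported in \<open>Z\<close>, and for the
        cut off differences, supported in \<open>Kc l\<close>.\<close>
      define K1 where "K1 l = Z \<union> Kc l" for l
      define C where "C l u = cut (MM.mul (c l)) u" for l and u :: "('m \<Rightarrow> 'e, 'k) iter"
      have fin: "finite J0" unfolding J0_def by (rule fK[OF Z(1)])
      have K1: "cpt (K1 l)" if "l \<in> J" for l unfolding K1_def by (intro compactin_Un Z(1) Kc that)
      have ZK1: "MM.CKM Z \<subseteq> MM.CKM (K1 l)" and KK1: "MM.CKM (Kc l) \<subseteq> MM.CKM (K1 l)" if "l \<in> J" for l
        using MM.CKM_mono[OF Z(1) K1[OF that]] MM.CKM_mono[OF Kc[OF that] K1[OF that]] by (auto simp: K1_def)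
      have cm: "continuous_map (vtop MM.XM) (vtop (MM.XK (K1 l))) (MM.mul (c l))"
        and cK: "\<gamma> \<in> MM.CcM \<Longrightarrow> MM.mul (c l) \<gamma> \<in> MM.CKM (Kc l)" if l: "l \<in> J" for l \<gamma>
      proof -
        note mul = MM.cont_mul[OF ctr[OF l] Kc[OF l] c0[OF l] BI]
        show "continuous_map (vtop MM.XM) (vtop (MM.XK (K1 l))) (MM.mul (c l))"
          using K.cont_comp[OF MM.cont_XK_mono[OF KK1[OF l]] mul(1)] .
        show "\<gamma> \<in> MM.CcM \<Longrightarrow> MM.mul (c l) \<gamma> \<in> MM.CKM (Kc l)" by (rule mul(2))
      qed
      have cC: "continuous_map (K.lv MM.XM m) (K.lv (MM.XK (K1 l)) m) (C l u)"
        if l: "l \<in> J" and u: "u \<in> ?L" "leaves u \<subseteq> MM.CKM Z" for l u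
        unfolding C_def using u ZK1[OF l]
        by (intro K.cont_cut[OF X u(1) cm[OF l] _ MM.tvs_XK[OF K1[OF l]]]) (auto simp: MM.topspace_XK[OF K1[OF l]])
      have V: "V l \<subseteq> topspace (mtop N)" if "l \<in> J" for l using openin_subset[OF NN.openU[OF that]] .
      have HC: "NN.rst l (H m w) = NN.rst l (H m (C l u w))"
        if l: "l \<in> J" and u: "u \<in> ?L" and w: "w \<in> D m" "C l u w \<in> D m" for l u w
      proof -
        have "agree_on (S l) w (C l u w)" unfolding C_def
          by (rule K.agree_on_cut[OF u D_lv[OF w(1)]]) (simp add: MM.mul_simps c1[OF l])
        then have "H m w v = H m (C l u w) v" if "v \<in> V l" for v
          using H_local[of "S l" v m w "C l u w"] fl[OF l _ _ _ that] V[OF l] that m w by blast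
        then show ?thesis by (auto simp: ext0_def)
      qed
      \<comment> \<open>The neighbourhood is taken in \<open>Ct\<close>, before intersecting with
        \<open>CKM (K1 l)\<close>, since \<open>uniform_cutoff_nbhd\<close> has to collect those for
        all \<open>l\<close> in one box.\<close>
      have far: "\<exists>O'. openin MM.Ct O' \<and> 0 \<in> O' \<and> (\<forall>w\<in>?L. in_box av {x. x - ?\<gamma> \<in> O' \<inter> MM.CKM (K1 l)} (O' \<inter> MM.CKM (K1 l)) (R + 1) (C l (bpoint ?\<gamma> m) w) \<longrightarrow>
            C l (bpoint ?\<gamma> m) w \<in> D m \<and> H m (C l (bpoint ?\<gamma> m) w) \<in> {\<eta> \<in> NN.CcM. NN.rst l (\<eta> - H m (bpoint ?\<gamma> m)) \<in> A})"
        if l: "l \<in> J" and A: "openin (NN.Ti l) A" "0 \<in> A" for l A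
      proof -
        have bD: "bpoint ?\<gamma> m \<in> D m" by (rule K.bpoint_idom[OF X _ \<gamma>(1)]) (use QC in simp)
        have o: "openin (vtop NN.XM) {\<eta> \<in> NN.CcM. NN.rst l (\<eta> - H m (bpoint ?\<gamma> m)) \<in> A}"
          by (rule NN.open_slot[OF l A H_in[OF bD m]])
        have i: "H m (bpoint ?\<gamma> m) \<in> {\<eta> \<in> NN.CcM. NN.rst l (\<eta> - H m (bpoint ?\<gamma> m)) \<in> A}"
          using H_in[OF bD m] A(2) by (simp add: NN.rst_simps)
        have g: "?\<gamma> \<in> Q \<inter> MM.CKM (K1 l)" using \<gamma> ZK1[OF l] by auto
        from box_control[OF K1[OF l] g m o i, of "R + 1"] obtain B where B: "openin (vtop (MM.XK (K1 l))) B" "0 \<in> B"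
          "\<forall>w\<in>topspace (K.lv (MM.XK (K1 l)) m). in_box av {x. x - ?\<gamma> \<in> B} B (R + 1) w \<longrightarrow>
            w \<in> D m \<and> H m w \<in> {\<eta> \<in> NN.CcM. NN.rst l (\<eta> - H m (bpoint ?\<gamma> m)) \<in> A}" .
        obtain O' where O': "openin MM.Ct O'" "B = O' \<inter> MM.CKM (K1 l)"
          using B(1) by (auto simp: CrK_def openin_subtopology)
        have "leaves (bpoint ?\<gamma> m :: ('m \<Rightarrow> 'e, 'k) iter) \<subseteq> MM.CKM Z"
          using K.lv_leaves[OF K.bpoint_in[OF MM.tvs_XK[OF Z(1)]]] \<gamma>(2) by (simp add: MM.topspace_XK[OF Z(1)])
        then have "C l (bpoint ?\<gamma> m) w \<in> topspace (K.lv (MM.XK (K1 l)) m)" if "w \<in> ?L" for w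
          using continuous_map_image_subset_topspace[OF cC[OF l D_lv[OF bD]]] that by blast
        then show ?thesis using B O' by (intro exI[of _ O'] conjI) blast+
      qed
      \<comment> \<open>The values at \<open>w\<close> and at \<open>w0\<close> are both compared
        with the value at \<open>bpoint ?\<gamma> m\<close>, so differences of elements of
        \<open>A l\<close> have to lie in \<open>W l\<close>.\<close>
      have "\<forall>l\<in>J. \<exists>A. openin (NN.Ti l) A \<and> 0 \<in> A \<and> (\<forall>v\<in>A. \<forall>w\<in>A. v - w \<in> W l)"
      proof
        fix l assume l: "l \<in> J"
        have "openin (vtop (NN.TV l)) (W l)" "0 \<in> W l" using W(1) l by (auto simp: NN.zero_nbhds_def)
        from K.tvs_diff_nbhd[OF NN.tvs_TV[OF l] this]
        show "\<exists>A. openin (NN.Ti l) A \<and> 0 \<in> A \<and> (\<forall>v\<in>A. \<forall>w\<in>A. v - w \<in> W l)" by (metis tvs.select_convs(2))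
      qed
      from bchoice[OF this] obtain A where A: "\<forall>l\<in>J. openin (NN.Ti l) (A l) \<and> 0 \<in> A l \<and> (\<forall>v\<in>A l. \<forall>w\<in>A l. v - w \<in> W l)"
        by (rule exE)
      have "\<forall>l\<in>J. \<exists>O'. openin MM.Ct O' \<and> 0 \<in> O' \<and> (\<forall>w\<in>?L. in_box av {x. x - ?\<gamma> \<in> O' \<inter> MM.CKM (K1 l)} (O' \<inter> MM.CKM (K1 l)) (R + 1) (C l (bpoint ?\<gamma> m) w) \<longrightarrow>
            C l (bpoint ?\<gamma> m) w \<in> D m \<and> H m (C l (bpoint ?\<gamma> m) w) \<in> {\<eta> \<in> NN.CcM. NN.rst l (\<eta> - H m (bpoint ?\<gamma> m)) \<in> A l})"
        using A by (intro ballI far) auto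
      from bchoice[OF this] obtain O' where O': "\<forall>l\<in>J. openin MM.Ct (O' l) \<and> 0 \<in> O' l \<and> (\<forall>w\<in>?L. in_box av {x. x - ?\<gamma> \<in> O' l \<inter> MM.CKM (K1 l)} (O' l \<inter> MM.CKM (K1 l)) (R + 1) (C l (bpoint ?\<gamma> m) w) \<longrightarrow>
            C l (bpoint ?\<gamma> m) w \<in> D m \<and> H m (C l (bpoint ?\<gamma> m) w) \<in> {\<eta> \<in> NN.CcM. NN.rst l (\<eta> - H m (bpoint ?\<gamma> m)) \<in> A l})"
        by (rule exE)
      have OO: "openin MM.Ct (O' l) \<and> 0 \<in> O' l" if "l \<in> J" for l using O' that by blast
      obtain W' where W': "MM.zero_nbhds W'" "\<And>l \<gamma>. l \<in> J \<Longrightarrow> \<gamma> \<in> MM.CM \<Longrightarrow> \<forall>i\<in>I. MM.rst i \<gamma> \<in> W' i \<Longrightarrow> MM.mul (c l) \<gamma> \<in> O' l"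
        using MM.uniform_cutoff_nbhd[of J B c O', OF ctr fB BI OO] by blast
      define Sb where "Sb = {\<eta> \<in> MM.CcM. \<forall>i\<in>I. MM.rst i (\<eta> - 0) \<in> W' i}"
      have Sb: "openin (vtop MM.XM) Sb" "0 \<in> Sb"
        using MM.open_box[OF W'(1) MM.CcM_0] MM.mem_box[OF W'(1) MM.CcM_0] by (simp_all add: Sb_def)
      define N1 where "N1 = {w \<in> ?L. near av Sb w0 w}"
      have N1: "openin (K.lv MM.XM m) N1" "w0 \<in> N1"
        unfolding N1_def using K.open_near[OF X Sb(1) w0L] K.near_self[OF Sb(2) w0L] w0L by auto
      have far_in: "NN.rst l (H m w - H m w0) \<in> W l" if l: "l \<in> J" "l \<notin> J0" and w: "w \<in> N1" "w \<in> D m" for l w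
      proof -
        let ?b = "bpoint ?\<gamma> m"
        have c_Z: "MM.mul (c l) a = 0" if "a \<in> MM.CKM Z" for a
        proof
          fix x show "MM.mul (c l) a x = 0 x"
          proof (cases "x \<in> Z")
            case True
            then have "x \<notin> Kc l" using l by (auto simp: J0_def)
            then show ?thesis using c0[OF l(1)] by (simp add: MM.mul_simps)
          next
            case False
            then show ?thesis using that by (simp add: MM.CrK_iff[OF Z(1)] MM.mul_simps)
          qed
        qed
        \<comment> \<open>Applied to \<open>w\<close> and also to \<open>w0\<close>: even with its
          test functions cut off, \<open>w0\<close> keeps its parameters and so may differ from
          \<open>?b\<close>.\<close>
        have *: "C l ?b v \<in> D m \<and> H m (C l ?b v) \<in> {\<eta> \<in> NN.CcM. NN.rst l (\<eta> - H m ?b) \<in> A l}" if v: "v \<in> N1" for v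
        proof -
          have vL: "v \<in> ?L" "near av Sb w0 v" using v by (auto simp: N1_def)
          have "in_box av {x. x - ?\<gamma> \<in> O' l \<inter> MM.CKM (K1 l)} (O' l \<inter> MM.CKM (K1 l)) (R + 1) (C l ?b v)"
            unfolding C_def
          proof (rule K.near_in_box[OF w0L vL R])
            show "MM.mul (c l) a = 0" if "a \<in> leaves w0" for a using c_Z Z(2) that by blast
            show "MM.mul (c l) ?\<gamma> = 0" by (rule c_Z[OF \<gamma>(2)])
            show "MM.mul (c l) a \<in> O' l \<inter> MM.CKM (K1 l)" if a: "a \<in> Sb" for a
            proof -
              have "a \<in> MM.CcM" "\<forall>i\<in>I. MM.rst i a \<in> W' i" using a by (auto simp: Sb_def)
              moreover have "a \<in> MM.CM" using calculation(1) MM.Crc_iff by blast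
              ultimately show ?thesis using W'(2)[OF l(1)] cK[OF l(1)] KK1[OF l(1)] by blast
            qed
            show "MM.mul (c l) (a - b) = MM.mul (c l) a - MM.mul (c l) b" for a b by (rule MM.mul_simps(2))
          qed
          then show ?thesis using O' l(1) vL(1) by blast
        qed
        have bL: "?b \<in> ?L" by (rule K.bpoint_in[OF X]) (use \<gamma>(1) QC in auto)
        have Al: "NN.rst l (H m (C l ?b w) - H m ?b) \<in> A l" "NN.rst l (H m (C l ?b w0) - H m ?b) \<in> A l"
          using *[OF w(1)] *[OF N1(2)] by auto
        have "NN.rst l (H m w - H m w0) = NN.rst l (H m (C l ?b w)) - NN.rst l (H m (C l ?b w0))"
          using HC[OF l(1) bL w(2)] HC[OF l(1) bL w0] * w(1) N1(2) by (simp add: NN.rst_simps)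
        also have "\<dots> = NN.rst l (H m (C l ?b w) - H m ?b) - NN.rst l (H m (C l ?b w0) - H m ?b)" by (simp add: NN.rst_simps)
        also have "\<dots> \<in> W l" using A l(1) Al by blast
        finally show ?thesis .
      qed
      \<comment> \<open>Here the cut is taken over \<open>w0\<close> and fixes it, so continuity of
        \<open>hk (K1 l) m\<close> at \<open>w0\<close> is enough; finitely many such neighbourhoods
        may be intersected.\<close>
      have "\<forall>l\<in>J0. \<exists>N. openin (K.lv MM.XM m) N \<and> w0 \<in> N \<and> (\<forall>w\<in>N \<inter> D m. NN.rst l (H m w - H m w0) \<in> W l)"
      proof
        fix l assume "l \<in> J0"
        then have l: "l \<in> J" by (simp add: J0_def)
        have self: "C l w0 w0 = w0" unfolding C_def by (rule K.cut_self) (rule MM.mul_simps(3))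
        let ?G = "{\<eta> \<in> NN.CcM. NN.rst l (\<eta> - H m w0) \<in> W l}"
        have G: "openin (vtop NN.XM) ?G"
          using W(1) l by (intro NN.open_slot[OF l _ _ H_in[OF w0 m]]) (auto simp: NN.zero_nbhds_def)
        have w0K: "w0 \<in> DK (K1 l) m" using w0 Z(2) ZK1[OF l] by (auto simp: MM.idom_XK[OF K1[OF l]])
        have "openin (K.lv MM.XM m) {w \<in> ?L. C l w0 w \<in> {w \<in> DK (K1 l) m. hk (K1 l) m w \<in> ?G}}"
          by (rule openin_continuous_map_preimage[OF cC[OF l w0L Z(2)] hk_preimage[OF K1[OF l] m G]])
        moreover have "w0 \<in> {w \<in> ?L. C l w0 w \<in> {w \<in> DK (K1 l) m. hk (K1 l) m w \<in> ?G}}"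
          using w0L w0K self H_eq[OF K1[OF l] w0K m, symmetric] H_in[OF w0 m] W(1) l by (simp add: NN.rst_simps NN.zero_nbhds_def)
        moreover have "NN.rst l (H m w - H m w0) \<in> W l"
          if w: "w \<in> D m" "C l w0 w \<in> DK (K1 l) m" "hk (K1 l) m (C l w0 w) \<in> ?G" for w
        proof -
          have "C l w0 w \<in> D m" using w(2) by (simp add: MM.idom_XK[OF K1[OF l]])
          from HC[OF l w0L w(1) this] show ?thesis
            using w(3) H_eq[OF K1[OF l] w(2) m] by (simp add: NN.rst_simps)
        qed
        ultimately show "\<exists>N. openin (K.lv MM.XM m) N \<and> w0 \<in> N \<and> (\<forall>w\<in>N \<inter> D m. NN.rst l (H m w - H m w0) \<in> W l)"
          by (intro exI[of _ "{w \<in> ?L. C l w0 w \<in> {w \<in> DK (K1 l) m. hk (K1 l) m w \<in> ?G}}"] conjI ballI) auto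
      qed
      from bchoice[OF this] obtain Nl where Nl: "\<forall>l\<in>J0. openin (K.lv MM.XM m) (Nl l) \<and> w0 \<in> Nl l \<and>
          (\<forall>w\<in>Nl l \<inter> D m. NN.rst l (H m w - H m w0) \<in> W l)" by (rule exE)
      show ?thesis
      proof (intro exI conjI ballI)
        show "openin (K.lv MM.XM m) (N1 \<inter> (?L \<inter> (\<Inter>l\<in>J0. Nl l)))"
          using Nl by (intro openin_Int N1(1) openin_Int_Inter) (auto simp: fin)
        show "w0 \<in> N1 \<inter> (?L \<inter> (\<Inter>l\<in>J0. Nl l))" using N1(2) w0L Nl by auto
        fix w assume w: "w \<in> N1 \<inter> (?L \<inter> (\<Inter>l\<in>J0. Nl l)) \<inter> D m"
        then have wD: "w \<in> D m" and w1: "w \<in> N1" by auto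
        show "H m w \<in> G"
        proof (rule W(2)[OF H_in[OF wD m]], rule ballI)
          fix l assume l: "l \<in> J"
          show "NN.rst l (H m w - H m w0) \<in> W l"
          proof (cases "l \<in> J0")
            case True then show ?thesis using Nl w by blast
          qed (rule far_in[OF l _ w1 wD])
        qed
      qed
    qed
  qed
  show ?thesis
    unfolding continuous_map
  proof (intro conjI allI impI)
    show "H m ` topspace (idom_top K.VT MM.XM Q m) \<subseteq> topspace (vtop NN.XM)" using H_in m by (auto simp: tD)
    fix G assume G: "openin (vtop NN.XM) G"
    show "openin (idom_top K.VT MM.XM Q m) {w \<in> topspace (idom_top K.VT MM.XM Q m). H m w \<in> G}"
    proof (subst openin_subopen, intro ballI)
      fix w0 assume "w0 \<in> {w \<in> topspace (idom_top K.VT MM.XM Q m). H m w \<in> G}"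
      then have w0: "w0 \<in> D m" "H m w0 \<in> G" by (auto simp: tD)
      from loc[OF w0(1) G w0(2)] obtain N where N: "openin (K.lv MM.XM m) N" "w0 \<in> N" "\<forall>w\<in>N \<inter> D m. H m w \<in> G" by blast
      then show "\<exists>T. openin (idom_top K.VT MM.XM Q m) T \<and> w0 \<in> T \<and> T \<subseteq> {w \<in> topspace (idom_top K.VT MM.XM Q m). H m w \<in> G}"
        using w0 by (intro exI[of _ "N \<inter> D m"]) (auto simp: tD, auto simp: idom_top_def openin_subtopology)
    qed
  qed
qed

text \<open>The maps \<open>H m\<close> form a chain as in \<open>cdiff_of_seq\<close>:
  \<open>cont_H\<close> gives continuity and \<open>H_dq\<close> the quotient relations.\<close>

theorem cdiff_almost_local: "K.cdiff k pt MM.XM NN.XM 0 ({()} \<times> D 0) (\<lambda>z. f (base (snd z)))"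
proof (rule K.cdiff_cong)
  show "K.cdiff k pt MM.XM NN.XM 0 ({()} \<times> D 0) (\<lambda>z. H 0 (snd z))"
  proof (rule K.cdiff_of_seq)
    fix m assume "m \<le> k"
    then show "K.cont_on pt MM.XM (vtop NN.XM) m ({()} \<times> D m) (\<lambda>z. H m (snd z))"
      using cont_H K.cont_on_unit_idom[of Q MM.XM "vtop NN.XM" m "H m"] QC by simp
  next
    fix m assume m: "m < k"
    show "K.dq_rel MM.XM NN.XM m ({()} \<times> D m) (\<lambda>z. H m (snd z)) (\<lambda>z. H (Suc m) (snd z))"
      unfolding K.dq_rel_def K.dq_dom_idom using H_dq[OF m] by (auto simp del: K.Node_in_idom)
  qed
qed (auto simp: H_0)

end

section \<open>Topological extension fields\<close>

text \<open>The smaller field receives its absolute value by restriction along \<open>emb\<close>.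
  As \<open>emb\<close> is an embedding, this absolute value describes the given topology, and it is
  non-discrete together with it. The real and the local case thus both become valued fields.\<close>

lemma valued_topology_emb:
  assumes av: "valued_field av" and ext: "topological_extension_field TF (valued_topology av) emb"
    and TF: "topspace TF = UNIV" "TF \<noteq> discrete_topology UNIV"
  shows "TF = valued_topology (\<lambda>x. av (emb x))" "valued_field (\<lambda>x. av (emb x))"
proof -
  interpret K: valued av by (rule valued.intro[OF av])
  have e: "emb 1 = 1" "emb (x + y) = emb x + emb y" "emb (x * y) = emb x * emb y" for x y
    using ext by (auto simp: topological_extension_field_def field_hom_def)
  have e0: "emb 0 = 0" by (metis e(2) add.right_neutral add_left_cancel)
  have ed: "emb (x - y) = emb x - emb y" for x y using e(2)[of "x - y" y] by (simp add: algebra_simps)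
  have "emb x \<noteq> 0" if "x \<noteq> 0" for x using e(1) e(3)[of x "inverse x"] that by auto
  then have abs: "absolute_value (\<lambda>x. av (emb x))"
    using K.av_props e0 by (auto simp: absolute_value_def e)
  have "Metric_space UNIV (\<lambda>x y. av (emb (x - y)))"
  proof
    show "av (emb (x - y)) = 0 \<longleftrightarrow> x = y" for x y
      unfolding K.av_props(2) using \<open>\<And>x. x \<noteq> 0 \<Longrightarrow> emb x \<noteq> 0\<close>[of "x - y"] e0 by auto
    show "av (emb (x - y)) = av (emb (y - x))" for x y unfolding ed by (rule K.av_minus_commute)
    show "av (emb (x - z)) \<le> av (emb (x - y)) + av (emb (y - z))" for x y z unfolding ed by (rule K.av_triangle)
  qed (rule K.av_props(1))
  then interpret V: Metric_space UNIV "\<lambda>x y. av (emb (x - y))" .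
  have hom: "homeomorphic_map TF (subtopology K.VT (range emb)) emb"
    using ext TF(1) by (simp add: topological_extension_field_def embedding_map_def)
  have "openin TF A \<longleftrightarrow> (\<forall>x\<in>A. \<exists>r>0. \<forall>y. av (emb x - emb y) < r \<longrightarrow> y \<in> A)" (is "_ \<longleftrightarrow> ?r") for A
  proof -
    have "inj emb" using hom TF(1) by (auto simp: homeomorphic_map_def)
    have "openin TF A \<longleftrightarrow> openin (subtopology K.VT (range emb)) (emb ` A)"
      using homeomorphic_map_openness[OF hom, of A] TF(1) by simp
    also have "\<dots> \<longleftrightarrow> ?r"
    proof
      assume "openin (subtopology K.VT (range emb)) (emb ` A)"
      then obtain T where T: "openin K.VT T" "emb ` A = T \<inter> range emb" by (auto simp: openin_subtopology)
      show ?r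
      proof
        fix x assume "x \<in> A"
        then have "emb x \<in> T" using T(2) by blast
        then obtain r where r: "r > 0" "\<And>y. av (y - emb x) < r \<Longrightarrow> y \<in> T" using T(1) unfolding K.openin_VT by blast
        have "y \<in> A" if "av (emb x - emb y) < r" for y
        proof -
          have "emb y \<in> emb ` A" using r(2)[of "emb y"] that T(2) K.av_minus_commute[of "emb x"] by auto
          then show ?thesis using \<open>inj emb\<close> by (simp add: inj_image_mem_iff)
        qed
        then show "\<exists>r>0. \<forall>y. av (emb x - emb y) < r \<longrightarrow> y \<in> A" using r(1) by blast
      qed
    next
      assume r: ?r
      define T where "T = \<Union>{B. openin K.VT B \<and> B \<inter> range emb \<subseteq> emb ` A}"
      have "openin K.VT T" unfolding T_def by (rule openin_Union) auto
      moreover have "emb ` A = T \<inter> range emb"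
      proof
        show "emb ` A \<subseteq> T \<inter> range emb"
        proof safe
          fix x assume "x \<in> A"
          then obtain d where d: "d > 0" "\<And>y. av (emb x - emb y) < d \<Longrightarrow> y \<in> A" using r by blast
          then have "{y. av (y - emb x) < d} \<inter> range emb \<subseteq> emb ` A" by (auto simp: K.av_minus_commute[of _ "emb x"])
          then show "emb x \<in> T" unfolding T_def using K.openin_ball[of "emb x" d] d(1) by auto
        qed auto
      qed (auto simp: T_def)
      ultimately show "openin (subtopology K.VT (range emb)) (emb ` A)" by (auto simp: openin_subtopology)
    qed
    finally show ?thesis .
  qed
  then have "openin TF A \<longleftrightarrow> openin (valued_topology (\<lambda>x. av (emb x))) A" for A
    unfolding valued_topology_def V.openin_mtopology V.mball_def by (auto simp: subset_iff ed)
  then show eq: "TF = valued_topology (\<lambda>x. av (emb x))" by (simp add: topology_eq)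
  show "valued_field (\<lambda>x. av (emb x))"
    unfolding valued_field_def using abs TF(2) eq by simp
qed

lemma is_real_field_nondiscrete:
  assumes "is_real_field TF"
  shows "TF \<noteq> discrete_topology UNIV" "locally_compact_space TF" "topspace TF = UNIV"
proof -
  obtain h :: "'a \<Rightarrow> real" where h: "homeomorphic_map TF euclideanreal h" and top: "topspace TF = UNIV"
    using assms by (auto simp: is_real_field_def)
  show "topspace TF = UNIV" by (rule top)
  show "locally_compact_space TF"
    using homeomorphic_locally_compact_space[of TF euclideanreal] h homeomorphic_map_imp_homeomorphic_space
      locally_compact_space_euclidean by blast
  show "TF \<noteq> discrete_topology UNIV"
  proof
    assume "TF = discrete_topology UNIV"
    then have "openin euclideanreal (h ` {0})" using homeomorphic_map_openness[OF h, of "{0}"] by simp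
    then show False using not_open_singleton[of "h 0"] by (simp add: open_openin[symmetric])
  qed
qed

theorem theorem10p4:
  fixes TF :: "'a::field topology"
    and av :: "'k::field \<Rightarrow> real"
    and emb :: "'a \<Rightarrow> 'k"
    and r s k :: enat
    and M :: "('a, 'z::ab_group_add, 'm) manifold"
    and N :: "('a, 'y::ab_group_add, 'n) manifold"
    and E :: "('k, 'e::ab_group_add) tvs"
    and F :: "('k, 'f::ab_group_add) tvs"
    and I :: "'i set" and U :: "'i \<Rightarrow> 'm set"
    and J :: "'j set" and V :: "'j \<Rightarrow> 'n set"
    and P :: "('m \<Rightarrow> 'e) set"
    and f :: "('m \<Rightarrow> 'e) \<Rightarrow> 'n \<Rightarrow> 'f"
  assumes "is_real_field TF \<or> local_field TF"
    and "valued_field av"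
    and "topological_extension_field TF (valued_topology av) emb"
    and "Cr_manifold TF r M" "paracompact_space (mtop M)" "finite_dimensional_tvs (model M)"
    and "Cr_manifold TF s N" "paracompact_space (mtop N)" "finite_dimensional_tvs (model N)"
    and "topological_vector_space (valued_topology av) E"
    and "topological_vector_space (valued_topology av) F"
    and "rc_cover (mtop M) I U" "rc_cover (mtop N) J V"
    and "openin (vtop (Crc TF emb r M E I U)) P"
    and "f \<in> P \<rightarrow> Crc_fun TF s N (restrict_scalars emb F)"
    and "\<And>K. compactin (mtop M) K \<Longrightarrow>
           Ck (valued_topology av) (CrK TF emb r M E K) (Crc TF emb s N F J V) k
             (P \<inter> CrK_fun TF r M (restrict_scalars emb E) K) f"
    and "locally_almost_local (vtop (Crc TF emb r M E I U)) (mtop M) (mtop N) P f"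
  shows "Ck (valued_topology av) (Crc TF emb r M E I U) (Crc TF emb s N F J V) k P f"
proof -
  define av' where "av' = (\<lambda>x. av (emb x))"
  have top: "topspace TF = UNIV" "TF \<noteq> discrete_topology UNIV" "locally_compact_space TF"
    using assms(1) is_real_field_nondiscrete by (auto simp: local_field_def topological_field_def)
  have TF: "TF = valued_topology av'" and av': "valued_field av'"
    using valued_topology_emb[OF assms(2,3) top(1,2)] by (simp_all add: av'_def)
  have hom: "field_hom emb" using assms(3) by (simp add: topological_extension_field_def)
  interpret two_valued av av' emb
    by (intro two_valued.intro two_valued_axioms.intro valued.intro assms(2) av' hom)
      (use top(3) TF in \<open>simp_all add: av'_def\<close>)
  note assms' = assms(4-17)[unfolded TF]
  \<comment> \<open>The case distinction on the base field ends here: all later steps see only the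
    existence of bump functions.\<close>
  have bump: "\<exists>\<psi>. F.field_bump e \<psi>" if "e > 0" for e
    using assms(1)
  proof
    assume "is_real_field TF"
    then obtain h :: "'a \<Rightarrow> real" where "field_hom h" "homeomorphic_map F.VT euclideanreal h"
      by (auto simp: is_real_field_def TF)
    then interpret real_valued av' h
      by unfold_locales
    show ?thesis using field_bump_real[OF that] .
  next
    assume "local_field TF"
    then have "totally_disconnected_space F.VT" by (simp add: local_field_def TF)
    then show ?thesis by (rule F.field_bump_totally_disconnected[OF lcF _ that])
  qed
  have tvsM: "F.tvs (model M)" "F.tvs (model N)" using assms'(1,4) by (simp_all add: Cr_manifold_def)
  have lc: "locally_compact_space (vtop (model M))" "locally_compact_space (vtop (model N))"
    using F.fd_locally_compact[OF _ _ lcF bump] tvsM assms'(3,6) by blast+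
  have tM: "test_functions av av' emb r M E I U" and tN: "test_functions av av' emb s N F J V"
    using assms'(1,4,7,8,9,10) lc by (intro test_functions.intro two_valued_axioms test_functions_axioms.intro; simp)+
  have cM: "cutoffs av av' emb r M E I U"
    by (intro cutoffs.intro cutoffs_axioms.intro tM assms'(3) bump)
  interpret MM: cutoffs av av' emb r M E I U by (rule cM)
  interpret NN: test_functions av av' emb s N F J V by (rule tN)
  note X = MM.tvs_XM and Y = NN.tvs_XM and P = assms'(11)
  \<comment> \<open>Differentiability is local, so \<open>P\<close> may be replaced by open sets
    \<open>Q\<close> on which \<open>f\<close> is almost local. An infinite \<open>k\<close> is
    treated through its finite orders \<open>j\<close>.\<close>
  have "Ck_nat K.VT MM.XM NN.XM P f j" if j: "enat j \<le> k" for j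
    unfolding K.Ck_nat_iff_cdiff[OF X Y P]
  proof (rule K.cdiff_local[OF X Y])
    have open_dom: "openin (prod_topology (discrete_topology {()}) (K.lv MM.XM 0)) ({()} \<times> idom K.VT MM.XM Q 0)"
      if "openin (vtop MM.XM) Q" for Q
      using K.open_idom[OF X that, of 0] by (simp add: openin_prod_Times_iff)
    show "openin (prod_topology (discrete_topology {()}) (K.lv MM.XM 0)) ({()} \<times> idom K.VT MM.XM P 0)"
      by (rule open_dom[OF P])
    fix z assume "z \<in> {()} \<times> idom K.VT MM.XM P 0"
    then obtain \<gamma> where \<gamma>: "z = ((), Base \<gamma>)" "\<gamma> \<in> P" by auto
    then obtain Q where Q: "openin (vtop MM.XM) Q" "\<gamma> \<in> Q" "Q \<subseteq> P" "almost_local (mtop M) (mtop N) Q f"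
      using assms'(14) unfolding locally_almost_local_def by blast
    have "almost_local_map av av' emb r M E I U s N F J V j Q f"
    proof (intro almost_local_map.intro almost_local_map_axioms.intro two_valued_axioms cM tN Q(1,4))
      show "f \<in> Q \<rightarrow> NN.CcM" using assms'(12) Q(3) by blast
      fix K assume K: "compactin (mtop M) K"
      have "Ck_nat K.VT (MM.XK K) NN.XM (P \<inter> MM.CKM K) f j" using assms'(13)[OF K] j by (simp add: Ck_def)
      then have "K.cdiff j (discrete_topology {()}) (MM.XK K) NN.XM 0 ({()} \<times> idom K.VT (MM.XK K) (P \<inter> MM.CKM K) 0) (\<lambda>z. f (base (snd z)))"
        unfolding K.Ck_nat_iff_cdiff[OF MM.tvs_XK[OF K] Y MM.open_XK[OF K P]] .
      then show "K.cdiff j (discrete_topology {()}) (MM.XK K) NN.XM 0 ({()} \<times> idom K.VT (MM.XK K) (Q \<inter> MM.CKM K) 0) (\<lambda>z. f (base (snd z)))"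
        by (rule K.cdiff_subset) (use Q(3) in auto)
    qed
    from almost_local_map.cdiff_almost_local[OF this] open_dom[OF Q(1)] \<gamma> Q(2,3)
    show "\<exists>D'. openin (prod_topology (discrete_topology {()}) (K.lv MM.XM 0)) D' \<and> z \<in> D' \<and> D' \<subseteq> {()} \<times> idom K.VT MM.XM P 0 \<and>
        K.cdiff j (discrete_topology {()}) MM.XM NN.XM 0 D' (\<lambda>z. f (base (snd z)))"
      by (intro exI[of _ "{()} \<times> idom K.VT MM.XM Q 0"]) auto
  qed
  then show ?thesis unfolding TF Ck_def by blast
qed

end
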